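(* Let $C_1=\mathfrak{S}_{L^2(\mathbb{R}^d)}$ be the convex set of trace one positive semidefinite self-adjoint operators over $L^2(\mathbb{R}^d)$ and $C_2=\mathcal{P}(\mathbb{R}^d\times\mathbb{R}^d)$, with extreme boundaries respectively $E_1=\mathbf{P}_{L^2(\mathbb{R}^d)}$ (the rank-one orthogonal projectors $P_\psi$ over $L^2(\mathbb{R}^d)$, $\|\psi\|=1$) and $E_2\cong\mathbb{R}^d\times\mathbb{R}^d$ (Dirac masses). For $\lambda,\hbar>0$ define the cost function $$c_{\lambda,\hbar}:(P_\psi,(x,\xi))\in E_1\times E_2\ \mapsto\ \langle\psi\,|\,\hat c_{\lambda,\hbar}(x,\xi)\,|\,\psi\rangle_{L^2(\mathbb{R}^d)}\in\mathbb{R}_+\cup\{+\infty\}.$$ Then for any $R\in\mathfrak{S}_{L^2(\mathbb{R}^d)}$ and any probability density $f$ on $\mathbb{R}^d\times\mathbb{R}^d$, denoting by $\nu_f$ the measure $f\,dx\,d\xi$, $$\mathrm{GP}_{\lambda,\hbar}(R,f)^2=(c_{\lambda,\hbar})_*(R,\nu_f),$$ where $(c_{\lambda,\hbar})_*$ is the maximal convex extension of $c_{\lambda,\hbar}$ from $E_1\times E_2$ to $C_1\times C_2$.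
   Context: Cost operator: for $(x,\xi)\in\mathbb{R}^d\times\mathbb{R}^d$, $\hat c_{\lambda,\hbar}(x,\xi)$ is the operator on $L^2(\mathbb{R}^d)$ acting as $\hat c_{\lambda,\hbar}(x,\xi)\psi(y)=\lambda|x-y|^2\psi(y)+[(\xi+i\hbar\nabla_y)^2\psi](y)$. It is nonnegative, and $\langle\psi|\hat c_{\lambda,\hbar}(x,\xi)|\psi\rangle$ is understood as the quadratic form $\lambda\int|x-y|^2|\psi(y)|^2dy+\int|(\xi+i\hbar\nabla_y)\psi(y)|^2dy\in[0,+\infty]$ (equal to $+\infty$ when $\psi$ is not in the form domain). For a positive semidefinite trace-class operator $Q=\sum_k q_kP_{\psi_k}$ (spectral decomposition), $\mathrm{Tr}(\hat c_{\lambda,\hbar}(x,\xi)Q)$ means $\sum_k q_k\langle\psi_k|\hat c_{\lambda,\hbar}(x,\xi)|\psi_k\rangle\in[0,+\infty]$. Couplings: given $R\in\mathfrak{S}_{L^2(\mathbb{R}^d)}$ and a probability density $f$ (w.r.t. Lebesgue measure) on $\mathbb{R}^d\times\mathbb{R}^d$, a coupling between $R$ and $f$ is a (weakly measurable) map $(x,\xi)\mapsto Q(x,\xi)$ such that $Q(x,\xi)$ is a trace-class positive semidefinite self-adjoint operator over $L^2(\mathbb{R}^d)$ for all $(x,\xi)$, with $\mathrm{Tr}(Q(x,\xi))=f(x,\xi)$ and $\iint Q(x,\xi)\,dx\,d\xi=R$ (weak integral). Golse–Paul semiclassical cost: $$\mathrm{GP}_{\lambda,\hbar}(R,f)=\inf_{Q\text{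 coupling between }R\text{ and }f}\Big(\iint_{\mathbb{R}^d\times\mathbb{R}^d}\mathrm{Tr}\big(\hat c_{\lambda,\hbar}(x,\xi)\,Q(x,\xi)\big)\,dx\,d\xi\Big)^{1/2}.$$ Maximal convex extension: for $R\in C_1$ and $\nu\in C_2$, $$(c_{\lambda,\hbar})_*(R,\nu)=\inf_{\mu\in\mathcal{P}_R}\mathcal{K}_{c_{\lambda,\hbar}}(\mu,\nu),$$ where $\mathcal{P}_R$ is the set of Radon probability measures $\mu$ on $\mathbf{P}_{L^2(\mathbb{R}^d)}$ (trace-norm topology) with $\int P\,d\mu(P)=R$, and $\mathcal{K}_c(\mu,\nu)=\inf_\pi\iint c\,d\pi$ over Radon probability measures $\pi$ on $\mathbf{P}_{L^2(\mathbb{R}^d)}\times(\mathbb{R}^d\times\mathbb{R}^d)$ with marginals $\mu$ and $\nu$ (each $\nu\in C_2$ is represented by a unique measure on $E_2\cong\mathbb{R}^d\times\mathbb{R}^d$, namely $\nu$ itself). *)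

theory Defs
  imports "HOL-Probability.Probability"
begin

section \<open>The complex Hilbert space of square-integrable functions\<close>

definition sq_integrable :: "(real^'d \<Rightarrow> complex) \<Rightarrow> bool" where
  "sq_integrable f \<longleftrightarrow>
     f \<in> borel_measurable lborel \<and> integrable lborel (\<lambda>x. (cmod (f x))\<^sup>2)"

lemma sq_integrable_zero: "sq_integrable (\<lambda>x. 0)"
  by (simp add: sq_integrable_def)

lemma sq_integrable_add:
  assumes "sq_integrable f" "sq_integrable g"
  shows "sq_integrable (\<lambda>x. f x + g x)"
proof -
  have [measurable]: "f \<in> borel_measurable lborel" "g \<in> borel_measurable lborel"
    using assms by (auto simp: sq_integrable_def)
  have "integrable lborel (\<lambda>x. 2 * (cmod (f x))\<^sup>2 + 2 * (cmod (g x))\<^sup>2)"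
    using assms by (auto simp: sq_integrable_def)
  moreover have "(cmod (f x + g x))\<^sup>2 \<le> 2 * (cmod (f x))\<^sup>2 + 2 * (cmod (g x))\<^sup>2" for x
  proof -
    have "(cmod (f x + g x))\<^sup>2 \<le> (cmod (f x) + cmod (g x))\<^sup>2"
      by (intro power_mono norm_triangle_ineq) auto
    also have "\<dots> \<le> 2 * (cmod (f x))\<^sup>2 + 2 * (cmod (g x))\<^sup>2"
      using sum_squares_bound[of "cmod (f x)" "cmod (g x)"] by (simp add: power2_sum)
    finally show ?thesis .
  qed
  ultimately have "integrable lborel (\<lambda>x. (cmod (f x + g x))\<^sup>2)"
    by (elim Bochner_Integration.integrable_bound) auto
  then show ?thesis by (simp add: sq_integrable_def)
qed

lemma sq_integrable_mult: "sq_integrable f \<Longrightarrow> sq_integrable (\<lambda>x. c * f x)"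
  by (auto simp: sq_integrable_def norm_mult power_mult_distrib)

lemma measurable_cnj_mult:
  assumes "sq_integrable f" "sq_integrable g"
  shows "(\<lambda>x. cnj (f x) * g x) \<in> borel_measurable lborel"
  using assms unfolding sq_integrable_def
  by (intro borel_measurable_times borel_measurable_continuous_on[of cnj])
     (auto intro: continuous_intros)

lemma integrable_cnj_mult:
  assumes "sq_integrable f" "sq_integrable g"
  shows "integrable lborel (\<lambda>x. cnj (f x) * g x)"
proof -
  have [measurable]: "f \<in> borel_measurable lborel" "g \<in> borel_measurable lborel"
    using assms by (auto simp: sq_integrable_def)
  have "integrable lborel (\<lambda>x. (cmod (f x))\<^sup>2 + (cmod (g x))\<^sup>2)"
    using assms by (auto simp: sq_integrable_def)
  moreover have "cmod (f x) * cmod (g x) \<le> (cmod (f x))\<^sup>2 + (cmod (g x))\<^sup>2" for x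
    using sum_squares_bound[of "cmod (f x)" "cmod (g x)"]
      mult_nonneg_nonneg[OF norm_ge_zero[of "f x"] norm_ge_zero[of "g x"]] by linarith
  moreover note measurable_cnj_mult[OF assms]
  ultimately show ?thesis
    by (elim Bochner_Integration.integrable_bound) (auto simp: norm_mult)
qed

definition L2_rel :: "(real^'d \<Rightarrow> complex) \<Rightarrow> (real^'d \<Rightarrow> complex) \<Rightarrow> bool" where
  "L2_rel f g \<longleftrightarrow> sq_integrable f \<and> sq_integrable g \<and> (AE x in lborel. f x = g x)"

lemma part_equivp_L2_rel: "part_equivp L2_rel"
proof (rule part_equivpI)
  show "\<exists>f. L2_rel f f"
    using sq_integrable_zero by (auto simp: L2_rel_def)
  show "symp L2_rel"
    by (auto simp: L2_rel_def symp_def elim: AE_mp)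
  show "transp L2_rel"
    by (auto simp: L2_rel_def transp_def elim: AE_mp)
qed

quotient_type (overloaded) 'd L2 = "real^('d::finite) \<Rightarrow> complex" / partial: L2_rel
  by (rule part_equivp_L2_rel)

text \<open>The inner product is antilinear in the first argument.\<close>

lift_definition cinner :: "'d::finite L2 \<Rightarrow> 'd L2 \<Rightarrow> complex"
  is "\<lambda>f g. LINT x|lborel. cnj (f x) * g x"
  unfolding L2_rel_def
  by (intro integral_cong_AE measurable_cnj_mult) (auto elim!: AE_mp)

lift_definition scaleC :: "complex \<Rightarrow> 'd::finite L2 \<Rightarrow> 'd L2"
  is "\<lambda>c f x. c * f x"
  unfolding L2_rel_def by (auto intro: sq_integrable_mult elim: AE_mp)

lemma cinner_commute: "cinner a b = cnj (cinner b a)"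
proof (transfer, goal_cases)
  case (1 f g)
  have "(LINT x|lborel. cnj (f x) * g x) = (LINT x|lborel. cnj (cnj (g x) * f x))"
    by (simp add: mult.commute del: Bochner_Integration.integral_cnj)
  then show ?case by (simp only: Bochner_Integration.integral_cnj)
qed

instantiation L2 :: (finite) real_inner
begin

lift_definition zero_L2 :: "'a L2" is "\<lambda>x. 0"
  by (simp add: L2_rel_def sq_integrable_zero)

lift_definition plus_L2 :: "'a L2 \<Rightarrow> 'a L2 \<Rightarrow> 'a L2" is "\<lambda>f g x. f x + g x"
  unfolding L2_rel_def by (auto intro: sq_integrable_add elim!: AE_mp)

definition uminus_L2 :: "'a L2 \<Rightarrow> 'a L2" where
  "uminus_L2 \<psi> = scaleC (- 1) \<psi>"

definition minus_L2 :: "'a L2 \<Rightarrow> 'a L2 \<Rightarrow> 'a L2" where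
  "minus_L2 \<psi> \<phi> = \<psi> + scaleC (- 1) \<phi>"

definition scaleR_L2 :: "real \<Rightarrow> 'a L2 \<Rightarrow> 'a L2" where
  "scaleR_L2 r \<psi> = scaleC (of_real r) \<psi>"

definition inner_L2 :: "'a L2 \<Rightarrow> 'a L2 \<Rightarrow> real" where
  "inner_L2 \<psi> \<phi> = Re (cinner \<psi> \<phi>)"

definition norm_L2 :: "'a L2 \<Rightarrow> real" where
  "norm_L2 \<psi> = sqrt (inner \<psi> \<psi>)"

definition sgn_L2 :: "'a L2 \<Rightarrow> 'a L2" where
  "sgn_L2 \<psi> = scaleR (inverse (norm \<psi>)) \<psi>"

definition dist_L2 :: "'a L2 \<Rightarrow> 'a L2 \<Rightarrow> real" where
  "dist_L2 \<psi> \<phi> = norm (\<psi> - \<phi>)"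

definition uniformity_L2 :: "('a L2 \<times> 'a L2) filter" where
  "uniformity_L2 = (INF e\<in>{0<..}. principal {(x, y). dist x y < e})"

definition open_L2 :: "'a L2 set \<Rightarrow> bool" where
  "open_L2 U \<longleftrightarrow> (\<forall>x\<in>U. eventually (\<lambda>(x', y). x' = x \<longrightarrow> y \<in> U) uniformity)"

instance
proof
  fix a b c :: "'a L2" and r s :: real
  show "a + b + c = a + (b + c)"
    by transfer (auto simp: L2_rel_def add.assoc intro!: sq_integrable_add)
  show "a + b = b + a"
    by transfer (auto simp: L2_rel_def add.commute intro!: sq_integrable_add)
  show "0 + a = a"
    by transfer (auto simp: L2_rel_def)
  show "- a + a = 0"
    unfolding uminus_L2_def
    by transfer (use sq_integrable_zero in \<open>auto simp: L2_rel_def\<close>)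
  show "a - b = a + - b"
    by (simp add: minus_L2_def uminus_L2_def)
  show "r *\<^sub>R (a + b) = r *\<^sub>R a + r *\<^sub>R b"
    unfolding scaleR_L2_def
    by transfer
       (auto simp: L2_rel_def distrib_left intro!: sq_integrable_add sq_integrable_mult)
  show "(r + s) *\<^sub>R a = r *\<^sub>R a + s *\<^sub>R a"
    unfolding scaleR_L2_def
    by transfer
       (auto simp: L2_rel_def distrib_right intro!: sq_integrable_add sq_integrable_mult)
  show "r *\<^sub>R s *\<^sub>R a = (r * s) *\<^sub>R a"
    unfolding scaleR_L2_def
    by transfer (auto simp: L2_rel_def mult.assoc intro!: sq_integrable_mult)
  show "1 *\<^sub>R a = a"
    unfolding scaleR_L2_def by transfer (auto simp: L2_rel_def)
  show "sgn a = inverse (norm a) *\<^sub>R a" by (rule sgn_L2_def)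
  show "dist a b = norm (a - b)" by (rule dist_L2_def)
  show "(uniformity :: ('a L2 \<times> 'a L2) filter)
          = (INF e\<in>{0<..}. principal {(x, y). dist x y < e})"
    by (rule uniformity_L2_def)
  show "norm a = sqrt (inner a a)" by (rule norm_L2_def)
  show "inner a b = inner b a"
    by (metis inner_L2_def cinner_commute complex_cnj_cnj cnj.sel(1))
  show "inner (a + b) c = inner a c + inner b c"
  proof -
    have "cinner (a + b) c = cinner a c + cinner b c"
      by transfer
         (auto simp: L2_rel_def distrib_right
               intro!: Bochner_Integration.integral_add integrable_cnj_mult)
    then show ?thesis by (simp add: inner_L2_def)
  qed
  show "inner (r *\<^sub>R a) b = r * inner a b"
  proof -
    have "cinner (scaleC (of_real r) a) b = of_real r * cinner a b"
      by transfer (simp add: mult.assoc)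
    then show ?thesis by (simp add: inner_L2_def scaleR_L2_def)
  qed
  have inner_eq: "cnj (f x) * f x = of_real ((cmod (f x))\<^sup>2)" for f :: "real^'a \<Rightarrow> complex" and x
    by (simp add: complex_norm_square mult.commute del: of_real_power)
  show "0 \<le> inner a a"
    unfolding inner_L2_def
    by transfer (simp add: inner_eq del: of_real_power)
  show "inner a a = 0 \<longleftrightarrow> a = 0"
    unfolding inner_L2_def
  proof (transfer, goal_cases)
    case (1 f)
    then have f: "sq_integrable f" by (simp add: L2_rel_def)
    then have "integrable lborel (\<lambda>x. (cmod (f x))\<^sup>2)" by (simp add: sq_integrable_def)
    then have "(LINT x|lborel. (cmod (f x))\<^sup>2) = 0 \<longleftrightarrow> (AE x in lborel. (cmod (f x))\<^sup>2 = 0)"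
      by (intro integral_nonneg_eq_0_iff_AE) auto
    then show ?case
      using f by (simp add: inner_eq L2_rel_def sq_integrable_zero del: of_real_power)
  qed
qed (fact open_L2_def)

end

lemma cinner_add_right: "cinner a (b + c) = cinner a b + cinner a c"
  by transfer
     (auto simp: L2_rel_def distrib_left
           intro!: Bochner_Integration.integral_add integrable_cnj_mult)

lemma cinner_scaleC_right: "cinner a (scaleC c b) = c * cinner a b"
  by transfer (simp add: mult.left_commute)

lemma cinner_scaleC_left: "cinner (scaleC c a) b = cnj c * cinner a b"
  by (metis cinner_commute cinner_scaleC_right complex_cnj_mult)

lemma scaleC_add_left: "scaleC (c + d) a = scaleC c a + scaleC d a"
  by transfer (auto simp: L2_rel_def distrib_right intro!: sq_integrable_add sq_integrable_mult)

lemma scaleC_scaleC: "scaleC c (scaleC d a) = scaleC (c * d) a"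
  by transfer (auto simp: L2_rel_def mult.assoc intro!: sq_integrable_mult)

lemma norm_scaleC: "norm (scaleC c a) = cmod c * norm a"
proof -
  have "cinner (scaleC c a) (scaleC c a) = (c * cnj c) * cinner a a"
    by (simp add: cinner_scaleC_left cinner_scaleC_right)
  also have "\<dots> = of_real ((cmod c)\<^sup>2) * cinner a a"
    by (simp only: complex_norm_square)
  finally have "inner (scaleC c a) (scaleC c a) = (cmod c)\<^sup>2 * inner a a"
    by (simp add: inner_L2_def del: of_real_power)
  then show ?thesis
    by (simp add: norm_L2_def real_sqrt_mult)
qed

lemma cmod_cinner_le: "cmod (cinner a b) \<le> norm a * norm b"
proof (cases "cinner a b = 0")
  case False
  define w where "w = sgn (cinner a b)"
  have w: "cmod w = 1" using False by (simp add: w_def norm_sgn)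
  have "cnj w * cinner a b = of_real (cmod (cinner a b))"
  proof -
    have "cnj w * cinner a b = cinner a b * cnj (cinner a b) / of_real (cmod (cinner a b))"
      by (simp add: w_def sgn_eq)
    also have "\<dots> = of_real ((cmod (cinner a b))\<^sup>2) / of_real (cmod (cinner a b))"
      by (simp only: complex_norm_square)
    also have "\<dots> = of_real (cmod (cinner a b))"
      using False by (simp add: power2_eq_square)
    finally show ?thesis .
  qed
  then have "cmod (cinner a b) = inner (scaleC w a) b"
    by (simp add: inner_L2_def cinner_scaleC_left)
  also have "\<dots> \<le> norm (scaleC w a) * norm b" by (rule norm_cauchy_schwarz)
  finally show ?thesis using w by (simp add: norm_scaleC)
qed simp

section \<open>Operators, traces and density operators\<close>

text \<open>Elements of the blinfun type below are only real-linear; complex linearity is imposed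
  by the predicate \<open>clinear_op\<close>.\<close>

type_synonym 'd operator = "'d L2 \<Rightarrow>\<^sub>L 'd L2"

definition clinear_op :: "'d::finite operator \<Rightarrow> bool" where
  "clinear_op T \<longleftrightarrow> (\<forall>c \<psi>. blinfun_apply T (scaleC c \<psi>) = scaleC c (blinfun_apply T \<psi>))"

definition self_adjoint :: "'d::finite operator \<Rightarrow> bool" where
  "self_adjoint T \<longleftrightarrow>
     (\<forall>\<phi> \<psi>. cinner \<phi> (blinfun_apply T \<psi>) = cinner (blinfun_apply T \<phi>) \<psi>)"

definition psd :: "'d::finite operator \<Rightarrow> bool" where
  "psd T \<longleftrightarrow> clinear_op T \<and> self_adjoint T \<and> (\<forall>\<psi>. 0 \<le> Re (cinner \<psi> (blinfun_apply T \<psi>)))"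

lift_definition rank_one_op :: "'d::finite L2 \<Rightarrow> 'd operator"
  is "\<lambda>\<psi> \<phi>. scaleC (cinner \<psi> \<phi>) \<psi>"
proof (rule bounded_linear_intro[of _ "norm \<psi> * norm \<psi>" for \<psi>])
  fix \<psi> x y :: "'d L2" and r :: real
  show "scaleC (cinner \<psi> (x + y)) \<psi> = scaleC (cinner \<psi> x) \<psi> + scaleC (cinner \<psi> y) \<psi>"
    by (simp add: cinner_add_right scaleC_add_left)
  show "scaleC (cinner \<psi> (r *\<^sub>R x)) \<psi> = r *\<^sub>R scaleC (cinner \<psi> x) \<psi>"
    by (simp add: scaleR_L2_def cinner_scaleC_right scaleC_scaleC)
  have "cmod (cinner \<psi> x) * norm \<psi> \<le> (norm \<psi> * norm x) * norm \<psi>"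
    by (intro mult_right_mono cmod_cinner_le) auto
  then show "norm (scaleC (cinner \<psi> x) \<psi>) \<le> norm x * (norm \<psi> * norm \<psi>)"
    by (simp add: norm_scaleC mult_ac)
qed

definition rank_one_projectors :: "'d::finite operator set" where
  "rank_one_projectors = {rank_one_op \<psi> | \<psi>. norm \<psi> = 1}"

definition orthonormal :: "'d::finite L2 set \<Rightarrow> bool" where
  "orthonormal B \<longleftrightarrow> (\<forall>e\<in>B. \<forall>e'\<in>B. cinner e e' = (if e = e' then 1 else 0))"

text \<open>An orthonormal basis is a maximal orthonormal system.\<close>

definition is_onb :: "'d::finite L2 set \<Rightarrow> bool" where
  "is_onb B \<longleftrightarrow> orthonormal B \<and> (\<forall>B'. orthonormal B' \<longrightarrow> B \<subseteq> B' \<longrightarrow> B' = B)"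

lemma ex_onb: "\<exists>B :: 'd::finite L2 set. is_onb B"
proof -
  have "\<exists>M\<in>{B :: 'd L2 set. orthonormal B}. \<forall>X\<in>{B. orthonormal B}. M \<subseteq> X \<longrightarrow> X = M"
  proof (rule Zorn_Lemma2, intro ballI)
    fix C :: "'d L2 set set"
    assume C: "C \<in> chains {B. orthonormal B}"
    have "orthonormal (\<Union>C)"
      unfolding orthonormal_def
    proof (intro ballI)
      fix e e' assume "e \<in> \<Union>C" "e' \<in> \<Union>C"
      then obtain X Y where XY: "X \<in> C" "Y \<in> C" "e \<in> X" "e' \<in> Y" by blast
      with C have "X \<subseteq> Y \<or> Y \<subseteq> X" "orthonormal X" "orthonormal Y"
        by (auto simp: chains_def chain_subset_def)
      with XY show "cinner e e' = (if e = e' then 1 else 0)"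
        unfolding orthonormal_def by blast
    qed
    then show "\<exists>U\<in>{B. orthonormal B}. \<forall>X\<in>C. X \<subseteq> U" by blast
  qed
  then show ?thesis by (auto simp: is_onb_def)
qed

text \<open>Traces are computed in a fixed orthonormal basis; the values for positive semidefinite and
  for trace-class operators do not depend on it.\<close>

definition onb :: "'d::finite L2 set" where
  "onb = (SOME B. is_onb B)"

text \<open>The modulus of \<open>T\<close> is the positive semidefinite square root \<open>S\<close> of \<open>T\<^sup>* T\<close>; the identity
  \<open>S\<^sup>* S = T\<^sup>* T\<close> is written without adjoints.\<close>

definition modulus :: "'d::finite operator \<Rightarrow> 'd operator" where
  "modulus T = (THE S. psd S \<and>
     (\<forall>\<phi> \<psi>. cinner (blinfun_apply S \<phi>) (blinfun_apply S \<psi>)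
           = cinner (blinfun_apply T \<phi>) (blinfun_apply T \<psi>)))"

definition trace_norm :: "'d::finite operator \<Rightarrow> ennreal" where
  "trace_norm T = (\<Sum>\<^sub>\<infinity>e\<in>onb. ennreal (Re (cinner e (blinfun_apply (modulus T) e))))"

definition trace_class :: "'d::finite operator \<Rightarrow> bool" where
  "trace_class T \<longleftrightarrow> clinear_op T \<and> trace_norm T < \<top>"

definition op_trace :: "'d::finite operator \<Rightarrow> complex" where
  "op_trace T = (\<Sum>\<^sub>\<infinity>e\<in>onb. cinner e (blinfun_apply T e))"

definition density_operators :: "'d::finite operator set" where
  "density_operators = {R. psd R \<and> trace_class R \<and> op_trace R = 1}"

type_synonym 'd phase_space = "(real^'d) \<times> (real^'d)"

section \<open>The cost operator as a quadratic form\<close>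

primrec Ck :: "nat \<Rightarrow> (real^'d \<Rightarrow> complex) \<Rightarrow> bool" where
  "Ck 0 \<phi> \<longleftrightarrow> continuous_on UNIV \<phi>"
| "Ck (Suc k) \<phi> \<longleftrightarrow>
     (\<forall>y. \<phi> differentiable (at y)) \<and>
     (\<forall>j. Ck k (\<lambda>y. frechet_derivative \<phi> (at y) (axis j 1)))"

definition test_function :: "(real^'d \<Rightarrow> complex) \<Rightarrow> bool" where
  "test_function \<phi> \<longleftrightarrow> (\<forall>k. Ck k \<phi>) \<and> compact (closure {y. \<phi> y \<noteq> 0})"

definition is_weak_gradient :: "(real^'d \<Rightarrow> complex) \<Rightarrow> (real^'d \<Rightarrow> complex^'d) \<Rightarrow> bool" where
  "is_weak_gradient u g \<longleftrightarrow> (\<forall>j. sq_integrable (\<lambda>y. g y $ j) \<and>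
     (\<forall>\<phi>. test_function \<phi> \<longrightarrow>
        (LINT y|lborel. u y * frechet_derivative \<phi> (at y) (axis j 1))
          = - (LINT y|lborel. g y $ j * \<phi> y)))"

text \<open>The quadratic form of the cost operator at \<open>(x, \<xi>)\<close>. It is infinite unless \<open>\<psi>\<close> has a
  square-integrable weak gradient (unique up to null sets, so the choice is immaterial) and
  \<open>\<bar>y\<bar> \<psi>(y)\<close> is square-integrable; in the latter case the first integral is infinite.\<close>

definition cost_form ::
    "real \<Rightarrow> real \<Rightarrow> 'd phase_space \<Rightarrow> 'd::finite L2 \<Rightarrow> ennreal" where
  "cost_form lam hbar = (\<lambda>(x, \<xi>) \<psi>.
     let u = rep_L2 \<psi> in
     if \<exists>g. is_weak_gradient u g then
       let g = (SOME g. is_weak_gradient u g) in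
         ennreal lam * (\<integral>\<^sup>+y. ennreal ((norm (x - y))\<^sup>2 * (cmod (u y))\<^sup>2) \<partial>lborel)
         + (\<integral>\<^sup>+y. ennreal
              ((norm (\<chi> j. of_real (\<xi> $ j) * u y + \<i> * of_real hbar * (g y $ j)))\<^sup>2) \<partial>lborel)
     else \<top>)"

definition cost ::
    "real \<Rightarrow> real \<Rightarrow> 'd::finite operator \<times> 'd phase_space \<Rightarrow> ennreal" where
  "cost lam hbar = (\<lambda>(P, z). cost_form lam hbar z (SOME \<psi>. norm \<psi> = 1 \<and> P = rank_one_op \<psi>))"

text \<open>Eigenvalues may vanish, so that finite-rank operators are covered as well.\<close>

definition spectral_decomposition ::
    "'d::finite operator \<Rightarrow> (nat \<Rightarrow> real) \<Rightarrow> (nat \<Rightarrow> 'd L2) \<Rightarrow> bool" where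
  "spectral_decomposition Q q \<psi> \<longleftrightarrow>
     (\<forall>k. 0 \<le> q k) \<and>
     (\<forall>j k. cinner (\<psi> j) (\<psi> k) = (if j = k then 1 else 0)) \<and>
     (\<forall>\<phi>. (\<lambda>k. q k *\<^sub>R blinfun_apply (rank_one_op (\<psi> k)) \<phi>) sums blinfun_apply Q \<phi>)"

text \<open>\<open>Tr(c\<^sub>z Q)\<close>; the value does not depend on the chosen spectral decomposition.\<close>

definition trace_cost ::
    "real \<Rightarrow> real \<Rightarrow> 'd phase_space \<Rightarrow> 'd::finite operator \<Rightarrow> ennreal" where
  "trace_cost lam hbar z Q =
     (let (q, \<psi>) = (SOME (q, \<psi>). spectral_decomposition Q q \<psi>)
      in \<Sum>k. ennreal (q k) * cost_form lam hbar z (\<psi> k))"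

section \<open>The Golse--Paul cost\<close>

definition probability_density :: "('d::finite phase_space \<Rightarrow> real) \<Rightarrow> bool" where
  "probability_density f \<longleftrightarrow>
     f \<in> borel_measurable lebesgue \<and> (\<forall>z. 0 \<le> f z) \<and> (\<integral>\<^sup>+z. ennreal (f z) \<partial>lebesgue) = 1"

definition couplings ::
    "'d::finite operator \<Rightarrow> ('d phase_space \<Rightarrow> real) \<Rightarrow> ('d phase_space \<Rightarrow> 'd operator) set"
where
  "couplings R f = {Q.
     (\<forall>z. psd (Q z) \<and> trace_class (Q z) \<and> op_trace (Q z) = of_real (f z)) \<and>
     (\<forall>\<phi> \<psi>. (\<lambda>z. cinner \<phi> (blinfun_apply (Q z) \<psi>)) \<in> borel_measurable lebesgue) \<and>
     (\<forall>\<phi> \<psi>. has_bochner_integral lebesgue (\<lambda>z. cinner \<phi> (blinfun_apply (Q z) \<psi>))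
              (cinner \<phi> (blinfun_apply R \<psi>)))}"

definition ennreal_sqrt :: "ennreal \<Rightarrow> ennreal" where
  "ennreal_sqrt a = (if a = \<top> then \<top> else ennreal (sqrt (enn2real a)))"

definition GP ::
    "real \<Rightarrow> real \<Rightarrow> 'd::finite operator \<Rightarrow> ('d phase_space \<Rightarrow> real) \<Rightarrow> ennreal" where
  "GP lam hbar R f =
     (INF Q\<in>couplings R f. ennreal_sqrt (\<integral>\<^sup>+z. trace_cost lam hbar z (Q z) \<partial>lebesgue))"

section \<open>The maximal convex extension\<close>

definition borel_of :: "'a topology \<Rightarrow> 'a measure" where
  "borel_of X = sigma (topspace X) {U. openin X U}"

definition radon_probability :: "'a topology \<Rightarrow> 'a measure \<Rightarrow> bool" where
  "radon_probability X \<mu> \<longleftrightarrow> sets \<mu> = sets (borel_of X) \<and> prob_space \<mu> \<and>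
     (\<forall>A\<in>sets \<mu>. emeasure \<mu> A = (SUP K\<in>{K \<in> sets \<mu>. compactin X K \<and> K \<subseteq> A}. emeasure \<mu> K))"

text \<open>The trace-norm topology on the set of rank-one projectors.\<close>

definition projector_topology :: "'d::finite operator topology" where
  "projector_topology = topology (\<lambda>U. U \<subseteq> rank_one_projectors \<and>
     (\<forall>P\<in>U. \<exists>r::real>0. \<forall>P'\<in>rank_one_projectors. trace_norm (P' - P) < ennreal r \<longrightarrow> P' \<in> U))"

lemma openin_projector_topology:
  fixes U :: "'d::finite operator set"
  shows "openin projector_topology U \<longleftrightarrow> U \<subseteq> rank_one_projectors \<and>
     (\<forall>P\<in>U. \<exists>r::real>0. \<forall>P'\<in>rank_one_projectors. trace_norm (P' - P) < ennreal r \<longrightarrow> P' \<in> U)"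
proof -
  let ?L = "\<lambda>U :: 'd operator set. U \<subseteq> rank_one_projectors \<and>
     (\<forall>P\<in>U. \<exists>r::real>0. \<forall>P'\<in>rank_one_projectors. trace_norm (P' - P) < ennreal r \<longrightarrow> P' \<in> U)"
  have "istopology ?L"
    unfolding istopology_def
  proof (intro conjI allI impI)
    fix S T :: "'d operator set" assume S: "?L S" and T: "?L T"
    show "S \<inter> T \<subseteq> rank_one_projectors" using S by blast
    show "\<forall>P\<in>S \<inter> T. \<exists>r::real>0. \<forall>P'\<in>rank_one_projectors.
            trace_norm (P' - P) < ennreal r \<longrightarrow> P' \<in> S \<inter> T"
    proof
      fix P assume "P \<in> S \<inter> T"
      then have PS: "P \<in> S" and PT: "P \<in> T" by blast+
      from bspec[OF conjunct2[OF S] PS] obtain r :: real where r: "0 < r"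
        "\<forall>P'\<in>rank_one_projectors. trace_norm (P' - P) < ennreal r \<longrightarrow> P' \<in> S" by blast
      from bspec[OF conjunct2[OF T] PT] obtain s :: real where s: "0 < s"
        "\<forall>P'\<in>rank_one_projectors. trace_norm (P' - P) < ennreal s \<longrightarrow> P' \<in> T" by blast
      have "ennreal (min r s) \<le> ennreal r" "ennreal (min r s) \<le> ennreal s"
        by (auto intro: ennreal_leI)
      then have "\<forall>P'\<in>rank_one_projectors.
          trace_norm (P' - P) < ennreal (min r s) \<longrightarrow> P' \<in> S \<inter> T"
        using r(2) s(2) by (auto dest: less_le_trans)
      moreover have "0 < min r s" using r(1) s(1) by simp
      ultimately show "\<exists>r::real>0. \<forall>P'\<in>rank_one_projectors.
          trace_norm (P' - P) < ennreal r \<longrightarrow> P' \<in> S \<inter> T"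
        by blast
    qed
  next
    fix \<K> :: "'d operator set set" assume \<K>: "\<forall>K\<in>\<K>. ?L K"
    then show "\<Union>\<K> \<subseteq> rank_one_projectors" by blast
    show "\<forall>P\<in>\<Union>\<K>. \<exists>r::real>0. \<forall>P'\<in>rank_one_projectors.
            trace_norm (P' - P) < ennreal r \<longrightarrow> P' \<in> \<Union>\<K>"
    proof
      fix P assume "P \<in> \<Union>\<K>"
      then obtain K where K: "K \<in> \<K>" "P \<in> K" by blast
      from bspec[OF conjunct2[OF bspec[OF \<K> K(1)]] K(2)] obtain r :: real where "0 < r"
        "\<forall>P'\<in>rank_one_projectors. trace_norm (P' - P) < ennreal r \<longrightarrow> P' \<in> K" by blast
      with K(1) show "\<exists>r::real>0. \<forall>P'\<in>rank_one_projectors.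
            trace_norm (P' - P) < ennreal r \<longrightarrow> P' \<in> \<Union>\<K>" by blast
    qed
  qed
  then show ?thesis
    unfolding projector_topology_def by (subst topology_inverse') auto
qed

lemma topspace_projector_topology:
  "topspace projector_topology = (rank_one_projectors :: 'd::finite operator set)"
proof
  have "openin projector_topology (rank_one_projectors :: 'd operator set)"
    unfolding openin_projector_topology using zero_less_one by blast
  then show "rank_one_projectors \<subseteq> topspace (projector_topology :: 'd operator topology)"
    by (rule openin_subset)
  show "topspace projector_topology \<subseteq> (rank_one_projectors :: 'd operator set)"
    using openin_projector_topology[THEN iffD1, OF openin_topspace] by (rule conjunct1)
qed

text \<open>Radon probability measures on the rank-one projectors with barycenter \<open>R\<close>; the barycenter is
  a weak integral.\<close>

definition representing_measures :: "'d::finite operator \<Rightarrow> 'd operator measure set" where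
  "representing_measures R = {\<mu>. radon_probability projector_topology \<mu> \<and>
     (\<forall>\<phi> \<psi>. has_bochner_integral \<mu> (\<lambda>P. cinner \<phi> (blinfun_apply P \<psi>))
              (cinner \<phi> (blinfun_apply R \<psi>)))}"

text \<open>Dirac masses on phase space are identified with points, so a measure on phase space represents
  itself.\<close>

definition transport_plans ::
    "'d::finite operator measure \<Rightarrow> 'd phase_space measure
     \<Rightarrow> ('d operator \<times> 'd phase_space) measure set" where
  "transport_plans \<mu> \<nu> = {\<pi>. radon_probability (prod_topology projector_topology euclidean) \<pi> \<and>
     distr \<pi> (borel_of projector_topology) fst = \<mu> \<and> distr \<pi> borel snd = \<nu>}"

definition transport_cost ::
    "('d::finite operator \<times> 'd phase_space \<Rightarrow> ennreal)
     \<Rightarrow> 'd operator measure \<Rightarrow> 'd phase_space measure \<Rightarrow> ennreal" where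
  "transport_cost c \<mu> \<nu> = (INF \<pi>\<in>transport_plans \<mu> \<nu>. \<integral>\<^sup>+p. c p \<partial>\<pi>)"

definition maximal_convex_extension ::
    "('d::finite operator \<times> 'd phase_space \<Rightarrow> ennreal)
     \<Rightarrow> 'd operator \<Rightarrow> 'd phase_space measure \<Rightarrow> ennreal" where
  "maximal_convex_extension c R \<nu> = (INF \<mu>\<in>representing_measures R. transport_cost c \<mu> \<nu>)"

text \<open>The Borel measure \<open>f dx d\<xi>\<close>; the density is Lebesgue measurable, so the measure is
  restricted to the Borel sets.\<close>

definition density_measure :: "('d::finite phase_space \<Rightarrow> real) \<Rightarrow> 'd phase_space measure" where
  "density_measure f = distr (density lebesgue (\<lambda>z. ennreal (f z))) borel (\<lambda>z. z)"

end

theory Submission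
  imports Defs
begin

text \<open>The position and momentum parts of the form of \<open>c(x, \<xi>)\<close> are increasing limits of
  \<open>\<parallel>2\<^sup>n (U - 1) \<psi>\<parallel>\<^sup>2\<close>, where \<open>U\<close> runs through modulations and translations at time \<open>2\<^sup>-\<^sup>n\<close>
  (monotone because \<open>\<parallel>U\<^sup>2 \<psi> - \<psi>\<parallel> \<le> 2 \<parallel>U \<psi> - \<psi>\<parallel>\<close>). Expanding in an orthonormal basis, the cost of \<open>P\<^sub>\<psi>\<close>
  is a supremum of countable sums of numbers \<open>\<langle>v, P\<^sub>\<psi> v\<rangle>\<close>. Replacing \<open>P\<^sub>\<psi>\<close> by a positive trace-class
  operator \<open>Q\<close> in this expression gives \<open>Tr(c Q)\<close> for every decomposition of \<open>Q\<close> into rank-one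
  operators, and monotone convergence makes it compatible with weak integrals of positive operators.

  A coupling therefore has the cost of the plan obtained by splitting each \<open>Q(z)\<close>, measurably in \<open>z\<close>,
  into rank-one operators. Conversely a plan \<open>\<pi>\<close> has the cost of the coupling given by
  \<open>Q(z) dz = \<integral> P \<pi>(dP, dz)\<close>, whose matrix entries in a fixed basis are Radon-Nikodym densities.\<close>

section \<open>The Hilbert space of square-integrable functions\<close>

text \<open>The obstacle is that the cost is an unbounded form, infinite off its domain and defined
  through a chosen weak gradient, so neither its measurability in \<open>(P, z)\<close> nor its
  additivity over sums and integrals of operators can be read off the definition. Dyadic times are
  used because halving the time makes the approximants monotone; infinite values then need no
  separate treatment on the operator side. Spectral decompositions only give
  \<open>trace_cost\<close> its meaning. For building a plan, eigenvectors would have to be selected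
  measurably in \<open>z\<close>; Cholesky vectors are explicit functions of the matrix entries, and
  their lack of orthogonality is harmless because \<open>opcost\<close> does not see the
  decomposition. In the converse direction the entries of \<open>Q(z)\<close> are separately chosen
  densities, so positivity and trace hold only almost everywhere and must be recovered from
  countably many conditions before an operator can be assembled. The Radon property of the plan is
  inherited from the Polish space of pairs of an \<open>L2\<close> vector and a phase space
  point.\<close>

lemma cinner_add_left: "cinner (a + b) c = cinner a c + cinner b c"
  by (metis cinner_add_right cinner_commute complex_cnj_add)

interpretation cinner: bounded_bilinear "cinner :: 'd::finite L2 \<Rightarrow> _"
proof
  fix a b c :: "'d L2" and r :: real
  show "cinner (a + b) c = cinner a c + cinner b c" by (rule cinner_add_left)
  show "cinner a (b + c) = cinner a b + cinner a c" by (rule cinner_add_right)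
  show "cinner (r *\<^sub>R a) b = r *\<^sub>R cinner a b"
    by (simp add: scaleR_L2_def cinner_scaleC_left scaleR_conv_of_real)
  show "cinner a (r *\<^sub>R b) = r *\<^sub>R cinner a b"
    by (simp add: scaleR_L2_def cinner_scaleC_right scaleR_conv_of_real)
  show "\<exists>K. \<forall>a b :: 'd L2. cmod (cinner a b) \<le> norm a * norm b * K"
    by (rule exI[of _ 1]) (simp add: cmod_cinner_le)
qed

lemma scaleC_add_right: "scaleC c (a + b) = scaleC c a + scaleC c b"
  by transfer (auto simp: L2_rel_def distrib_left intro!: sq_integrable_add sq_integrable_mult)

lemma scaleC_of_real: "scaleC (of_real r) a = r *\<^sub>R a"
  by (simp add: scaleR_L2_def)

interpretation scaleC: bounded_bilinear "scaleC :: _ \<Rightarrow> 'd::finite L2 \<Rightarrow> _"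
proof
  fix a b :: "'d L2" and c d :: complex and r :: real
  show "scaleC (c + d) a = scaleC c a + scaleC d a" by (rule scaleC_add_left)
  show "scaleC c (a + b) = scaleC c a + scaleC c b" by (rule scaleC_add_right)
  show "scaleC (r *\<^sub>R c) a = r *\<^sub>R scaleC c a"
    by (simp add: scaleR_L2_def scaleC_scaleC scaleR_conv_of_real)
  show "scaleC c (r *\<^sub>R a) = r *\<^sub>R scaleC c a"
    by (simp add: scaleR_L2_def scaleC_scaleC mult.commute)
  show "\<exists>K. \<forall>c (a :: 'd L2). norm (scaleC c a) \<le> norm c * norm a * K"
    by (rule exI[of _ 1]) (simp add: norm_scaleC)
qed

lemma scaleC_1 [simp]: "scaleC 1 a = a"
  using scaleC_of_real[of 1 a] by simp

lemma scaleC_neg1 [simp]: "scaleC (- 1) a = - a"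
  by (simp add: uminus_L2_def)

declare norm_scaleC [simp]

lemma Im_cinner_self [simp]: "Im (cinner a a) = 0"
  by (metis Reals_cnj_iff cinner_commute complex_is_Real_iff)

lemma cinner_self: "cinner a a = of_real ((norm a)\<^sup>2)"
proof -
  have "Re (cinner a a) = (norm a)\<^sup>2"
    by (metis inner_L2_def power2_norm_eq_inner)
  then show ?thesis by (simp add: complex_eq_iff)
qed

lemma norm_sq_diff: "(norm (a - b))\<^sup>2 = (norm a)\<^sup>2 + (norm b)\<^sup>2 - 2 * Re (cinner a b)"
proof -
  have "Re (cinner b a) = Re (cinner a b)"
    by (subst cinner_commute) simp
  moreover have "cinner (a - b) (a - b) = cinner a a - cinner a b - (cinner b a - cinner b b)"
    by (simp add: cinner.diff_left cinner.diff_right)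
  ultimately have "Re (cinner (a - b) (a - b)) = Re (cinner a a) + Re (cinner b b) - 2 * Re (cinner a b)"
    by simp
  then show ?thesis
    unfolding cinner_self Re_complex_of_real .
qed

lemma norm_sq_add: "(norm (a + b))\<^sup>2 = (norm a)\<^sup>2 + (norm b)\<^sup>2 + 2 * Re (cinner a b)"
  using norm_sq_diff[of a "- b"] by (simp add: cinner.minus_right)

section \<open>Passing between classes and representatives\<close>

lemma sq_integrable_rep: "sq_integrable (rep_L2 a)"
  using Quotient3_rep_reflp[OF Quotient3_L2, of a] by (simp add: L2_rel_def)

lemma borel_measurable_rep [measurable]: "rep_L2 a \<in> borel_measurable borel"
  using sq_integrable_rep[of a] by (simp add: sq_integrable_def)

lemma L2_rel_self: "L2_rel f f \<longleftrightarrow> sq_integrable f"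
  by (auto simp: L2_rel_def)

lemma abs_rep_L2 [simp]: "abs_L2 (rep_L2 a) = a"
  by (rule Quotient3_abs_rep[OF Quotient3_L2])

lemma abs_L2_eq_iff:
  "sq_integrable f \<Longrightarrow> sq_integrable g \<Longrightarrow> abs_L2 f = abs_L2 g \<longleftrightarrow> (AE x in lborel. f x = g x)"
  using Quotient3_rel[OF Quotient3_L2, of f g] by (auto simp: L2_rel_def)

lemma rep_abs_L2: "sq_integrable f \<Longrightarrow> AE x in lborel. rep_L2 (abs_L2 f) x = f x"
  by (metis abs_L2_eq_iff abs_rep_L2 sq_integrable_rep)

lemma cinner_abs:
  "sq_integrable f \<Longrightarrow> sq_integrable g \<Longrightarrow>
    cinner (abs_L2 f) (abs_L2 g) = (LINT x|lborel. cnj (f x) * g x)"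
  by (simp add: cinner.abs_eq L2_rel_self)

lemma cinner_rep: "cinner a b = (LINT x|lborel. cnj (rep_L2 a x) * rep_L2 b x)"
  by (metis abs_rep_L2 cinner_abs sq_integrable_rep)

lemma plus_abs:
  "sq_integrable f \<Longrightarrow> sq_integrable g \<Longrightarrow> abs_L2 f + abs_L2 g = abs_L2 (\<lambda>x. f x + g x)"
  by (simp add: plus_L2.abs_eq L2_rel_self)

lemma scaleC_abs: "sq_integrable f \<Longrightarrow> scaleC c (abs_L2 f) = abs_L2 (\<lambda>x. c * f x)"
  by (simp add: scaleC.abs_eq L2_rel_self)

lemma sq_integrable_diff:
  "sq_integrable f \<Longrightarrow> sq_integrable g \<Longrightarrow> sq_integrable (\<lambda>x. f x - g x)"
  using sq_integrable_add[of f "\<lambda>x. (- 1) * g x"] sq_integrable_mult[of g "- 1"] by simp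

lemma diff_abs:
  assumes "sq_integrable f" "sq_integrable g"
  shows "abs_L2 f - abs_L2 g = abs_L2 (\<lambda>x. f x - g x)"
  using assms plus_abs[of f "\<lambda>x. (- 1) * g x"] sq_integrable_mult[of g "- 1"]
    scaleC_abs[of g "- 1"] by (simp add: diff_conv_add_uminus del: add_uminus_conv_diff)

lemma norm_abs_sq: "sq_integrable f \<Longrightarrow> (norm (abs_L2 f))\<^sup>2 = (LINT x|lborel. (cmod (f x))\<^sup>2)"
proof -
  assume f: "sq_integrable f"
  have "complex_of_real ((norm (abs_L2 f))\<^sup>2) = (LINT x|lborel. cnj (f x) * f x)"
    using f cinner_abs cinner_self by metis
  also have "\<dots> = (LINT x|lborel. of_real ((cmod (f x))\<^sup>2))"
    by (simp add: complex_norm_square mult.commute del: of_real_power)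
  finally show ?thesis
    by (metis integral_complex_of_real of_real_eq_iff)
qed

lemma norm_abs_sq_nn:
  "sq_integrable f \<Longrightarrow> ennreal ((norm (abs_L2 f))\<^sup>2) = (\<integral>\<^sup>+x. ennreal ((cmod (f x))\<^sup>2) \<partial>lborel)"
  by (subst nn_integral_eq_integral) (auto simp: norm_abs_sq sq_integrable_def)

lemma norm_diff_rep_sq_nn:
  "ennreal ((norm (a - b))\<^sup>2) = (\<integral>\<^sup>+x. ennreal ((cmod (rep_L2 a x - rep_L2 b x))\<^sup>2) \<partial>lborel)"
  using norm_abs_sq_nn[OF sq_integrable_diff[OF sq_integrable_rep[of a] sq_integrable_rep[of b]]]
  by (simp add: diff_abs[OF sq_integrable_rep sq_integrable_rep, symmetric])

lemma sq_integrableI: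
  assumes "f \<in> borel_measurable borel" "(\<integral>\<^sup>+x. ennreal ((cmod (f x))\<^sup>2) \<partial>lborel) < \<infinity>"
  shows "sq_integrable f"
  using assms unfolding sq_integrable_def
  by (auto intro!: integrableI_nonneg)

text \<open>A rapidly converging subsequence converges almost everywhere; Fatou's lemma then gives
  convergence in norm.\<close>

lemma L2_fast_Cauchy_convergent:
  fixes Y :: "nat \<Rightarrow> 'd::finite L2"
  assumes fast: "\<And>m n. m \<le> n \<Longrightarrow> norm (Y n - Y m) \<le> (1/4) ^ m"
  shows "\<exists>l. Y \<longlonglongrightarrow> l"
proof -
  define u where "u n = rep_L2 (Y n)" for n
  have [measurable]: "u n \<in> borel_measurable borel" for n
    by (simp add: u_def)
  \<comment> \<open>The squared increments have integral at most \<open>(1/16) ^ n\<close>. The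
    weight \<open>4 ^ n\<close> leaves a convergent geometric series, and where \<open>S\<close> is
    finite it still forces increments of order \<open>(1/2) ^ n\<close>, hence pointwise
    convergence.\<close>
  define S where "S x = (\<Sum>n. ennreal (4 ^ n * (cmod (u (Suc n) x - u n x))\<^sup>2))" for x
  have [measurable]: "S \<in> borel_measurable borel" unfolding S_def by measurable
  have nrm: "(\<integral>\<^sup>+x. ennreal ((cmod (u n x - u m x))\<^sup>2) \<partial>lborel) = ennreal ((norm (Y n - Y m))\<^sup>2)" for m n
    by (simp add: u_def norm_diff_rep_sq_nn)
  have "(\<integral>\<^sup>+x. S x \<partial>lborel) = (\<Sum>n. \<integral>\<^sup>+x. ennreal (4 ^ n * (cmod (u (Suc n) x - u n x))\<^sup>2) \<partial>lborel)"
    unfolding S_def by (intro nn_integral_suminf) measurable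
  also have "\<dots> \<le> (\<Sum>n. ennreal ((1/4) ^ n))"
  proof (intro suminf_le allI)
    fix n
    have "(\<integral>\<^sup>+x. ennreal (4 ^ n * (cmod (u (Suc n) x - u n x))\<^sup>2) \<partial>lborel)
        = ennreal (4 ^ n) * ennreal ((norm (Y (Suc n) - Y n))\<^sup>2)"
      by (subst nrm[symmetric], subst nn_integral_cmult[symmetric]) (auto simp: ennreal_mult)
    also have "\<dots> \<le> ennreal (4 ^ n) * ennreal (((1/4) ^ n)\<^sup>2)"
      using fast[of n "Suc n"] by (intro mult_left_mono ennreal_leI power_mono) auto
    also have "\<dots> = ennreal ((1/4) ^ n)"
      by (simp add: ennreal_mult[symmetric] power2_eq_square power_mult_distrib[symmetric] mult.assoc[symmetric])
    finally show "(\<integral>\<^sup>+x. ennreal (4 ^ n * (cmod (u (Suc n) x - u n x))\<^sup>2) \<partial>lborel) \<le> ennreal ((1/4) ^ n)" .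
  qed auto
  also have "\<dots> < \<infinity>"
    by (subst suminf_ennreal2) auto
  finally have "AE x in lborel. S x \<noteq> \<infinity>"
    by (intro nn_integral_PInf_AE) auto
  then have conv: "AE x in lborel. convergent (\<lambda>n. u n x)"
  proof eventually_elim
    case (elim x)
    define s where "s = enn2real (S x)"
    have s: "S x = ennreal s" "0 \<le> s" using elim by (auto simp: s_def less_top)
    have le: "cmod (u (Suc n) x - u n x) \<le> sqrt s * (1/2) ^ n" for n
    proof -
      have "ennreal (4 ^ n * (cmod (u (Suc n) x - u n x))\<^sup>2) \<le> S x"
        unfolding S_def
        by (rule order_trans[OF eq_refl sum_le_suminf[where I = "{n}"]]) auto
      then have "4 ^ n * (cmod (u (Suc n) x - u n x))\<^sup>2 \<le> s" using s by (simp add: ennreal_le_iff)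
      moreover have "(4::real) ^ n = (2 ^ n)\<^sup>2" by (simp add: power_mult flip: power_even_eq)
      ultimately have "(2 ^ n * cmod (u (Suc n) x - u n x))\<^sup>2 \<le> s" by (simp only: power_mult_distrib)
      then have "2 ^ n * cmod (u (Suc n) x - u n x) \<le> sqrt s" by (rule real_le_rsqrt)
      then have "cmod (u (Suc n) x - u n x) \<le> sqrt s / 2 ^ n"
        by (subst pos_le_divide_eq) (auto simp: mult.commute)
      then show ?thesis by (simp add: power_divide)
    qed
    have "summable (\<lambda>n. u (Suc n) x - u n x)"
      by (rule summable_comparison_test'[OF _ le]) (auto intro!: summable_mult summable_geometric)
    then have "convergent (\<lambda>n. u n x - u 0 x)"
      by (simp only: summable_iff_convergent sum_lessThan_telescope[of "\<lambda>n. u n x"])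
    then show ?case by (simp add: convergent_diff_const_right_iff)
  qed
  define v where "v x = lim (\<lambda>n. u n x)" for x
  have [measurable]: "v \<in> borel_measurable borel" unfolding v_def by measurable
  have lim: "AE x in lborel. (\<lambda>n. u n x) \<longlonglongrightarrow> v x"
    using conv by eventually_elim (simp add: v_def convergent_LIMSEQ_iff)
  have bnd: "(\<integral>\<^sup>+x. ennreal ((cmod (v x - u m x))\<^sup>2) \<partial>lborel) \<le> ennreal (((1/4) ^ m)\<^sup>2)" for m
  proof -
    have "(\<integral>\<^sup>+x. ennreal ((cmod (v x - u m x))\<^sup>2) \<partial>lborel)
        = (\<integral>\<^sup>+x. liminf (\<lambda>n. ennreal ((cmod (u n x - u m x))\<^sup>2)) \<partial>lborel)"
    proof (rule nn_integral_cong_AE, use lim in eventually_elim)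
      case (elim x)
      have "(\<lambda>n. ennreal ((cmod (u n x - u m x))\<^sup>2)) \<longlonglongrightarrow> ennreal ((cmod (v x - u m x))\<^sup>2)"
        using elim by (intro tendsto_ennrealI tendsto_intros)
      then show ?case by (intro lim_imp_Liminf[symmetric]) auto
    qed
    also have "\<dots> \<le> liminf (\<lambda>n. \<integral>\<^sup>+x. ennreal ((cmod (u n x - u m x))\<^sup>2) \<partial>lborel)"
      by (rule nn_integral_liminf) measurable
    also have "\<dots> \<le> ennreal (((1/4) ^ m)\<^sup>2)"
      unfolding nrm
      by (intro Liminf_le eventually_sequentiallyI[of m] ennreal_leI power_mono fast) auto
    finally show ?thesis .
  qed
  have "sq_integrable (\<lambda>x. v x - u 0 x)"
    by (rule sq_integrableI) (use bnd[of 0] in \<open>auto simp: le_less_trans\<close>)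
  then have "sq_integrable (\<lambda>x. (v x - u 0 x) + u 0 x)"
    by (rule sq_integrable_add) (simp add: u_def sq_integrable_rep)
  then have sv: "sq_integrable v" by simp
  have "norm (Y m - abs_L2 v) \<le> (1/4) ^ m" for m
  proof -
    have "abs_L2 v - Y m = abs_L2 (\<lambda>x. v x - u m x)"
      using diff_abs[OF sv sq_integrable_rep, of "Y m"] by (simp add: u_def)
    then have "ennreal ((norm (abs_L2 v - Y m))\<^sup>2) = (\<integral>\<^sup>+x. ennreal ((cmod (v x - u m x))\<^sup>2) \<partial>lborel)"
      using sv by (simp add: norm_abs_sq_nn sq_integrable_diff sq_integrable_rep u_def)
    then have "ennreal ((norm (abs_L2 v - Y m))\<^sup>2) \<le> ennreal (((1/4) ^ m)\<^sup>2)"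
      using bnd[of m] by simp
    then have "(norm (abs_L2 v - Y m))\<^sup>2 \<le> ((1/4) ^ m)\<^sup>2" by (simp add: ennreal_le_iff)
    then show ?thesis
      by (metis norm_minus_commute power2_le_imp_le zero_le_divide_1_iff zero_le_numeral zero_le_power)
  qed
  moreover have "(\<lambda>m. (1/4::real) ^ m) \<longlonglongrightarrow> 0" by (rule LIMSEQ_power_zero) simp
  ultimately have "(\<lambda>m. Y m - abs_L2 v) \<longlonglongrightarrow> 0"
    using Lim_null_comparison[of "\<lambda>m. Y m - abs_L2 v" "\<lambda>m. (1/4) ^ m" sequentially] by simp
  then show ?thesis by (auto simp: LIM_zero_iff)
qed

instance L2 :: (finite) complete_space
proof
  fix X :: "nat \<Rightarrow> 'a L2"
  assume X: "Cauchy X"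
  have "\<exists>N. \<forall>m\<ge>N. \<forall>n\<ge>N. norm (X m - X n) < (1/4) ^ k" for k
    using X[unfolded Cauchy_iff] by simp
  then obtain N where N: "\<And>k m n. N k \<le> m \<Longrightarrow> N k \<le> n \<Longrightarrow> norm (X m - X n) < (1/4) ^ k"
    by metis
  \<comment> \<open>Summing all earlier thresholds and adding \<open>k\<close> makes
    \<open>r\<close> strictly increasing and at least \<open>N\<close> at the same time.\<close>
  define r where "r k = (\<Sum>i\<le>k. N i) + k" for k
  have rN: "N k \<le> r k" for k
    unfolding r_def by (rule trans_le_add1, rule member_le_sum) auto
  have "strict_mono r" unfolding r_def by (rule strict_monoI_Suc) simp
  have "norm (X (r n) - X (r m)) \<le> (1/4) ^ m" if "m \<le> n" for m n
  proof -
    have "r m \<le> r n" using \<open>strict_mono r\<close> that by (simp add: strict_mono_less_eq)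
    then show ?thesis using N[of m "r n" "r m"] rN[of m] by simp
  qed
  then obtain l where "(X \<circ> r) \<longlonglongrightarrow> l"
    using L2_fast_Cauchy_convergent[of "X \<circ> r"] by auto
  then show "convergent X"
    using Cauchy_converges_subseq[OF X \<open>strict_mono r\<close>] by (auto simp: convergent_def)
qed

instance L2 :: (finite) banach ..

section \<open>Density of total subspaces\<close>

lemma parallelogram: "(norm (a + b))\<^sup>2 + (norm (a - b))\<^sup>2 = 2 * (norm a)\<^sup>2 + 2 * (norm (b :: 'd::finite L2))\<^sup>2"
  unfolding norm_sq_add norm_sq_diff by simp

text \<open>The projection theorem in disguise: a minimising sequence for the distance from
  \<open>x\<close> to \<open>M\<close> is Cauchy, its limit \<open>p\<close> leaves a residue
  \<open>x - p\<close> orthogonal to \<open>M\<close>, and totality makes this residue vanish, so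
  \<open>x\<close> is a limit of points of \<open>M\<close>.\<close>

lemma dense_if_total:
  fixes M :: "'d::finite L2 set"
  assumes add: "\<And>a b. a \<in> M \<Longrightarrow> b \<in> M \<Longrightarrow> a + b \<in> M"
    and scale: "\<And>c a. a \<in> M \<Longrightarrow> scaleC c a \<in> M"
    and ne: "M \<noteq> {}"
    and total: "\<And>v. (\<And>m. m \<in> M \<Longrightarrow> cinner m v = 0) \<Longrightarrow> v = 0"
  shows "closure M = UNIV"
proof -
  have "x \<in> closure M" for x
  proof -
    define d where "d = infdist x M"
    have d0: "0 \<le> d" unfolding d_def by (rule infdist_nonneg)
    have dle: "d \<le> norm (x - m)" if "m \<in> M" for m
      using infdist_le[OF that, of x] by (simp add: d_def dist_norm)
    have "\<exists>m\<in>M. norm (x - m) < d + inverse (Suc n)" for n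
    proof (rule ccontr)
      assume "\<not> ?thesis"
      then have *: "\<And>m. m \<in> M \<Longrightarrow> d + inverse (Suc n) \<le> dist x m" by (force simp: dist_norm)
      have "d + inverse (Suc n) \<le> infdist x M"
        unfolding infdist_notempty[OF ne] by (rule cINF_greatest[OF ne *])
      then show False by (simp add: d_def)
    qed
    then obtain m where m: "\<And>n. m n \<in> M" "\<And>n. norm (x - m n) < d + inverse (Suc n)" by metis
    have lim: "(\<lambda>n. norm (x - m n)) \<longlonglongrightarrow> d"
    proof (rule tendsto_sandwich[of "\<lambda>_. d" _ _ "\<lambda>n. d + inverse (Suc n)"])
      show "(\<lambda>n. d + inverse (Suc n)) \<longlonglongrightarrow> d"
        using tendsto_add[OF tendsto_const LIMSEQ_inverse_real_of_nat, of d] by simp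
      show "\<forall>\<^sub>F n in sequentially. norm (x - m n) \<le> d + inverse (Suc n)"
        using m(2) by (intro always_eventually allI less_imp_le)
    qed (auto intro!: always_eventually dle m(1))
    \<comment> \<open>The midpoint of \<open>m i\<close> and \<open>m j\<close> is again in
      \<open>M\<close>, hence at distance at least \<open>d\<close> from \<open>x\<close>; the
      parallelogram identity turns this into a bound on \<open>m i - m j\<close>.\<close>
    have par: "(norm (m i - m j))\<^sup>2 \<le> 2 * (norm (x - m i))\<^sup>2 + 2 * (norm (x - m j))\<^sup>2 - 4 * d\<^sup>2" for i j
    proof -
      have "(x - m i) + (x - m j) = 2 *\<^sub>R (x - (1/2) *\<^sub>R (m i + m j))"
        by (simp add: scaleR_2 algebra_simps)
      then have "norm ((x - m i) + (x - m j)) = 2 * norm (x - (1/2) *\<^sub>R (m i + m j))" by simp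
      moreover have "(1/2) *\<^sub>R (m i + m j) \<in> M"
        using scale[OF add[OF m(1) m(1)], of "of_real (1/2)" i j] by (simp only: scaleC_of_real)
      ultimately have "2 * d \<le> norm ((x - m i) + (x - m j))" using dle by simp
      then have "(2 * d)\<^sup>2 \<le> (norm ((x - m i) + (x - m j)))\<^sup>2" using d0 by (intro power_mono) auto
      moreover have "(x - m i) - (x - m j) = m j - m i" by simp
      ultimately show ?thesis
        using parallelogram[of "x - m i" "x - m j"] by (simp add: power_mult_distrib norm_minus_commute)
    qed
    have "Cauchy m"
    proof (rule metric_CauchyI)
      fix e :: real assume e: "0 < e"
      have "(\<lambda>n. (norm (x - m n))\<^sup>2) \<longlonglongrightarrow> d\<^sup>2" using lim by (intro tendsto_power)
      then have "\<forall>\<^sub>F n in sequentially. (norm (x - m n))\<^sup>2 < d\<^sup>2 + e\<^sup>2 / 4"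
        using e by (intro order_tendstoD(2)) auto
      then obtain N where N: "\<And>n. N \<le> n \<Longrightarrow> (norm (x - m n))\<^sup>2 < d\<^sup>2 + e\<^sup>2 / 4"
        by (auto simp: eventually_sequentially)
      have "dist (m i) (m j) < e" if "N \<le> i" "N \<le> j" for i j
      proof -
        have "(norm (m i - m j))\<^sup>2 < e\<^sup>2"
          using par[of i j] N[OF that(1)] N[OF that(2)] by simp
        then show ?thesis using e by (simp add: dist_norm power_less_imp_less_base)
      qed
      then show "\<exists>N. \<forall>i\<ge>N. \<forall>j\<ge>N. dist (m i) (m j) < e" by blast
    qed
    then obtain p where p: "m \<longlonglongrightarrow> p" using Cauchy_convergent convergent_def by blast
    define v where "v = x - p"
    have "(\<lambda>n. norm (x - m n)) \<longlonglongrightarrow> norm v" unfolding v_def using p by (intro tendsto_intros)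
    then have nv: "norm v = d" using lim LIMSEQ_unique by blast
    have near: "d \<le> norm (v - y)" if "y \<in> M" for y
    proof -
      have "(\<lambda>n. norm (x - (m n + y))) \<longlonglongrightarrow> norm (x - (p + y))" using p by (intro tendsto_intros)
      then have "d \<le> norm (x - (p + y))"
        by (rule LIMSEQ_le_const) (use dle add m(1) that in blast)
      then show ?thesis by (simp add: v_def algebra_simps)
    qed
    have "cinner y v = 0" if y: "y \<in> M" for y
    proof (rule ccontr)
      assume nz: "cinner y v \<noteq> 0"
      \<comment> \<open>Moving from \<open>v\<close> by the multiple \<open>t * cinner y v\<close>
        of \<open>y\<close> changes the squared distance by
        \<open>t * (cmod (cinner y v))\<^sup>2 * (t * (norm y)\<^sup>2 - 2)\<close>. This
        \<open>t\<close> is small enough to make the change negative, and the \<open>1 +\<close>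
        covers \<open>y = 0\<close>.\<close>
      define t where "t = 1 / (1 + (norm y)\<^sup>2)"
      have t: "0 < t" "t * (norm y)\<^sup>2 < 1"
        unfolding t_def by (auto simp: field_simps add_pos_nonneg)
      define w where "w = scaleC (of_real t * cinner y v) y"
      have "cinner v w = of_real t * of_real ((cmod (cinner y v))\<^sup>2)"
        unfolding w_def
        by (simp add: cinner_scaleC_right cinner_commute[of v y] complex_norm_square mult.assoc del: of_real_power)
      then have "Re (cinner v w) = t * (cmod (cinner y v))\<^sup>2"
        by (metis Re_complex_of_real of_real_mult)
      moreover have "(norm w)\<^sup>2 = t\<^sup>2 * (cmod (cinner y v))\<^sup>2 * (norm y)\<^sup>2"
        using t by (simp add: w_def power_mult_distrib norm_mult)
      ultimately have "(norm (v - w))\<^sup>2 = d\<^sup>2 + t * (cmod (cinner y v))\<^sup>2 * (t * (norm y)\<^sup>2 - 2)"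
        unfolding norm_sq_diff nv by (simp add: power2_eq_square algebra_simps)
      moreover have "t * (cmod (cinner y v))\<^sup>2 * (t * (norm y)\<^sup>2 - 2) < 0"
        using t nz by (intro mult_pos_neg mult_pos_pos) auto
      ultimately have "(norm (v - w))\<^sup>2 < d\<^sup>2" by linarith
      moreover have "d\<^sup>2 \<le> (norm (v - w))\<^sup>2"
        using near[of w] scale[OF y] d0 by (intro power_mono) (auto simp: w_def)
      ultimately show False by linarith
    qed
    then have "v = 0" by (rule total)
    then show ?thesis using p m(1) by (auto simp: v_def closure_sequential)
  qed
  then show ?thesis by blast
qed

section \<open>Test functions\<close>

text \<open>\<open>expinv 0\<close> is the classical smooth function that is flat at 0. The powers
  of \<open>1 / t\<close> are included so that the span of the family is closed under
  differentiation.\<close>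

definition expinv :: "nat \<Rightarrow> real \<Rightarrow> real" where
  "expinv k t = (if 0 < t then (1 / t) ^ k * exp (- (1 / t)) else 0)"

lemma expinv_tendsto_0: "(expinv k \<longlongrightarrow> 0) (at_right 0)"
proof -
  have "((\<lambda>s::real. s ^ k / exp s) \<longlongrightarrow> 0) at_top" by (rule tendsto_power_div_exp_0)
  then have "((\<lambda>t::real. (1 / t) ^ k / exp (1 / t)) \<longlongrightarrow> 0) (at_right 0)"
    by (rule filterlim_compose) (use filterlim_inverse_at_top_right in \<open>simp add: inverse_eq_divide\<close>)
  then show ?thesis
    by (rule Lim_transform_eventually)
       (auto simp: expinv_def exp_minus divide_inverse eventually_at_filter intro!: always_eventually)
qed

lemma DERIV_expinv: "(expinv k has_real_derivative expinv (k + 2) t - of_nat k * expinv (k + 1) t) (at t)"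
proof -
  consider "0 < t" | "t < 0" | "t = 0" by linarith
  then show ?thesis
  proof cases
    case 1
    define s E where "s = 1 / t" and "E = exp (- s)"
    have D: "((\<lambda>t. 1 / t) has_real_derivative - (s\<^sup>2)) (at t)"
      using 1 by (auto intro!: derivative_eq_intros simp: s_def power2_eq_square)
    have "((\<lambda>t. (1 / t) ^ k * exp (- (1 / t))) has_real_derivative
        of_nat k * (- (s\<^sup>2) * s ^ (k - Suc 0)) * E + E * - (- (s\<^sup>2)) * s ^ k) (at t)"
      using DERIV_mult[OF DERIV_power[OF D, of k] DERIV_fun_exp[OF DERIV_minus[OF D]]]
      by (simp add: s_def E_def)
    moreover have "of_nat k * (- (s\<^sup>2) * s ^ (k - Suc 0)) * E + E * - (- (s\<^sup>2)) * s ^ k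
        = expinv (k + 2) t - of_nat k * expinv (k + 1) t"
      using 1 unfolding expinv_def s_def[symmetric] E_def[symmetric]
      by (cases k) (simp_all add: power2_eq_square algebra_simps)
    ultimately have "((\<lambda>t. (1 / t) ^ k * exp (- (1 / t))) has_real_derivative
        expinv (k + 2) t - of_nat k * expinv (k + 1) t) (at t)" by simp
    moreover have "\<forall>\<^sub>F x in nhds t. (1 / x) ^ k * exp (- (1 / x)) = expinv k x"
      by (rule eventually_mono[OF eventually_nhds_in_open[of "{0<..}" t]]) (use 1 in \<open>auto simp: expinv_def\<close>)
    ultimately show ?thesis by (subst (asm) DERIV_cong_ev[OF refl _ refl])
  next
    case 2
    have "\<forall>\<^sub>F x in nhds t. 0 = expinv k x"
      by (rule eventually_mono[OF eventually_nhds_in_open[of "{..<0}" t]]) (use 2 in \<open>auto simp: expinv_def\<close>)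
    then have "((\<lambda>x. 0) has_real_derivative 0) (at t) \<longleftrightarrow> (expinv k has_real_derivative 0) (at t)"
      by (rule DERIV_cong_ev[OF refl _ refl])
    then show ?thesis using 2 by (simp add: expinv_def)
  next
    case 3
    \<comment> \<open>At the origin the difference quotient is \<open>expinv (Suc k)\<close> itself,
      so flatness of the next member of the family gives derivative 0.\<close>
    have "((\<lambda>h. expinv k h / h) \<longlongrightarrow> 0) (at_right 0)"
    proof (rule Lim_transform_eventually[OF expinv_tendsto_0[of "Suc k"]])
      show "\<forall>\<^sub>F h in at_right 0. expinv (Suc k) h = expinv k h / h"
        by (auto simp: expinv_def eventually_at_filter)
    qed
    moreover have "((\<lambda>h. expinv k h / h) \<longlongrightarrow> 0) (at_left 0)"
      by (rule Lim_transform_eventually[OF tendsto_const]) (auto simp: expinv_def eventually_at_filter)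
    ultimately have "((\<lambda>h. expinv k h / h) \<longlongrightarrow> 0) (at 0)"
      by (simp add: filterlim_at_split)
    then show ?thesis using 3 by (simp add: DERIV_def) (simp add: expinv_def)
  qed
qed

lemma continuous_on_expinv: "continuous_on UNIV (expinv k)"
  by (intro DERIV_continuous_on) (rule has_field_derivative_at_within[OF DERIV_expinv])

text \<open>\<open>Ck\<close> is defined by recursion on partial derivatives, so smoothness is
  proved for a whole class closed under taking them. Constants and the functions
  \<open>expinv k\<close> of affine coordinates generate such an algebra, and
  \<open>Ck_bump_algebra\<close> then needs only induction on the order.\<close>

inductive_set bump_algebra :: "(real^'d \<Rightarrow> complex) set" where
  const: "(\<lambda>y. c) \<in> bump_algebra"
| coord: "(\<lambda>y. of_real (expinv k (s * y $ i + c))) \<in> bump_algebra"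
| add: "f \<in> bump_algebra \<Longrightarrow> g \<in> bump_algebra \<Longrightarrow> (\<lambda>y. f y + g y) \<in> bump_algebra"
| mult: "f \<in> bump_algebra \<Longrightarrow> g \<in> bump_algebra \<Longrightarrow> (\<lambda>y. f y * g y) \<in> bump_algebra"

lemma bump_algebra_derivative:
  assumes "f \<in> bump_algebra"
  shows "\<exists>D. (\<forall>j. D j \<in> bump_algebra) \<and>
    (\<forall>y :: real^'d. (f has_derivative (\<lambda>v. \<Sum>j\<in>UNIV. of_real (v $ j) * D j y)) (at y))"
  using assms
proof induction
  case (const c)
  have "(\<lambda>y :: real^'d. 0::complex) \<in> bump_algebra" by (rule bump_algebra.const)
  then show ?case by (intro exI[of _ "\<lambda>j y. 0"]) auto
next
  case (coord k s i c)
  define D where "D j = (\<lambda>y :: real^'d. if j = i then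
      of_real s * (of_real (expinv (k + 2) (s * y $ i + c))
        + (- of_nat k) * of_real (expinv (k + 1) (s * y $ i + c))) else (0::complex))" for j
  have "D j \<in> bump_algebra" for j
    unfolding D_def by (cases "j = i") (simp_all only: simp_thms if_True if_False, (intro bump_algebra.intros)+)
  moreover have "((\<lambda>y. complex_of_real (expinv k (s * y $ i + c))) has_derivative
      (\<lambda>v. \<Sum>j\<in>UNIV. of_real (v $ j) * D j y)) (at y)" for y
  proof -
    have "((\<lambda>y. expinv k (s * y $ i + c)) has_derivative
        (\<lambda>v. (expinv (k + 2) (s * y $ i + c) - of_nat k * expinv (k + 1) (s * y $ i + c)) * (s * v $ i))) (at y)"
      by (rule has_derivative_compose[of "\<lambda>y. s * y $ i + c" _ _ _ "expinv k",
            OF _ DERIV_expinv[unfolded has_field_derivative_def]])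
         (auto intro!: derivative_eq_intros bounded_linear_imp_has_derivative bounded_linear_vec_nth)
    then have "((\<lambda>y. complex_of_real (expinv k (s * y $ i + c))) has_derivative
        (\<lambda>v. of_real ((expinv (k + 2) (s * y $ i + c) - of_nat k * expinv (k + 1) (s * y $ i + c)) * (s * v $ i)))) (at y)"
      by (rule bounded_linear.has_derivative[OF bounded_linear_of_real])
    moreover have "(\<Sum>j\<in>UNIV. of_real (v $ j) * D j y) = of_real ((expinv (k + 2) (s * y $ i + c)
        - of_nat k * expinv (k + 1) (s * y $ i + c)) * (s * v $ i))" for v
    proof -
      have "(\<Sum>j\<in>UNIV. of_real (v $ j) * D j y) = (\<Sum>j\<in>{i}. of_real (v $ j) * D j y)"
        by (rule sum.mono_neutral_right) (auto simp: D_def)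
      then show ?thesis by (simp add: D_def algebra_simps)
    qed
    ultimately show ?thesis by simp
  qed
  ultimately show ?case by blast
next
  case (add f g)
  then obtain D E where D: "\<And>j. D j \<in> bump_algebra"
      "\<And>y. (f has_derivative (\<lambda>v. \<Sum>j\<in>UNIV. of_real (v $ j) * D j y)) (at y)"
    and E: "\<And>j. E j \<in> bump_algebra"
      "\<And>y. (g has_derivative (\<lambda>v. \<Sum>j\<in>UNIV. of_real (v $ j) * E j y)) (at y)"
    by blast
  have "((\<lambda>y. f y + g y) has_derivative (\<lambda>v. \<Sum>j\<in>UNIV. of_real (v $ j) * (D j y + E j y))) (at y)" for y
    using has_derivative_add[OF D(2) E(2)] by (simp add: distrib_left sum.distrib)
  then show ?case
    by (intro exI[of _ "\<lambda>j y. D j y + E j y"]) (auto intro: bump_algebra.add D E)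
next
  case (mult f g)
  then obtain D E where D: "\<And>j. D j \<in> bump_algebra"
      "\<And>y. (f has_derivative (\<lambda>v. \<Sum>j\<in>UNIV. of_real (v $ j) * D j y)) (at y)"
    and E: "\<And>j. E j \<in> bump_algebra"
      "\<And>y. (g has_derivative (\<lambda>v. \<Sum>j\<in>UNIV. of_real (v $ j) * E j y)) (at y)"
    by blast
  have "((\<lambda>y. f y * g y) has_derivative
      (\<lambda>v. \<Sum>j\<in>UNIV. of_real (v $ j) * (f y * E j y + D j y * g y))) (at y)" for y
    using has_derivative_mult[OF D(2) E(2)]
    by (simp add: sum_distrib_left sum_distrib_right distrib_left sum.distrib mult_ac)
  then show ?case
    using bump_algebra.add[OF bump_algebra.mult[OF mult.hyps(1) E(1)] bump_algebra.mult[OF D(1) mult.hyps(2)]]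
    by (intro exI[of _ "\<lambda>j y. f y * E j y + D j y * g y"]) blast
qed

lemma Ck_bump_algebra: "f \<in> bump_algebra \<Longrightarrow> Ck k f"
proof (induction k arbitrary: f)
  case 0
  obtain D where "\<And>y. (f has_derivative (\<lambda>v. \<Sum>j\<in>UNIV. of_real (v $ j) * D j y)) (at y)"
    using bump_algebra_derivative[OF 0] by blast
  then show ?case
    by (auto intro!: has_derivative_continuous continuous_at_imp_continuous_on)
next
  case (Suc k)
  obtain D where D: "\<And>j. D j \<in> bump_algebra"
    "\<And>y. (f has_derivative (\<lambda>v. \<Sum>j\<in>UNIV. of_real (v $ j) * D j y)) (at y)"
    using bump_algebra_derivative[OF Suc.prems] by blast
  have "frechet_derivative f (at y) (axis j 1) = D j y" for j y
  proof -
    have "frechet_derivative f (at y) (axis j 1) = (\<Sum>i\<in>UNIV. of_real (axis j 1 $ i) * D i y)"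
      by (subst frechet_derivative_at[OF D(2), symmetric]) (rule refl)
    also have "\<dots> = (\<Sum>i\<in>{j}. of_real (axis j 1 $ i) * D i y)"
      by (rule sum.mono_neutral_right) (auto simp: axis_def)
    finally show ?thesis by (simp add: axis_def)
  qed
  then have "(\<lambda>y. frechet_derivative f (at y) (axis j 1)) = D j" for j by blast
  with D Suc.IH show ?case by (auto simp: differentiable_def)
qed

lemma Ck_translate: "Ck k f \<Longrightarrow> Ck k (\<lambda>y. f (y + c))"
proof (induction k arbitrary: f)
  case 0
  then show ?case by (auto intro!: continuous_intros elim!: continuous_on_compose2)
next
  case (Suc k)
  have *: "((\<lambda>y. f (y + c)) has_derivative frechet_derivative f (at (y + c))) (at y)" for y
    using Suc.prems
    by (intro has_derivative_compose[of "\<lambda>y. y + c" _ _ _ f, simplified])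
       (auto intro!: derivative_eq_intros simp: frechet_derivative_works[symmetric])
  have "frechet_derivative (\<lambda>y. f (y + c)) (at y) = frechet_derivative f (at (y + c))" for y
    by (rule frechet_derivative_at[OF *, symmetric])
  moreover have "Ck k (\<lambda>y. frechet_derivative f (at (y + c)) (axis j 1))" for j
    using Suc.IH[of "\<lambda>y. frechet_derivative f (at y) (axis j 1)"] Suc.prems by simp
  ultimately show ?case using * by (auto simp: differentiable_def)
qed

lemma Ck_lincomb: "Ck k f \<Longrightarrow> Ck k g \<Longrightarrow> Ck k (\<lambda>y. a * f y + b * g y)"
proof (induction k arbitrary: f g)
  case 0
  then show ?case by (auto intro!: continuous_intros)
next
  case (Suc k)
  have *: "((\<lambda>y. a * f y + b * g y) has_derivative
      (\<lambda>v. a * frechet_derivative f (at y) v + b * frechet_derivative g (at y) v)) (at y)" for y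
    using Suc.prems
    by (auto intro!: has_derivative_add has_derivative_mult_right simp: frechet_derivative_works[symmetric])
  have "frechet_derivative (\<lambda>y. a * f y + b * g y) (at y)
      = (\<lambda>v. a * frechet_derivative f (at y) v + b * frechet_derivative g (at y) v)" for y
    by (rule frechet_derivative_at[OF *, symmetric])
  moreover have "Ck k (\<lambda>y. a * frechet_derivative f (at y) (axis j 1) + b * frechet_derivative g (at y) (axis j 1))" for j
    using Suc.IH[of "\<lambda>y. frechet_derivative f (at y) (axis j 1)" "\<lambda>y. frechet_derivative g (at y) (axis j 1)"]
      Suc.prems by simp
  ultimately show ?case using * by (auto simp: differentiable_def)
qed

lemma test_functionI:
  assumes "\<And>k. Ck k f" "bounded B" "\<And>y. y \<notin> B \<Longrightarrow> f y = 0"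
  shows "test_function f"
proof -
  have "{y. f y \<noteq> 0} \<subseteq> B" using assms(3) by blast
  then have "bounded {y. f y \<noteq> 0}" using assms(2) bounded_subset by blast
  then show ?thesis using assms(1) by (simp add: test_function_def compact_eq_bounded_closed bounded_closure)
qed

lemma test_function_bounded_support:
  "test_function f \<Longrightarrow> \<exists>r>0. \<forall>y. r < norm y \<longrightarrow> f y = 0"
proof -
  assume "test_function f"
  then have "bounded {y. f y \<noteq> 0}"
    using bounded_subset[OF compact_imp_bounded closure_subset] by (auto simp: test_function_def)
  then obtain r where "0 < r" "\<And>y. f y \<noteq> 0 \<Longrightarrow> norm y \<le> r" by (auto simp: bounded_pos)
  then show ?thesis by (metis leD)
qed

lemma test_function_translate:
  assumes "test_function f" shows "test_function (\<lambda>y. f (y + c))"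
proof -
  obtain r where r: "0 < r" "\<And>y. r < norm y \<Longrightarrow> f y = 0"
    using test_function_bounded_support[OF assms] by blast
  show ?thesis
  proof (rule test_functionI[where B = "cball 0 (r + norm c)"])
    show "Ck k (\<lambda>y. f (y + c))" for k
      using assms by (intro Ck_translate) (simp add: test_function_def)
    show "f (y + c) = 0" if "y \<notin> cball 0 (r + norm c)" for y
    proof (rule r(2))
      have "norm y \<le> norm (y + c) + norm c" using norm_triangle_ineq4[of "y + c" c] by simp
      with that show "r < norm (y + c)" by simp
    qed
  qed simp
qed

lemma test_function_lincomb:
  assumes "test_function f" "test_function g" shows "test_function (\<lambda>y. a * f y + b * g y)"
proof -
  obtain r where r: "0 < r" "\<And>y. r < norm y \<Longrightarrow> f y = 0"
    using test_function_bounded_support[OF assms(1)] by blast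
  obtain s where s: "0 < s" "\<And>y. s < norm y \<Longrightarrow> g y = 0"
    using test_function_bounded_support[OF assms(2)] by blast
  show ?thesis
    by (rule test_functionI[where B = "cball 0 (max r s)"])
       (use assms r s in \<open>auto simp: test_function_def intro: Ck_lincomb\<close>)
qed

lemma test_function_continuous: "test_function f \<Longrightarrow> continuous_on UNIV f"
  unfolding test_function_def using Ck.simps(1)[of f] by blast

lemma bounded_continuous_bounded_support:
  fixes f :: "real^'d \<Rightarrow> complex"
  assumes "continuous_on UNIV f" "\<And>y. r < norm y \<Longrightarrow> f y = 0"
  shows "\<exists>B\<ge>0. \<forall>y. cmod (f y) \<le> B"
proof -
  have "compact (f ` cball 0 r)"
    by (intro compact_continuous_image continuous_on_subset[OF assms(1)]) auto
  then obtain B where B: "0 < B" "\<And>y. y \<in> cball 0 r \<Longrightarrow> cmod (f y) \<le> B"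
    by (auto dest!: compact_imp_bounded simp: bounded_pos)
  have "cmod (f y) \<le> B" for y
    using B(1) B(2)[of y] assms(2)[of y] by (cases "norm y \<le> r") auto
  then show ?thesis using B(1) by (intro exI[of _ B]) auto
qed

lemma sq_integrable_bounded_support:
  fixes f :: "real^'d \<Rightarrow> complex"
  assumes [measurable]: "f \<in> borel_measurable borel" and "\<And>y. cmod (f y) \<le> B" "\<And>y. r < norm y \<Longrightarrow> f y = 0"
  shows "sq_integrable f"
proof -
  have "(\<integral>\<^sup>+y. ennreal ((cmod (f y))\<^sup>2) \<partial>lborel) \<le> (\<integral>\<^sup>+y. ennreal (B\<^sup>2) * indicator (cball (0::real^'d) r) y \<partial>lborel)"
    by (rule nn_integral_mono) (use assms(2,3) in \<open>auto simp: indicator_def intro!: ennreal_leI power_mono\<close>)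
  also have "\<dots> = ennreal (B\<^sup>2) * emeasure lborel (cball (0::real^'d) r)"
    by (rule nn_integral_cmult_indicator) simp
  also have "\<dots> < \<infinity>"
    using emeasure_bounded_finite[of "cball (0::real^'d) r"] by (simp add: ennreal_mult_less_top)
  finally show ?thesis by (intro sq_integrableI) auto
qed

lemma test_function_sq_integrable: "test_function f \<Longrightarrow> sq_integrable f"
proof -
  assume f: "test_function f"
  obtain r where r: "\<And>y. r < norm y \<Longrightarrow> f y = 0" using test_function_bounded_support[OF f] by blast
  obtain B where "\<And>y. cmod (f y) \<le> B"
    using bounded_continuous_bounded_support[OF test_function_continuous[OF f] r] by blast
  then show ?thesis
    using sq_integrable_bounded_support[of f B r] r test_function_continuous[OF f]
    by (auto intro: borel_measurable_continuous_onI)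
qed

lemma sq_integrable_cnj: "sq_integrable f \<Longrightarrow> sq_integrable (\<lambda>x. cnj (f x))"
  unfolding sq_integrable_def
  by (auto intro: borel_measurable_continuous_on[of cnj] continuous_intros)

lemma integrable_mult_sq:
  assumes "sq_integrable f" "sq_integrable g"
  shows "integrable lborel (\<lambda>x. f x * g x)"
  using integrable_cnj_mult[OF sq_integrable_cnj[OF assms(1)] assms(2)] by simp

lemma pairing_eq_cinner:
  "sq_integrable f \<Longrightarrow> (LINT y|lborel. f y * rep_L2 v y) = cinner (abs_L2 (\<lambda>y. cnj (f y))) v"
  using cinner_abs[OF sq_integrable_cnj sq_integrable_rep, of f v] by simp

lemma norm_abs_cnj: "sq_integrable f \<Longrightarrow> norm (abs_L2 (\<lambda>y. cnj (f y))) = norm (abs_L2 f)"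
proof -
  assume f: "sq_integrable f"
  have "(norm (abs_L2 (\<lambda>x. cnj (f x))))\<^sup>2 = (norm (abs_L2 f))\<^sup>2"
    unfolding norm_abs_sq[OF f] norm_abs_sq[OF sq_integrable_cnj[OF f]] by simp
  then show ?thesis by (rule power2_eq_imp_eq) (rule norm_ge_zero)+
qed

lemma pairing_le:
  assumes "sq_integrable f"
  shows "cmod (LINT x|lborel. f x * rep_L2 v x) \<le> norm (abs_L2 f) * norm v"
  using cmod_cinner_le[of "abs_L2 (\<lambda>x. cnj (f x))" v]
  by (simp add: pairing_eq_cinner[OF assms] norm_abs_cnj[OF assms])

text \<open>Each coordinate contributes \<open>exp (- 1 / (n (y - a)))\<close> and
  \<open>exp (- 1 / (n (b - y)))\<close> inside the box and 0 outside; increasing \<open>n\<close>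
  pushes both factors to 1 and the product to the indicator of the open box. The arguments are
  written as slope times coordinate plus constant to match the rule \<open>coord\<close>.\<close>

definition bump :: "real^'d \<Rightarrow> real^'d \<Rightarrow> nat \<Rightarrow> real^'d \<Rightarrow> complex" where
  "bump a b n y = (\<Prod>i\<in>UNIV. of_real (expinv 0 (real n * y $ i + - real n * a $ i))
      * of_real (expinv 0 (- real n * y $ i + real n * b $ i)))"

lemma bump_algebra_prod:
  "finite I \<Longrightarrow> (\<And>i. i \<in> I \<Longrightarrow> f i \<in> bump_algebra) \<Longrightarrow> (\<lambda>y. \<Prod>i\<in>I. f i y) \<in> bump_algebra"
  by (induction I rule: finite_induct) (auto intro: bump_algebra.const bump_algebra.mult)

lemma expinv_0_bounds: "0 \<le> expinv 0 t" "expinv 0 t \<le> 1"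
  by (auto simp: expinv_def)

lemma bump_nonzero_imp: "bump a b n y \<noteq> 0 \<Longrightarrow> y \<in> box a b"
proof -
  assume "bump a b n y \<noteq> 0"
  then have "0 < real n * y $ i + - real n * a $ i \<and> 0 < - real n * y $ i + real n * b $ i" for i
    by (auto simp: bump_def expinv_def split: if_splits)
  then have "real n * a $ i < real n * y $ i \<and> real n * y $ i < real n * b $ i" for i
    by (simp add: algebra_simps)
  then show "y \<in> box a b"
    using mult_less_cancel_left_pos[of "real n"] by (auto simp: mem_box_cart mult_less_cancel_left)
qed

lemma test_function_bump: "test_function (bump a b n)"
proof (rule test_functionI)
  have "bump a b n \<in> bump_algebra"
    unfolding bump_def by (intro bump_algebra_prod bump_algebra.mult bump_algebra.coord) auto
  then show "Ck k (bump a b n)" for k by (rule Ck_bump_algebra)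
  show "bounded (box a b)" by (rule bounded_box)
qed (use bump_nonzero_imp in blast)

lemma cmod_bump_le: "cmod (bump a b n y) \<le> 1"
  unfolding bump_def prod_norm[symmetric] norm_mult norm_of_real
  by (rule prod_le_1) (use expinv_0_bounds in \<open>auto intro!: mult_le_one\<close>)

lemma expinv_0_tendsto:
  assumes "0 < t" shows "(\<lambda>n. expinv 0 (real n * t)) \<longlonglongrightarrow> 1"
proof (rule Lim_transform_eventually)
  have "(\<lambda>n. exp (- ((1 / t) * inverse (real n)))) \<longlonglongrightarrow> exp (- ((1 / t) * 0))"
    by (intro tendsto_intros lim_inverse_n)
  then show "(\<lambda>n. exp (- ((1 / t) * inverse (real n)))) \<longlonglongrightarrow> 1" by simp
  show "\<forall>\<^sub>F n in sequentially. exp (- ((1 / t) * inverse (real n))) = expinv 0 (real n * t)"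
    using eventually_gt_at_top[of 0]
    by eventually_elim (use assms in \<open>auto simp: expinv_def divide_inverse\<close>)
qed

lemma bump_tendsto: "(\<lambda>n. bump a b n y) \<longlonglongrightarrow> indicator (box a b) y"
proof (cases "y \<in> box a b")
  case True
  have "(\<lambda>n. bump a b n y) \<longlonglongrightarrow> (\<Prod>i\<in>(UNIV::'a set). of_real 1 * of_real 1)"
    unfolding bump_def
  proof (intro tendsto_intros)
    fix i :: 'a
    have "0 < y $ i - a $ i" "0 < b $ i - y $ i" using True by (auto simp: mem_box_cart)
    from this[THEN expinv_0_tendsto]
    show "(\<lambda>n. expinv 0 (real n * y $ i + - real n * a $ i)) \<longlonglongrightarrow> 1"
      "(\<lambda>n. expinv 0 (- real n * y $ i + real n * b $ i)) \<longlonglongrightarrow> 1"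
      by (simp_all add: algebra_simps)
  qed
  then show ?thesis using True by simp
next
  case False
  then have "bump a b n y = 0" for n using bump_nonzero_imp by blast
  then show ?thesis using False by simp
qed

section \<open>Pairings with bump functions separate points\<close>

lemma integrable_indicator_rep:
  fixes v :: "'d::finite L2"
  assumes [measurable]: "K \<in> sets borel" and "bounded K"
  shows "integrable lborel (\<lambda>y. indicator K y * rep_L2 v y)"
    and "integrable lborel (\<lambda>y. indicator K y * cmod (rep_L2 v y))"
proof -
  obtain r where r: "\<And>y. y \<in> K \<Longrightarrow> norm y \<le> r" using assms(2) by (auto simp: bounded_iff)
  have "sq_integrable (indicator K :: _ \<Rightarrow> complex)"
    by (rule sq_integrable_bounded_support[of _ 1 r]) (use r in \<open>auto simp: indicator_def not_less\<close>, force)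
  then show 1: "integrable lborel (\<lambda>y. indicator K y * rep_L2 v y)"
    by (rule integrable_mult_sq) (rule sq_integrable_rep)
  show "integrable lborel (\<lambda>y. indicator K y * cmod (rep_L2 v y))"
    using integrable_norm[OF 1]
    by (rule Bochner_Integration.integrable_cong[THEN iffD1, rotated -1]) (auto simp: indicator_def)
qed

lemma bump_measurable [measurable]: "bump a b n \<in> borel_measurable borel"
  by (intro borel_measurable_continuous_onI test_function_continuous test_function_bump)

lemma rational_vector_approx:
  fixes a :: "real^'d"
  shows "\<exists>A. (\<forall>m i. A m $ i \<in> \<rat>) \<and> (\<forall>m i. \<bar>A m $ i - a $ i\<bar> < 1) \<and> (\<forall>i. (\<lambda>m. A m $ i) \<longlonglongrightarrow> a $ i)"
proof -
  have "\<exists>q\<in>\<rat>. \<bar>q - a $ i\<bar> < inverse (real (Suc m))" for m i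
  proof -
    have "a $ i < a $ i + inverse (real (Suc m))" by simp
    from Rats_dense_in_real[OF this] obtain q
      where "q \<in> \<rat>" "a $ i < q" "q < a $ i + inverse (real (Suc m))" by blast
    then show ?thesis by (intro bexI[of _ q]) (auto simp del: of_nat_Suc)
  qed
  then have "\<exists>q. q \<in> \<rat> \<and> \<bar>q - a $ i\<bar> < inverse (real (Suc m))" for m i by blast
  note ex = someI_ex[OF this]
  define q where "q m i = (SOME q. q \<in> \<rat> \<and> \<bar>q - a $ i\<bar> < inverse (real (Suc m)))" for m i
  have q: "q m i \<in> \<rat>" "\<bar>q m i - a $ i\<bar> < inverse (real (Suc m))" for m i
    using ex[of i m] by (simp_all only: q_def)
  have le: "inverse (real (Suc m)) \<le> 1" for m by (simp add: field_simps)
  have "(\<lambda>m. q m i - a $ i) \<longlonglongrightarrow> 0" for i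
    by (rule Lim_null_comparison[OF _ LIMSEQ_inverse_real_of_nat])
       (intro always_eventually allI, simp only: real_norm_def less_imp_le[OF q(2)])
  then have "(\<lambda>m. q m i) \<longlonglongrightarrow> a $ i" for i by (simp add: LIM_zero_iff)
  then show ?thesis
    using q(1) less_le_trans[OF q(2) le]
    by (intro exI[of _ "\<lambda>m. \<chi> i. q m i"] conjI allI) (simp_all only: vec_lambda_beta)
qed

lemma pairing_bump_tendsto:
  fixes v :: "'d::finite L2"
  assumes lim: "\<And>y. (\<lambda>m. bump (A m) (B m) (N m) y) \<longlonglongrightarrow> g y"
    and A: "\<And>m i. \<bar>A m $ i - a $ i\<bar> < 1" and B: "\<And>m i. \<bar>B m $ i - b $ i\<bar> < 1"
    and [measurable]: "g \<in> borel_measurable borel"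
  shows "(\<lambda>m. LINT y|lborel. bump (A m) (B m) (N m) y * rep_L2 v y) \<longlonglongrightarrow> (LINT y|lborel. g y * rep_L2 v y)"
proof (rule integral_dominated_convergence)
  \<comment> \<open>All corners stay within distance 1 of \<open>a\<close> and \<open>b\<close> in
    each coordinate, so one enlarged box dominates the whole sequence of bumps.\<close>
  let ?K = "box (\<chi> i. a $ i - 1) (\<chi> i. b $ i + 1) :: (real^'d) set"
  show "integrable lborel (\<lambda>y. indicator ?K y * cmod (rep_L2 v y))"
    by (rule integrable_indicator_rep) (auto simp: bounded_box)
  show "AE y in lborel. (\<lambda>m. bump (A m) (B m) (N m) y * rep_L2 v y) \<longlonglongrightarrow> g y * rep_L2 v y"
    by (intro AE_I2 tendsto_intros lim)
  have "cmod (bump (A m) (B m) (N m) y * rep_L2 v y) \<le> indicator ?K y * cmod (rep_L2 v y)" for m y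
  proof (cases "y \<in> ?K")
    case True
    then show ?thesis using mult_right_mono[OF cmod_bump_le norm_ge_zero] by (simp add: norm_mult)
  next
    case False
    have "y \<notin> box (A m) (B m)"
    proof
      assume y: "y \<in> box (A m) (B m)"
      have "a $ i - 1 < y $ i \<and> y $ i < b $ i + 1" for i
        using y[unfolded mem_box_cart, rule_format, of i] A[of m i] B[of m i] by linarith
      then show False using False by (auto simp: mem_box_cart)
    qed
    then have "bump (A m) (B m) (N m) y = 0" using bump_nonzero_imp by blast
    then show ?thesis by simp
  qed
  then show "AE y in lborel. cmod (bump (A m) (B m) (N m) y * rep_L2 v y) \<le> indicator ?K y * cmod (rep_L2 v y)" for m
    by simp
qed measurable

text \<open>Lebesgue differentiation: outside a negligible set the value of \<open>rep_L2 v\<close>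
  is the limit of its averages over shrinking cubes, and all these averages are 0.\<close>

lemma eq_0_if_box_integrals_0:
  fixes v :: "'d::finite L2"
  assumes box: "\<And>a b. (LINT y|lborel. indicator (box a b) y * rep_L2 v y) = 0"
  shows "v = 0"
proof -
  let ?f = "rep_L2 v"
  have si: "set_integrable lborel S ?f" if "S \<in> sets borel" "bounded S" for S
    unfolding set_integrable_def using integrable_indicator_rep(1)[OF that, of v]
    by (rule Bochner_Integration.integrable_cong[THEN iffD1, rotated -1]) (auto simp: indicator_def)
  have int0: "integral (cbox a b) ?f = 0" for a b
  proof -
    have "integral (cbox a b) ?f = (LINT y : box a b | lborel. ?f y)"
      using set_borel_integral_eq_integral(2)[OF si[of "box a b"]]
      by (simp add: bounded_box integral_open_interval)
    also have "\<dots> = (LINT y|lborel. indicator (box a b) y * ?f y)"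
      unfolding set_lebesgue_integral_def by (intro Bochner_Integration.integral_cong) (auto simp: indicator_def)
    finally show ?thesis using box by simp
  qed
  have "?f integrable_on cbox a b" for a b
    by (rule set_borel_integral_eq_integral(1)[OF si]) auto
  then obtain N where N: "negligible N"
    "\<And>x e. \<lbrakk>x \<notin> N; 0 < e\<rbrakk> \<Longrightarrow> \<exists>d>0. \<forall>h. 0 < h \<and> h < d \<longrightarrow>
        norm (integral (cbox x (x + h *\<^sub>R One)) ?f /\<^sub>R h ^ DIM(real^'d) - ?f x) < e"
    using integrable_ccontinuous_explicit[of ?f] by blast
  have "?f x = 0" if x: "x \<notin> N" for x
  proof (rule ccontr)
    assume "?f x \<noteq> 0"
    then obtain d where d: "0 < d" "\<forall>h. 0 < h \<and> h < d \<longrightarrow>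
        norm (integral (cbox x (x + h *\<^sub>R One)) ?f /\<^sub>R h ^ DIM(real^'d) - ?f x) < norm (?f x)"
      using N(2)[OF x, of "norm (?f x)"] by auto
    from d(2)[rule_format, of "d / 2"] d(1) show False by (simp add: int0)
  qed
  then have "AE x in lebesgue. ?f x = 0"
    using N(1) by (auto simp: negligible_iff_null_sets intro: AE_I')
  then have "AE x in lborel. ?f x = 0" by (simp add: AE_completion_iff)
  then have "abs_L2 ?f = abs_L2 (\<lambda>x. 0)"
    by (subst abs_L2_eq_iff) (auto simp: sq_integrable_rep sq_integrable_zero)
  then show ?thesis by (simp add: zero_L2_def)
qed

text \<open>Rational corners make the separating family countable, which is what
  \<open>countable_onb\<close> relies on. Letting rational corners tend to real ones, and then the
  bumps to indicators, reduces the claim to integrals over boxes.\<close>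

lemma eq_0_if_bump_pairings_0:
  fixes v :: "'d::finite L2"
  assumes rat: "\<And>a b n. (\<And>i. a $ i \<in> \<rat>) \<Longrightarrow> (\<And>i. b $ i \<in> \<rat>) \<Longrightarrow>
    (LINT y|lborel. bump a b n y * rep_L2 v y) = 0"
  shows "v = 0"
proof (rule eq_0_if_box_integrals_0)
  fix a b :: "real^'d"
  obtain A B where AB: "\<And>m i. A m $ i \<in> \<rat>" "\<And>m i. \<bar>A m $ i - a $ i\<bar> < 1"
      "\<And>i. (\<lambda>m. A m $ i) \<longlonglongrightarrow> a $ i" "\<And>m i. B m $ i \<in> \<rat>"
      "\<And>m i. \<bar>B m $ i - b $ i\<bar> < 1" "\<And>i. (\<lambda>m. B m $ i) \<longlonglongrightarrow> b $ i"
    using rational_vector_approx[of a] rational_vector_approx[of b] by blast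
  have "(LINT y|lborel. bump a b n y * rep_L2 v y) = 0" for n
  proof -
    have "(\<lambda>m. bump (A m) (B m) n y) \<longlonglongrightarrow> bump a b n y" for y
      unfolding bump_def
      by (intro tendsto_prod tendsto_mult tendsto_of_real
          continuous_on_tendsto_compose[OF continuous_on_expinv] tendsto_intros AB) auto
    then have "(\<lambda>m. LINT y|lborel. bump (A m) (B m) n y * rep_L2 v y)
        \<longlonglongrightarrow> (LINT y|lborel. bump a b n y * rep_L2 v y)"
      by (rule pairing_bump_tendsto) (use AB in auto)
    then show ?thesis using AB by (simp add: rat LIMSEQ_const_iff)
  qed
  moreover have "(\<lambda>n. LINT y|lborel. bump a b n y * rep_L2 v y)
      \<longlonglongrightarrow> (LINT y|lborel. indicator (box a b) y * rep_L2 v y)"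
    by (rule pairing_bump_tendsto[where a = a and b = b]) (auto simp: bump_tendsto)
  ultimately show "(LINT y|lborel. indicator (box a b) y * rep_L2 v y) = 0"
    by (simp add: LIMSEQ_const_iff)
qed

lemma eq_0_if_test_pairings_0:
  "(\<And>\<phi>. test_function \<phi> \<Longrightarrow> (LINT y|lborel. \<phi> y * rep_L2 v y) = 0) \<Longrightarrow> v = 0"
  by (rule eq_0_if_bump_pairings_0) (simp add: test_function_bump)

text \<open>The conjugate appears because the pairing of \<phi> with a vector is bilinear while
  \<open>cinner\<close> is antilinear on the left.\<close>

lemma test_functions_dense:
  "closure {abs_L2 (\<lambda>y. cnj (\<phi> y)) | \<phi>. test_function \<phi>} = (UNIV :: 'd::finite L2 set)"
    (is "closure ?M = _")
proof (rule dense_if_total)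
  have sq: "sq_integrable (\<lambda>y. cnj (\<phi> y))" if "test_function \<phi>" for \<phi> :: "real^'d \<Rightarrow> complex"
    by (intro sq_integrable_cnj test_function_sq_integrable that)
  show "a + b \<in> ?M" if "a \<in> ?M" "b \<in> ?M" for a b
  proof -
    obtain \<phi> \<psi> where "a = abs_L2 (\<lambda>y. cnj (\<phi> y))" "test_function \<phi>"
        "b = abs_L2 (\<lambda>y. cnj (\<psi> y))" "test_function \<psi>"
      using \<open>a \<in> ?M\<close> \<open>b \<in> ?M\<close> by blast
    with test_function_lincomb[of \<phi> \<psi> 1 1] show ?thesis
      by (auto simp: plus_abs sq intro!: exI[of _ "\<lambda>y. \<phi> y + \<psi> y"])
  qed
  show "scaleC c a \<in> ?M" if "a \<in> ?M" for a c
  proof -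
    obtain \<phi> where "a = abs_L2 (\<lambda>y. cnj (\<phi> y))" "test_function \<phi>"
      using \<open>a \<in> ?M\<close> by blast
    with test_function_lincomb[of \<phi> \<phi> "cnj c" 0] show ?thesis
      by (auto simp: scaleC_abs sq intro!: exI[of _ "\<lambda>y. cnj c * \<phi> y"])
  qed
  show "?M \<noteq> {}" using test_function_bump by blast
  show "v = 0" if "\<And>m. m \<in> ?M \<Longrightarrow> cinner m v = 0" for v
    by (rule eq_0_if_test_pairings_0) (use that in \<open>auto simp: pairing_eq_cinner test_function_sq_integrable\<close>)
qed

text \<open>The norm by duality: the bound extends by density from test functions to every vector,
  and then it is applied to \<open>v\<close> itself. This is how norms of weakly described vectors
  are controlled later.\<close>

lemma norm_le_if_test_pairings_le:
  fixes v :: "'d::finite L2"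
  assumes le: "\<And>\<phi>. test_function \<phi> \<Longrightarrow> cmod (LINT y|lborel. \<phi> y * rep_L2 v y) \<le> M * norm (abs_L2 \<phi>)"
    and M: "0 \<le> M"
  shows "norm v \<le> M"
proof -
  have "closed {x. cmod (cinner x v) \<le> M * norm x}"
    by (intro closed_Collect_le continuous_intros cinner.continuous_on)
  moreover have "{abs_L2 (\<lambda>y. cnj (\<phi> y)) | \<phi>. test_function \<phi>} \<subseteq> {x. cmod (cinner x v) \<le> M * norm x}"
    using le by (auto simp: pairing_eq_cinner[symmetric] norm_abs_cnj test_function_sq_integrable)
  ultimately have "closure {abs_L2 (\<lambda>y. cnj (\<phi> y)) | \<phi>. test_function \<phi>} \<subseteq> {x. cmod (cinner x v) \<le> M * norm x}"
    by (rule closure_minimal[rotated])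
  then have "cmod (cinner v v) \<le> M * norm v" unfolding test_functions_dense by blast
  then have "norm v * norm v \<le> M * norm v" by (simp add: cinner_self power2_eq_square norm_mult)
  then show ?thesis using M by (cases "norm v = 0") (auto simp: mult_le_cancel_right)
qed

section \<open>Orthonormal bases, separability and weak compactness\<close>

lemma orthonormal_norm: "orthonormal B \<Longrightarrow> e \<in> B \<Longrightarrow> norm e = 1"
proof -
  assume "orthonormal B" "e \<in> B"
  then have "cinner e e = 1" by (simp add: orthonormal_def)
  then have "complex_of_real ((norm e)\<^sup>2) = of_real 1" unfolding cinner_self by simp
  then have "(norm e)\<^sup>2 = 1" unfolding of_real_eq_iff .
  then show "norm e = 1" by (metis norm_ge_zero power2_eq_1_iff zero_le_one neg_0_le_iff_le not_one_le_zero)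
qed

definition fourier_sum :: "'d::finite L2 set \<Rightarrow> 'd L2 \<Rightarrow> 'd L2" where
  "fourier_sum F x = (\<Sum>e\<in>F. scaleC (cinner e x) e)"

lemma cinner_fourier_sum:
  assumes "orthonormal B" "finite F" "F \<subseteq> B" "e \<in> B"
  shows "cinner e (fourier_sum F x) = (if e \<in> F then cinner e x else 0)"
proof -
  have "cinner e (fourier_sum F x) = (\<Sum>e'\<in>F. cinner e' x * cinner e e')"
    by (simp add: fourier_sum_def cinner.sum_right cinner_scaleC_right)
  also have "\<dots> = (\<Sum>e'\<in>F. if e' = e then cinner e x else 0)"
    using assms by (intro sum.cong) (auto simp: orthonormal_def subset_iff)
  finally show ?thesis using assms(2) by simp
qed

lemma cnj_mult_self: "cnj z * z = of_real ((cmod z)\<^sup>2)"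
  by (simp add: complex_norm_square mult.commute del: of_real_power)

lemma norm_fourier_diff:
  assumes "orthonormal F" "finite F"
  shows "(norm (x - fourier_sum F x))\<^sup>2 = (norm x)\<^sup>2 - (\<Sum>e\<in>F. (cmod (cinner e x))\<^sup>2)"
proof -
  have 1: "cinner (fourier_sum F x) z = (\<Sum>e\<in>F. cnj (cinner e x) * cinner e z)" for z
    by (simp add: fourier_sum_def cinner.sum_left cinner_scaleC_left)
  have a: "cinner (fourier_sum F x) x = of_real (\<Sum>e\<in>F. (cmod (cinner e x))\<^sup>2)"
    unfolding 1 cnj_mult_self by simp
  have b: "cinner (fourier_sum F x) (fourier_sum F x) = of_real (\<Sum>e\<in>F. (cmod (cinner e x))\<^sup>2)"
    unfolding 1 of_real_sum cnj_mult_self[symmetric]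
    by (intro sum.cong refl) (simp add: cinner_fourier_sum[OF assms subset_refl])
  have c: "(norm (fourier_sum F x))\<^sup>2 = (\<Sum>e\<in>F. (cmod (cinner e x))\<^sup>2)"
    using b unfolding cinner_self of_real_eq_iff .
  have d: "Re (cinner x (fourier_sum F x)) = (\<Sum>e\<in>F. (cmod (cinner e x))\<^sup>2)"
    using a by (subst cinner_commute) simp
  show ?thesis unfolding norm_sq_diff c d by simp
qed

lemma Bessel:
  assumes "orthonormal F" "finite F"
  shows "(\<Sum>e\<in>F. (cmod (cinner e x))\<^sup>2) \<le> (norm x)\<^sup>2"
  using norm_fourier_diff[OF assms, of x] zero_le_power2[of "norm (x - fourier_sum F x)"] by linarith

lemma countable_not_orthogonal:
  assumes "orthonormal B"
  shows "countable {e \<in> B. cinner e x \<noteq> 0}"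
proof -
  have "(\<Sum>e\<in>F. (cmod (cinner e x))\<^sup>2) \<le> (norm x)\<^sup>2" if "finite F" "F \<subseteq> B" for F
    using that assms by (intro Bessel) (auto simp: orthonormal_def subset_iff)
  then have "(\<lambda>e. (cmod (cinner e x))\<^sup>2) summable_on B"
    by (intro nonneg_bdd_above_summable_on bdd_aboveI[of _ "(norm x)\<^sup>2"]) auto
  from summable_countable_real[OF this] show ?thesis by simp
qed

lemma is_onb_onb: "is_onb (onb :: 'd::finite L2 set)"
  unfolding onb_def by (rule someI_ex[OF ex_onb])

lemma orthonormal_onb: "orthonormal (onb :: 'd::finite L2 set)"
  by (rule conjunct1[OF is_onb_onb[unfolded is_onb_def]])

lemma orthonormal_insert:
  assumes B: "orthonormal B" and v: "norm v = 1" "\<And>e. e \<in> B \<Longrightarrow> cinner e v = 0"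
  shows "orthonormal (insert v B)"
proof -
  have "cinner v e = 0" if "e \<in> B" for e
    using v(2)[OF that] by (subst cinner_commute) simp
  moreover have "cinner v v = 1" unfolding cinner_self v(1) by simp
  ultimately show ?thesis
    using B v(2) unfolding orthonormal_def by (metis insert_iff zero_neq_one)
qed

lemma eq_0_if_orthogonal_onb:
  fixes v :: "'d::finite L2"
  assumes "\<And>e. e \<in> onb \<Longrightarrow> cinner e v = 0"
  shows "v = 0"
proof (rule ccontr)
  assume "v \<noteq> 0"
  define w where "w = inverse (norm v) *\<^sub>R v"
  have w: "norm w = 1" "\<And>e. e \<in> onb \<Longrightarrow> cinner e w = 0"
    using \<open>v \<noteq> 0\<close> assms by (auto simp: w_def cinner.scaleR_right)
  have "insert w onb = onb"
    using conjunct2[OF is_onb_onb[unfolded is_onb_def], rule_format, OF orthonormal_insert[OF orthonormal_onb w]]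
    by blast
  then have "w \<in> onb" by blast
  from w(2)[OF this] have "w = 0" by (simp add: cinner_self)
  then show False using w(1) by simp
qed

text \<open>Every basis vector fails to be orthogonal to some member of the countable set of
  rational bumps, since otherwise it would vanish; and by Bessel each bump is non-orthogonal to only
  countably many basis vectors.\<close>

lemma countable_onb: "countable (onb :: 'd::finite L2 set)"
proof -
  define Q :: "(real^'d) set" where "Q = range (\<lambda>g :: 'd \<Rightarrow> rat. \<chi> i. of_rat (g i))"
  have Q: "a \<in> Q" if "\<And>i. a $ i \<in> \<rat>" for a
  proof -
    have "\<exists>r. a $ i = of_rat r" for i using that[of i] by (auto elim: Rats_cases)
    then obtain g where "\<And>i. a $ i = of_rat (g i)" by metis
    then have "a = (\<chi> i. of_rat (g i))" by (simp add: vec_eq_iff)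
    then show ?thesis by (auto simp: Q_def)
  qed
  define X where "X = (\<lambda>(a, b, n). abs_L2 (\<lambda>y. cnj (bump a b n y))) ` (Q \<times> Q \<times> (UNIV :: nat set))"
  have "countable X" unfolding X_def Q_def by (intro countable_image countable_SIGMA) auto
  have "e \<in> (\<Union>x\<in>X. {e \<in> onb. cinner e x \<noteq> 0})" if e: "e \<in> onb" for e
  proof (rule ccontr)
    assume "\<not> ?thesis"
    then have 0: "\<And>x. x \<in> X \<Longrightarrow> cinner e x = 0" using e by blast
    have "e = 0"
    proof (rule eq_0_if_bump_pairings_0)
      fix a b :: "real^'d" and n
      assume "\<And>i. a $ i \<in> \<rat>" "\<And>i. b $ i \<in> \<rat>"
      then have "abs_L2 (\<lambda>y. cnj (bump a b n y)) \<in> X"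
        unfolding X_def using Q by force
      then have "cinner (abs_L2 (\<lambda>y. cnj (bump a b n y))) e = 0"
        using 0 by (subst cinner_commute) simp
      then show "(LINT y|lborel. bump a b n y * rep_L2 e y) = 0"
        by (simp add: pairing_eq_cinner test_function_sq_integrable test_function_bump)
    qed
    then show False using orthonormal_norm[OF orthonormal_onb e] by simp
  qed
  then have "onb \<subseteq> (\<Union>x\<in>X. {e \<in> onb. cinner e x \<noteq> (0::complex)})" by blast
  moreover have "countable (\<Union>x\<in>X. {e \<in> onb. cinner e x \<noteq> (0::complex)})"
    by (intro countable_UN \<open>countable X\<close> countable_not_orthogonal orthonormal_onb)
  ultimately show ?thesis by (rule countable_subset)
qed

text \<open>Indicators of the disjoint unit cubes along the diagonal are nonzero and pairwise
  orthogonal.\<close>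

lemma ex_infinite_independent: "\<exists>S :: 'd::finite L2 set. infinite S \<and> independent S"
proof -
  define A :: "nat \<Rightarrow> (real^'d) set" where "A n = box (\<chi> i. real n) (\<chi> i. real n + 1)" for n
  have disj: "A m \<inter> A n = {}" if "m \<noteq> n" for m n
  proof -
    have False if "x \<in> A m" "x \<in> A n" "m < n" for x and m n :: nat
      using that unfolding A_def mem_box_cart by (auto dest!: spec[of _ undefined])
    then show ?thesis using that by (meson disjoint_iff nat_neq_iff)
  qed
  have em: "emeasure lborel (A n) = 1" for n
  proof -
    have *: "((\<chi> i. real n + 1) - (\<chi> i. real n)) \<bullet> b = 1" if "b \<in> Basis" for b :: "real^'d"
      using that by (auto simp: Basis_vec_def inner_axis)
    show ?thesis
      unfolding A_def by (subst emeasure_lborel_box) (auto simp: * Basis_vec_def inner_axis)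
  qed
  have sq: "sq_integrable (indicator (A n) :: _ \<Rightarrow> complex)" for n
  proof -
    have "(\<integral>\<^sup>+x. ennreal ((cmod (indicator (A n) x))\<^sup>2) \<partial>lborel) = (\<integral>\<^sup>+x. indicator (A n) x \<partial>lborel)"
      by (intro nn_integral_cong) (auto simp: indicator_def)
    also have "\<dots> = 1" by (simp add: em A_def flip: em[of n])
    finally show ?thesis by (intro sq_integrableI) (auto simp: A_def)
  qed
  define w where "w n = abs_L2 (indicator (A n))" for n
  have w0: "w n \<noteq> 0" for n
  proof
    assume "w n = 0"
    then have "AE x in lborel. (indicator (A n) x :: complex) = 0"
      using abs_L2_eq_iff[OF sq[of n] sq_integrable_zero] by (simp add: w_def zero_L2_def)
    then have "AE x in lborel. x \<notin> A n" by (simp add: indicator_eq_0_iff)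
    then have "emeasure lborel (A n) = 0"
      by (subst (asm) AE_iff_measurable[of "A n"]) (auto simp: A_def)
    then show False by (simp add: em)
  qed
  have orth: "inner (w m) (w n) = 0" if "m \<noteq> n" for m n
  proof -
    have "cinner (w m) (w n) = (LINT x|lborel. cnj (indicator (A m) x) * indicator (A n) x)"
      unfolding w_def by (rule cinner_abs[OF sq sq])
    also have "\<dots> = (LINT x|(lborel :: (real^'d) measure). 0)"
      using disj[OF that] by (intro Bochner_Integration.integral_cong) (auto simp: indicator_def)
    finally show ?thesis by (simp add: inner_L2_def)
  qed
  have "inj w"
  proof (rule injI, rule ccontr)
    fix m n assume "w m = w n" "m \<noteq> n"
    then show False using orth[of m n] w0[of n] by simp
  qed
  moreover have "independent (range w)"
    by (rule pairwise_orthogonal_independent) (use orth w0 in \<open>auto simp: pairwise_def orthogonal_def, metis\<close>)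
  ultimately show ?thesis using range_inj_infinite by blast
qed

text \<open>Infinite dimension is what makes this true: without such a vector every \<open>x\<close>
  would equal its finite Fourier sum, and the space would be spanned by finitely many
  vectors.\<close>

lemma ex_unit_orthogonal:
  fixes F :: "'d::finite L2 set"
  assumes F: "orthonormal F" "finite F"
  shows "\<exists>u. norm u = 1 \<and> (\<forall>e\<in>F. cinner e u = 0)"
proof (rule ccontr)
  assume no: "\<not> ?thesis"
  have "x = fourier_sum F x" for x
  proof (rule ccontr)
    define v where "v = x - fourier_sum F x"
    assume "x \<noteq> fourier_sum F x"
    then have v: "v \<noteq> 0" by (simp add: v_def)
    have "cinner e v = 0" if "e \<in> F" for e
      using that cinner_fourier_sum[OF F(1,2) subset_refl that] by (simp add: v_def cinner.diff_right)
    then have "norm (inverse (norm v) *\<^sub>R v) = 1" "\<forall>e\<in>F. cinner e (inverse (norm v) *\<^sub>R v) = 0"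
      using v by (auto simp: cinner.scaleR_right)
    with no show False by blast
  qed
  \<comment> \<open>The library's \<open>span\<close> is over the reals, so \<open>F\<close> has to
    be doubled by its multiples with the imaginary unit.\<close>
  define T where "T = F \<union> scaleC \<i> ` F"
  have "x \<in> span T" for x
  proof -
    have "scaleC c e \<in> span T" if "e \<in> F" for c e
    proof -
      have "scaleC c e = Re c *\<^sub>R e + Im c *\<^sub>R scaleC \<i> e"
        unfolding scaleR_L2_def scaleC_scaleC scaleC_add_left[symmetric]
        by (metis complex_eq mult.commute)
      moreover have "e \<in> span T" "scaleC \<i> e \<in> span T"
        using that by (auto simp: T_def intro!: span_base)
      ultimately show ?thesis by (simp only: span_add span_scale)
    qed
    then have "fourier_sum F x \<in> span T" unfolding fourier_sum_def by (intro span_sum)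
    with \<open>x = fourier_sum F x\<close> show ?thesis by simp
  qed
  moreover have "finite T" using F(2) by (simp add: T_def)
  moreover obtain S :: "'d L2 set" where "infinite S" "independent S"
    using ex_infinite_independent by blast
  ultimately show False using independent_span_bound[of T S] by blast
qed

lemma infinite_onb: "infinite (onb :: 'd::finite L2 set)"
proof
  assume "finite (onb :: 'd L2 set)"
  then obtain u :: "'d L2" where "norm u = 1" "\<forall>e\<in>onb. cinner e u = 0"
    using ex_unit_orthogonal[OF orthonormal_onb] by blast
  then show False using eq_0_if_orthogonal_onb[of u] by auto
qed

text \<open>An enumeration of the very basis in which \<open>op_trace\<close> and
  \<open>trace_norm\<close> are defined, so that sums over \<open>onb\<close> become series. That it
  is a bijection needs \<open>onb\<close> to be both countable and infinite.\<close>

definition bas :: "nat \<Rightarrow> 'd::finite L2" where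
  "bas = from_nat_into onb"

lemma bij_betw_bas: "bij_betw (bas :: nat \<Rightarrow> 'd::finite L2) UNIV onb"
  unfolding bas_def by (rule bij_betw_from_nat_into[OF countable_onb infinite_onb])

definition orthonormal_seq :: "(nat \<Rightarrow> 'd::finite L2) \<Rightarrow> bool" where
  "orthonormal_seq e \<longleftrightarrow> (\<forall>j k. cinner (e j) (e k) = (if j = k then 1 else 0))"

lemma orthonormal_seq_bas: "orthonormal_seq (bas :: nat \<Rightarrow> 'd::finite L2)"
  unfolding orthonormal_seq_def
proof (intro allI)
  fix j k
  have "(bas j :: 'd L2) \<in> onb" "(bas k :: 'd L2) \<in> onb" and eq: "(bas j :: 'd L2) = bas k \<longleftrightarrow> j = k"
    using bij_betw_bas[where 'd = 'd] by (auto simp: bij_betw_def inj_def)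
  then show "cinner (bas j :: 'd L2) (bas k) = (if j = k then 1 else 0)"
    using orthonormal_onb[where 'd = 'd] by (simp add: orthonormal_def)
qed

lemma cinner_bas: "cinner (bas j) (bas k) = (if j = k then 1 else 0)"
  by (rule orthonormal_seq_bas[unfolded orthonormal_seq_def, rule_format])

lemma norm_bas [simp]: "norm (bas k :: 'd::finite L2) = 1"
  using bij_betw_bas[where 'd = 'd] by (intro orthonormal_norm[OF orthonormal_onb]) (auto simp: bij_betw_def)

lemma eq_0_if_orthogonal_bas:
  fixes v :: "'d::finite L2"
  shows "(\<And>k. cinner (bas k) v = 0) \<Longrightarrow> v = 0"
proof (rule eq_0_if_orthogonal_onb)
  fix e :: "'d L2" assume 0: "\<And>k. cinner (bas k) v = 0" and "e \<in> onb"
  then have "e \<in> range bas" by (simp add: bij_betw_imp_surj_on[OF bij_betw_bas])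
  with 0 show "cinner e v = 0" by blast
qed

section \<open>Riesz-Fischer, Fourier expansion and Parseval\<close>

lemma norm_sum_orthonormal_seq:
  assumes "orthonormal_seq e" "finite I"
  shows "(norm (\<Sum>k\<in>I. scaleC (c k) (e k)))\<^sup>2 = (\<Sum>k\<in>I. (cmod (c k))\<^sup>2)"
proof -
  have "cinner (\<Sum>k\<in>I. scaleC (c k) (e k)) (\<Sum>k\<in>I. scaleC (c k) (e k))
      = (\<Sum>k\<in>I. \<Sum>j\<in>I. cnj (c k) * (c j * cinner (e k) (e j)))"
    unfolding cinner.sum_left cinner_scaleC_left unfolding cinner.sum_right cinner_scaleC_right
      sum_distrib_left ..
  also have "\<dots> = (\<Sum>k\<in>I. \<Sum>j\<in>I. if j = k then cnj (c k) * c k else 0)"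
    using assms(1) by (intro sum.cong) (auto simp: orthonormal_seq_def)
  also have "\<dots> = of_real (\<Sum>k\<in>I. (cmod (c k))\<^sup>2)"
    using assms(2) unfolding of_real_sum cnj_mult_self[symmetric] by simp
  finally show ?thesis unfolding cinner_self of_real_eq_iff .
qed

lemma Riesz_Fischer:
  assumes e: "orthonormal_seq e" and c: "summable (\<lambda>k. (cmod (c k))\<^sup>2)"
  shows "summable (\<lambda>k. scaleC (c k) (e k))"
  unfolding summable_Cauchy
proof (intro allI impI)
  fix r :: real assume r: "0 < r"
  then obtain N where N: "\<And>m n. N \<le> m \<Longrightarrow> norm (\<Sum>k=m..<n. (cmod (c k))\<^sup>2) < r\<^sup>2"
    using c[unfolded summable_Cauchy, rule_format, of "r\<^sup>2"] by auto
  have "norm (\<Sum>k=m..<n. scaleC (c k) (e k)) < r" if "N \<le> m" for m n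
  proof -
    have "(norm (\<Sum>k=m..<n. scaleC (c k) (e k)))\<^sup>2 < r\<^sup>2"
      using N[OF that, of n] unfolding norm_sum_orthonormal_seq[OF e finite_atLeastLessThan]
      by (simp add: sum_nonneg)
    then show ?thesis using r by (simp add: power_less_imp_less_base)
  qed
  then show "\<exists>N. \<forall>m\<ge>N. \<forall>n. norm (\<Sum>k=m..<n. scaleC (c k) (e k)) < r" by blast
qed

lemma cinner_sums_orthonormal_seq:
  assumes e: "orthonormal_seq e" and w: "(\<lambda>k. scaleC (c k) (e k)) sums w"
  shows "cinner (e j) w = c j"
proof -
  have "(\<lambda>k. cinner (e j) (scaleC (c k) (e k))) sums cinner (e j) w"
    by (rule bounded_linear.sums[OF cinner.bounded_linear_right w])
  moreover have "(\<lambda>k. cinner (e j) (scaleC (c k) (e k))) = (\<lambda>k. if k = j then c k else 0)"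
    using e by (auto simp: cinner_scaleC_right orthonormal_seq_def)
  ultimately have "(\<lambda>k. if k = j then c k else 0) sums cinner (e j) w" by simp
  from sums_unique2[OF this sums_single] show ?thesis .
qed

lemma orthonormal_seq_Bessel:
  assumes e: "orthonormal_seq e"
  shows "(\<Sum>k<n. (cmod (cinner (e k) x))\<^sup>2) \<le> (norm x)\<^sup>2"
proof -
  have inj: "inj e"
  proof (rule injI, rule ccontr)
    fix j k assume "e j = e k" "j \<noteq> k"
    with e[unfolded orthonormal_seq_def, rule_format, of j k]
      e[unfolded orthonormal_seq_def, rule_format, of k k]
    show False by simp
  qed
  have "(\<Sum>k<n. (cmod (cinner (e k) x))\<^sup>2) = (\<Sum>v\<in>e ` {..<n}. (cmod (cinner v x))\<^sup>2)"
    by (subst sum.reindex) (use inj in \<open>auto simp: inj_on_def\<close>)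
  also have "\<dots> \<le> (norm x)\<^sup>2"
    using e inj by (intro Bessel) (auto simp: orthonormal_def orthonormal_seq_def inj_def)
  finally show ?thesis .
qed

lemma summable_Bessel:
  assumes e: "orthonormal_seq e"
  shows "summable (\<lambda>k. (cmod (cinner (e k) x))\<^sup>2)"
  by (rule summableI_nonneg_bounded[of _ "(norm x)\<^sup>2"]) (auto intro: orthonormal_seq_Bessel[OF e])

text \<open>Bessel and Riesz-Fischer supply a sum \<open>w\<close> of the Fourier series;
  \<open>x - w\<close> has vanishing coefficients and is therefore 0 by maximality of the
  basis.\<close>

lemma bas_expansion:
  fixes x :: "'d::finite L2"
  shows "(\<lambda>k. scaleC (cinner (bas k) x) (bas k)) sums x"
proof -
  obtain w :: "'d L2" where w: "(\<lambda>k. scaleC (cinner (bas k) x) (bas k)) sums w"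
    using Riesz_Fischer[OF orthonormal_seq_bas summable_Bessel[OF orthonormal_seq_bas]]
    by (auto simp: summable_def)
  have "x - w = 0"
    by (rule eq_0_if_orthogonal_bas)
       (simp add: cinner.diff_right cinner_sums_orthonormal_seq[OF orthonormal_seq_bas w])
  with w show ?thesis by simp
qed

lemma Parseval: "(\<lambda>k. cinner x (bas k) * cinner (bas k) y) sums cinner x y"
  using bounded_linear.sums[OF cinner.bounded_linear_right[of x] bas_expansion[of y]]
  by (simp add: cinner_scaleC_right mult.commute)

lemma Parseval_norm: "(\<lambda>k. (cmod (cinner (bas k) x))\<^sup>2) sums (norm x)\<^sup>2"
proof -
  have "cinner x (bas k) * cinner (bas k) x = of_real ((cmod (cinner (bas k) x))\<^sup>2)" for k
    using cnj_mult_self[of "cinner (bas k) x"] cinner_commute[of x "bas k"] by simp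
  then show ?thesis using Parseval[of x x] unfolding cinner_self by (simp only: sums_of_real_iff)
qed

lemma Parseval_norm_ennreal:
  "(\<Sum>k. ennreal ((cmod (cinner (bas k) x))\<^sup>2)) = ennreal ((norm x)\<^sup>2)"
  using Parseval_norm[of x] by (intro suminf_ennreal_eq) auto

lemma infsum_onb_ennreal:
  "(\<Sum>\<^sub>\<infinity>e\<in>onb. g e) = (\<Sum>k. (g (bas k) :: ennreal))"
proof -
  have "(\<Sum>\<^sub>\<infinity>e\<in>onb. g e) = (\<Sum>\<^sub>\<infinity>k. g (bas k))"
    by (rule infsum_reindex_bij_betw[OF bij_betw_bas, symmetric])
  also have "\<dots> = (\<Sum>k. g (bas k))"
  proof -
    have "(\<lambda>k. g (bas k)) summable_on UNIV" by (rule nonneg_summable_on_complete) simp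
    then show ?thesis using has_sum_imp_sums[OF has_sum_infsum] sums_unique by blast
  qed
  finally show ?thesis .
qed

lemma infsum_onb_complex:
  assumes "summable (\<lambda>k. cmod (g (bas k)))"
  shows "(\<Sum>\<^sub>\<infinity>e\<in>onb. g e) = (\<Sum>k. (g (bas k) :: complex))"
proof -
  have "(\<Sum>\<^sub>\<infinity>e\<in>onb. g e) = (\<Sum>\<^sub>\<infinity>k. g (bas k))"
    by (rule infsum_reindex_bij_betw[OF bij_betw_bas, symmetric])
  also have "\<dots> = (\<Sum>k. g (bas k))"
    using norm_summable_imp_has_sum[OF assms summable_sums[OF summable_norm_cancel[OF assms]]]
    by (rule infsumI)
  finally show ?thesis .
qed

section \<open>Separability\<close>

definition rational_combinations :: "complex set \<Rightarrow> 'd::finite L2 set" where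
  "rational_combinations D = (\<lambda>l. \<Sum>k<length l. scaleC (l ! k) (bas k)) ` lists D"

lemma rational_combinations_dense:
  fixes x :: "'d::finite L2"
  assumes D: "\<And>X :: complex set. open X \<Longrightarrow> X \<noteq> {} \<Longrightarrow> \<exists>d\<in>D. d \<in> X" and r: "0 < r"
  shows "\<exists>y\<in>rational_combinations D. dist y x < r"
proof -
  have "(\<lambda>n. \<Sum>k<n. scaleC (cinner (bas k) x) (bas k)) \<longlonglongrightarrow> x"
    using bas_expansion[of x] by (simp add: sums_def)
  from metric_LIMSEQ_D[OF this, of "r / 2"] r
  obtain N where N: "dist (\<Sum>k<N. scaleC (cinner (bas k) x) (bas k)) x < r / 2" by auto
  have "\<exists>d\<in>D. dist (cinner (bas k) x) d < r / (2 * real (Suc N))" for k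
  proof -
    have "0 < r / (2 * real (Suc N))" using r by simp
    then have "ball (cinner (bas k) x) (r / (2 * real (Suc N))) \<noteq> {}" by (simp del: of_nat_Suc)
    from D[OF open_ball this] show ?thesis by (simp del: of_nat_Suc)
  qed
  then obtain d where d: "\<And>k. d k \<in> D" "\<And>k. dist (cinner (bas k) x) (d k) < r / (2 * real (Suc N))"
    by metis
  define y :: "'d L2" where "y = (\<Sum>k<N. scaleC (d k) (bas k))"
  have "y \<in> rational_combinations D"
    unfolding rational_combinations_def y_def
    by (rule image_eqI[of _ _ "map d [0..<N]"]) (use d(1) in auto)
  moreover have "dist y (\<Sum>k<N. scaleC (cinner (bas k) x) (bas k)) \<le> r / 2"
  proof -
    have "norm (y - (\<Sum>k<N. scaleC (cinner (bas k) x) (bas k)))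
        = norm (\<Sum>k<N. scaleC (d k - cinner (bas k) x) (bas k :: 'd L2))"
      by (simp add: y_def sum_subtractf scaleC.diff_left)
    also have "\<dots> \<le> (\<Sum>k<N. r / (2 * real (Suc N)))"
      by (rule sum_norm_le) (use d(2) in \<open>simp add: dist_norm norm_minus_commute less_imp_le del: of_nat_Suc\<close>)
    also have "\<dots> \<le> r / 2" using r by (simp add: field_simps)
    finally show ?thesis by (simp add: dist_norm)
  qed
  moreover have "dist y x \<le> dist y (\<Sum>k<N. scaleC (cinner (bas k) x) (bas k))
      + dist (\<Sum>k<N. scaleC (cinner (bas k) x) (bas k)) x"
    by (rule dist_triangle)
  ultimately show ?thesis using N by (intro bexI[of _ y]) linarith+
qed

lemma ex_countable_dense_L2:
  "\<exists>D :: 'd::finite L2 set. countable D \<and> (\<forall>x. \<forall>r>0. \<exists>y\<in>D. dist y x < r)"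
proof -
  obtain D :: "complex set" where D: "countable D" "\<And>X. open X \<Longrightarrow> X \<noteq> {} \<Longrightarrow> \<exists>d\<in>D. d \<in> X"
    by (rule countable_dense_setE) blast
  have "countable (rational_combinations D :: 'd L2 set)"
    unfolding rational_combinations_def using D(1) by (intro countable_image countable_lists)
  then show ?thesis using rational_combinations_dense[OF D(2)] by blast
qed

text \<open>Together with completeness this makes the space Polish, as required by
  \<open>inner_regular\<close>, on which the Radon property of the constructed plan rests.\<close>

instance L2 :: (finite) second_countable_topology
proof
  obtain D :: "'a L2 set" where D: "countable D" "\<And>x r. 0 < r \<Longrightarrow> \<exists>y\<in>D. dist y x < r"
    using ex_countable_dense_L2 by blast
  define B where "B = (\<lambda>(y, n). ball y (inverse (real (Suc n)))) ` (D \<times> UNIV)"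
  have "countable B" unfolding B_def using D(1) by (intro countable_image countable_SIGMA) auto
  moreover have "topological_basis B"
  proof (rule topological_basisI)
    show "open b" if "b \<in> B" for b using that by (auto simp: B_def)
    fix U :: "'a L2 set" and x assume "open U" "x \<in> U"
    then obtain r where r: "0 < r" "ball x r \<subseteq> U" by (auto simp: open_contains_ball)
    obtain n where n: "inverse (real (Suc n)) < r / 2" using r(1) reals_Archimedean[of "r / 2"] by auto
    obtain y where y: "y \<in> D" "dist y x < inverse (real (Suc n))"
      using D(2)[of "inverse (real (Suc n))" x] by (auto simp del: of_nat_Suc)
    have "ball y (inverse (real (Suc n))) \<subseteq> ball x r"
    proof
      fix z assume "z \<in> ball y (inverse (real (Suc n)))"
      then have "dist y z < r / 2" "dist y x < r / 2" using n y(2) by auto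
      then show "z \<in> ball x r" using dist_triangle2[of x z y] by (simp add: dist_commute)
    qed
    then show "\<exists>b\<in>B. x \<in> b \<and> b \<subseteq> U"
      using y r(2) unfolding B_def by (intro bexI[of _ "ball y (inverse (real (Suc n)))"]) auto
  qed
  ultimately show "\<exists>B::'a L2 set set. countable B \<and> open = generate_topology B"
    using topological_basis_imp_subbasis by blast
qed

text \<open>The sequences of Fourier coefficients lie in a countable product of closed discs, which
  is compact and sequentially compact. A coordinatewise limit is square-summable by Bessel, hence
  belongs to a vector \<open>l\<close>, and boundedness upgrades coordinatewise to weak
  convergence.\<close>

lemma bounded_imp_weakly_convergent_subseq:
  fixes w :: "nat \<Rightarrow> 'd::finite L2"
  assumes M: "\<And>n. norm (w n) \<le> M"
  shows "\<exists>r l. strict_mono r \<and> norm l \<le> M \<and> (\<forall>x. (\<lambda>n. cinner x (w (r n))) \<longlonglongrightarrow> cinner x l)"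
proof -
  have M0: "0 \<le> M" using M[of 0] norm_ge_zero order_trans by blast
  define c where "c n = (\<lambda>k. cinner (bas k) (w n))" for n
  have "compactin (product_topology (\<lambda>_. euclidean) (UNIV :: nat set)) (Pi\<^sub>E UNIV (\<lambda>k. cball (0::complex) M))"
    by (subst compactin_PiE) simp
  then have "compact (Pi\<^sub>E UNIV (\<lambda>k::nat. cball (0::complex) M))"
    by (simp add: euclidean_product_topology)
  moreover have "c n \<in> Pi\<^sub>E UNIV (\<lambda>k. cball (0::complex) M)" for n
  proof -
    have "cmod (cinner (bas k) (w n)) \<le> M" for k
      using order_trans[OF cmod_cinner_le, of "bas k" "w n" M] M by simp
    then show ?thesis by (auto simp: c_def)
  qed
  ultimately obtain d r where d: "strict_mono (r :: nat \<Rightarrow> nat)" "(c \<circ> r) \<longlonglongrightarrow> d"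
    using compact_imp_seq_compact seq_compactE by metis
  have lim: "(\<lambda>n. cinner (bas k) (w (r n))) \<longlonglongrightarrow> d k" for k
    using continuous_on_tendsto_compose[OF continuous_on_product_coordinates[of k] d(2)]
    by (simp add: c_def)
  have le: "(\<Sum>k<N. (cmod (d k))\<^sup>2) \<le> M\<^sup>2" for N
  proof (rule LIMSEQ_le_const2)
    show "(\<lambda>n. \<Sum>k<N. (cmod (cinner (bas k) (w (r n))))\<^sup>2) \<longlonglongrightarrow> (\<Sum>k<N. (cmod (d k))\<^sup>2)"
      by (intro tendsto_intros lim)
    have "(\<Sum>k<N. (cmod (cinner (bas k) (w (r n))))\<^sup>2) \<le> M\<^sup>2" for n
      using order_trans[OF orthonormal_seq_Bessel[OF orthonormal_seq_bas] power_mono[OF M norm_ge_zero]] .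
    then show "\<exists>N'. \<forall>n\<ge>N'. (\<Sum>k<N. (cmod (cinner (bas k) (w (r n))))\<^sup>2) \<le> M\<^sup>2" by blast
  qed
  then have summ: "summable (\<lambda>k. (cmod (d k))\<^sup>2)"
    by (intro summableI_nonneg_bounded[of _ "M\<^sup>2"]) auto
  obtain l :: "'d L2" where l: "(\<lambda>k. scaleC (d k) (bas k)) sums l"
    using Riesz_Fischer[OF orthonormal_seq_bas summ] by (auto simp: summable_def)
  have dl: "cinner (bas k) l = d k" for k
    by (rule cinner_sums_orthonormal_seq[OF orthonormal_seq_bas l])
  have "(norm l)\<^sup>2 \<le> M\<^sup>2"
    using Parseval_norm[of l] le unfolding dl sums_def by (intro LIMSEQ_le_const2) auto
  then have nl: "norm l \<le> M" by (rule power2_le_imp_le[OF _ M0])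
  have "(\<lambda>n. cinner x (w (r n))) \<longlonglongrightarrow> cinner x l" for x
  proof (rule LIMSEQ_I)
    fix e :: real assume e: "0 < e"
    \<comment> \<open>Chosen so that the tail of \<open>x\<close> contributes at most
      \<open>e / 3\<close> against any vector of norm at most \<open>M\<close>; the
      \<open>+ 1\<close> avoids division by zero.\<close>
    define \<epsilon> where "\<epsilon> = (e / 3) / (M + 1)"
    have \<epsilon>: "0 < \<epsilon>" using e M0 by (simp add: \<epsilon>_def)
    define P :: "nat \<Rightarrow> 'd L2" where "P N = (\<Sum>k<N. scaleC (cinner (bas k) x) (bas k))" for N
    have "P \<longlonglongrightarrow> x" using bas_expansion[of x] by (simp add: sums_def P_def[abs_def])
    from LIMSEQ_D[OF this \<epsilon>] obtain N where N: "norm (P N - x) < \<epsilon>" by auto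
    have "(\<lambda>n. cinner (P N) (w (r n))) \<longlonglongrightarrow> cinner (P N) l"
      unfolding P_def cinner.sum_left cinner_scaleC_left dl by (intro tendsto_intros lim)
    from LIMSEQ_D[OF this, of "e / 3"] e obtain n0
      where n0: "\<And>n. n0 \<le> n \<Longrightarrow> cmod (cinner (P N) (w (r n)) - cinner (P N) l) < e / 3" by auto
    have small: "cmod (cinner (x - P N) z) \<le> e / 3" if "norm z \<le> M" for z
    proof -
      have "cmod (cinner (x - P N) z) \<le> norm (x - P N) * norm z" by (rule cmod_cinner_le)
      also have "\<dots> \<le> \<epsilon> * (M + 1)"
        using N that M0 \<epsilon> by (intro mult_mono) (auto simp: norm_minus_commute)
      also have "\<dots> = e / 3"
      proof -
        have "M + 1 \<noteq> 0" using M0 by linarith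
        then show ?thesis unfolding \<epsilon>_def by (rule nonzero_eq_divide_eq[THEN iffD1, OF _ refl])
      qed
      finally show ?thesis .
    qed
    have "cmod (cinner x (w (r n)) - cinner x l) < e" if "n0 \<le> n" for n
    proof -
      have "cinner x (w (r n)) - cinner x l
          = cinner (x - P N) (w (r n)) + (cinner (P N) (w (r n)) - cinner (P N) l) - cinner (x - P N) l"
        by (simp add: cinner.diff_left)
      also have "cmod \<dots> \<le> cmod (cinner (x - P N) (w (r n)))
          + cmod (cinner (P N) (w (r n)) - cinner (P N) l) + cmod (cinner (x - P N) l)"
        by (intro order_trans[OF norm_triangle_ineq4] add_mono norm_triangle_ineq order_refl)
      also have "\<dots> < e" using small[OF M[of "r n"]] small[OF nl] n0[OF that] by linarith
      finally show ?thesis .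
    qed
    then show "\<exists>no. \<forall>n\<ge>no. norm (cinner x (w (r n)) - cinner x l) < e" by blast
  qed
  with d(1) nl show ?thesis by blast
qed

section \<open>Positive operators, moduli and traces\<close>

lemma rank_one_apply: "blinfun_apply (rank_one_op \<phi>) x = scaleC (cinner \<phi> x) \<phi>"
  by (simp add: rank_one_op.rep_eq)

lemma cinner_rank_one: "cinner x (blinfun_apply (rank_one_op \<phi>) y) = cinner x \<phi> * cinner \<phi> y"
  by (simp add: rank_one_apply cinner_scaleC_right)

lemma cinner_mult_commute: "cinner x y * cinner y x = of_real ((cmod (cinner x y))\<^sup>2)"
  by (subst cinner_commute[of y x]) (simp add: complex_norm_square del: of_real_power)

lemma cmod_cinner_commute: "cmod (cinner x y) = cmod (cinner y x)"
  by (subst cinner_commute) simp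

lemma Re_cinner_rank_one: "Re (cinner x (blinfun_apply (rank_one_op \<phi>) x)) = (cmod (cinner \<phi> x))\<^sup>2"
  unfolding cinner_rank_one cinner_mult_commute by (simp add: cmod_cinner_commute)

lemma psd_scaleC: "psd T \<Longrightarrow> blinfun_apply T (scaleC c x) = scaleC c (blinfun_apply T x)"
  by (simp add: psd_def clinear_op_def)

lemma psd_self_adjoint: "psd T \<Longrightarrow> cinner (blinfun_apply T x) y = cinner x (blinfun_apply T y)"
  by (simp add: psd_def self_adjoint_def)

lemma psd_nonneg: "psd T \<Longrightarrow> 0 \<le> Re (cinner x (blinfun_apply T x))"
  by (simp add: psd_def)

lemma psd_Im: "psd T \<Longrightarrow> Im (cinner x (blinfun_apply T x)) = 0"
  by (metis Reals_cnj_iff cinner_commute complex_is_Real_iff psd_self_adjoint)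

lemma psd_real: "psd T \<Longrightarrow> cinner x (blinfun_apply T x) = of_real (Re (cinner x (blinfun_apply T x)))"
  by (simp add: complex_eq_iff psd_Im)

lemma psd_add: "psd S \<Longrightarrow> psd T \<Longrightarrow> psd (S + T)"
  by (auto simp: psd_def clinear_op_def self_adjoint_def blinfun.add_left scaleC_add_right
      cinner.add_left cinner.add_right)

lemma psd_scaleR: "psd T \<Longrightarrow> 0 \<le> r \<Longrightarrow> psd (r *\<^sub>R T)"
  by (auto simp: psd_def clinear_op_def self_adjoint_def blinfun.scaleR_left cinner.scaleR_left
      cinner.scaleR_right scaleC.scaleR_right)

lemma self_adjoint_rank_one: "self_adjoint (rank_one_op \<phi>)"
  unfolding self_adjoint_def rank_one_apply cinner_scaleC_left cinner_scaleC_right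
  by (simp add: cinner_commute[of \<phi>] mult.commute)

lemma clinear_rank_one: "clinear_op (rank_one_op \<phi>)"
  unfolding clinear_op_def rank_one_apply cinner_scaleC_right scaleC_scaleC by simp

lemma psd_rank_one: "psd (rank_one_op \<phi>)"
  by (simp add: psd_def self_adjoint_rank_one clinear_rank_one Re_cinner_rank_one)

lemma psd_zero: "psd 0"
  by (auto simp: psd_def clinear_op_def self_adjoint_def cinner.zero_left cinner.zero_right scaleC.zero_right)

lemma self_adjoint_diff: "self_adjoint S \<Longrightarrow> self_adjoint T \<Longrightarrow> self_adjoint (S - T)"
  by (auto simp: self_adjoint_def blinfun.diff_left cinner.diff_left cinner.diff_right)

lemma clinear_diff: "clinear_op S \<Longrightarrow> clinear_op T \<Longrightarrow> clinear_op (S - T)"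
  by (auto simp: clinear_op_def blinfun.diff_left scaleC.diff_right)

lemma psd_diffI:
  assumes "psd S" "psd T"
    and "\<And>x. Re (cinner x (blinfun_apply T x)) \<le> Re (cinner x (blinfun_apply S x))"
  shows "psd (S - T)"
proof -
  have "self_adjoint (S - T)" "clinear_op (S - T)"
    using assms(1,2) by (auto simp: psd_def intro: self_adjoint_diff clinear_diff)
  with assms(3) show ?thesis by (simp add: psd_def blinfun.diff_left cinner.diff_right)
qed

text \<open>The usual discriminant argument along \<open>x + u\<close> with \<open>u\<close> a
  multiple of \<open>y\<close>. The factor \<open>cnj z\<close> in \<open>u\<close> turns the phase
  of the cross terms so that they become real, leaving a real quadratic in \<open>s\<close>,
  evaluated at \<open>- (1 / b)\<close>.\<close>

lemma psd_Cauchy_Schwarz: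
  assumes T: "psd T"
  shows "(cmod (cinner x (blinfun_apply T y)))\<^sup>2
    \<le> Re (cinner x (blinfun_apply T x)) * Re (cinner y (blinfun_apply T y))"
proof (cases "cinner x (blinfun_apply T y) = 0")
  case True
  then show ?thesis using psd_nonneg[OF T] by simp
next
  case False
  define z where "z = cinner x (blinfun_apply T y)"
  define a b w where "a = Re (cinner x (blinfun_apply T x))" and "b = Re (cinner y (blinfun_apply T y))"
    and "w = (cmod z)\<^sup>2"
  have w: "0 < w" using False by (simp add: w_def z_def)
  have b: "0 \<le> b" unfolding b_def by (rule psd_nonneg[OF T])
  have ineq: "0 \<le> a + 2 * s * w + s\<^sup>2 * w * b" for s :: real
  proof -
    define u where "u = scaleC (of_real s * cnj z) y"
    have xu: "cinner x (blinfun_apply T u) = of_real (s * w)"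
      by (simp add: u_def psd_scaleC[OF T] cinner_scaleC_right flip: z_def)
         (simp add: w_def cnj_mult_self mult.assoc del: of_real_power)
    have "cinner u (blinfun_apply T x) = cnj (cinner x (blinfun_apply T u))"
      by (metis cinner_commute psd_self_adjoint[OF T])
    then have ux: "cinner u (blinfun_apply T x) = of_real (s * w)" unfolding xu by simp
    have uu: "cinner u (blinfun_apply T u) = of_real (s\<^sup>2 * w * b)"
    proof -
      have "cinner u (blinfun_apply T u)
          = of_real s * of_real s * (cnj z * z) * cinner y (blinfun_apply T y)"
        by (simp add: u_def psd_scaleC[OF T] cinner_scaleC_right cinner_scaleC_left)
      also have "\<dots> = of_real s * of_real s * of_real w * of_real b"
        unfolding cnj_mult_self w_def b_def using psd_real[OF T, of y] by simp
      finally show ?thesis by (simp add: power2_eq_square)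
    qed
    have "cinner (x + u) (blinfun_apply T (x + u)) = cinner x (blinfun_apply T x) + cinner x (blinfun_apply T u)
        + cinner u (blinfun_apply T x) + cinner u (blinfun_apply T u)"
      by (simp add: blinfun.add_right cinner.add_left cinner.add_right)
    then have "Re (cinner (x + u) (blinfun_apply T (x + u))) = a + s * w + s * w + s\<^sup>2 * w * b"
      unfolding xu ux uu by (simp add: a_def)
    then show ?thesis using psd_nonneg[OF T, of "x + u"] by simp
  qed
  \<comment> \<open>With \<open>b = 0\<close> the inequality would be affine in \<open>s\<close>
    with slope \<open>2 * w > 0\<close>; the parameter inserted below makes its right-hand side
    equal to -1.\<close>
  have "b \<noteq> 0"
  proof
    assume "b = 0"
    with ineq[of "- (a + 1) / (2 * w)"] w show False by (simp add: field_simps)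
  qed
  with b have b: "0 < b" by simp
  have "0 \<le> a + 2 * (- (1 / b)) * w + (- (1 / b))\<^sup>2 * w * b" by (rule ineq)
  also have "\<dots> = a - w / b" using b by (simp add: power2_eq_square field_simps)
  finally have "w \<le> a * b" using b by (simp add: field_simps)
  then show ?thesis by (simp add: w_def a_def b_def z_def)
qed

lemma psd_eq_0I:
  assumes "psd T" "Re (cinner y (blinfun_apply T y)) = 0"
  shows "blinfun_apply T y = 0"
proof -
  have "(cmod (cinner (blinfun_apply T y) (blinfun_apply T y)))\<^sup>2 \<le> 0"
    using psd_Cauchy_Schwarz[OF assms(1), of "blinfun_apply T y" y] assms(2) by simp
  then show ?thesis by (simp add: cinner_self)
qed

text \<open>Cauchy-Schwarz for the form of \<open>S\<close> between \<open>S y\<close> and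
  \<open>y\<close>. It is the estimate that makes \<open>1 - \<epsilon> S\<close> a contraction in
  the uniqueness of square roots.\<close>

lemma psd_norm_sq_le:
  assumes S: "psd S"
  shows "(norm (blinfun_apply S y))\<^sup>2 \<le> norm S * Re (cinner y (blinfun_apply S y))"
proof (cases "blinfun_apply S y = 0")
  case False
  define v where "v = blinfun_apply S y"
  have v: "0 < (norm v)\<^sup>2" using False by (simp add: v_def)
  have "Re (cinner v (blinfun_apply S v)) \<le> norm v * (norm S * norm v)"
    by (intro order_trans[OF complex_Re_le_cmod] order_trans[OF cmod_cinner_le] mult_left_mono norm_blinfun) auto
  then have le: "Re (cinner v (blinfun_apply S v)) \<le> norm S * (norm v)\<^sup>2"
    by (simp add: power2_eq_square mult_ac)
  have "cmod (cinner v v) = (norm v)\<^sup>2" unfolding cinner_self norm_of_real by simp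
  then have "((norm v)\<^sup>2)\<^sup>2 \<le> Re (cinner v (blinfun_apply S v)) * Re (cinner y (blinfun_apply S y))"
    using psd_Cauchy_Schwarz[OF S, of v y] by (simp flip: v_def)
  also have "\<dots> \<le> norm S * (norm v)\<^sup>2 * Re (cinner y (blinfun_apply S y))"
    by (rule mult_right_mono[OF le psd_nonneg[OF S]])
  finally have "(norm v)\<^sup>2 * (norm v)\<^sup>2 \<le> (norm v)\<^sup>2 * (norm S * Re (cinner y (blinfun_apply S y)))"
    by (simp add: power2_eq_square mult_ac)
  then show ?thesis unfolding v_def[symmetric] using v by (simp only: mult_le_cancel_left_pos)
qed (simp add: cinner.zero_right)

text \<open>Since \<open>D = A - B\<close> anticommutes with \<open>S = A + B\<close>, one has
  \<open>(1 + \<epsilon> S)\<^sup>n D = D (1 - \<epsilon> S)\<^sup>n\<close>. The right-hand side stays bounded in \<open>n\<close>, while the left-hand side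
  grows unless \<open>S D = 0\<close>.\<close>

lemma psd_square_root_unique:
  assumes A: "psd A" and B: "psd B"
    and sq: "\<And>x y. cinner (blinfun_apply A x) (blinfun_apply A y) = cinner (blinfun_apply B x) (blinfun_apply B y)"
  shows "A = B"
proof -
  define S D where "S = A + B" and "D = A - B"
  have S: "psd S" unfolding S_def by (rule psd_add[OF A B])
  have sa: "cinner (blinfun_apply D x) y = cinner x (blinfun_apply D y)" for x y
    by (simp add: D_def blinfun.diff_left cinner.diff_left cinner.diff_right psd_self_adjoint[OF A] psd_self_adjoint[OF B])
  have AB: "blinfun_apply A (blinfun_apply A x) = blinfun_apply B (blinfun_apply B x)" for x
  proof -
    let ?d = "blinfun_apply A (blinfun_apply A x) - blinfun_apply B (blinfun_apply B x)"
    have "cinner ?d ?d = 0"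
      using sq[of ?d x] by (simp add: cinner.diff_right psd_self_adjoint[OF A] psd_self_adjoint[OF B])
    then show ?thesis by (simp add: cinner_self)
  qed
  have anti: "blinfun_apply S (blinfun_apply D x) = - blinfun_apply D (blinfun_apply S x)" for x
    by (simp add: S_def D_def blinfun.add_left blinfun.diff_left blinfun.add_right blinfun.diff_right AB)
  define \<epsilon> where "\<epsilon> = 1 / (1 + norm S)"
  have \<epsilon>: "0 < \<epsilon>" "\<epsilon> * norm S \<le> 1"
    by (auto simp: \<epsilon>_def add_pos_nonneg pos_divide_le_eq)
  have SD: "blinfun_apply S (blinfun_apply D x) = 0" for x
  proof (rule ccontr)
    assume nz: "blinfun_apply S (blinfun_apply D x) \<noteq> 0"
    \<comment> \<open>\<open>z n\<close> is \<open>(1 - \<epsilon> S) ^ n\<close> applied to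
      \<open>x\<close>, and by anticommutation \<open>y n\<close>, its image under \<open>D\<close>,
      is \<open>(1 + \<epsilon> S) ^ n\<close> applied to \<open>D x\<close>.\<close>
    define z where "z n = ((\<lambda>w. w - \<epsilon> *\<^sub>R blinfun_apply S w) ^^ n) x" for n
    have z: "z 0 = x" "z (Suc n) = z n - \<epsilon> *\<^sub>R blinfun_apply S (z n)" for n by (simp_all add: z_def)
    define y where "y n = blinfun_apply D (z n)" for n
    have y: "y (Suc n) = y n + \<epsilon> *\<^sub>R blinfun_apply S (y n)" for n
      by (simp add: y_def z anti blinfun.diff_right blinfun.scaleR_right)
    have "norm (z (Suc n)) \<le> norm (z n)" for n
    proof -
      have "(norm (z (Suc n)))\<^sup>2 = (norm (z n))\<^sup>2 + \<epsilon>\<^sup>2 * (norm (blinfun_apply S (z n)))\<^sup>2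
          - 2 * (\<epsilon> * Re (cinner (z n) (blinfun_apply S (z n))))"
        unfolding z norm_sq_diff using \<epsilon> by (simp add: cinner.scaleR_right power_mult_distrib)
      moreover have "\<epsilon>\<^sup>2 * (norm (blinfun_apply S (z n)))\<^sup>2 \<le> \<epsilon> * Re (cinner (z n) (blinfun_apply S (z n)))"
      proof -
        have "\<epsilon>\<^sup>2 * (norm (blinfun_apply S (z n)))\<^sup>2 \<le> \<epsilon>\<^sup>2 * (norm S * Re (cinner (z n) (blinfun_apply S (z n))))"
          by (intro mult_left_mono psd_norm_sq_le S) auto
        also have "\<dots> = (\<epsilon> * norm S) * (\<epsilon> * Re (cinner (z n) (blinfun_apply S (z n))))"
          by (simp add: power2_eq_square mult_ac)
        also have "\<dots> \<le> 1 * (\<epsilon> * Re (cinner (z n) (blinfun_apply S (z n))))"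
          by (intro mult_right_mono \<epsilon> mult_nonneg_nonneg psd_nonneg S) (use \<epsilon> in auto)
        finally show ?thesis by simp
      qed
      moreover have "0 \<le> \<epsilon> * Re (cinner (z n) (blinfun_apply S (z n)))"
        using \<epsilon> psd_nonneg[OF S] by (intro mult_nonneg_nonneg) auto
      ultimately have "(norm (z (Suc n)))\<^sup>2 \<le> (norm (z n))\<^sup>2" by linarith
      then show ?thesis by (rule power2_le_imp_le) simp
    qed
    then have zb: "norm (z n) \<le> norm x" for n
      by (induction n) (auto simp: z(1) intro: order_trans)
    have yb: "(norm (y n))\<^sup>2 \<le> (norm D * norm x)\<^sup>2" for n
      unfolding y_def
      by (intro power_mono order_trans[OF norm_blinfun] mult_left_mono zb) auto
    define K where "K = (norm (blinfun_apply S (y 0)))\<^sup>2"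
    have K: "0 < K" using nz by (simp add: K_def y_def z)
    have grow: "(norm (w + \<epsilon> *\<^sub>R blinfun_apply S w))\<^sup>2 \<ge> (norm w)\<^sup>2 + \<epsilon>\<^sup>2 * (norm (blinfun_apply S w))\<^sup>2" for w
      unfolding norm_sq_add using \<epsilon> psd_nonneg[OF S, of w]
      by (simp add: cinner.scaleR_right power_mult_distrib)
    have Sy: "K \<le> (norm (blinfun_apply S (y n)))\<^sup>2" for n
    proof (induction n)
      case (Suc n)
      have eq: "blinfun_apply S (y (Suc n)) = blinfun_apply S (y n) + \<epsilon> *\<^sub>R blinfun_apply S (blinfun_apply S (y n))"
        by (simp add: y blinfun.add_right blinfun.scaleR_right)
      have "0 \<le> \<epsilon>\<^sup>2 * (norm (blinfun_apply S (blinfun_apply S (y n))))\<^sup>2" by simp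
      then show ?case unfolding eq using grow[of "blinfun_apply S (y n)"] Suc by linarith
    qed (simp add: K_def)
    have "real n * (\<epsilon>\<^sup>2 * K) \<le> (norm (y n))\<^sup>2" for n
    proof (induction n)
      case (Suc n)
      have "\<epsilon>\<^sup>2 * K \<le> \<epsilon>\<^sup>2 * (norm (blinfun_apply S (y n)))\<^sup>2" by (intro mult_left_mono Sy) auto
      then show ?case using grow[of "y n"] Suc unfolding y by (simp add: algebra_simps)
    qed simp
    then have bd: "real n * (\<epsilon>\<^sup>2 * K) \<le> (norm D * norm x)\<^sup>2" for n using yb order_trans by blast
    have "0 < \<epsilon>\<^sup>2 * K" using \<epsilon> K by simp
    from reals_Archimedean3[OF this, rule_format, of "(norm D * norm x)\<^sup>2"] bd show False
      by (meson not_le)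
  qed
  have "blinfun_apply D x = 0" for x
  proof -
    \<comment> \<open>From \<open>S D = 0\<close> the nonnegative forms of \<open>A\<close> and
      \<open>B\<close> at \<open>D x\<close> add up to 0, so both operators kill \<open>D x\<close>.
      Hence \<open>D (D x) = 0\<close>, and self-adjointness of \<open>D\<close> gives
      \<open>D x = 0\<close>.\<close>
    let ?v = "blinfun_apply D x"
    have "Re (cinner ?v (blinfun_apply A ?v)) + Re (cinner ?v (blinfun_apply B ?v)) = 0"
      using arg_cong[OF SD[of x], of "\<lambda>w. Re (cinner ?v w)"]
      by (simp add: S_def blinfun.add_left cinner.add_right cinner.zero_right)
    then have "Re (cinner ?v (blinfun_apply A ?v)) = 0" "Re (cinner ?v (blinfun_apply B ?v)) = 0"
      using psd_nonneg[OF A, of ?v] psd_nonneg[OF B, of ?v] by linarith+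
    then have "blinfun_apply A ?v = 0" "blinfun_apply B ?v = 0"
      using psd_eq_0I A B by blast+
    then have "blinfun_apply D ?v = 0" by (simp add: D_def blinfun.diff_left)
    then have "cinner ?v ?v = 0" unfolding sa by (simp add: cinner.zero_right)
    then show ?thesis by (simp add: cinner_self)
  qed
  then show ?thesis by (intro blinfun_eqI) (simp add: D_def blinfun.diff_left)
qed

text \<open>Uniqueness of positive square roots resolves the definite description. Moduli are
  therefore always computed by exhibiting a candidate, and no general existence theorem for square
  roots is invoked.\<close>

lemma modulus_eqI:
  assumes "psd S"
    and "\<And>x y. cinner (blinfun_apply S x) (blinfun_apply S y) = cinner (blinfun_apply T x) (blinfun_apply T y)"
  shows "modulus T = S"
  unfolding modulus_def
proof (rule the_equality)
  show "psd S \<and> (\<forall>\<phi> \<psi>. cinner (blinfun_apply S \<phi>) (blinfun_apply S \<psi>)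
      = cinner (blinfun_apply T \<phi>) (blinfun_apply T \<psi>))"
    using assms by blast
  fix S' assume "psd S' \<and> (\<forall>\<phi> \<psi>. cinner (blinfun_apply S' \<phi>) (blinfun_apply S' \<psi>)
      = cinner (blinfun_apply T \<phi>) (blinfun_apply T \<psi>))"
  then show "S' = S" using assms by (intro psd_square_root_unique) auto
qed

lemma modulus_psd: "psd Q \<Longrightarrow> modulus Q = Q"
  by (rule modulus_eqI) auto

lemma trace_norm_eq: "trace_norm T = (\<Sum>k. ennreal (Re (cinner (bas k) (blinfun_apply (modulus T) (bas k)))))"
  unfolding trace_norm_def by (rule infsum_onb_ennreal)

lemma psd_op_trace:
  assumes Q: "psd Q" and s: "(\<lambda>k. Re (cinner (bas k) (blinfun_apply Q (bas k)))) sums t"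
  shows "trace_class Q" "op_trace Q = of_real t"
proof -
  have "trace_norm Q = ennreal t"
    unfolding trace_norm_eq modulus_psd[OF Q] by (rule suminf_ennreal_eq[OF psd_nonneg[OF Q] s])
  then show "trace_class Q" using Q by (simp add: trace_class_def psd_def)
  have "cmod (cinner (bas k) (blinfun_apply Q (bas k))) = Re (cinner (bas k) (blinfun_apply Q (bas k)))" for k
    by (subst psd_real[OF Q]) (simp add: psd_nonneg[OF Q])
  then have "summable (\<lambda>k. cmod (cinner (bas k) (blinfun_apply Q (bas k))))"
    using s by (simp add: sums_iff)
  then have "op_trace Q = (\<Sum>k. cinner (bas k) (blinfun_apply Q (bas k)))"
    unfolding op_trace_def by (rule infsum_onb_complex)
  also have "(\<lambda>k. cinner (bas k) (blinfun_apply Q (bas k))) sums of_real t"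
    by (subst psd_real[OF Q]) (use s in \<open>simp add: sums_of_real_iff\<close>)
  then have "(\<Sum>k. cinner (bas k) (blinfun_apply Q (bas k))) = of_real t" by (simp add: sums_iff)
  finally show "op_trace Q = of_real t" .
qed

lemma psd_trace_sums:
  assumes Q: "psd Q" and "trace_class Q" and t: "op_trace Q = of_real t"
  shows "(\<lambda>k. Re (cinner (bas k) (blinfun_apply Q (bas k)))) sums t"
proof -
  have "(\<Sum>k. ennreal (Re (cinner (bas k) (blinfun_apply Q (bas k))))) < \<top>"
    using assms(2) unfolding trace_class_def trace_norm_eq modulus_psd[OF Q] by simp
  then have "summable (\<lambda>k. Re (cinner (bas k) (blinfun_apply Q (bas k))))"
    by (intro summable_suminf_not_top psd_nonneg Q) auto
  then obtain s where s: "(\<lambda>k. Re (cinner (bas k) (blinfun_apply Q (bas k)))) sums s"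
    by (auto simp: summable_def)
  from psd_op_trace(2)[OF Q s] t have "s = t" by simp
  with s show ?thesis by simp
qed

text \<open>\<open>T\<close> is self-adjoint and traceless of rank at most 2, so its nonzero
  eigenvalues are a pair \<open>s\<close>, \<open>- s\<close> with
  \<open>s\<^sup>2 = 1 - (cmod (cinner \<phi> \<psi>))\<^sup>2\<close>. The identity
  \<open>T\<^sup>3 = s\<^sup>2 T\<close> records this without diagonalising.\<close>

lemma rank_one_diff_cube:
  assumes n: "norm \<phi> = 1" "norm \<psi> = 1"
  defines "T \<equiv> rank_one_op \<phi> - rank_one_op \<psi>"
  shows "blinfun_apply T (blinfun_apply T (blinfun_apply T x))
    = (1 - (cmod (cinner \<phi> \<psi>))\<^sup>2) *\<^sub>R blinfun_apply T x"
proof -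
  define c where "c = cinner \<phi> \<psi>"
  have c': "cinner \<psi> \<phi> = cnj c" unfolding c_def by (rule cinner_commute)
  have one: "cinner \<phi> \<phi> = 1" "cinner \<psi> \<psi> = 1" by (simp_all add: cinner_self n)
  have Tx: "blinfun_apply T y = scaleC (cinner \<phi> y) \<phi> - scaleC (cinner \<psi> y) \<psi>" for y
    by (simp add: T_def blinfun.diff_left rank_one_apply)
  have lc: "blinfun_apply T (scaleC a \<phi> - scaleC b \<psi>) = scaleC (a - b * c) \<phi> - scaleC (a * cnj c - b) \<psi>" for a b
    unfolding Tx by (simp add: cinner.diff_right cinner_scaleC_right one c' flip: c_def)
  have cc: "c * cnj c = of_real ((cmod c)\<^sup>2)" by (simp only: complex_norm_square)
  have a: "a - b * c - (a * cnj c - b) * c = of_real (1 - (cmod c)\<^sup>2) * a" for a b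
    using cc by (simp add: algebra_simps del: of_real_power)
  have b: "(a - b * c) * cnj c - (a * cnj c - b) = of_real (1 - (cmod c)\<^sup>2) * b" for a b
    using cc by (simp add: algebra_simps del: of_real_power)
  show ?thesis
    unfolding Tx[of x] lc a b scaleR_L2_def c_def[symmetric]
    by (simp add: scaleC.diff_right scaleC_scaleC)
qed

text \<open>Both estimates follow from the cubic identity: it gives the operator norm bound
  \<open>s\<close>, and it shows that the modulus is \<open>T\<^sup>2 / s\<close>, whose trace is
  \<open>2 * s\<^sup>2 / s\<close>. The explicit value makes the trace-norm topology on projectors
  accessible.\<close>

lemma trace_norm_rank_one_diff:
  assumes n: "norm \<phi> = 1" "norm \<psi> = 1"
  shows "trace_norm (rank_one_op \<phi> - rank_one_op \<psi>) = ennreal (2 * sqrt (1 - (cmod (cinner \<phi> \<psi>))\<^sup>2))"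
    and "norm (blinfun_apply (rank_one_op \<phi> - rank_one_op \<psi>) x) \<le> sqrt (1 - (cmod (cinner \<phi> \<psi>))\<^sup>2) * norm x"
proof -
  define T where "T = rank_one_op \<phi> - rank_one_op \<psi>"
  define s where "s = sqrt (1 - (cmod (cinner \<phi> \<psi>))\<^sup>2)"
  have "cmod (cinner \<phi> \<psi>) \<le> 1" using cmod_cinner_le[of \<phi> \<psi>] n by simp
  then have "(cmod (cinner \<phi> \<psi>))\<^sup>2 \<le> 1" by (simp add: power_le_one)
  then have s: "0 \<le> s" "s\<^sup>2 = 1 - (cmod (cinner \<phi> \<psi>))\<^sup>2" by (simp_all add: s_def)
  have cube: "blinfun_apply T (blinfun_apply T (blinfun_apply T x)) = s\<^sup>2 *\<^sub>R blinfun_apply T x" for x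
    unfolding s(2) T_def by (rule rank_one_diff_cube[OF n])
  have "self_adjoint T" "clinear_op T"
    unfolding T_def by (simp_all add: self_adjoint_diff clinear_diff self_adjoint_rank_one clinear_rank_one)
  then have sa: "cinner (blinfun_apply T x) y = cinner x (blinfun_apply T y)"
    and cl: "blinfun_apply T (scaleC c x) = scaleC c (blinfun_apply T x)" for x y c
    by (auto simp: self_adjoint_def clinear_op_def)
  have sq: "cinner x (blinfun_apply T (blinfun_apply T x)) = of_real ((norm (blinfun_apply T x))\<^sup>2)" for x
    by (simp only: sa[of x "blinfun_apply T x", symmetric] cinner_self)
  have T2: "norm (blinfun_apply T (blinfun_apply T x)) = s * norm (blinfun_apply T x)" for x
  proof -
    have "cinner (blinfun_apply T (blinfun_apply T x)) (blinfun_apply T (blinfun_apply T x))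
        = s\<^sup>2 *\<^sub>R cinner (blinfun_apply T x) (blinfun_apply T x)"
      unfolding sa[of "blinfun_apply T x"] cube by (simp add: cinner.scaleR_right)
    then have "(norm (blinfun_apply T (blinfun_apply T x)))\<^sup>2 = s\<^sup>2 * (norm (blinfun_apply T x))\<^sup>2"
      unfolding cinner_self scaleR_conv_of_real of_real_mult[symmetric] of_real_eq_iff .
    then have "(norm (blinfun_apply T (blinfun_apply T x)))\<^sup>2 = (s * norm (blinfun_apply T x))\<^sup>2"
      by (simp only: power_mult_distrib)
    then show ?thesis by (rule power2_eq_imp_eq) (use s in auto)
  qed
  show bound: "norm (blinfun_apply (rank_one_op \<phi> - rank_one_op \<psi>) x) \<le> sqrt (1 - (cmod (cinner \<phi> \<psi>))\<^sup>2) * norm x" for x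
  proof -
    let ?v = "blinfun_apply T x"
    have "cmod (cinner x (blinfun_apply T ?v)) \<le> norm x * (s * norm ?v)"
      using cmod_cinner_le[of x "blinfun_apply T ?v"] unfolding T2 .
    then have "(norm ?v)\<^sup>2 \<le> norm x * (s * norm ?v)" unfolding sq norm_of_real by simp
    then have "norm ?v * norm ?v \<le> (s * norm x) * norm ?v" by (simp add: power2_eq_square mult_ac)
    then have "norm ?v \<le> s * norm x"
      using s(1) by (cases "norm ?v = 0") (auto simp: mult_le_cancel_right)
    then show ?thesis by (simp only: T_def s_def)
  qed
  \<comment> \<open>The squared Hilbert-Schmidt norm of \<open>T\<close>, that is the trace of its
    square, evaluated by Parseval.\<close>
  have hs: "(\<lambda>k. (norm (blinfun_apply T (bas k)))\<^sup>2) sums (2 * s\<^sup>2)"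
  proof -
    have e: "(norm (blinfun_apply T e))\<^sup>2 = (cmod (cinner e \<phi>))\<^sup>2 + (cmod (cinner e \<psi>))\<^sup>2
        - 2 * Re (cinner \<phi> \<psi> * (cinner \<psi> e * cinner e \<phi>))" for e
      unfolding T_def blinfun.diff_left rank_one_apply norm_sq_diff norm_scaleC n
        cinner_scaleC_left cinner_scaleC_right
      by (simp add: cmod_cinner_commute[of e] cinner_commute[of e \<phi>, symmetric] mult_ac)
    have "(\<lambda>k. (cmod (cinner (bas k) \<phi>))\<^sup>2 + (cmod (cinner (bas k) \<psi>))\<^sup>2
        - 2 * Re (cinner \<phi> \<psi> * (cinner \<psi> (bas k) * cinner (bas k) \<phi>)))
        sums ((norm \<phi>)\<^sup>2 + (norm \<psi>)\<^sup>2 - 2 * Re (cinner \<phi> \<psi> * cinner \<psi> \<phi>))"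
      by (intro sums_add sums_diff sums_mult sums_Re Parseval_norm Parseval)
    moreover have "(norm \<phi>)\<^sup>2 + (norm \<psi>)\<^sup>2 - 2 * Re (cinner \<phi> \<psi> * cinner \<psi> \<phi>) = 2 * s\<^sup>2"
      unfolding cinner_mult_commute s(2) n by simp
    ultimately show ?thesis unfolding e by simp
  qed
  show "trace_norm (rank_one_op \<phi> - rank_one_op \<psi>) = ennreal (2 * sqrt (1 - (cmod (cinner \<phi> \<psi>))\<^sup>2))"
  proof (cases "s = 0")
    case True
    have "blinfun_apply T x = 0" for x
      using bound[of x] True unfolding s_def[symmetric] T_def[symmetric] by simp
    then have "T = 0" by (intro blinfun_eqI) simp
    then show ?thesis
      using True unfolding s_def[symmetric] T_def[symmetric]
      by (simp add: trace_norm_eq modulus_psd[OF psd_zero] cinner.zero_right)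
  next
    case False
    then have s0: "0 < s" using s by simp
    \<comment> \<open>The candidate for the modulus: it is positive, and its square is
      \<open>T\<^sup>4 / s\<^sup>2 = T\<^sup>2\<close>.\<close>
    define S where "S = inverse s *\<^sub>R (T o\<^sub>L T)"
    have Sx: "blinfun_apply S x = inverse s *\<^sub>R blinfun_apply T (blinfun_apply T x)" for x
      by (simp add: S_def blinfun.scaleR_left)
    have "psd S"
      unfolding psd_def clinear_op_def self_adjoint_def Sx
      using s0 by (auto simp: cl sa sq cinner.scaleR_left cinner.scaleR_right scaleC.scaleR_right)
    moreover have "cinner (blinfun_apply S x) (blinfun_apply S y) = cinner (blinfun_apply T x) (blinfun_apply T y)" for x y
    proof -
      have "cinner (blinfun_apply S x) (blinfun_apply S y)
          = (inverse s * inverse s * s\<^sup>2) *\<^sub>R cinner (blinfun_apply T x) (blinfun_apply T y)"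
        unfolding Sx cinner.scaleR_left cinner.scaleR_right sa[of "blinfun_apply T x"] cube by simp
      also have "inverse s * inverse s * s\<^sup>2 = 1" using s0 by (simp add: power2_eq_square field_simps)
      finally show ?thesis by simp
    qed
    ultimately have mod: "modulus T = S" by (rule modulus_eqI)
    have "trace_norm T = (\<Sum>k. ennreal (inverse s * (norm (blinfun_apply T (bas k)))\<^sup>2))"
      unfolding trace_norm_eq mod Sx cinner.scaleR_right sq by simp
    also have "\<dots> = ennreal (inverse s * (2 * s\<^sup>2))"
      by (intro suminf_ennreal_eq sums_mult hs) (use s0 in auto)
    also have "inverse s * (2 * s\<^sup>2) = 2 * s" using s0 by (simp add: power2_eq_square)
    finally show ?thesis by (simp only: T_def s_def)
  qed
qed

section \<open>Decompositions of positive trace-class operators\<close>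

lemma suminf_swap_ennreal: "(\<Sum>i. \<Sum>j. f i j) = (\<Sum>j. \<Sum>i. (f i j :: ennreal))"
proof -
  have "(\<Sum>i. \<Sum>j. f i j) = (\<integral>\<^sup>+i. (\<Sum>j. f i j) \<partial>count_space UNIV)"
    by (rule nn_integral_count_space_nat[symmetric])
  also have "\<dots> = (\<Sum>j. \<integral>\<^sup>+i. f i j \<partial>count_space UNIV)"
    by (rule nn_integral_suminf) simp
  finally show ?thesis by (simp only: nn_integral_count_space_nat)
qed

text \<open>Cauchy-Schwarz between \<open>A x\<close> and \<open>x\<close>. Both iterative
  constructions below control only the quadratic form of their remainder, and this turns it into
  convergence in norm.\<close>

lemma psd_norm_le_if_form_le:
  assumes A: "psd A" and le: "\<And>x. Re (cinner x (blinfun_apply A x)) \<le> c * (norm x)\<^sup>2" and c: "0 \<le> c"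
  shows "norm (blinfun_apply A x) \<le> c * norm x"
proof (cases "blinfun_apply A x = 0")
  case False
  define v where "v = blinfun_apply A x"
  have v: "0 < (norm v)\<^sup>2" using False by (simp add: v_def)
  have "(cmod (cinner v v))\<^sup>2 \<le> Re (cinner v (blinfun_apply A v)) * Re (cinner x (blinfun_apply A x))"
    using psd_Cauchy_Schwarz[OF A, of v x] by (simp only: v_def)
  also have "\<dots> \<le> (c * (norm v)\<^sup>2) * (c * (norm x)\<^sup>2)"
    by (intro mult_mono le psd_nonneg[OF A]) (use c in auto)
  finally have "(norm v)\<^sup>2 * (norm v)\<^sup>2 \<le> (norm v)\<^sup>2 * (c * norm x)\<^sup>2"
    unfolding cinner_self norm_of_real by (simp add: power2_eq_square mult_ac)
  then have "(norm v)\<^sup>2 \<le> (c * norm x)\<^sup>2" using v by (simp only: mult_le_cancel_left_pos)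
  then show ?thesis unfolding v_def by (rule power2_le_imp_le) (use c in auto)
qed (use c in simp)

lemma Re_cinner_blinfun_le: "Re (cinner x (blinfun_apply Q x)) \<le> norm Q * (norm x)\<^sup>2"
proof -
  have "Re (cinner x (blinfun_apply Q x)) \<le> norm x * (norm Q * norm x)"
    by (intro order_trans[OF complex_Re_le_cmod] order_trans[OF cmod_cinner_le] mult_left_mono norm_blinfun) auto
  then show ?thesis by (simp add: power2_eq_square mult_ac)
qed

text \<open>One elimination step of the Cholesky factorisation: subtracting the rank-one operator of
  \<open>pivot A e\<close> from \<open>A\<close> annihilates \<open>e\<close>. If \<open>\<langle>e, A e\<rangle> = 0\<close> then \<open>A e = 0\<close>, and the junk value
  \<open>1 / 0 = 0\<close> makes the step trivial.\<close>

definition pivot :: "'d::finite operator \<Rightarrow> 'd L2 \<Rightarrow> 'd L2" where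
  "pivot A e = (1 / sqrt (Re (cinner e (blinfun_apply A e)))) *\<^sub>R blinfun_apply A e"

text \<open>Cauchy-Schwarz for \<open>A\<close> between \<open>x\<close> and \<open>e\<close>,
  divided by the diagonal entry; it is what keeps the remainder of an elimination step
  positive.\<close>

lemma cmod_cinner_pivot_le:
  assumes A: "psd A"
  shows "(cmod (cinner (pivot A e) x))\<^sup>2 \<le> Re (cinner x (blinfun_apply A x))"
proof (cases "Re (cinner e (blinfun_apply A e)) = 0")
  case True
  then show ?thesis using psd_nonneg[OF A] by (simp add: pivot_def cinner.zero_left)
next
  case False
  define d where "d = Re (cinner e (blinfun_apply A e))"
  have d: "0 < d" using False psd_nonneg[OF A, of e] by (simp add: d_def)
  have "(cmod (cinner (pivot A e) x))\<^sup>2 = (cmod (cinner x (blinfun_apply A e)))\<^sup>2 / d"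
    using d by (simp add: pivot_def cinner.scaleR_left cmod_cinner_commute[of x] power_divide flip: d_def)
  also have "\<dots> \<le> Re (cinner x (blinfun_apply A x)) * d / d"
    using psd_Cauchy_Schwarz[OF A, of x e] d by (intro divide_right_mono) (auto simp: d_def)
  finally show ?thesis using d by simp
qed

lemma psd_pivot: "psd A \<Longrightarrow> psd (A - rank_one_op (pivot A e))"
  by (rule psd_diffI) (simp_all add: psd_rank_one Re_cinner_rank_one cmod_cinner_pivot_le)

lemma pivot_kills:
  assumes A: "psd A"
  shows "blinfun_apply (A - rank_one_op (pivot A e)) e = 0"
proof (cases "Re (cinner e (blinfun_apply A e)) = 0")
  case True
  then show ?thesis
    using psd_eq_0I[OF A True] by (simp add: blinfun.diff_left pivot_def rank_one_apply scaleC.zero_right)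
next
  case False
  define d where "d = Re (cinner e (blinfun_apply A e))"
  have d: "0 < d" using False psd_nonneg[OF A, of e] by (simp add: d_def)
  have "cinner e (blinfun_apply A e) = of_real d" unfolding d_def by (rule psd_real[OF A])
  then have pe: "cinner (pivot A e) e = of_real (d / sqrt d)"
    by (simp add: pivot_def cinner.scaleR_left psd_self_adjoint[OF A] scaleR_conv_of_real)
  have "pivot A e = (1 / sqrt d) *\<^sub>R blinfun_apply A e" by (simp only: pivot_def d_def)
  then have "scaleC (cinner (pivot A e) e) (pivot A e) = (d / sqrt d * (1 / sqrt d)) *\<^sub>R blinfun_apply A e"
    unfolding pe scaleC_of_real by (simp only: scaleR_scaleR)
  also have "d / sqrt d * (1 / sqrt d) = 1" using d by simp
  finally show ?thesis by (simp add: blinfun.diff_left rank_one_apply)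
qed

lemma pivot_preserves_kernel:
  assumes A: "psd A" and "blinfun_apply A x = 0"
  shows "blinfun_apply (A - rank_one_op (pivot A e)) x = 0"
proof -
  have "cinner (pivot A e) x = 0"
    unfolding pivot_def cinner.scaleR_left psd_self_adjoint[OF A] assms(2) by (simp add: cinner.zero_right)
  then show ?thesis by (simp add: blinfun.diff_left rank_one_apply assms(2) scaleC.zero_left)
qed

primrec chol_rem :: "'d::finite operator \<Rightarrow> nat \<Rightarrow> 'd operator" where
  "chol_rem Q 0 = Q"
| "chol_rem Q (Suc n) = chol_rem Q n - rank_one_op (pivot (chol_rem Q n) (bas n))"

definition chol :: "'d::finite operator \<Rightarrow> nat \<Rightarrow> 'd L2" where
  "chol Q n = pivot (chol_rem Q n) (bas n)"

lemma psd_chol_rem: "psd Q \<Longrightarrow> psd (chol_rem Q n)"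
  by (induction n) (auto intro: psd_pivot)

lemma chol_rem_kills: "psd Q \<Longrightarrow> j < n \<Longrightarrow> blinfun_apply (chol_rem Q n) (bas j) = 0"
proof (induction n)
  case (Suc n)
  then show ?case
    using pivot_kills[OF psd_chol_rem] pivot_preserves_kernel[OF psd_chol_rem] by (cases "j = n") auto
qed simp

lemma chol_rem_apply:
  "blinfun_apply (chol_rem Q n) x = blinfun_apply Q x - (\<Sum>k<n. scaleC (cinner (chol Q k) x) (chol Q k))"
  by (induction n) (auto simp: blinfun.diff_left rank_one_apply chol_def)

lemma chol_rem_form_le:
  "psd Q \<Longrightarrow> Re (cinner x (blinfun_apply (chol_rem Q n) x)) \<le> Re (cinner x (blinfun_apply Q x))"
proof (induction n)
  case (Suc n)
  have "Re (cinner x (blinfun_apply (chol_rem Q (Suc n)) x))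
      = Re (cinner x (blinfun_apply (chol_rem Q n) x)) - (cmod (cinner (pivot (chol_rem Q n) (bas n)) x))\<^sup>2"
    by (simp add: blinfun.diff_left cinner.diff_right Re_cinner_rank_one)
  also have "\<dots> \<le> Re (cinner x (blinfun_apply (chol_rem Q n) x))" by simp
  finally show ?case using Suc by linarith
qed simp

definition decomposes :: "(nat \<Rightarrow> 'd::finite L2) \<Rightarrow> 'd operator \<Rightarrow> bool" where
  "decomposes \<phi> Q \<longleftrightarrow> (\<forall>x. (\<lambda>k. scaleC (cinner (\<phi> k) x) (\<phi> k)) sums blinfun_apply Q x)"

text \<open>After \<open>n\<close> steps the remainder annihilates the first \<open>n\<close> basis
  vectors, so on \<open>x\<close> it acts only through the tail \<open>x - P n\<close>. Its form
  never exceeds that of \<open>Q\<close>, so its norm is bounded uniformly in \<open>n\<close>, and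
  the tail tends to 0.\<close>

lemma decomposes_chol:
  fixes Q :: "'d::finite operator"
  assumes Q: "psd Q"
  shows "decomposes (chol Q) Q"
  unfolding decomposes_def
proof
  fix x :: "'d L2"
  define P :: "nat \<Rightarrow> 'd L2" where "P n = (\<Sum>k<n. scaleC (cinner (bas k) x) (bas k))" for n
  have "(\<lambda>n. x - P n) \<longlonglongrightarrow> x - x"
    using bas_expansion[of x] unfolding sums_def P_def[abs_def] by (intro tendsto_intros)
  then have lim: "(\<lambda>n. norm Q * norm (x - P n)) \<longlonglongrightarrow> 0"
    by (simp add: tendsto_mult_right_zero tendsto_norm_zero)
  have "norm (blinfun_apply (chol_rem Q n) x) \<le> norm Q * norm (x - P n)" for n
  proof -
    have "blinfun_apply (chol_rem Q n) (P n) = 0"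
      by (simp add: P_def blinfun.sum_right psd_scaleC[OF psd_chol_rem[OF Q]] chol_rem_kills[OF Q] scaleC.zero_right)
    then have "blinfun_apply (chol_rem Q n) x = blinfun_apply (chol_rem Q n) (x - P n)"
      by (simp add: blinfun.diff_right)
    also have "norm \<dots> \<le> norm Q * norm (x - P n)"
      by (rule psd_norm_le_if_form_le[OF psd_chol_rem[OF Q]])
         (auto intro: order_trans[OF chol_rem_form_le[OF Q] Re_cinner_blinfun_le])
    finally show ?thesis .
  qed
  then have "(\<lambda>n. blinfun_apply (chol_rem Q n) x) \<longlonglongrightarrow> 0"
    by (intro Lim_null_comparison[OF always_eventually lim]) blast
  then have "(\<lambda>n. blinfun_apply Q x - blinfun_apply (chol_rem Q n) x) \<longlonglongrightarrow> blinfun_apply Q x - 0"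
    by (intro tendsto_intros)
  then show "(\<lambda>k. scaleC (cinner (chol Q k) x) (chol Q k)) sums blinfun_apply Q x"
    by (simp add: sums_def chol_rem_apply)
qed

lemma decomposes_form:
  assumes "decomposes \<phi> Q"
  shows "(\<lambda>k. cinner x (\<phi> k) * cinner (\<phi> k) y) sums cinner x (blinfun_apply Q y)"
  using bounded_linear.sums[OF cinner.bounded_linear_right[of x] assms[unfolded decomposes_def, rule_format, of y]]
  by (simp add: cinner_scaleC_right mult.commute)

lemma decomposes_form_Re:
  assumes "decomposes \<phi> Q"
  shows "(\<lambda>k. (cmod (cinner x (\<phi> k)))\<^sup>2) sums Re (cinner x (blinfun_apply Q x))"
  using sums_Re[OF decomposes_form[OF assms, of x x]] unfolding cinner_mult_commute Re_complex_of_real .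

text \<open>The nonnegative double series of squared coefficients of the \<phi>'s, summed in the two
  possible orders.\<close>

lemma decomposes_trace:
  assumes "decomposes \<phi> Q"
  shows "(\<Sum>k. ennreal ((norm (\<phi> k))\<^sup>2)) = (\<Sum>j. ennreal (Re (cinner (bas j) (blinfun_apply Q (bas j)))))"
proof -
  have "(\<Sum>k. ennreal ((norm (\<phi> k))\<^sup>2)) = (\<Sum>k. \<Sum>j. ennreal ((cmod (cinner (bas j) (\<phi> k)))\<^sup>2))"
    by (simp only: Parseval_norm_ennreal)
  also have "\<dots> = (\<Sum>j. \<Sum>k. ennreal ((cmod (cinner (bas j) (\<phi> k)))\<^sup>2))"
    by (rule suminf_swap_ennreal)
  also have "\<dots> = (\<Sum>j. ennreal (Re (cinner (bas j) (blinfun_apply Q (bas j)))))"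
    by (intro suminf_cong suminf_ennreal_eq decomposes_form_Re assms) auto
  finally show ?thesis .
qed

definition diag_sums :: "'d::finite operator \<Rightarrow> real \<Rightarrow> bool" where
  "diag_sums Q t \<longleftrightarrow> (\<lambda>k. Re (cinner (bas k) (blinfun_apply Q (bas k)))) sums t"

lemma diag_sums_nonneg: "psd Q \<Longrightarrow> diag_sums Q t \<Longrightarrow> 0 \<le> t"
  unfolding diag_sums_def by (rule sums_le[OF psd_nonneg sums_zero])

lemma decomposes_norm_sums:
  assumes Q: "psd Q" "diag_sums Q t" and dec: "decomposes \<phi> Q"
  shows "(\<lambda>k. (norm (\<phi> k))\<^sup>2) sums t"
proof -
  have eq: "(\<Sum>k. ennreal ((norm (\<phi> k))\<^sup>2)) = ennreal t"
    unfolding decomposes_trace[OF dec]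
    by (rule suminf_ennreal_eq[OF psd_nonneg[OF Q(1)] Q(2)[unfolded diag_sums_def]])
  then have s: "summable (\<lambda>k. (norm (\<phi> k))\<^sup>2)"
    by (intro summable_suminf_not_top) auto
  have "ennreal (\<Sum>k. (norm (\<phi> k))\<^sup>2) = ennreal t"
    using suminf_ennreal_eq[OF _ summable_sums[OF s]] eq by simp
  then have "(\<Sum>k. (norm (\<phi> k))\<^sup>2) = t"
    using suminf_nonneg[OF s] diag_sums_nonneg[OF Q] by simp
  then show ?thesis using summable_sums[OF s] by simp
qed

section \<open>Spectral theorem by deflation\<close>

lemma psd_form_le_trace:
  assumes Q: "psd Q" "diag_sums Q t"
  shows "Re (cinner x (blinfun_apply Q x)) \<le> t * (norm x)\<^sup>2"
proof (rule sums_le)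
  show "(\<lambda>k. (cmod (cinner x (chol Q k)))\<^sup>2) sums Re (cinner x (blinfun_apply Q x))"
    by (rule decomposes_form_Re[OF decomposes_chol[OF Q(1)]])
  show "(\<lambda>k. (norm (chol Q k))\<^sup>2 * (norm x)\<^sup>2) sums (t * (norm x)\<^sup>2)"
    by (rule sums_mult2[OF decomposes_norm_sums[OF Q decomposes_chol[OF Q(1)]]])
  show "(cmod (cinner x (chol Q k)))\<^sup>2 \<le> (norm (chol Q k))\<^sup>2 * (norm x)\<^sup>2" for k
    unfolding power_mult_distrib[symmetric]
    by (rule power_mono) (use cmod_cinner_le[of x "chol Q k"] in \<open>auto simp: mult.commute\<close>)
qed

lemma psd_cinner_le_trace:
  assumes Q: "psd Q" "diag_sums Q t"
  shows "cmod (cinner x (blinfun_apply Q y)) \<le> t * (norm x * norm y)"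
proof -
  have "cmod (cinner x (blinfun_apply Q y)) \<le> norm x * (t * norm y)"
    by (intro order_trans[OF cmod_cinner_le] mult_left_mono
        psd_norm_le_if_form_le[OF Q(1) psd_form_le_trace[OF Q] diag_sums_nonneg[OF Q]]) auto
  then show ?thesis by (simp add: mult_ac)
qed

text \<open>Weak compactness gives a limit of a maximising sequence, and the form is weakly
  continuous on the unit ball: it is a series of terms that are weakly continuous and dominated by
  the summable \<open>(norm (\<phi> k))\<^sup>2\<close>, so Tannery's theorem applies.\<close>

lemma psd_form_attains_max:
  assumes Q: "psd Q" "diag_sums Q t"
  shows "\<exists>x. norm x \<le> 1 \<and>
    (\<forall>y. norm y \<le> 1 \<longrightarrow> Re (cinner y (blinfun_apply Q y)) \<le> Re (cinner x (blinfun_apply Q x)))"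
proof -
  define q where "q x = Re (cinner x (blinfun_apply Q x))" for x
  define \<phi> where "\<phi> = chol Q"
  have dec: "decomposes \<phi> Q" unfolding \<phi>_def by (rule decomposes_chol[OF Q(1)])
  have t0: "0 \<le> t" by (rule diag_sums_nonneg[OF Q])
  have bd: "q y \<le> t" if "norm y \<le> 1" for y
  proof -
    have "t * (norm y)\<^sup>2 \<le> t * 1" using that t0 by (intro mult_left_mono power_le_one) auto
    then show ?thesis using psd_form_le_trace[OF Q, of y] by (simp add: q_def)
  qed
  define L where "L = (SUP y\<in>{y. norm y \<le> 1}. q y)"
  have bdd: "bdd_above (q ` {y. norm y \<le> 1})" using bd by (intro bdd_aboveI[of _ t]) auto
  have le_L: "q y \<le> L" if "norm y \<le> 1" for y
    unfolding L_def using that bdd by (intro cSUP_upper) auto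
  have "\<exists>y. norm y \<le> 1 \<and> L - inverse (real (Suc n)) < q y" for n
  proof -
    have "L - inverse (real (Suc n)) < L" by simp
    then have "\<exists>y\<in>{y. norm y \<le> 1}. L - inverse (real (Suc n)) < q y"
      unfolding L_def by (subst (asm) less_cSUP_iff) (use bdd in \<open>auto intro: exI[of _ 0]\<close>)
    then show ?thesis by blast
  qed
  then obtain w where w: "\<And>n. norm (w n) \<le> 1" "\<And>n. L - inverse (real (Suc n)) < q (w n)" by metis
  obtain r l where rl: "strict_mono r" "norm l \<le> 1"
      "\<And>x. (\<lambda>n. cinner x (w (r n))) \<longlonglongrightarrow> cinner x l"
    using bounded_imp_weakly_convergent_subseq[of w 1, OF w(1)] by blast
  have q_sum: "q x = (\<Sum>k. (cmod (cinner (\<phi> k) x))\<^sup>2)" for x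
    using decomposes_form_Re[OF dec, of x] by (simp add: q_def sums_iff cmod_cinner_commute[of x])
  have "(\<lambda>n. \<Sum>k. (cmod (cinner (\<phi> k) (w (r n))))\<^sup>2) \<longlonglongrightarrow> (\<Sum>k. (cmod (cinner (\<phi> k) l))\<^sup>2)"
  proof (rule conjunct2[OF conjunct2[OF tannerys_theorem]])
    show "(\<lambda>n. (cmod (cinner (\<phi> k) (w (r n))))\<^sup>2) \<longlonglongrightarrow> (cmod (cinner (\<phi> k) l))\<^sup>2" for k
      by (intro tendsto_intros rl)
    show "summable (\<lambda>k. (norm (\<phi> k))\<^sup>2)"
      using decomposes_norm_sums[OF Q dec] by (simp add: sums_iff)
    have "norm ((cmod (cinner (\<phi> k) (w (r n))))\<^sup>2) \<le> (norm (\<phi> k))\<^sup>2" for k n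
    proof -
      have "cmod (cinner (\<phi> k) (w (r n))) \<le> norm (\<phi> k) * 1"
        by (intro order_trans[OF cmod_cinner_le] mult_left_mono w) auto
      then show ?thesis by (simp add: power_mono)
    qed
    then show "\<forall>\<^sub>F (k, n) in sequentially \<times>\<^sub>F sequentially. norm ((cmod (cinner (\<phi> k) (w (r n))))\<^sup>2) \<le> (norm (\<phi> k))\<^sup>2"
      by (intro always_eventually) auto
  qed simp
  then have lim: "(\<lambda>n. q (w (r n))) \<longlonglongrightarrow> q l" by (simp only: q_sum)
  have "(\<lambda>n. L - inverse (real (Suc n))) \<longlonglongrightarrow> L - 0"
    by (intro tendsto_intros LIMSEQ_inverse_real_of_nat)
  then have "(\<lambda>n. L - inverse (real (Suc (r n)))) \<longlonglongrightarrow> L"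
    using LIMSEQ_subseq_LIMSEQ[OF _ rl(1)] by (auto simp: o_def)
  then have "L \<le> q l"
    by (rule LIMSEQ_le[OF _ lim]) (use w(2) less_imp_le in blast)
  then show ?thesis using rl(2) le_L order_trans unfolding q_def by blast
qed

text \<open>At a maximiser \<open>v\<close> the operator \<open>q v - Q\<close> is positive and its
  form vanishes at \<open>v\<close>, hence it kills \<open>v\<close>. This replaces the variational
  derivative.\<close>

lemma psd_top_eigenvector:
  assumes Q: "psd Q" "diag_sums Q t" and "Q \<noteq> 0"
  shows "\<exists>v c. norm v = 1 \<and> 0 < c \<and> blinfun_apply Q v = c *\<^sub>R v
    \<and> (\<forall>x. Re (cinner x (blinfun_apply Q x)) \<le> c * (norm x)\<^sup>2)"
proof -
  define q where "q x = Re (cinner x (blinfun_apply Q x))" for x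
  obtain v where v: "norm v \<le> 1" "\<And>y. norm y \<le> 1 \<Longrightarrow> q y \<le> q v"
    using psd_form_attains_max[OF Q] unfolding q_def by blast
  have scale: "q (s *\<^sub>R y) = s\<^sup>2 * q y" for s y
    by (simp add: q_def blinfun.scaleR_right cinner.scaleR_left cinner.scaleR_right power2_eq_square)
  have le: "q x \<le> q v * (norm x)\<^sup>2" for x
  proof (cases "x = 0")
    case True
    then show ?thesis by (simp add: q_def cinner.zero_left)
  next
    case False
    then have "q (inverse (norm x) *\<^sub>R x) \<le> q v" by (intro v) simp
    then have "inverse ((norm x)\<^sup>2) * q x \<le> q v" unfolding scale by (simp add: power_inverse)
    then show ?thesis using False by (simp add: field_simps)
  qed
  have pos: "0 < q v"
  proof (rule ccontr)
    assume "\<not> 0 < q v"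
    then have "q v * (norm x)\<^sup>2 \<le> 0" for x :: "'a L2" by (simp add: mult_nonpos_nonneg not_less)
    then have "q x = 0" for x
      using le[of x] psd_nonneg[OF Q(1), of x] unfolding q_def by (meson order.antisym order.trans)
    then have "blinfun_apply Q x = 0" for x using psd_eq_0I[OF Q(1)] by (simp add: q_def)
    then have "Q = 0" by (intro blinfun_eqI) simp
    then show False using \<open>Q \<noteq> 0\<close> by simp
  qed
  have "norm v = 1"
  proof -
    have "q v * 1 \<le> q v * (norm v)\<^sup>2" using le[of v] by simp
    then have "1 \<le> (norm v)\<^sup>2" using pos by (simp only: mult_le_cancel_left_pos)
    then have "1 \<le> norm v" by (metis norm_ge_zero one_power2 power2_le_imp_le)
    then show ?thesis using v(1) by simp
  qed
  define A where "A = q v *\<^sub>R id_blinfun - Q"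
  have "psd (q v *\<^sub>R (id_blinfun :: 'a operator))"
    by (rule psd_scaleR) (use pos in \<open>auto simp: psd_def clinear_op_def self_adjoint_def cinner_self\<close>)
  then have "psd A"
    unfolding A_def
    by (rule psd_diffI[OF _ Q(1)])
       (use le in \<open>simp add: blinfun.scaleR_left cinner.scaleR_right cinner_self q_def\<close>)
  moreover have "Re (cinner v (blinfun_apply A v)) = 0"
    using \<open>norm v = 1\<close>
    by (simp add: A_def blinfun.diff_left blinfun.scaleR_left cinner.diff_right cinner.scaleR_right cinner_self flip: q_def)
  ultimately have "blinfun_apply A v = 0" by (rule psd_eq_0I)
  then have "blinfun_apply Q v = q v *\<^sub>R v" by (simp add: A_def blinfun.diff_left blinfun.scaleR_left)
  then show ?thesis using \<open>norm v = 1\<close> pos le unfolding q_def by blast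
qed

text \<open>The components are the remaining operator, the eigenvectors extracted so far, and the
  remaining trace. Keeping the old eigenvectors in the kernel is what forces new ones to be
  orthogonal to them.\<close>

definition deflation_state :: "'d::finite operator \<times> 'd L2 set \<times> real \<Rightarrow> bool" where
  "deflation_state = (\<lambda>(Q, F, t). psd Q \<and> diag_sums Q t \<and> orthonormal F \<and> finite F
     \<and> (\<forall>f\<in>F. blinfun_apply Q f = 0))"

definition deflation_step ::
    "'d::finite operator \<times> 'd L2 set \<times> real \<Rightarrow> 'd operator \<times> 'd L2 set \<times> real \<Rightarrow> real \<Rightarrow> 'd L2 \<Rightarrow> bool" where
  "deflation_step = (\<lambda>(Q, F, t) (Q', F', t') c v. norm v = 1 \<and> (\<forall>f\<in>F. cinner f v = 0) \<and> 0 \<le> c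
     \<and> Q' = Q - c *\<^sub>R rank_one_op v \<and> F' = insert v F \<and> t' = t - c
     \<and> (\<forall>x. Re (cinner x (blinfun_apply Q x)) \<le> c * (norm x)\<^sup>2))"

lemma ex_deflation_step:
  fixes s :: "'d::finite operator \<times> 'd L2 set \<times> real"
  assumes "deflation_state s"
  shows "\<exists>s'. deflation_state s' \<and> (\<exists>c v. deflation_step s s' c v)"
proof -
  obtain Q F t where s: "s = (Q, F, t)" by (cases s)
  have Q: "psd Q" "diag_sums Q t" and F: "orthonormal F" "finite F" "\<And>f. f \<in> F \<Longrightarrow> blinfun_apply Q f = 0"
    using assms by (auto simp: s deflation_state_def)
  have "\<exists>c v. norm v = 1 \<and> (\<forall>f\<in>F. cinner f v = 0) \<and> 0 \<le> c \<and> blinfun_apply Q v = c *\<^sub>R v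
      \<and> (\<forall>x. Re (cinner x (blinfun_apply Q x)) \<le> c * (norm x)\<^sup>2)"
  proof (cases "Q = 0")
    case True
    \<comment> \<open>\<open>spectral_decomposition\<close> asks for an infinite orthonormal
      sequence even for finite rank, so once the operator is exhausted the sequence continues with
      arbitrary orthogonal vectors and eigenvalue 0.\<close>
    obtain v where "norm v = 1" "\<forall>f\<in>F. cinner f v = 0" using ex_unit_orthogonal[OF F(1,2)] by blast
    then show ?thesis using True by (intro exI[of _ 0] exI[of _ v]) (simp add: cinner.zero_right)
  next
    case False
    then obtain v c where v: "norm v = 1" "0 < c" "blinfun_apply Q v = c *\<^sub>R v"
        "\<forall>x. Re (cinner x (blinfun_apply Q x)) \<le> c * (norm x)\<^sup>2"
      using psd_top_eigenvector[OF Q] by blast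
    have "cinner f v = 0" if "f \<in> F" for f
    proof -
      have "c *\<^sub>R cinner f v = cinner (blinfun_apply Q f) v"
        unfolding psd_self_adjoint[OF Q(1)] v(3) by (simp add: cinner.scaleR_right)
      then show ?thesis using F(3)[OF that] v(2) by (simp add: cinner.zero_left)
    qed
    then show ?thesis using v less_imp_le by blast
  qed
  then obtain c v where v: "norm v = 1" "\<And>f. f \<in> F \<Longrightarrow> cinner f v = 0" and c: "0 \<le> c"
    and ev: "blinfun_apply Q v = c *\<^sub>R v" and top: "\<forall>x. Re (cinner x (blinfun_apply Q x)) \<le> c * (norm x)\<^sup>2"
    by blast
  define Q' where "Q' = Q - c *\<^sub>R rank_one_op v"
  have Q'x: "blinfun_apply Q' x = blinfun_apply Q x - c *\<^sub>R scaleC (cinner v x) v" for x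
    by (simp add: Q'_def blinfun.diff_left blinfun.scaleR_left rank_one_apply)
  have "psd Q'"
    unfolding Q'_def
  proof (rule psd_diffI[OF Q(1) psd_scaleR[OF psd_rank_one c]])
    fix x
    \<comment> \<open>Cauchy-Schwarz at the eigenvector reads \<open>c\<^sup>2 * (cmod (cinner x
      v))\<^sup>2 \<le> Re (cinner x (blinfun_apply Q x)) * c\<close>; cancelling \<open>c\<close>
      gives positivity of the deflated operator.\<close>
    have "cinner x (blinfun_apply Q v) = c *\<^sub>R cinner x v" unfolding ev by (rule cinner.scaleR_right)
    moreover have "Re (cinner v (blinfun_apply Q v)) = c"
      unfolding ev cinner.scaleR_right cinner_self using v(1) by simp
    ultimately have "c * (c * (cmod (cinner x v))\<^sup>2) \<le> c * Re (cinner x (blinfun_apply Q x))"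
      using psd_Cauchy_Schwarz[OF Q(1), of x v] c
      by (simp add: power2_eq_square mult_ac)
    then have "c * (cmod (cinner x v))\<^sup>2 \<le> Re (cinner x (blinfun_apply Q x))"
      using c psd_nonneg[OF Q(1), of x] by (cases "c = 0") (auto simp: mult_le_cancel_left)
    then show "Re (cinner x (blinfun_apply (c *\<^sub>R rank_one_op v) x)) \<le> Re (cinner x (blinfun_apply Q x))"
      by (simp add: blinfun.scaleR_left cinner.scaleR_right Re_cinner_rank_one cmod_cinner_commute)
  qed
  moreover have "diag_sums Q' (t - c)"
  proof -
    have "(\<lambda>k. Re (cinner (bas k) (blinfun_apply Q (bas k))) - c * (cmod (cinner (bas k) v))\<^sup>2)
        sums (t - c * (norm v)\<^sup>2)"
      by (intro sums_diff sums_mult Parseval_norm Q(2)[unfolded diag_sums_def])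
    then show ?thesis
      using v(1) unfolding diag_sums_def Q'_def
      by (simp add: blinfun.diff_left blinfun.scaleR_left cinner.diff_right cinner.scaleR_right
          Re_cinner_rank_one cmod_cinner_commute[of v])
  qed
  moreover have "blinfun_apply Q' v = 0" unfolding Q'x ev cinner_self v(1) by simp
  moreover have "blinfun_apply Q' f = 0" if "f \<in> F" for f
  proof -
    have "cinner v f = 0" using v(2)[OF that] by (subst cinner_commute) simp
    then show ?thesis unfolding Q'x F(3)[OF that] by (simp add: scaleC.zero_left)
  qed
  ultimately have "deflation_state (Q', insert v F, t - c)"
    using orthonormal_insert[OF F(1) v] F(2) by (auto simp: deflation_state_def)
  moreover have "deflation_step s (Q', insert v F, t - c) c v"
    using v c top by (auto simp: s deflation_step_def Q'_def)
  ultimately show ?thesis by blast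
qed

text \<open>The remaining trace stays nonnegative, so the extracted eigenvalues are summable and
  tend to 0. Each bounds the form of the operator it was extracted from, so the remainders tend to 0
  strongly.\<close>

theorem ex_spectral_decomposition:
  fixes Q :: "'d::finite operator"
  assumes Q: "psd Q" "diag_sums Q t"
  shows "\<exists>q \<psi>. spectral_decomposition Q q \<psi>"
proof -
  have "\<exists>s. \<forall>n. ((deflation_state (s n) \<and> (n = 0 \<longrightarrow> s n = (Q, {}, t)))
      \<and> (\<exists>c v. deflation_step (s n) (s (Suc n)) c v))"
  proof (rule dependent_nat_choice)
    show "\<exists>x. deflation_state x \<and> (0 = 0 \<longrightarrow> x = (Q, {}, t))"
      using Q by (auto simp: deflation_state_def orthonormal_def)
  qed (use ex_deflation_step in blast)
  then obtain s where s: "\<And>n. deflation_state (s n)" "s 0 = (Q, {}, t)"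
      "\<And>n. \<exists>c v. deflation_step (s n) (s (Suc n)) c v"
    by blast
  then obtain q \<psi> where step: "\<And>n. deflation_step (s n) (s (Suc n)) (q n) (\<psi> n)" by metis
  define A F T where "A n = fst (s n)" and "F n = fst (snd (s n))" and "T n = snd (snd (s n))" for n
  have A: "psd (A n)" "diag_sums (A n) (T n)" for n
    using s(1)[of n] by (auto simp: deflation_state_def A_def T_def split: prod.splits)
  have st: "norm (\<psi> n) = 1" "\<And>f. f \<in> F n \<Longrightarrow> cinner f (\<psi> n) = 0" "0 \<le> q n"
      "A (Suc n) = A n - q n *\<^sub>R rank_one_op (\<psi> n)" "F (Suc n) = insert (\<psi> n) (F n)" "T (Suc n) = T n - q n"
      "\<And>x. Re (cinner x (blinfun_apply (A n) x)) \<le> q n * (norm x)\<^sup>2" for n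
    using step[of n] by (auto simp: deflation_step_def A_def F_def T_def split: prod.splits)
  have init: "A 0 = Q" "T 0 = t" by (simp_all add: A_def T_def s(2))
  have F_mono: "\<psi> j \<in> F n" if "j < n" for j n
    using that by (induction n) (auto simp: st(5) less_Suc_eq)
  have orth: "cinner (\<psi> j) (\<psi> k) = (if j = k then 1 else 0)" for j k
  proof -
    have "cinner (\<psi> j) (\<psi> k) = 0" if "j < k" for j k by (rule st(2)[OF F_mono[OF that]])
    moreover have "cinner (\<psi> j) (\<psi> k) = 0" if "k < j" for j k
      using st(2)[OF F_mono[OF that]] by (subst cinner_commute) simp
    moreover have "cinner (\<psi> j) (\<psi> j) = 1" unfolding cinner_self st(1) by simp
    ultimately show ?thesis by (metis linorder_neqE_nat)
  qed
  have sumq: "(\<Sum>k<n. q k) = t - T n" for n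
    by (induction n) (auto simp: init st(6))
  then have "(\<Sum>k<n. q k) \<le> t" for n using diag_sums_nonneg[OF A] by simp
  then have "summable q" by (intro summableI_nonneg_bounded[of _ t] st(3))
  then have q0: "q \<longlonglongrightarrow> 0" by (rule summable_LIMSEQ_zero)
  have Ax: "blinfun_apply (A n) x = blinfun_apply Q x - (\<Sum>k<n. q k *\<^sub>R blinfun_apply (rank_one_op (\<psi> k)) x)" for n x
    by (induction n) (auto simp: init st(4) blinfun.diff_left blinfun.scaleR_left)
  have "(\<lambda>k. q k *\<^sub>R blinfun_apply (rank_one_op (\<psi> k)) x) sums blinfun_apply Q x" for x
  proof -
    have "norm (blinfun_apply (A n) x) \<le> q n * norm x" for n
      by (rule psd_norm_le_if_form_le[OF A(1) st(7) st(3)])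
    then have "(\<lambda>n. blinfun_apply (A n) x) \<longlonglongrightarrow> 0"
      by (intro Lim_null_comparison[OF always_eventually tendsto_mult_left_zero[OF q0]]) blast
    then have "(\<lambda>n. blinfun_apply Q x - blinfun_apply (A n) x) \<longlonglongrightarrow> blinfun_apply Q x - 0"
      by (intro tendsto_intros)
    then show ?thesis by (simp add: sums_def Ax)
  qed
  then have "spectral_decomposition Q q \<psi>"
    unfolding spectral_decomposition_def using st(3) orth by blast
  then show ?thesis by blast
qed

section \<open>Translations, modulations and weak derivatives\<close>

lemma AE_translate:
  fixes c :: "real^'d"
  assumes "AE x in lborel. P x" shows "AE x in lborel. P (x + c)"
proof -
  have "AE x in distr lborel borel ((+) c). P x" unfolding lborel_distr_plus by (rule assms)
  then have "AE x in lborel. P (c + x)" by (rule AE_distrD[rotated]) simp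
  then show ?thesis by (simp add: add.commute)
qed

lemma integral_translate:
  fixes c :: "real^'d" and f :: "_ \<Rightarrow> complex"
  assumes "f \<in> borel_measurable borel"
  shows "(LINT x|lborel. f (x + c)) = (LINT x|lborel. f x)"
proof -
  have "(LINT x|lborel. f x) = (LINT x|distr lborel borel ((+) c). f x)" unfolding lborel_distr_plus ..
  also have "\<dots> = (LINT x|lborel. f (c + x))" by (rule integral_distr) (use assms in auto)
  finally show ?thesis by (simp add: add.commute)
qed

lemma sq_integrable_translate:
  fixes c :: "real^'d"
  assumes "sq_integrable f" shows "sq_integrable (\<lambda>y. f (y + c))"
proof -
  have [measurable]: "f \<in> borel_measurable borel" using assms by (simp add: sq_integrable_def)
  have "integrable (distr lborel borel ((+) c)) (\<lambda>x. (cmod (f x))\<^sup>2)"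
    unfolding lborel_distr_plus using assms by (simp add: sq_integrable_def)
  then have "integrable lborel (\<lambda>x. (cmod (f (c + x)))\<^sup>2)" by (rule integrable_distr[rotated]) simp
  then show ?thesis by (simp add: sq_integrable_def add.commute)
qed

lemma cnj_measurable [measurable]: "cnj \<in> borel_measurable borel"
  by (intro borel_measurable_continuous_onI continuous_intros)

definition shift :: "real^'d \<Rightarrow> 'd::finite L2 \<Rightarrow> 'd L2" where
  "shift c v = abs_L2 (\<lambda>y. rep_L2 v (y + c))"

lemma rep_shift: "AE y in lborel. rep_L2 (shift c v) y = rep_L2 v (y + c)"
  unfolding shift_def by (intro rep_abs_L2 sq_integrable_translate sq_integrable_rep)

lemma pairing_shift:
  assumes [measurable]: "f \<in> borel_measurable borel"
  shows "(LINT y|lborel. f y * rep_L2 (shift c v) y) = (LINT y|lborel. f (y - c) * rep_L2 v y)"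
proof -
  have "(LINT y|lborel. f y * rep_L2 (shift c v) y) = (LINT y|lborel. f ((y + c) - c) * rep_L2 v (y + c))"
    by (intro integral_cong_AE) (use rep_shift[of c v] in auto)
  also have "\<dots> = (LINT y|lborel. f (y - c) * rep_L2 v y)"
    by (rule integral_translate) measurable
  finally show ?thesis .
qed

lemma cinner_shift_right: "cinner a (shift c b) = cinner (shift (- c) a) b"
proof -
  have "cinner a (shift c b) = (LINT y|lborel. cnj (rep_L2 a (y - c)) * rep_L2 b y)"
    unfolding cinner_rep[of a] by (rule pairing_shift) measurable
  also have "\<dots> = cinner (shift (- c) a) b"
    unfolding cinner_rep[of _ b]
    by (intro integral_cong_AE) (measurable, use rep_shift[of "- c" a] in auto)
  finally show ?thesis .
qed

lemma L2_eqI: "(\<And>x. cinner x a = cinner x b) \<Longrightarrow> a = b"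
proof -
  assume "\<And>x. cinner x a = cinner x b"
  then have "cinner (a - b) (a - b) = 0" by (simp add: cinner.diff_right)
  then show "a = b" by (simp add: cinner_self)
qed

lemma shift_add: "shift c (a + b) = shift c a + shift c b"
  by (rule L2_eqI) (simp add: cinner_shift_right cinner.add_right)

lemma shift_scaleC: "shift c (scaleC k a) = scaleC k (shift c a)"
  by (rule L2_eqI) (simp add: cinner_shift_right cinner_scaleC_right)

lemma shift_shift: "shift c (shift d v) = shift (c + d) v"
proof -
  have "shift c (shift d v) = abs_L2 (\<lambda>y. rep_L2 v (y + (c + d)))"
    unfolding shift_def[of c]
    by (subst abs_L2_eq_iff)
       (use AE_translate[OF rep_shift[of d v], of c] in
         \<open>auto intro: sq_integrable_translate sq_integrable_rep simp: add.assoc\<close>)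
  then show ?thesis by (simp add: shift_def)
qed

lemma shift_0: "shift 0 v = v"
  by (simp add: shift_def)

lemma norm_shift: "norm (shift c v) = norm v"
proof -
  have "cinner (shift c v) (shift c v) = cinner v v"
    by (simp add: cinner_shift_right shift_shift shift_0)
  then have "(norm (shift c v))\<^sup>2 = (norm v)\<^sup>2" unfolding cinner_self of_real_eq_iff .
  then show ?thesis by (rule power2_eq_imp_eq) (rule norm_ge_zero)+
qed

definition modu :: "real \<Rightarrow> 'd \<Rightarrow> 'd::finite L2 \<Rightarrow> 'd L2" where
  "modu h i v = abs_L2 (\<lambda>y. cis (h * y $ i) * rep_L2 v y)"

lemma cis_measurable [measurable]: "cis \<in> borel_measurable borel"
  by (intro borel_measurable_continuous_onI continuous_on_cis continuous_intros)

lemma vec_nth_measurable [measurable]: "(\<lambda>y :: real^'d. y $ i) \<in> borel_measurable borel"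
  by (intro borel_measurable_continuous_onI continuous_intros)

lemma sq_integrable_modu: "sq_integrable (\<lambda>y. cis (h * y $ i) * rep_L2 v y)"
  using sq_integrable_rep[of v] unfolding sq_integrable_def by (auto simp: norm_mult)

lemma rep_modu: "AE y in lborel. rep_L2 (modu h i v) y = cis (h * y $ i) * rep_L2 v y"
  unfolding modu_def by (intro rep_abs_L2 sq_integrable_modu)

lemma cinner_modu_right: "cinner a (modu h i b) = cinner (modu (- h) i a) b"
proof -
  have "cinner a (modu h i b) = (LINT y|lborel. cnj (cis (- h * y $ i) * rep_L2 a y) * rep_L2 b y)"
    unfolding cinner_rep[of a]
    by (intro integral_cong_AE) (measurable, use rep_modu[of h i b] in \<open>auto simp: cis_cnj\<close>)
  also have "\<dots> = cinner (modu (- h) i a) b"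
    unfolding cinner_rep[of _ b]
    by (intro integral_cong_AE) (measurable, use rep_modu[of "- h" i a] in auto)
  finally show ?thesis .
qed

text \<open>\<open>2\<^sup>n (U - 1)\<close> for the one-parameter groups \<open>U\<close> generated by position and momentum, at time
  \<open>2\<^sup>-\<^sup>n\<close> and centred at \<open>\<alpha>\<close>.\<close>

definition pos_quot :: "nat \<Rightarrow> 'd \<Rightarrow> real \<Rightarrow> 'd::finite L2 \<Rightarrow> 'd L2" where
  "pos_quot n i \<alpha> v = 2 ^ n *\<^sub>R (scaleC (cis (- (\<alpha> / 2 ^ n))) (modu (1 / 2 ^ n) i v) - v)"

definition mom_quot :: "nat \<Rightarrow> 'd \<Rightarrow> real \<Rightarrow> 'd::finite L2 \<Rightarrow> 'd L2" where
  "mom_quot n i \<alpha> v = 2 ^ n *\<^sub>R (scaleC (cis (- (\<alpha> / 2 ^ n))) (shift ((1 / 2 ^ n) *\<^sub>R axis i 1) v) - v)"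

lemma norm_double_step_le:
  fixes v :: "'d::finite L2"
  assumes lin: "\<And>a b. U (a - b) = U a - (U b :: 'd L2)" and iso: "\<And>a. norm (U a) = norm (a :: 'd L2)"
  shows "norm (U (U v) - v) \<le> 2 * norm (U v - v)"
proof -
  have "norm (U (U v) - v) = norm (U (U v - v) + (U v - v))" by (simp add: lin)
  also have "\<dots> \<le> norm (U v - v) + norm (U v - v)" by (intro order_trans[OF norm_triangle_ineq]) (simp add: iso)
  finally show ?thesis by simp
qed

lemma incseq_norm_mom_quot:
  fixes v :: "'d::finite L2"
  shows "incseq (\<lambda>n. norm (mom_quot n i \<alpha> v))"
proof (rule incseq_SucI)
  fix n
  define h where "h = 1 / (2::real) ^ Suc n"
  define U where "U a = scaleC (cis (- (\<alpha> * h))) (shift (h *\<^sub>R axis i 1) a)" for a :: "'d L2"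
  have diff: "shift c (a - b) = shift c a - shift c b" for c and a b :: "'d L2"
    using shift_add[of c "a - b" b] by simp
  have UU: "U (U v) = scaleC (cis (- (\<alpha> * (2 * h)))) (shift ((2 * h) *\<^sub>R axis i 1) v)"
    by (simp add: U_def shift_scaleC shift_shift scaleC_scaleC cis_mult mult.assoc mult.left_commute
        flip: scaleR_add_left)
  have "norm (U (U v) - v) \<le> 2 * norm (U v - v)"
    by (rule norm_double_step_le) (simp_all add: U_def diff scaleC.diff_right norm_shift)
  then have "2 ^ n * norm (U (U v) - v) \<le> 2 ^ Suc n * norm (U v - v)" by simp
  moreover have "2 * h = 1 / 2 ^ n" "\<alpha> * (1 / 2 ^ n) = \<alpha> / 2 ^ n" by (simp_all add: h_def)
  ultimately show "norm (mom_quot n i \<alpha> v) \<le> norm (mom_quot (Suc n) i \<alpha> v)"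
    unfolding UU by (simp add: mom_quot_def U_def h_def)
qed

lemma cmod_cis_minus_1_double: "cmod (cis (2 * t) - 1) \<le> 2 * cmod (cis t - 1)"
proof -
  have "cis (2 * t) = cis t * cis t" by (simp add: cis_mult)
  then have "cis (2 * t) - 1 = (cis t + 1) * (cis t - 1)" by (simp add: algebra_simps)
  moreover have "cmod (cis t + 1) \<le> 2" using norm_triangle_ineq[of "cis t" 1] by simp
  ultimately show ?thesis by (simp add: norm_mult mult_right_mono)
qed

lemma cis_quot_incseq: "incseq (\<lambda>n. 2 ^ n * cmod (cis (s / 2 ^ n) - 1))"
proof (rule incseq_SucI)
  fix n
  have "cmod (cis (2 * (s / 2 ^ Suc n)) - 1) \<le> 2 * cmod (cis (s / 2 ^ Suc n) - 1)"
    by (rule cmod_cis_minus_1_double)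
  then show "2 ^ n * cmod (cis (s / 2 ^ n) - 1) \<le> 2 ^ Suc n * cmod (cis (s / 2 ^ Suc n) - 1)" by simp
qed

lemma half_power_filterlim: "filterlim (\<lambda>n. (1 / 2) ^ n :: 'a::real_normed_field) (at 0) sequentially"
  unfolding filterlim_at
proof
  show "(\<lambda>n. (1 / 2) ^ n :: 'a) \<longlonglongrightarrow> 0"
    by (rule LIMSEQ_power_zero) (simp add: norm_divide)
qed simp

lemma cis_quot_tendsto: "(\<lambda>n. 2 ^ n * cmod (cis (s / 2 ^ n) - 1)) \<longlonglongrightarrow> \<bar>s\<bar>"
proof -
  have "((\<lambda>h. exp (\<i> * of_real s * h)) has_field_derivative \<i> * of_real s) (at 0)"
    by (auto intro!: derivative_eq_intros)
  then have "((\<lambda>h. (exp (\<i> * of_real s * h) - 1) / h) \<longlongrightarrow> \<i> * of_real s) (at 0)"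
    by (simp add: DERIV_def)
  from filterlim_compose[OF this half_power_filterlim]
  have "(\<lambda>n. (exp (\<i> * of_real s * (1 / 2) ^ n) - 1) / (1 / 2) ^ n) \<longlonglongrightarrow> \<i> * of_real s" .
  from tendsto_norm[OF this]
  have "(\<lambda>n. cmod ((exp (\<i> * of_real s * (1 / 2) ^ n) - 1) / (1 / 2) ^ n)) \<longlonglongrightarrow> \<bar>s\<bar>"
    by (simp add: norm_mult)
  moreover have "cmod ((exp (\<i> * of_real s * (1 / 2) ^ n) - 1) / (1 / 2) ^ n) = 2 ^ n * cmod (cis (s / 2 ^ n) - 1)" for n
    by (simp add: cis_conv_exp norm_divide norm_power norm_mult power_one_over mult.commute)
  ultimately show ?thesis by simp
qed

lemma norm_pos_quot_sq:
  "ennreal ((norm (pos_quot n i \<alpha> v))\<^sup>2)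
    = (\<integral>\<^sup>+y. ennreal ((2 ^ n * cmod (cis ((y $ i - \<alpha>) / 2 ^ n) - 1))\<^sup>2 * (cmod (rep_L2 v y))\<^sup>2) \<partial>lborel)"
proof -
  let ?g = "\<lambda>y. of_real (2 ^ n) * (cis (- (\<alpha> / 2 ^ n)) * (cis (1 / 2 ^ n * y $ i) * rep_L2 v y) - rep_L2 v y)"
  have s: "sq_integrable (\<lambda>y. cis (- (\<alpha> / 2 ^ n)) * (cis (1 / 2 ^ n * y $ i) * rep_L2 v y) - rep_L2 v y)"
    by (intro sq_integrable_diff sq_integrable_mult sq_integrable_modu sq_integrable_rep)
  have "pos_quot n i \<alpha> v = scaleC (of_real (2 ^ n)) (scaleC (cis (- (\<alpha> / 2 ^ n))) (modu (1 / 2 ^ n) i v) - abs_L2 (rep_L2 v))"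
    by (simp add: pos_quot_def scaleR_L2_def)
  also have "\<dots> = abs_L2 ?g"
    unfolding modu_def
    by (subst scaleC_abs[OF sq_integrable_modu], subst diff_abs, (intro sq_integrable_mult sq_integrable_modu sq_integrable_rep)+,
        subst scaleC_abs[OF s], rule refl)
  finally have "ennreal ((norm (pos_quot n i \<alpha> v))\<^sup>2) = (\<integral>\<^sup>+y. ennreal ((cmod (?g y))\<^sup>2) \<partial>lborel)"
    by (simp only: norm_abs_sq_nn[OF sq_integrable_mult[OF s]])
  also have "\<dots> = (\<integral>\<^sup>+y. ennreal ((2 ^ n * cmod (cis ((y $ i - \<alpha>) / 2 ^ n) - 1))\<^sup>2 * (cmod (rep_L2 v y))\<^sup>2) \<partial>lborel)"
  proof (intro nn_integral_cong arg_cong[where f = ennreal])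
    fix y
    have "cis (- (\<alpha> / 2 ^ n)) * cis (1 / 2 ^ n * y $ i) = cis ((y $ i - \<alpha>) / 2 ^ n)"
      by (simp add: cis_mult diff_divide_distrib)
    then have "?g y = of_real (2 ^ n) * ((cis ((y $ i - \<alpha>) / 2 ^ n) - 1) * rep_L2 v y)"
      by (simp add: algebra_simps)
    then have "cmod (?g y) = 2 ^ n * cmod (cis ((y $ i - \<alpha>) / 2 ^ n) - 1) * cmod (rep_L2 v y)"
      by (simp only: norm_mult norm_of_real) simp
    then show "(cmod (?g y))\<^sup>2 = (2 ^ n * cmod (cis ((y $ i - \<alpha>) / 2 ^ n) - 1))\<^sup>2 * (cmod (rep_L2 v y))\<^sup>2"
      by (simp only: power_mult_distrib)
  qed
  finally show ?thesis .
qed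

lemma pos_quot_mono: "m \<le> n \<Longrightarrow> ennreal ((norm (pos_quot m i \<alpha> v))\<^sup>2) \<le> ennreal ((norm (pos_quot n i \<alpha> v))\<^sup>2)"
  unfolding norm_pos_quot_sq
  by (intro nn_integral_mono ennreal_leI mult_right_mono power_mono)
     (use cis_quot_incseq in \<open>auto simp: incseq_def\<close>)

text \<open>Modulations act by multiplication, so the norms are integrals whose integrands increase
  pointwise to the position weight. Monotone convergence identifies the supremum even when it is
  infinite.\<close>

lemma SUP_pos_quot:
  "(SUP n. ennreal ((norm (pos_quot n i \<alpha> v))\<^sup>2))
    = (\<integral>\<^sup>+y. ennreal ((y $ i - \<alpha>)\<^sup>2 * (cmod (rep_L2 v y))\<^sup>2) \<partial>lborel)"
proof -
  let ?f = "\<lambda>n y. ennreal ((2 ^ n * cmod (cis ((y $ i - \<alpha>) / 2 ^ n) - 1))\<^sup>2 * (cmod (rep_L2 v y))\<^sup>2)"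
  have inc: "incseq ?f"
    unfolding incseq_def le_fun_def
    by (intro allI impI ennreal_leI mult_right_mono power_mono)
       (use cis_quot_incseq in \<open>auto simp: incseq_def\<close>)
  have "(SUP n. ennreal ((norm (pos_quot n i \<alpha> v))\<^sup>2)) = (\<integral>\<^sup>+y. (SUP n. ?f n y) \<partial>lborel)"
    unfolding norm_pos_quot_sq by (rule nn_integral_monotone_convergence_SUP[OF inc, symmetric]) measurable
  also have "\<dots> = (\<integral>\<^sup>+y. ennreal ((y $ i - \<alpha>)\<^sup>2 * (cmod (rep_L2 v y))\<^sup>2) \<partial>lborel)"
  proof (rule nn_integral_cong)
    fix y
    have lim: "(\<lambda>n. ?f n y) \<longlonglongrightarrow> ennreal (\<bar>y $ i - \<alpha>\<bar>\<^sup>2 * (cmod (rep_L2 v y))\<^sup>2)"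
      by (intro tendsto_ennrealI tendsto_intros cis_quot_tendsto)
    have "(\<lambda>n. ?f n y) \<longlonglongrightarrow> (SUP n. ?f n y)"
      by (rule LIMSEQ_SUP) (use inc in \<open>auto simp: incseq_def le_fun_def\<close>)
    from LIMSEQ_unique[OF this lim]
    show "(SUP n. ?f n y) = ennreal ((y $ i - \<alpha>)\<^sup>2 * (cmod (rep_L2 v y))\<^sup>2)"
      by (simp only: power2_abs)
  qed
  finally show ?thesis .
qed

section \<open>Weak partial derivatives through orbits of translations\<close>

definition pd :: "'d::finite \<Rightarrow> (real^'d \<Rightarrow> complex) \<Rightarrow> real^'d \<Rightarrow> complex" where
  "pd j \<phi> y = frechet_derivative \<phi> (at y) (axis j 1)"

lemma test_function_has_derivative:
  "test_function \<phi> \<Longrightarrow> (\<phi> has_derivative frechet_derivative \<phi> (at y)) (at y)"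
proof -
  assume "test_function \<phi>"
  then have "Ck (Suc 0) \<phi>" unfolding test_function_def by blast
  then show ?thesis by (simp add: frechet_derivative_works[symmetric])
qed

lemma pd_continuous: "test_function \<phi> \<Longrightarrow> continuous_on UNIV (pd j \<phi>)"
proof -
  assume "test_function \<phi>"
  then have "Ck (Suc 0) \<phi>" unfolding test_function_def by blast
  then show ?thesis by (simp add: pd_def[abs_def])
qed

lemma pd_translate:
  assumes "test_function \<phi>"
  shows "pd j (\<lambda>y. \<phi> (y + c)) y = pd j \<phi> (y + c)"
proof -
  have "((\<lambda>y. \<phi> (y + c)) has_derivative frechet_derivative \<phi> (at (y + c))) (at y)"
    using test_function_has_derivative[OF assms, of "y + c"]
    by (intro has_derivative_compose[of "\<lambda>y. y + c" _ _ _ \<phi>, simplified])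
       (auto intro!: derivative_eq_intros)
  from frechet_derivative_at[OF this] show ?thesis by (simp add: pd_def)
qed

lemma test_function_line_derivative:
  assumes "test_function \<phi>"
  shows "((\<lambda>s. \<phi> (y + s *\<^sub>R axis j 1)) has_vector_derivative pd j \<phi> (y + s *\<^sub>R axis j 1)) (at s)"
proof -
  have "((\<lambda>s. \<phi> (y + s *\<^sub>R axis j 1)) has_derivative
      (\<lambda>h. frechet_derivative \<phi> (at (y + s *\<^sub>R axis j 1)) (h *\<^sub>R axis j 1))) (at s)"
    by (rule has_derivative_compose[of "\<lambda>s. y + s *\<^sub>R axis j 1" _ _ _ \<phi>, OF _ test_function_has_derivative[OF assms]])
       (auto intro!: derivative_eq_intros)
  moreover have "linear (frechet_derivative \<phi> (at (y + s *\<^sub>R axis j 1)))"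
    by (rule has_derivative_linear[OF test_function_has_derivative[OF assms]])
  ultimately show ?thesis
    by (simp add: has_vector_derivative_def pd_def linear_cmul)
qed

lemma vector_derivative_norm_bound:
  fixes f :: "real \<Rightarrow> complex"
  assumes "\<And>s. (f has_vector_derivative f' s) (at s)" and "\<And>s. cmod (f' s) \<le> B"
  shows "cmod (f a - f b) \<le> B * \<bar>a - b\<bar>"
proof -
  have "norm (f a - f b) \<le> B * norm (a - b)"
  proof (rule differentiable_bound[of UNIV f "\<lambda>s h. h *\<^sub>R f' s"])
    show "(f has_derivative (\<lambda>h. h *\<^sub>R f' s)) (at s within UNIV)" for s
      using assms(1)[of s] by (simp add: has_vector_derivative_def)
    show "onorm (\<lambda>h. h *\<^sub>R f' s) \<le> B" for s
      by (rule onorm_le) (use assms(2)[of s] in \<open>simp add: mult.commute[of B] mult_left_mono\<close>)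
  qed auto
  then show ?thesis by simp
qed

lemma pd_bounded_support:
  assumes "test_function \<phi>"
  shows "\<exists>B r. 0 \<le> B \<and> 0 < r \<and> (\<forall>y. cmod (pd j \<phi> y) \<le> B) \<and> (\<forall>y. r < norm y \<longrightarrow> \<phi> y = 0 \<and> pd j \<phi> y = 0)"
proof -
  obtain r where r: "0 < r" "\<And>y. r < norm y \<Longrightarrow> \<phi> y = 0"
    using test_function_bounded_support[OF assms] by blast
  have pd0: "pd j \<phi> y = 0" if "r < norm y" for y
  proof -
    have "open {y :: real^'a. r < norm y}" by (intro open_Collect_less continuous_intros)
    then have "((\<lambda>y. \<phi> y) has_derivative (\<lambda>h. 0)) (at y)"
      by (rule has_derivative_transform_within_open[OF has_derivative_const]) (use that r in auto)
    from frechet_derivative_at[OF this] show ?thesis by (simp add: pd_def fun_eq_iff)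
  qed
  obtain B where "0 \<le> B" "\<And>y. cmod (pd j \<phi> y) \<le> B"
    using bounded_continuous_bounded_support[OF pd_continuous[OF assms] pd0] by blast
  with r pd0 show ?thesis by blast
qed

lemma norm_divideR: "norm (a /\<^sub>R r) = norm a / norm (r :: real)"
  by (simp add: divide_inverse mult.commute)

lemma has_vector_derivativeI_lim:
  fixes f :: "real \<Rightarrow> complex"
  assumes "((\<lambda>h. (f (s + h) - f s) /\<^sub>R h) \<longlongrightarrow> D) (at 0)"
  shows "(f has_vector_derivative D) (at s)"
  unfolding has_vector_derivative_def has_derivative_at
proof
  show "bounded_linear (\<lambda>h. h *\<^sub>R D)" by (rule bounded_linear_scaleR_left)
  have "((\<lambda>h. norm ((f (s + h) - f s) /\<^sub>R h - D)) \<longlongrightarrow> 0) (at 0)"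
    using assms by (simp add: LIM_zero tendsto_norm_zero)
  then show "(\<lambda>h. norm (f (s + h) - f s - h *\<^sub>R D) / norm h) \<midarrow>0\<rightarrow> 0"
  proof (rule Lim_transform_eventually)
    show "\<forall>\<^sub>F h in at 0. norm ((f (s + h) - f s) /\<^sub>R h - D) = norm (f (s + h) - f s - h *\<^sub>R D) / norm h"
      unfolding eventually_at_filter
    proof (intro always_eventually allI impI)
      fix h :: real assume h: "h \<noteq> 0"
      then have "(f (s + h) - f s) /\<^sub>R h - D = (f (s + h) - f s - h *\<^sub>R D) /\<^sub>R h"
        by (simp add: scaleR_diff_right)
      then show "norm ((f (s + h) - f s) /\<^sub>R h - D) = norm (f (s + h) - f s - h *\<^sub>R D) / norm h"
        by (simp add: divide_inverse mult.commute)
    qed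
  qed
qed

text \<open>Differentiation under the integral sign. The base point \<open>s\<close> is absorbed
  into the test function, so only the derivative at 0 matters; the difference quotients are
  dominated by a Lipschitz constant on a fixed ball, where \<open>rep_L2 v\<close> is
  integrable.\<close>

lemma pairing_line_derivative:
  fixes v :: "'d::finite L2"
  assumes \<phi>: "test_function \<phi>"
  shows "((\<lambda>s. LINT y|lborel. \<phi> (y + s *\<^sub>R axis j 1) * rep_L2 v y) has_vector_derivative
    (LINT y|lborel. pd j \<phi> (y + s *\<^sub>R axis j 1) * rep_L2 v y)) (at s)"
proof -
  define \<psi> where "\<psi> = (\<lambda>y. \<phi> (y + s *\<^sub>R axis j 1))"
  have \<psi>: "test_function \<psi>" unfolding \<psi>_def by (rule test_function_translate[OF \<phi>])
  have pd\<psi>: "pd j \<psi> y = pd j \<phi> (y + s *\<^sub>R axis j 1)" for y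
    unfolding \<psi>_def by (rule pd_translate[OF \<phi>])
  obtain B r where B: "0 \<le> B" "\<And>y. cmod (pd j \<psi> y) \<le> B" and r: "0 < r" "\<And>y. r < norm y \<Longrightarrow> \<psi> y = 0"
    using pd_bounded_support[OF \<psi>, of j] by blast
  have lip: "cmod (\<psi> (y + h *\<^sub>R axis j 1) - \<psi> y) \<le> B * \<bar>h\<bar>" for y h
    using vector_derivative_norm_bound[OF test_function_line_derivative[OF \<psi>, of y j] B(2), of h 0] by simp
  have [measurable]: "\<psi> \<in> borel_measurable borel"
    by (intro borel_measurable_continuous_onI test_function_continuous \<psi>)
  have [measurable]: "pd j \<psi> \<in> borel_measurable borel"
    by (intro borel_measurable_continuous_onI pd_continuous \<psi>)
  have lim: "(\<lambda>n. LINT y|lborel. ((\<psi> (y + X n *\<^sub>R axis j 1) - \<psi> y) /\<^sub>R X n) * rep_L2 v y)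
      \<longlonglongrightarrow> (LINT y|lborel. pd j \<psi> y * rep_L2 v y)"
    if X: "\<And>n. X n \<noteq> 0" "X \<longlonglongrightarrow> 0" for X :: "nat \<Rightarrow> real"
  proof -
    \<comment> \<open>\<open>K\<close> bounds the increments. Translates by at most \<open>K\<close>
      of a function supported in the ball of radius \<open>r\<close> are supported in the ball of
      radius \<open>r + K\<close>.\<close>
    obtain K where K: "\<And>n. \<bar>X n\<bar> \<le> K" "0 < K"
      using Bseq_eq_bounded convergent_imp_Bseq[OF convergentI[OF X(2)]] by (metis BseqE real_norm_def)
    show ?thesis
    proof (rule integral_dominated_convergence)
      show "integrable lborel (\<lambda>y. B * (indicator (cball 0 (r + K)) y * cmod (rep_L2 v y)))"
        by (intro integrable_mult_right integrable_indicator_rep) auto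
      show "AE y in lborel. (\<lambda>n. ((\<psi> (y + X n *\<^sub>R axis j 1) - \<psi> y) /\<^sub>R X n) * rep_L2 v y)
          \<longlonglongrightarrow> pd j \<psi> y * rep_L2 v y"
      proof (intro AE_I2 tendsto_mult tendsto_const)
        fix y
        have "(\<lambda>h. norm (\<psi> (y + (0 + h) *\<^sub>R axis j 1) - \<psi> (y + 0 *\<^sub>R axis j 1) - h *\<^sub>R pd j \<psi> (y + 0 *\<^sub>R axis j 1)) / norm h) \<midarrow>0\<rightarrow> 0"
          using test_function_line_derivative[OF \<psi>, of y j 0]
          unfolding has_vector_derivative_def has_derivative_at by blast
        then have "(\<lambda>n. norm (\<psi> (y + X n *\<^sub>R axis j 1) - \<psi> y - X n *\<^sub>R pd j \<psi> y) / norm (X n)) \<longlonglongrightarrow> 0"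
          using X by (simp add: tendsto_at_iff_sequentially o_def)
        moreover have "norm (\<psi> (y + X n *\<^sub>R axis j 1) - \<psi> y - X n *\<^sub>R pd j \<psi> y) / norm (X n)
            = norm ((\<psi> (y + X n *\<^sub>R axis j 1) - \<psi> y) /\<^sub>R X n - pd j \<psi> y)" for n
        proof -
          have "(\<psi> (y + X n *\<^sub>R axis j 1) - \<psi> y) /\<^sub>R X n - pd j \<psi> y
              = (\<psi> (y + X n *\<^sub>R axis j 1) - \<psi> y - X n *\<^sub>R pd j \<psi> y) /\<^sub>R X n"
            using X(1)[of n] by (simp add: scaleR_diff_right)
          then show ?thesis by (simp add: divide_inverse mult.commute)
        qed
        ultimately show "(\<lambda>n. (\<psi> (y + X n *\<^sub>R axis j 1) - \<psi> y) /\<^sub>R X n) \<longlonglongrightarrow> pd j \<psi> y"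
          by (simp add: tendsto_norm_zero_iff LIM_zero_iff)
      qed
      show "AE y in lborel. norm (((\<psi> (y + X n *\<^sub>R axis j 1) - \<psi> y) /\<^sub>R X n) * rep_L2 v y)
          \<le> B * (indicator (cball 0 (r + K)) y * cmod (rep_L2 v y))" for n
      proof (rule AE_I2)
        fix y
        have "norm ((\<psi> (y + X n *\<^sub>R axis j 1) - \<psi> y) /\<^sub>R X n) \<le> B * indicator (cball 0 (r + K)) y"
        proof (cases "y \<in> cball 0 (r + K)")
          case True
          have "norm ((\<psi> (y + X n *\<^sub>R axis j 1) - \<psi> y) /\<^sub>R X n) \<le> B * \<bar>X n\<bar> / \<bar>X n\<bar>"
            using lip[of y "X n"] by (simp add: divide_inverse mult.commute mult_left_mono)
          then show ?thesis using True X(1)[of n] by simp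
        next
          case False
          have "norm y \<le> norm (y + X n *\<^sub>R axis j 1) + norm (X n *\<^sub>R (axis j 1 :: real^'d))"
            using norm_triangle_ineq4[of "y + X n *\<^sub>R axis j 1" "X n *\<^sub>R axis j 1"] by simp
          then have "r < norm (y + X n *\<^sub>R axis j 1)" using False K(1)[of n] by simp
          moreover have "r < norm y" using False K(2) by simp
          ultimately show ?thesis using r(2) B(1) by simp
        qed
        from mult_right_mono[OF this norm_ge_zero[of "rep_L2 v y"]]
        show "norm (((\<psi> (y + X n *\<^sub>R axis j 1) - \<psi> y) /\<^sub>R X n) * rep_L2 v y)
          \<le> B * (indicator (cball 0 (r + K)) y * cmod (rep_L2 v y))"
          by (simp only: norm_mult mult.assoc)
      qed
    qed measurable
  qed
  show ?thesis
  proof (rule has_vector_derivativeI_lim)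
    have "((\<lambda>h. LINT y|lborel. ((\<psi> (y + h *\<^sub>R axis j 1) - \<psi> y) /\<^sub>R h) * rep_L2 v y)
        \<longlongrightarrow> (LINT y|lborel. pd j \<psi> y * rep_L2 v y)) (at 0)"
      unfolding tendsto_at_iff_sequentially using lim by (auto simp: o_def)
    moreover have "(LINT y|lborel. ((\<psi> (y + h *\<^sub>R axis j 1) - \<psi> y) /\<^sub>R h) * rep_L2 v y)
        = ((LINT y|lborel. \<phi> (y + (s + h) *\<^sub>R axis j 1) * rep_L2 v y)
          - (LINT y|lborel. \<phi> (y + s *\<^sub>R axis j 1) * rep_L2 v y)) /\<^sub>R h" for h
    proof -
      have int: "integrable lborel (\<lambda>y. \<phi> (y + c) * rep_L2 v y)" for c
        by (intro integrable_mult_sq test_function_sq_integrable test_function_translate \<phi> sq_integrable_rep)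
      have "\<psi> (y + h *\<^sub>R axis j 1) = \<phi> (y + (s + h) *\<^sub>R axis j 1)" for y
        unfolding \<psi>_def scaleR_add_left by (simp add: algebra_simps)
      then have "((\<psi> (y + h *\<^sub>R axis j 1) - \<psi> y) /\<^sub>R h) * rep_L2 v y
          = (\<phi> (y + (s + h) *\<^sub>R axis j 1) * rep_L2 v y - \<phi> (y + s *\<^sub>R axis j 1) * rep_L2 v y) /\<^sub>R h" for y
        by (simp add: \<psi>_def left_diff_distrib)
      then show ?thesis by (simp only: integral_scaleR_right Bochner_Integration.integral_diff[OF int int])
    qed
    ultimately show "((\<lambda>h. ((LINT y|lborel. \<phi> (y + (s + h) *\<^sub>R axis j 1) * rep_L2 v y)
          - (LINT y|lborel. \<phi> (y + s *\<^sub>R axis j 1) * rep_L2 v y)) /\<^sub>R h)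
        \<longlongrightarrow> (LINT y|lborel. pd j \<phi> (y + s *\<^sub>R axis j 1) * rep_L2 v y)) (at 0)"
      by (simp only: pd\<psi>)
  qed
qed

text \<open>A single component of a weak gradient. The momentum form is a sum over coordinates, and
  boundedness of one family \<open>mom_quot\<close> yields only the derivative in its own
  direction.\<close>

definition weak_partial :: "'d::finite \<Rightarrow> (real^'d \<Rightarrow> complex) \<Rightarrow> (real^'d \<Rightarrow> complex) \<Rightarrow> bool" where
  "weak_partial j u g \<longleftrightarrow> sq_integrable g \<and>
     (\<forall>\<phi>. test_function \<phi> \<longrightarrow> (LINT y|lborel. u y * pd j \<phi> y) = - (LINT y|lborel. g y * \<phi> y))"

lemma is_weak_gradient_iff: "is_weak_gradient u g \<longleftrightarrow> (\<forall>j. weak_partial j u (\<lambda>y. g y $ j))"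
  by (simp add: is_weak_gradient_def weak_partial_def pd_def)

text \<open>The pairing of \<open>\<phi>\<close> with the orbit of \<open>v\<close> under the one-parameter group, time reversed.\<close>

definition orbit_pairing ::
    "'d::finite \<Rightarrow> real \<Rightarrow> 'd L2 \<Rightarrow> (real^'d \<Rightarrow> complex) \<Rightarrow> real \<Rightarrow> complex" where
  "orbit_pairing j \<alpha> v \<phi> s = cis (\<alpha> * s) * (LINT y|lborel. \<phi> (y + s *\<^sub>R axis j 1) * rep_L2 v y)"

definition orbit_pairing' ::
    "'d::finite \<Rightarrow> real \<Rightarrow> 'd L2 \<Rightarrow> (real^'d \<Rightarrow> complex) \<Rightarrow> real \<Rightarrow> complex" where
  "orbit_pairing' j \<alpha> v \<phi> s = cis (\<alpha> * s) *
     ((LINT y|lborel. pd j \<phi> (y + s *\<^sub>R axis j 1) * rep_L2 v y)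
      + \<i> * of_real \<alpha> * (LINT y|lborel. \<phi> (y + s *\<^sub>R axis j 1) * rep_L2 v y))"

lemma cis_line_derivative: "((\<lambda>s. cis (\<alpha> * s)) has_vector_derivative \<i> * of_real \<alpha> * cis (\<alpha> * s)) (at s)"
proof -
  have "((\<lambda>z. exp (\<i> * of_real \<alpha> * z)) has_field_derivative \<i> * of_real \<alpha> * exp (\<i> * of_real \<alpha> * of_real s)) (at (of_real s))"
    by (auto intro!: derivative_eq_intros)
  from has_vector_derivative_real_field[OF this]
  have "((\<lambda>s. exp (\<i> * of_real \<alpha> * of_real s)) has_vector_derivative \<i> * of_real \<alpha> * exp (\<i> * of_real \<alpha> * of_real s)) (at s)" .
  then show ?thesis by (simp add: cis_conv_exp mult.assoc)
qed

lemma orbit_pairing_derivative: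
  assumes "test_function \<phi>"
  shows "(orbit_pairing j \<alpha> v \<phi> has_vector_derivative orbit_pairing' j \<alpha> v \<phi> s) (at s)"
  using has_vector_derivative_mult[OF cis_line_derivative[of \<alpha> s] pairing_line_derivative[OF assms, of j v s]]
  unfolding orbit_pairing_def[abs_def] orbit_pairing'_def by (simp add: algebra_simps)

text \<open>Moving the translation onto the smooth \<phi> reverses time and gives a difference
  quotient of a differentiable function of one real variable, although \<open>v\<close> itself may
  have no derivative.\<close>

lemma pairing_mom_quot:
  fixes v :: "'d::finite L2"
  assumes \<phi>: "test_function \<phi>"
  shows "(LINT y|lborel. \<phi> y * rep_L2 (mom_quot n j \<alpha> v) y)
    = (orbit_pairing j \<alpha> v \<phi> (- ((1 / 2) ^ n)) - orbit_pairing j \<alpha> v \<phi> 0) /\<^sub>R (1 / 2) ^ n"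
proof -
  let ?c = "cinner (abs_L2 (\<lambda>y. cnj (\<phi> y)))"
  have pc: "?c w = (LINT y|lborel. \<phi> y * rep_L2 w y)" for w
    by (rule pairing_eq_cinner[OF test_function_sq_integrable[OF \<phi>], symmetric])
  have [measurable]: "\<phi> \<in> borel_measurable borel"
    by (intro borel_measurable_continuous_onI test_function_continuous \<phi>)
  have sh: "?c (shift c v) = (LINT y|lborel. \<phi> (y - c) * rep_L2 v y)" for c
    unfolding pc by (rule pairing_shift) measurable
  have "?c (mom_quot n j \<alpha> v) = 2 ^ n *\<^sub>R (cis (- (\<alpha> / 2 ^ n)) * ?c (shift ((1 / 2 ^ n) *\<^sub>R axis j 1) v) - ?c v)"
    unfolding mom_quot_def cinner.scaleR_right cinner.diff_right cinner_scaleC_right ..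
  also have "\<dots> = (orbit_pairing j \<alpha> v \<phi> (- ((1 / 2) ^ n)) - orbit_pairing j \<alpha> v \<phi> 0) /\<^sub>R (1 / 2) ^ n"
    unfolding sh pc[of v] by (simp add: orbit_pairing_def power_one_over inverse_eq_divide)
  finally show ?thesis unfolding pc .
qed

lemma pairing_mom_quot_tendsto:
  assumes \<phi>: "test_function \<phi>"
  shows "(\<lambda>n. LINT y|lborel. \<phi> y * rep_L2 (mom_quot n j \<alpha> v) y) \<longlonglongrightarrow> - orbit_pairing' j \<alpha> v \<phi> 0"
proof -
  let ?F = "orbit_pairing j \<alpha> v \<phi>" and ?D = "orbit_pairing' j \<alpha> v \<phi> 0"
  have "(\<lambda>h. norm (?F (0 + h) - ?F 0 - h *\<^sub>R ?D) / norm h) \<midarrow>0\<rightarrow> 0"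
    using orbit_pairing_derivative[OF \<phi>, of j \<alpha> v 0]
    unfolding has_vector_derivative_def has_derivative_at by blast
  moreover have "filterlim (\<lambda>n. - ((1 / 2) ^ n) :: real) (at 0) sequentially"
    unfolding filterlim_at using tendsto_minus[OF LIMSEQ_power_zero[of "1/2 :: real"]] by auto
  ultimately have "(\<lambda>n. norm (?F (0 + - ((1 / 2) ^ n)) - ?F 0 - (- ((1 / 2) ^ n)) *\<^sub>R ?D) / norm (- ((1 / 2) ^ n) :: real)) \<longlonglongrightarrow> 0"
    by (rule filterlim_compose)
  moreover have "norm (?F (0 + - ((1 / 2) ^ n)) - ?F 0 - (- ((1 / 2) ^ n)) *\<^sub>R ?D) / norm (- ((1 / 2) ^ n) :: real)
      = norm ((LINT y|lborel. \<phi> y * rep_L2 (mom_quot n j \<alpha> v) y) - (- ?D))" for n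
  proof -
    have "(LINT y|lborel. \<phi> y * rep_L2 (mom_quot n j \<alpha> v) y) - (- ?D)
        = (?F (0 + - ((1 / 2) ^ n)) - ?F 0 - (- ((1 / 2) ^ n)) *\<^sub>R ?D) /\<^sub>R (1 / 2) ^ n"
      unfolding pairing_mom_quot[OF \<phi>] by (simp add: scaleR_diff_right scaleR_add_right)
    then show ?thesis by (simp only: norm_divideR norm_minus_cancel)
  qed
  ultimately have "(\<lambda>n. norm ((LINT y|lborel. \<phi> y * rep_L2 (mom_quot n j \<alpha> v) y) - (- ?D))) \<longlonglongrightarrow> 0"
    by (simp only:)
  then show ?thesis unfolding tendsto_norm_zero_iff LIM_zero_iff .
qed

text \<open>The defining property of \<open>g\<close>, applied to the translated test function,
  moves the derivative from \<phi> to \<open>v\<close>. Up to a phase the derivative of the orbit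
  pairing is thus a pairing with the fixed vector \<open>g - i \<alpha> v\<close>.\<close>

lemma orbit_pairing'_weak_partial:
  assumes \<phi>: "test_function \<phi>" and g: "weak_partial j (rep_L2 v) g"
  shows "orbit_pairing' j \<alpha> v \<phi> s = - cis (\<alpha> * s) *
    (LINT y|lborel. \<phi> (y + s *\<^sub>R axis j 1) * (g y - \<i> * of_real \<alpha> * rep_L2 v y))"
proof -
  let ?\<psi> = "\<lambda>y. \<phi> (y + s *\<^sub>R axis j 1)"
  have \<psi>: "test_function ?\<psi>" by (rule test_function_translate[OF \<phi>])
  have i1: "integrable lborel (\<lambda>y. ?\<psi> y * rep_L2 v y)" and i2: "integrable lborel (\<lambda>y. ?\<psi> y * g y)"
    using g by (auto intro!: integrable_mult_sq test_function_sq_integrable \<psi> sq_integrable_rep simp: weak_partial_def)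
  have e1: "(LINT y|lborel. pd j \<phi> (y + s *\<^sub>R axis j 1) * rep_L2 v y) = - (LINT y|lborel. ?\<psi> y * g y)"
    using conjunct2[OF g[unfolded weak_partial_def], rule_format, OF \<psi>]
    unfolding pd_translate[OF \<phi>] by (simp only: mult.commute)
  have e2: "(LINT y|lborel. ?\<psi> y * (g y - \<i> * of_real \<alpha> * rep_L2 v y))
      = (LINT y|lborel. ?\<psi> y * g y) - \<i> * of_real \<alpha> * (LINT y|lborel. ?\<psi> y * rep_L2 v y)"
  proof -
    have "?\<psi> y * (g y - \<i> * of_real \<alpha> * rep_L2 v y) = ?\<psi> y * g y - \<i> * of_real \<alpha> * (?\<psi> y * rep_L2 v y)" for y
      by (simp add: algebra_simps)
    then show ?thesis
      by (simp only: Bochner_Integration.integral_diff[OF i2 integrable_mult_right[OF i1]] integral_mult_right_zero)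
  qed
  show ?thesis unfolding orbit_pairing'_def e1 e2 by (simp add: algebra_simps)
qed

text \<open>With \<open>w = g - i \<alpha> v\<close> there are two halves. The mean value inequality
  for the orbit pairing bounds every quotient by the norm of \<open>w\<close>; and since the
  quotients converge to \<open>w\<close> against test functions, the norm of \<open>w\<close> is at
  most any common bound. No Fourier transform is involved.\<close>

lemma SUP_mom_quot_weak_partial:
  fixes v :: "'d::finite L2"
  assumes g: "weak_partial j (rep_L2 v) g"
  shows "(SUP n. ennreal ((norm (mom_quot n j \<alpha> v))\<^sup>2))
    = (\<integral>\<^sup>+y. ennreal ((cmod (g y - \<i> * of_real \<alpha> * rep_L2 v y))\<^sup>2) \<partial>lborel)"
proof -
  let ?d = "\<lambda>y. g y - \<i> * of_real \<alpha> * rep_L2 v y"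
  have d: "sq_integrable ?d"
    using g by (intro sq_integrable_diff sq_integrable_mult sq_integrable_rep) (simp add: weak_partial_def)
  define w where "w = abs_L2 ?d"
  have rep_w: "(LINT y|lborel. f y * ?d y) = (LINT y|lborel. f y * rep_L2 w y)"
    if [measurable]: "f \<in> borel_measurable borel" for f
  proof (rule integral_cong_AE)
    have [measurable]: "?d \<in> borel_measurable borel" using d by (simp add: sq_integrable_def)
    show "(\<lambda>y. f y * ?d y) \<in> borel_measurable lborel" by measurable
    show "(\<lambda>y. f y * rep_L2 w y) \<in> borel_measurable lborel" by measurable
    show "AE y in lborel. f y * ?d y = f y * rep_L2 w y"
      using rep_abs_L2[OF d] unfolding w_def by eventually_elim simp
  qed
  have meas: "\<phi> \<in> borel_measurable borel" if "test_function \<phi>" for \<phi> :: "real^'d \<Rightarrow> complex"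
    by (intro borel_measurable_continuous_onI test_function_continuous that)
  have upper: "norm (mom_quot n j \<alpha> v) \<le> norm w" for n
  proof (rule norm_le_if_test_pairings_le)
    fix \<phi> :: "real^'d \<Rightarrow> complex" assume \<phi>: "test_function \<phi>"
    have "cmod (orbit_pairing' j \<alpha> v \<phi> s) \<le> norm w * norm (abs_L2 \<phi>)" for s
    proof -
      let ?\<psi> = "\<lambda>y. \<phi> (y + s *\<^sub>R axis j 1)"
      have \<psi>: "test_function ?\<psi>" by (rule test_function_translate[OF \<phi>])
      have "cmod (orbit_pairing' j \<alpha> v \<phi> s) = cmod (LINT y|lborel. ?\<psi> y * rep_L2 w y)"
        unfolding orbit_pairing'_weak_partial[OF \<phi> g] rep_w[OF meas[OF \<psi>]] by (simp add: norm_mult)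
      also have "\<dots> \<le> norm (abs_L2 ?\<psi>) * norm w"
        by (rule pairing_le[OF test_function_sq_integrable[OF \<psi>]])
      \<comment> \<open>Translation preserves the norm of the test function, so the bound on the
        derivative is uniform along the orbit.\<close>
      also have "abs_L2 ?\<psi> = shift (s *\<^sub>R axis j 1) (abs_L2 \<phi>)"
        unfolding shift_def
        by (subst abs_L2_eq_iff)
           (use AE_translate[OF rep_abs_L2[OF test_function_sq_integrable[OF \<phi>]], of "s *\<^sub>R axis j 1"] in
             \<open>auto intro: sq_integrable_translate sq_integrable_rep test_function_sq_integrable \<psi>\<close>)
      finally show ?thesis by (simp add: norm_shift mult.commute)
    qed
    from vector_derivative_norm_bound[OF orbit_pairing_derivative[OF \<phi>] this, of "- ((1 / 2) ^ n)" 0]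
    have "cmod (orbit_pairing j \<alpha> v \<phi> (- ((1 / 2) ^ n)) - orbit_pairing j \<alpha> v \<phi> 0) \<le> norm w * norm (abs_L2 \<phi>) * (1 / 2) ^ n"
      by simp
    then have "cmod (orbit_pairing j \<alpha> v \<phi> (- ((1 / 2) ^ n)) - orbit_pairing j \<alpha> v \<phi> 0) / (1 / 2) ^ n \<le> norm w * norm (abs_L2 \<phi>)"
      by (subst pos_divide_le_eq) auto
    then show "cmod (LINT y|lborel. \<phi> y * rep_L2 (mom_quot n j \<alpha> v) y) \<le> norm w * norm (abs_L2 \<phi>)"
      unfolding pairing_mom_quot[OF \<phi>] by (simp only: norm_scaleR norm_inverse divide_inverse) (simp add: mult.commute)
  qed simp
  have lower: "norm w \<le> S" if S: "\<And>n. norm (mom_quot n j \<alpha> v) \<le> S" for S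
  proof (rule norm_le_if_test_pairings_le)
    fix \<phi> :: "real^'d \<Rightarrow> complex" assume \<phi>: "test_function \<phi>"
    have "orbit_pairing' j \<alpha> v \<phi> 0 = - (LINT y|lborel. \<phi> y * rep_L2 w y)"
      using orbit_pairing'_weak_partial[OF \<phi> g, of \<alpha> 0] rep_w[OF meas[OF \<phi>]] by simp
    then have "(\<lambda>n. cmod (LINT y|lborel. \<phi> y * rep_L2 (mom_quot n j \<alpha> v) y)) \<longlonglongrightarrow> cmod (LINT y|lborel. \<phi> y * rep_L2 w y)"
      using tendsto_norm[OF pairing_mom_quot_tendsto[OF \<phi>, of j \<alpha> v]] by simp
    moreover have "cmod (LINT y|lborel. \<phi> y * rep_L2 (mom_quot n j \<alpha> v) y) \<le> S * norm (abs_L2 \<phi>)" for n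
      using order_trans[OF pairing_le[OF test_function_sq_integrable[OF \<phi>]] mult_left_mono[OF S[of n] norm_ge_zero]]
      by (simp add: mult.commute)
    ultimately show "cmod (LINT y|lborel. \<phi> y * rep_L2 w y) \<le> S * norm (abs_L2 \<phi>)"
      by (intro LIMSEQ_le_const2) auto
  qed (use order_trans[OF norm_ge_zero S] in blast)
  have "(SUP n. ennreal ((norm (mom_quot n j \<alpha> v))\<^sup>2)) = ennreal ((norm w)\<^sup>2)"
  proof (rule antisym)
    show "(SUP n. ennreal ((norm (mom_quot n j \<alpha> v))\<^sup>2)) \<le> ennreal ((norm w)\<^sup>2)"
      by (intro SUP_least ennreal_leI power_mono upper) auto
    have bdd: "bdd_above (range (\<lambda>n. norm (mom_quot n j \<alpha> v)))"
      using upper by (intro bdd_aboveI[of _ "norm w"]) auto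
    define S where "S = (SUP n. norm (mom_quot n j \<alpha> v))"
    have "norm w \<le> S" unfolding S_def by (rule lower) (rule cSUP_upper[OF UNIV_I bdd])
    moreover have "(\<lambda>n. norm (mom_quot n j \<alpha> v)) \<longlonglongrightarrow> S"
      unfolding S_def by (rule LIMSEQ_incseq_SUP[OF bdd incseq_norm_mom_quot])
    then have "(\<lambda>n. ennreal ((norm (mom_quot n j \<alpha> v))\<^sup>2)) \<longlonglongrightarrow> ennreal (S\<^sup>2)"
      by (intro tendsto_ennrealI tendsto_intros)
    then have "ennreal (S\<^sup>2) \<le> (SUP n. ennreal ((norm (mom_quot n j \<alpha> v))\<^sup>2))"
      by (rule LIMSEQ_le_const2) (intro exI[of _ 0] allI impI SUP_upper UNIV_I)
    ultimately show "ennreal ((norm w)\<^sup>2) \<le> (SUP n. ennreal ((norm (mom_quot n j \<alpha> v))\<^sup>2))"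
      using order_trans[OF ennreal_leI[OF power_mono[of "norm w" S 2]]] by simp
  qed
  then show ?thesis unfolding w_def norm_abs_sq_nn[OF d] .
qed

text \<open>A weak limit \<open>l\<close> of a subsequence of quotients plays the role of
  \<open>g - i \<alpha> v\<close>. Undoing the centring, \<open>l + i \<alpha> v\<close> is the weak
  derivative.\<close>

lemma ex_weak_partial_if_mom_quot_bounded:
  fixes v :: "'d::finite L2"
  assumes S: "\<And>n. norm (mom_quot n j \<alpha> v) \<le> S"
  shows "\<exists>g. weak_partial j (rep_L2 v) g"
proof -
  obtain r l where r: "strict_mono r" and l: "\<And>x. (\<lambda>n. cinner x (mom_quot (r n) j \<alpha> v)) \<longlonglongrightarrow> cinner x l"
    using bounded_imp_weakly_convergent_subseq[of "\<lambda>n. mom_quot n j \<alpha> v", OF S] by blast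
  let ?g = "\<lambda>y. rep_L2 l y + \<i> * of_real \<alpha> * rep_L2 v y"
  have "(LINT y|lborel. rep_L2 v y * pd j \<phi> y) = - (LINT y|lborel. ?g y * \<phi> y)"
    if \<phi>: "test_function \<phi>" for \<phi>
  proof -
    have sq: "sq_integrable \<phi>" by (rule test_function_sq_integrable[OF \<phi>])
    have "(\<lambda>n. LINT y|lborel. \<phi> y * rep_L2 (mom_quot (r n) j \<alpha> v) y) \<longlonglongrightarrow> (LINT y|lborel. \<phi> y * rep_L2 l y)"
      unfolding pairing_eq_cinner[OF sq] by (rule l)
    moreover have "(\<lambda>n. LINT y|lborel. \<phi> y * rep_L2 (mom_quot (r n) j \<alpha> v) y) \<longlonglongrightarrow> - orbit_pairing' j \<alpha> v \<phi> 0"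
      using LIMSEQ_subseq_LIMSEQ[OF pairing_mom_quot_tendsto[OF \<phi>] r] by (simp add: o_def)
    ultimately have eq: "(LINT y|lborel. \<phi> y * rep_L2 l y) = - orbit_pairing' j \<alpha> v \<phi> 0"
      by (rule LIMSEQ_unique)
    have i: "integrable lborel (\<lambda>y. \<phi> y * rep_L2 w y)" for w
      by (intro integrable_mult_sq sq sq_integrable_rep)
    have "(LINT y|lborel. ?g y * \<phi> y) = (LINT y|lborel. \<phi> y * rep_L2 l y) + \<i> * of_real \<alpha> * (LINT y|lborel. \<phi> y * rep_L2 v y)"
    proof -
      have "?g y * \<phi> y = \<phi> y * rep_L2 l y + \<i> * of_real \<alpha> * (\<phi> y * rep_L2 v y)" for y
        by (simp add: algebra_simps)
      then show ?thesis
        by (simp only: Bochner_Integration.integral_add[OF i integrable_mult_right[OF i]] integral_mult_right_zero)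
    qed
    then show ?thesis unfolding eq by (simp add: orbit_pairing'_def mult.commute)
  qed
  moreover have "sq_integrable ?g"
    by (intro sq_integrable_add sq_integrable_mult sq_integrable_rep)
  ultimately show ?thesis unfolding weak_partial_def by blast
qed

section \<open>The cost as a supremum of countable sums of bounded forms\<close>

text \<open>The flag selects position or momentum in direction \<open>i\<close>. The momentum centre
  is \<open>\<xi> / hbar\<close> because
  \<open>\<xi> + i hbar D = i hbar (D - i \<xi> / hbar)\<close>, which also explains the weight
  \<open>hbar\<^sup>2\<close>.\<close>

definition quot :: "real \<Rightarrow> nat \<Rightarrow> 'd \<times> bool \<Rightarrow> 'd phase_space \<Rightarrow> 'd::finite L2 \<Rightarrow> 'd L2" where
  "quot hbar n = (\<lambda>(i, b) z v. if b then pos_quot n i (fst z $ i) v else mom_quot n i (snd z $ i / hbar) v)"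

definition weight :: "real \<Rightarrow> real \<Rightarrow> 'd \<times> bool \<Rightarrow> ennreal" where
  "weight lam hbar p = (if snd p then ennreal lam else ennreal (hbar\<^sup>2))"

lemma quot_mono: "m \<le> n \<Longrightarrow> ennreal ((norm (quot hbar m p z v))\<^sup>2) \<le> ennreal ((norm (quot hbar n p z v))\<^sup>2)"
proof (cases p)
  case (Pair i b)
  assume "m \<le> n"
  then show ?thesis
    using pos_quot_mono[of m n i "fst z $ i" v] incseq_norm_mom_quot[of i "snd z $ i / hbar" v]
    by (cases b) (auto simp: Pair quot_def incseq_def intro!: ennreal_leI power_mono)
qed

lemma SUP_sum_ennreal:
  fixes f :: "'i \<Rightarrow> nat \<Rightarrow> ennreal"
  assumes "\<And>i. i \<in> I \<Longrightarrow> incseq (f i)"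
  shows "(SUP n. \<Sum>i\<in>I. f i n) = (\<Sum>i\<in>I. SUP n. f i n)"
proof -
  have "(\<lambda>n. \<Sum>i\<in>I. f i n) \<longlonglongrightarrow> (\<Sum>i\<in>I. SUP n. f i n)"
    by (intro tendsto_sum LIMSEQ_SUP assms)
  moreover have "(\<lambda>n. \<Sum>i\<in>I. f i n) \<longlonglongrightarrow> (SUP n. \<Sum>i\<in>I. f i n)"
    by (intro LIMSEQ_SUP) (use assms in \<open>auto simp: incseq_def intro!: sum_mono\<close>)
  ultimately show ?thesis by (rule LIMSEQ_unique[rotated])
qed

lemma SUP_weighted_quot:
  fixes v :: "'d::finite L2"
  shows "(SUP n. \<Sum>p\<in>UNIV. weight lam hbar p * ennreal ((norm (quot hbar n p z v))\<^sup>2))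
    = ennreal lam * (\<Sum>i\<in>UNIV. SUP n. ennreal ((norm (pos_quot n i (fst z $ i) v))\<^sup>2))
      + ennreal (hbar\<^sup>2) * (\<Sum>i\<in>UNIV. SUP n. ennreal ((norm (mom_quot n i (snd z $ i / hbar) v))\<^sup>2))"
proof -
  have "(SUP n. \<Sum>p\<in>UNIV. weight lam hbar p * ennreal ((norm (quot hbar n p z v))\<^sup>2))
      = (\<Sum>p\<in>(UNIV :: ('d \<times> bool) set). weight lam hbar p * (SUP n. ennreal ((norm (quot hbar n p z v))\<^sup>2)))"
    by (subst SUP_sum_ennreal)
       (auto simp: incseq_def SUP_mult_left_ennreal intro!: mult_left_mono quot_mono)
  also have "\<dots> = (\<Sum>i\<in>(UNIV :: 'd set). \<Sum>b\<in>(UNIV :: bool set).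
      weight lam hbar (i, b) * (SUP n. ennreal ((norm (quot hbar n (i, b) z v))\<^sup>2)))"
    by (simp add: sum.cartesian_product flip: UNIV_Times_UNIV)
  also have "\<dots> = (\<Sum>i\<in>UNIV. ennreal lam * (SUP n. ennreal ((norm (pos_quot n i (fst z $ i) v))\<^sup>2))
      + ennreal (hbar\<^sup>2) * (SUP n. ennreal ((norm (mom_quot n i (snd z $ i / hbar) v))\<^sup>2)))"
    by (simp add: UNIV_bool weight_def quot_def add.commute)
  finally show ?thesis by (simp add: sum.distrib sum_distrib_left)
qed

lemma nn_integral_position:
  "(\<integral>\<^sup>+y. ennreal ((norm (x - y))\<^sup>2 * (cmod (rep_L2 v y))\<^sup>2) \<partial>lborel)
    = (\<Sum>i\<in>UNIV. \<integral>\<^sup>+y. ennreal ((y $ i - x $ i)\<^sup>2 * (cmod (rep_L2 v y))\<^sup>2) \<partial>lborel)"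
proof -
  have "ennreal ((norm (x - y))\<^sup>2 * (cmod (rep_L2 v y))\<^sup>2)
      = (\<Sum>i\<in>UNIV. ennreal ((y $ i - x $ i)\<^sup>2 * (cmod (rep_L2 v y))\<^sup>2))" for y
  proof -
    have "(norm (x - y))\<^sup>2 = (\<Sum>i\<in>UNIV. (y $ i - x $ i)\<^sup>2)"
      by (simp add: norm_vec_def L2_set_def sum_nonneg power2_commute)
    then show ?thesis by (simp add: sum_distrib_right)
  qed
  note eq = this
  show ?thesis unfolding eq by (rule nn_integral_sum) measurable
qed

lemma nn_integral_momentum:
  assumes hbar: "0 < hbar" and g: "is_weak_gradient (rep_L2 v) g"
  shows "(\<integral>\<^sup>+y. ennreal ((norm (\<chi> j. of_real (\<xi> $ j) * rep_L2 v y + \<i> * of_real hbar * (g y $ j)))\<^sup>2) \<partial>lborel)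
    = ennreal (hbar\<^sup>2) * (\<Sum>j\<in>UNIV. \<integral>\<^sup>+y. ennreal ((cmod (g y $ j - \<i> * of_real (\<xi> $ j / hbar) * rep_L2 v y))\<^sup>2) \<partial>lborel)"
proof -
  have [measurable]: "(\<lambda>y. g y $ j) \<in> borel_measurable borel" for j
    using g by (simp add: is_weak_gradient_def sq_integrable_def)
  have "ennreal ((norm (\<chi> j. of_real (\<xi> $ j) * rep_L2 v y + \<i> * of_real hbar * (g y $ j)))\<^sup>2)
      = (\<Sum>j\<in>UNIV. ennreal (hbar\<^sup>2) * ennreal ((cmod (g y $ j - \<i> * of_real (\<xi> $ j / hbar) * rep_L2 v y))\<^sup>2))" for y
  proof -
    have "of_real (\<xi> $ j) * rep_L2 v y + \<i> * of_real hbar * (g y $ j)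
        = \<i> * of_real hbar * (g y $ j - \<i> * of_real (\<xi> $ j / hbar) * rep_L2 v y)" for j
      using hbar by (simp add: right_diff_distrib)
    then have "(norm (\<chi> j. of_real (\<xi> $ j) * rep_L2 v y + \<i> * of_real hbar * (g y $ j)))\<^sup>2
        = (\<Sum>j\<in>UNIV. hbar\<^sup>2 * (cmod (g y $ j - \<i> * of_real (\<xi> $ j / hbar) * rep_L2 v y))\<^sup>2)"
      by (simp add: norm_vec_def L2_set_def sum_nonneg norm_mult power_mult_distrib)
    then show ?thesis by (simp add: ennreal_mult[symmetric])
  qed
  then show ?thesis by (simp add: nn_integral_sum nn_integral_cmult sum_distrib_left)
qed

text \<open>With a weak gradient this is the sum of the coordinatewise identities. Without one, some
  single direction has no weak derivative, its quotients are unbounded, and both sides are infinite;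
  in particular the arbitrary choice of gradient disappears.\<close>

lemma cost_form_eq_SUP:
  fixes v :: "'d::finite L2"
  assumes hbar: "0 < hbar"
  shows "cost_form lam hbar z v = (SUP n. \<Sum>p\<in>UNIV. weight lam hbar p * ennreal ((norm (quot hbar n p z v))\<^sup>2))"
proof -
  obtain x \<xi> where z: "z = (x, \<xi>)" by (cases z)
  show ?thesis
  proof (cases "\<exists>g. is_weak_gradient (rep_L2 v) g")
    case True
    define g where "g = (SOME g. is_weak_gradient (rep_L2 v) g)"
    have g: "is_weak_gradient (rep_L2 v) g" unfolding g_def by (rule someI_ex[OF True])
    have mom: "(SUP n. ennreal ((norm (mom_quot n j (\<xi> $ j / hbar) v))\<^sup>2))
        = (\<integral>\<^sup>+y. ennreal ((cmod (g y $ j - \<i> * of_real (\<xi> $ j / hbar) * rep_L2 v y))\<^sup>2) \<partial>lborel)" for j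
      using g by (intro SUP_mom_quot_weak_partial) (simp add: is_weak_gradient_iff)
    show ?thesis
      unfolding SUP_weighted_quot SUP_pos_quot z fst_conv snd_conv mom
        nn_integral_position[symmetric] nn_integral_momentum[OF hbar g, symmetric]
      using True by (simp add: cost_form_def Let_def flip: g_def)
  next
    case False
    have "\<exists>j. \<nexists>g. weak_partial j (rep_L2 v) g"
    proof (rule ccontr)
      assume "\<not> ?thesis"
      then have "\<forall>j. \<exists>g. weak_partial j (rep_L2 v) g" by blast
      then obtain G where "\<And>j. weak_partial j (rep_L2 v) (G j)" by metis
      then have "is_weak_gradient (rep_L2 v) (\<lambda>y. \<chi> j. G j y)" by (simp add: is_weak_gradient_iff)
      with False show False by blast
    qed
    then obtain j where j: "\<nexists>g. weak_partial j (rep_L2 v) g" by blast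
    have "(SUP n. ennreal ((norm (mom_quot n j (\<xi> $ j / hbar) v))\<^sup>2)) = \<top>"
    proof (rule ccontr)
      assume "\<not> ?thesis"
      then obtain S where S: "0 \<le> S" "(SUP n. ennreal ((norm (mom_quot n j (\<xi> $ j / hbar) v))\<^sup>2)) = ennreal S"
        by (cases "SUP n. ennreal ((norm (mom_quot n j (\<xi> $ j / hbar) v))\<^sup>2)") auto
      have "norm (mom_quot n j (\<xi> $ j / hbar) v) \<le> sqrt S" for n
      proof (rule real_le_rsqrt)
        have "ennreal ((norm (mom_quot n j (\<xi> $ j / hbar) v))\<^sup>2) \<le> ennreal S"
          unfolding S(2)[symmetric] by (rule SUP_upper[OF UNIV_I])
        then show "(norm (mom_quot n j (\<xi> $ j / hbar) v))\<^sup>2 \<le> S" using S(1) by (simp only: ennreal_le_iff)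
      qed
      from ex_weak_partial_if_mom_quot_bounded[OF this] j show False by blast
    qed
    moreover have "(SUP n. ennreal ((norm (mom_quot n j (\<xi> $ j / hbar) v))\<^sup>2))
        \<le> (\<Sum>i\<in>UNIV. SUP n. ennreal ((norm (mom_quot n i (\<xi> $ i / hbar) v))\<^sup>2))"
      by (rule member_le_sum) auto
    ultimately have top: "(\<Sum>i\<in>UNIV. SUP n. ennreal ((norm (mom_quot n i (\<xi> $ i / hbar) v))\<^sup>2)) = \<top>"
      by (simp only: top_unique)
    have "cost_form lam hbar z v = \<top>"
      unfolding cost_form_def z split_conv Let_def by (rule if_not_P[OF False])
    moreover have "ennreal (hbar\<^sup>2) * \<top> = \<top>" using hbar by (simp add: ennreal_mult_top)
    ultimately show ?thesis unfolding SUP_weighted_quot z fst_conv snd_conv top by simp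
  qed
qed

text \<open>The adjoint of \<open>quot\<close> applied to \<open>bas k\<close>, hence the reversed
  phase and the reversed modulation or translation. It moves all dependence on the state into a
  coefficient of \<open>v\<close> against a known vector.\<close>

definition testvec :: "real \<Rightarrow> nat \<Rightarrow> 'd \<times> bool \<Rightarrow> nat \<Rightarrow> 'd phase_space \<Rightarrow> 'd::finite L2" where
  "testvec hbar n = (\<lambda>(i, b) k z. 2 ^ n *\<^sub>R
     (scaleC (cis ((if b then fst z $ i else snd z $ i / hbar) / 2 ^ n))
        (if b then modu (- (1 / 2 ^ n)) i (bas k) else shift (- ((1 / 2 ^ n) *\<^sub>R axis i 1)) (bas k))
      - bas k))"

lemma cinner_bas_quot: "cinner (bas k) (quot hbar n p z v) = cinner (testvec hbar n p k z) v"
  by (cases p)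
     (simp add: quot_def testvec_def pos_quot_def mom_quot_def cinner.scaleR_left cinner.scaleR_right
       cinner.diff_left cinner.diff_right cinner_scaleC_left cinner_scaleC_right cinner_modu_right
       cinner_shift_right cis_cnj)

lemma quot_norm_eq: "ennreal ((norm (quot hbar n p z v))\<^sup>2) = (\<Sum>k. ennreal ((cmod (cinner (testvec hbar n p k z) v))\<^sup>2))"
  unfolding Parseval_norm_ennreal[symmetric] cinner_bas_quot ..

text \<open>Squared coefficients of a vector are diagonal entries of its rank-one operator. In this
  form the bounded cost depends linearly on the operator, so it can be added over decompositions and
  integrated.\<close>

definition opcost_step :: "real \<Rightarrow> real \<Rightarrow> nat \<Rightarrow> 'd phase_space \<Rightarrow> 'd::finite operator \<Rightarrow> ennreal" where
  "opcost_step lam hbar n z Q = (\<Sum>p\<in>UNIV. weight lam hbar p *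
     (\<Sum>k. ennreal (Re (cinner (testvec hbar n p k z) (blinfun_apply Q (testvec hbar n p k z))))))"

definition opcost :: "real \<Rightarrow> real \<Rightarrow> 'd phase_space \<Rightarrow> 'd::finite operator \<Rightarrow> ennreal" where
  "opcost lam hbar z Q = (SUP n. opcost_step lam hbar n z Q)"

lemma opcost_step_decomposes:
  fixes Q :: "'d::finite operator"
  assumes "decomposes \<phi> Q"
  shows "opcost_step lam hbar n z Q
    = (\<Sum>m. \<Sum>p\<in>UNIV. weight lam hbar p * ennreal ((norm (quot hbar n p z (\<phi> m)))\<^sup>2))"
proof -
  have "(\<Sum>k. ennreal (Re (cinner (testvec hbar n p k z) (blinfun_apply Q (testvec hbar n p k z)))))
      = (\<Sum>m. ennreal ((norm (quot hbar n p z (\<phi> m)))\<^sup>2))" for p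
  proof -
    have "(\<Sum>k. ennreal (Re (cinner (testvec hbar n p k z) (blinfun_apply Q (testvec hbar n p k z)))))
        = (\<Sum>k. \<Sum>m. ennreal ((cmod (cinner (testvec hbar n p k z) (\<phi> m)))\<^sup>2))"
      by (intro suminf_cong suminf_ennreal_eq[symmetric] decomposes_form_Re assms) auto
    also have "\<dots> = (\<Sum>m. ennreal ((norm (quot hbar n p z (\<phi> m)))\<^sup>2))"
      unfolding quot_norm_eq by (rule suminf_swap_ennreal)
    finally show ?thesis .
  qed
  note eq = this
  have "(\<Sum>m. \<Sum>p\<in>UNIV. weight lam hbar p * ennreal ((norm (quot hbar n p z (\<phi> m)))\<^sup>2))
      = (\<Sum>p\<in>UNIV. \<Sum>m. weight lam hbar p * ennreal ((norm (quot hbar n p z (\<phi> m)))\<^sup>2))"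
    by (rule suminf_sum) (rule summableI)
  then show ?thesis unfolding opcost_step_def eq ennreal_suminf_cmult by (rule sym)
qed

lemma incseq_opcost_step:
  assumes "decomposes \<phi> Q" shows "incseq (\<lambda>n. opcost_step lam hbar n z Q)"
  unfolding opcost_step_decomposes[OF assms]
  by (intro incseq_SucI suminf_le sum_mono mult_left_mono quot_mono) auto

text \<open>The right-hand side does not contain \<phi>, so the spectral and the Cholesky
  decompositions have the same total cost. The supremum is exchanged with the series by monotone
  convergence for counting measure.\<close>

lemma suminf_cost_form:
  fixes Q :: "'d::finite operator"
  assumes hbar: "0 < hbar" and dec: "decomposes \<phi> Q"
  shows "(\<Sum>m. cost_form lam hbar z (\<phi> m)) = opcost lam hbar z Q"
proof -
  let ?f = "\<lambda>n m. \<Sum>p\<in>UNIV. weight lam hbar p * ennreal ((norm (quot hbar n p z (\<phi> m)))\<^sup>2)"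
  have "(\<Sum>m. cost_form lam hbar z (\<phi> m)) = (\<integral>\<^sup>+m. (SUP n. ?f n m) \<partial>count_space UNIV)"
    unfolding cost_form_eq_SUP[OF hbar] by (rule nn_integral_count_space_nat[symmetric])
  also have "\<dots> = (SUP n. \<integral>\<^sup>+m. ?f n m \<partial>count_space UNIV)"
    by (rule nn_integral_monotone_convergence_SUP)
       (auto simp: incseq_def le_fun_def intro!: sum_mono mult_left_mono quot_mono)
  also have "\<dots> = opcost lam hbar z Q"
    unfolding opcost_def opcost_step_decomposes[OF dec] nn_integral_count_space_nat ..
  finally show ?thesis .
qed

lemma quot_scaleC: "quot hbar n p z (scaleC c v) = scaleC c (quot hbar n p z v)"
proof -
  have "cinner x (quot hbar n p z (scaleC c v)) = cinner x (scaleC c (quot hbar n p z v))" for x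
    by (cases p)
     (simp add: quot_def pos_quot_def mom_quot_def cinner.scaleR_right cinner.diff_right
       cinner_scaleC_right cinner_modu_right cinner_shift_right right_diff_distrib mult.left_commute)
  then show ?thesis by (rule L2_eqI)
qed

lemma cost_form_scaleC:
  fixes v :: "'d::finite L2"
  assumes hbar: "0 < hbar"
  shows "cost_form lam hbar z (scaleC c v) = ennreal ((cmod c)\<^sup>2) * cost_form lam hbar z v"
proof -
  have "weight lam hbar p * ennreal ((norm (quot hbar n p z (scaleC c v)))\<^sup>2)
      = ennreal ((cmod c)\<^sup>2) * (weight lam hbar p * ennreal ((norm (quot hbar n p z v))\<^sup>2))" for n p
    by (simp add: quot_scaleC power_mult_distrib ennreal_mult mult.left_commute)
  then show ?thesis
    unfolding cost_form_eq_SUP[OF hbar] by (simp add: SUP_mult_left_ennreal sum_distrib_left)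
qed

text \<open>The existence of a spectral decomposition gives the choice in \<open>trace_cost\<close>
  its meaning. Absorbing square roots of the eigenvalues into the eigenvectors turns it into a
  decomposition in the sense of \<open>decomposes\<close>.\<close>

lemma trace_cost_eq_opcost:
  fixes Q :: "'d::finite operator"
  assumes hbar: "0 < hbar" and Q: "psd Q" "diag_sums Q t"
  shows "trace_cost lam hbar z Q = opcost lam hbar z Q"
proof -
  define s where "s = (SOME (q, \<psi>). spectral_decomposition Q q \<psi>)"
  have "\<exists>s. (\<lambda>(q, \<psi>). spectral_decomposition Q q \<psi>) s" using ex_spectral_decomposition[OF Q] by auto
  then have "(\<lambda>(q, \<psi>). spectral_decomposition Q q \<psi>) s" unfolding s_def by (rule someI_ex)
  moreover obtain q \<psi> where s: "s = (q, \<psi>)" by (cases s)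
  ultimately have sd: "spectral_decomposition Q q \<psi>" by simp
  have q: "0 \<le> q k" for k using sd by (simp add: spectral_decomposition_def)
  define \<phi> where "\<phi> k = scaleC (of_real (sqrt (q k))) (\<psi> k)" for k
  have "decomposes \<phi> Q"
    unfolding decomposes_def
  proof
    fix x
    have "scaleC (cinner (\<phi> k) x) (\<phi> k) = q k *\<^sub>R blinfun_apply (rank_one_op (\<psi> k)) x" for k
    proof -
      have "complex_of_real (sqrt (q k)) * of_real (sqrt (q k)) = of_real (q k)"
        using q[of k] by (simp flip: of_real_mult)
      note sq = this
      let ?r = "complex_of_real (sqrt (q k))"
      have "scaleC (cinner (\<phi> k) x) (\<phi> k) = scaleC (?r * cinner (\<psi> k) x * ?r) (\<psi> k)"
        by (simp add: \<phi>_def cinner_scaleC_left scaleC_scaleC)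
      also have "?r * cinner (\<psi> k) x * ?r = ?r * ?r * cinner (\<psi> k) x" by (simp only: mult_ac)
      also have "\<dots> = of_real (q k) * cinner (\<psi> k) x" unfolding sq ..
      finally show ?thesis by (simp add: rank_one_apply scaleR_L2_def scaleC_scaleC)
    qed
    then show "(\<lambda>k. scaleC (cinner (\<phi> k) x) (\<phi> k)) sums blinfun_apply Q x"
      using sd by (simp add: spectral_decomposition_def)
  qed
  moreover have "trace_cost lam hbar z Q = (\<Sum>k. ennreal (q k) * cost_form lam hbar z (\<psi> k))"
    using s unfolding s_def by (simp add: trace_cost_def)
  moreover have "ennreal (q k) * cost_form lam hbar z (\<psi> k) = cost_form lam hbar z (\<phi> k)" for k
    using q[of k] by (simp add: \<phi>_def cost_form_scaleC[OF hbar])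
  ultimately show ?thesis using suminf_cost_form[OF hbar, of \<phi> Q lam z] by simp
qed

lemma decomposes_rank_one: "decomposes (\<lambda>k. if k = 0 then \<psi> else 0) (rank_one_op \<psi>)"
  unfolding decomposes_def
proof
  fix x
  have "(\<lambda>k. scaleC (cinner (if k = 0 then \<psi> else 0) x) (if k = 0 then \<psi> else 0))
      = (\<lambda>k::nat. if k = 0 then scaleC (cinner \<psi> x) \<psi> else 0)"
    by (auto simp: scaleC.zero_right)
  then show "(\<lambda>k. scaleC (cinner (if k = 0 then \<psi> else 0) x) (if k = (0::nat) then \<psi> else 0))
      sums blinfun_apply (rank_one_op \<psi>) x"
    using sums_single[of 0 "\<lambda>_. scaleC (cinner \<psi> x) \<psi>"] by (simp add: rank_one_apply)
qed

lemma cost_form_eq_opcost_rank_one: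
  fixes \<psi> :: "'d::finite L2"
  assumes hbar: "0 < hbar"
  shows "cost_form lam hbar z \<psi> = opcost lam hbar z (rank_one_op \<psi>)"
proof -
  have 0: "cost_form lam hbar z (0 :: 'd L2) = 0"
    using cost_form_scaleC[OF hbar, of lam z 0 0] by (simp add: scaleC.zero_right)
  have "opcost lam hbar z (rank_one_op \<psi>) = (\<Sum>k. cost_form lam hbar z (if k = (0::nat) then \<psi> else 0))"
    by (rule suminf_cost_form[OF hbar decomposes_rank_one, symmetric])
  also have "\<dots> = (\<Sum>k\<in>{0}. cost_form lam hbar z (if k = (0::nat) then \<psi> else 0))"
    by (rule suminf_finite) (auto simp: 0)
  finally show ?thesis by simp
qed

text \<open>\<open>opcost\<close> is a function of the projector alone, so the representative
  selected in \<open>cost\<close> is immaterial.\<close>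

lemma cost_eq_opcost:
  fixes P :: "'d::finite operator"
  assumes hbar: "0 < hbar" and P: "P \<in> rank_one_projectors"
  shows "cost lam hbar (P, z) = opcost lam hbar z P"
proof -
  define \<psi> where "\<psi> = (SOME \<psi>. norm \<psi> = 1 \<and> P = rank_one_op \<psi>)"
  have "\<exists>\<psi>. norm \<psi> = 1 \<and> P = rank_one_op \<psi>" using P by (auto simp: rank_one_projectors_def)
  from someI_ex[OF this] have "P = rank_one_op \<psi>" by (simp add: \<psi>_def)
  moreover have "cost lam hbar (P, z) = cost_form lam hbar z \<psi>" by (simp add: cost_def \<psi>_def)
  ultimately show ?thesis using cost_form_eq_opcost_rank_one[OF hbar] by metis
qed

section \<open>Measures on the rank-one projectors\<close>

lemma trace_norm_rank_one_diff_le: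
  assumes n: "norm \<phi> = 1" "norm \<psi> = 1"
  shows "trace_norm (rank_one_op \<phi> - rank_one_op \<psi>) \<le> ennreal (2 * norm (\<phi> - \<psi>))"
proof -
  have "cmod (cinner \<phi> \<psi>) \<le> 1" using cmod_cinner_le[of \<phi> \<psi>] n by simp
  moreover have "Re (cinner \<phi> \<psi>) \<le> cmod (cinner \<phi> \<psi>)" by (rule complex_Re_le_cmod)
  moreover have "1 - (cmod (cinner \<phi> \<psi>))\<^sup>2 \<le> 2 * (1 - cmod (cinner \<phi> \<psi>))"
    using zero_le_power2[of "1 - cmod (cinner \<phi> \<psi>)"] by (simp add: power2_diff)
  ultimately have "1 - (cmod (cinner \<phi> \<psi>))\<^sup>2 \<le> (norm (\<phi> - \<psi>))\<^sup>2"
    unfolding norm_sq_diff n by simp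
  then have "sqrt (1 - (cmod (cinner \<phi> \<psi>))\<^sup>2) \<le> norm (\<phi> - \<psi>)" by (rule real_le_lsqrt[rotated]) simp
  then show ?thesis unfolding trace_norm_rank_one_diff(1)[OF n] by (intro ennreal_leI) simp
qed

text \<open>Measures are built on unit vectors first, where the topology is Polish, and this map
  transports them to projectors.\<close>

lemma continuous_map_rank_one_op:
  "continuous_map (subtopology euclidean {\<psi> :: 'd::finite L2. norm \<psi> = 1}) projector_topology rank_one_op"
  unfolding continuous_map_def
proof (intro conjI allI impI)
  show "rank_one_op \<in> topspace (subtopology euclidean {\<psi> :: 'd L2. norm \<psi> = 1}) \<rightarrow> topspace projector_topology"
    by (auto simp: topspace_projector_topology rank_one_projectors_def)
  fix U :: "'d operator set" assume U: "openin projector_topology U"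
  let ?W = "{\<psi> \<in> topspace (subtopology euclidean {\<psi> :: 'd L2. norm \<psi> = 1}). rank_one_op \<psi> \<in> U}"
  have "\<exists>e>0. \<forall>\<phi>\<in>{\<psi>. norm \<psi> = 1}. dist \<phi> \<psi> < e \<longrightarrow> \<phi> \<in> ?W" if "\<psi> \<in> ?W" for \<psi>
  proof -
    have \<psi>: "norm \<psi> = 1" "rank_one_op \<psi> \<in> U" using that by auto
    then obtain r where r: "0 < r" "\<And>P'. P' \<in> rank_one_projectors \<Longrightarrow> trace_norm (P' - rank_one_op \<psi>) < ennreal r \<Longrightarrow> P' \<in> U"
      using U unfolding openin_projector_topology by meson
    have "\<phi> \<in> ?W" if "norm \<phi> = 1" "dist \<phi> \<psi> < r / 2" for \<phi>
    proof -
      have "trace_norm (rank_one_op \<phi> - rank_one_op \<psi>) \<le> ennreal (2 * norm (\<phi> - \<psi>))"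
        by (rule trace_norm_rank_one_diff_le[OF that(1) \<psi>(1)])
      also have "\<dots> < ennreal r" using that(2) r(1) by (intro ennreal_lessI) (auto simp: dist_norm)
      finally have "rank_one_op \<phi> \<in> U" using that(1) by (intro r(2)) (auto simp: rank_one_projectors_def)
      then show ?thesis using that(1) by simp
    qed
    then show ?thesis using r(1) by (intro exI[of _ "r / 2"]) auto
  qed
  moreover have "?W \<subseteq> {\<psi>. norm \<psi> = 1}" by auto
  ultimately have "openin (top_of_set {\<psi>. norm \<psi> = 1}) ?W" unfolding openin_euclidean_subtopology_iff by blast
  then show "openin (subtopology euclidean {\<psi> :: 'd L2. norm \<psi> = 1}) ?W" .
qed

text \<open>The trace norm of a difference of projectors controls its operator norm, by the explicit
  formula. These functions supply both the measurability and the separation properties of the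
  projector space.\<close>

lemma continuous_map_projector_cinner:
  "continuous_map projector_topology euclidean (\<lambda>P :: 'd::finite operator. cinner a (blinfun_apply P b))"
  unfolding continuous_map_def
proof (intro conjI allI impI)
  fix U :: "complex set" assume "openin euclidean U"
  then have U: "open U" by simp
  show "openin projector_topology {P \<in> topspace projector_topology. cinner a (blinfun_apply P b) \<in> U}"
    unfolding openin_projector_topology topspace_projector_topology
  proof (intro conjI ballI)
    fix P assume "P \<in> {P \<in> rank_one_projectors. cinner a (blinfun_apply P b) \<in> U}"
    then have P: "P \<in> rank_one_projectors" "cinner a (blinfun_apply P b) \<in> U" by auto
    obtain e where e: "0 < e" "ball (cinner a (blinfun_apply P b)) e \<subseteq> U"
      using U P(2) by (auto simp: open_contains_ball)
    define r where "r = e / (1 + norm a * norm b)"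
    have pos: "0 < 1 + norm a * norm b" by (simp add: add_pos_nonneg)
    have r: "0 < r" unfolding r_def using e(1) pos by simp
    have "cinner a (blinfun_apply P' b) \<in> U"
      if P': "P' \<in> rank_one_projectors" "trace_norm (P' - P) < ennreal r" for P'
    proof -
      obtain \<phi> \<psi> where n: "norm \<phi> = 1" "norm \<psi> = 1" and eq: "P' = rank_one_op \<phi>" "P = rank_one_op \<psi>"
        using P(1) P'(1) by (auto simp: rank_one_projectors_def)
      let ?s = "sqrt (1 - (cmod (cinner \<phi> \<psi>))\<^sup>2)"
      have "cmod (cinner \<phi> \<psi>) \<le> 1" using cmod_cinner_le[of \<phi> \<psi>] n by simp
      then have s0: "0 \<le> ?s" by (simp add: power_le_one)
      have "2 * ?s < r"
        using P'(2) s0 r unfolding eq trace_norm_rank_one_diff(1)[OF n] by (simp add: ennreal_less_iff)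
      then have s: "?s \<le> r" using s0 by linarith
      have "cmod (cinner a (blinfun_apply P' b) - cinner a (blinfun_apply P b))
          = cmod (cinner a (blinfun_apply (P' - P) b))"
        by (simp add: blinfun.diff_left cinner.diff_right)
      also have "\<dots> \<le> norm a * norm (blinfun_apply (P' - P) b)" by (rule cmod_cinner_le)
      also have "\<dots> \<le> norm a * (?s * norm b)"
        unfolding eq by (intro mult_left_mono trace_norm_rank_one_diff(2)[OF n]) auto
      also have "\<dots> \<le> norm a * (r * norm b)" by (intro mult_left_mono mult_right_mono s) auto
      also have "\<dots> = r * (norm a * norm b)" by (simp add: mult_ac)
      also have "\<dots> < r * (1 + norm a * norm b)" using r by simp
      also have "\<dots> = e" using pos by (simp add: r_def)
      finally show ?thesis using e(2) by (auto simp: dist_norm norm_minus_commute)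
    qed
    then show "\<exists>r>0. \<forall>P'\<in>rank_one_projectors. trace_norm (P' - P) < ennreal r \<longrightarrow>
        P' \<in> {P \<in> rank_one_projectors. cinner a (blinfun_apply P b) \<in> U}"
      using r by blast
  qed auto
qed auto

text \<open>Matrix entries are continuous and separate projectors.\<close>

lemma Hausdorff_projector_topology: "Hausdorff_space (projector_topology :: 'd::finite operator topology)"
  unfolding Hausdorff_space_def
proof (intro allI impI)
  fix P P' :: "'d operator"
  assume P: "P \<in> topspace projector_topology \<and> P' \<in> topspace projector_topology \<and> P \<noteq> P'"
  have "\<exists>a b. cinner a (blinfun_apply P b) \<noteq> cinner a (blinfun_apply P' b)"
  proof (rule ccontr)
    assume "\<not> ?thesis"
    then have "blinfun_apply P b = blinfun_apply P' b" for b by (intro L2_eqI) blast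
    then have "P = P'" by (rule blinfun_eqI)
    then show False using P by blast
  qed
  then obtain a b where ab: "cinner a (blinfun_apply P b) \<noteq> cinner a (blinfun_apply P' b)" by blast
  let ?f = "\<lambda>P. cinner a (blinfun_apply P b)"
  obtain U V where UV: "open U" "open V" "?f P \<in> U" "?f P' \<in> V" "U \<inter> V = {}"
    using hausdorff[OF ab] by blast
  have op: "openin projector_topology {P \<in> topspace projector_topology. ?f P \<in> W}" if "open W" for W
    using continuous_map_projector_cinner[of a b] that by (auto simp: continuous_map_def)
  show "\<exists>U V. openin projector_topology U \<and> openin projector_topology V \<and> P \<in> U \<and> P' \<in> V \<and> disjnt U V"
    using op[OF UV(1)] op[OF UV(2)] UV(3-5) P
    by (intro exI[of _ "{P \<in> topspace projector_topology. ?f P \<in> U}"]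
        exI[of _ "{P \<in> topspace projector_topology. ?f P \<in> V}"]) (auto simp: disjnt_def)
qed

section \<open>Borel structure and Radon images\<close>

lemma openin_subset_Pow: "{U. openin X U} \<subseteq> Pow (topspace X)"
  by (auto dest: openin_subset)

lemma space_borel_of: "space (borel_of X) = topspace X"
  unfolding borel_of_def by (rule space_measure_of[OF openin_subset_Pow])

lemma sets_borel_of: "sets (borel_of X) = sigma_sets (topspace X) {U. openin X U}"
  unfolding borel_of_def by (rule sets_measure_of[OF openin_subset_Pow])

lemma openin_sets_borel_of: "openin X U \<Longrightarrow> U \<in> sets (borel_of X)"
  unfolding sets_borel_of by (rule sigma_sets.Basic) simp

lemma closedin_sets_borel_of: "closedin X C \<Longrightarrow> C \<in> sets (borel_of X)"
proof -
  assume C: "closedin X C"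
  then have "topspace X - (topspace X - C) \<in> sets (borel_of X)"
    unfolding sets_borel_of by (intro sigma_sets.Compl sigma_sets.Basic) auto
  then show ?thesis using closedin_subset[OF C] by (simp add: double_diff)
qed

lemma measurable_borel_of_borel:
  assumes "continuous_map X euclidean f"
  shows "f \<in> borel_measurable (borel_of X)"
proof (rule borel_measurableI)
  fix U :: "'b set" assume "open U"
  then have "openin X {x \<in> topspace X. f x \<in> U}" using assms by (auto simp: continuous_map_def)
  moreover have "f -` U \<inter> space (borel_of X) = {x \<in> topspace X. f x \<in> U}" by (auto simp: space_borel_of)
  ultimately show "f -` U \<inter> space (borel_of X) \<in> sets (borel_of X)" by (simp add: openin_sets_borel_of)
qed

lemma measurable_borel_of:
  assumes "continuous_map X Y f" shows "f \<in> borel_of X \<rightarrow>\<^sub>M borel_of Y"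
  unfolding borel_of_def[of Y]
proof (rule measurable_measure_of[OF openin_subset_Pow])
  show "f \<in> space (borel_of X) \<rightarrow> topspace Y" using assms by (auto simp: continuous_map_def space_borel_of)
  fix U assume "U \<in> {U. openin Y U}"
  then have "openin X {x \<in> topspace X. f x \<in> U}" using assms by (auto simp: continuous_map_def)
  moreover have "f -` U \<inter> space (borel_of X) = {x \<in> topspace X. f x \<in> U}" by (auto simp: space_borel_of)
  ultimately show "f -` U \<inter> space (borel_of X) \<in> sets (borel_of X)" by (simp add: openin_sets_borel_of)
qed

lemma measurable_comp_continuous_map:
  fixes h :: "'x \<Rightarrow> 'a::topological_space"
  assumes h: "h \<in> borel_measurable M" "\<And>x. x \<in> space M \<Longrightarrow> h x \<in> S" and S: "S \<in> sets borel"
    and G: "continuous_map (subtopology euclidean S) X G"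
  shows "(\<lambda>x. G (h x)) \<in> M \<rightarrow>\<^sub>M borel_of X"
  unfolding borel_of_def[of X]
proof (rule measurable_measure_of[OF openin_subset_Pow])
  show "(\<lambda>x. G (h x)) \<in> space M \<rightarrow> topspace X"
    using G h(2) by (auto simp: continuous_map_def)
  fix U assume "U \<in> {U. openin X U}"
  then have "openin (subtopology euclidean S) {w \<in> topspace (subtopology euclidean S). G w \<in> U}"
    using G by (auto simp: continuous_map_def)
  then obtain V where V: "open V" "{w \<in> S. G w \<in> U} = S \<inter> V" by (auto simp: openin_open)
  moreover have "(\<lambda>x. G (h x)) -` U \<inter> space M = h -` (S \<inter> V) \<inter> space M"
    unfolding V(2)[symmetric] using h(2) by auto
  moreover have "S \<inter> V \<in> sets borel" using S V(1) by simp
  ultimately show "(\<lambda>x. G (h x)) -` U \<inter> space M \<in> sets M"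
    using measurable_sets[OF h(1), of "S \<inter> V"] by (simp only:)
qed

text \<open>The law of \<open>h\<close> on a Polish space is inner regular; a continuous map sends
  compact sets to compact sets, which are closed and hence measurable in a Hausdorff target. Only
  the values of \<open>G\<close> on \<open>S\<close> matter.\<close>

lemma radon_probability_image:
  fixes h :: "'x \<Rightarrow> 'a::{second_countable_topology, complete_space}"
  assumes M: "prob_space M" and h: "h \<in> borel_measurable M" "\<And>x. x \<in> space M \<Longrightarrow> h x \<in> S"
    and S: "S \<in> sets borel" and G: "continuous_map (subtopology euclidean S) X G" and X: "Hausdorff_space X"
  shows "radon_probability X (distr M (borel_of X) (\<lambda>x. G (h x)))"
proof -
  let ?\<pi> = "distr M (borel_of X) (\<lambda>x. G (h x))"
  have meas: "(\<lambda>x. G (h x)) \<in> M \<rightarrow>\<^sub>M borel_of X" by (rule measurable_comp_continuous_map[OF h S G])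
  have Gm: "G \<in> restrict_space borel S \<rightarrow>\<^sub>M borel_of X"
    by (rule measurable_comp_continuous_map[of "\<lambda>x. x", OF _ _ S G])
       (auto simp: space_restrict_space intro: measurable_restrict_space1)
  have "emeasure ?\<pi> A = (SUP K\<in>{K \<in> sets ?\<pi>. compactin X K \<and> K \<subseteq> A}. emeasure ?\<pi> K)" if A: "A \<in> sets ?\<pi>" for A
  proof (rule antisym)
    define B where "B = {w \<in> S. G w \<in> A}"
    have "G -` A \<inter> space (restrict_space borel S) \<in> sets (restrict_space borel S)"
      using Gm A by (auto simp: measurable_sets)
    then have "B \<in> sets (restrict_space borel S)"
      by (simp add: B_def space_restrict_space vimage_def Int_def conj_commute)
    then have B: "B \<in> sets borel" using S by (simp add: sets_restrict_space_iff)
    let ?m = "distr M borel h"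
    interpret m: prob_space ?m by (rule prob_space.prob_space_distr[OF M h(1)])
    have "emeasure ?\<pi> A = emeasure M ((\<lambda>x. G (h x)) -` A \<inter> space M)"
      using meas A by (simp add: emeasure_distr)
    also have "(\<lambda>x. G (h x)) -` A \<inter> space M = h -` B \<inter> space M" using h(2) by (auto simp: B_def)
    also have "emeasure M (h -` B \<inter> space M) = emeasure ?m B" by (rule emeasure_distr[OF h(1) B, symmetric])
    also have "\<dots> = (SUP K\<in>{K. K \<subseteq> B \<and> compact K}. emeasure ?m K)"
      by (rule inner_regular) (use B m.emeasure_finite in auto)
    also have "\<dots> \<le> (SUP K\<in>{K \<in> sets ?\<pi>. compactin X K \<and> K \<subseteq> A}. emeasure ?\<pi> K)"
    proof (rule SUP_mono)
      fix K assume "K \<in> {K. K \<subseteq> B \<and> compact K}"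
      then have K: "K \<subseteq> B" "compact K" by auto
      have KS: "K \<subseteq> S" using K(1) by (auto simp: B_def)
      have "compactin (subtopology euclidean S) K" using K(2) KS by (simp add: compactin_subtopology)
      then have comp: "compactin X (G ` K)" by (rule image_compactin[OF _ G])
      then have sets: "G ` K \<in> sets ?\<pi>"
        using closedin_sets_borel_of[OF compactin_imp_closedin[OF X]] by simp
      have "emeasure ?m K = emeasure M (h -` K \<inter> space M)"
        by (rule emeasure_distr[OF h(1)]) (use K(2) in \<open>simp add: borel_closed compact_imp_closed\<close>)
      also have "\<dots> \<le> emeasure M ((\<lambda>x. G (h x)) -` (G ` K) \<inter> space M)"
        by (rule emeasure_mono) (use meas sets in \<open>auto simp: measurable_sets\<close>)
      also have "\<dots> = emeasure ?\<pi> (G ` K)" using meas sets by (simp add: emeasure_distr)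
      finally have "emeasure ?m K \<le> emeasure ?\<pi> (G ` K)" .
      moreover have "G ` K \<in> {K \<in> sets ?\<pi>. compactin X K \<and> K \<subseteq> A}"
        using sets comp K(1) by (auto simp: B_def)
      ultimately show "\<exists>K'\<in>{K \<in> sets ?\<pi>. compactin X K \<and> K \<subseteq> A}. emeasure ?m K \<le> emeasure ?\<pi> K'" by blast
    qed
    finally show "emeasure ?\<pi> A \<le> (SUP K\<in>{K \<in> sets ?\<pi>. compactin X K \<and> K \<subseteq> A}. emeasure ?\<pi> K)" .
    show "(SUP K\<in>{K \<in> sets ?\<pi>. compactin X K \<and> K \<subseteq> A}. emeasure ?\<pi> K) \<le> emeasure ?\<pi> A"
      by (rule SUP_least) (use A in \<open>auto intro: emeasure_mono\<close>)
  qed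
  then show ?thesis
    using prob_space.prob_space_distr[OF M meas] by (simp add: radon_probability_def)
qed

section \<open>Measurability of the cost on pairs of a projector and a phase point\<close>

abbreviation plan_topology :: "('d::finite operator \<times> 'd phase_space) topology" where
  "plan_topology \<equiv> prod_topology projector_topology euclidean"

lemma measurable_plan_fst: "fst \<in> borel_of plan_topology \<rightarrow>\<^sub>M borel_of (projector_topology :: 'd::finite operator topology)"
  by (rule measurable_borel_of[OF continuous_map_fst])

lemma measurable_plan_snd: "snd \<in> borel_measurable (borel_of (plan_topology :: ('d::finite operator \<times> 'd phase_space) topology))"
  by (rule measurable_borel_of_borel[OF continuous_map_snd])

lemma measurable_projector_cinner:
  "(\<lambda>P :: 'd::finite operator. cinner a (blinfun_apply P b)) \<in> borel_measurable (borel_of projector_topology)"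
  by (rule measurable_borel_of_borel[OF continuous_map_projector_cinner])

lemma space_plan: "space (borel_of (plan_topology :: ('d::finite operator \<times> 'd phase_space) topology)) = rank_one_projectors \<times> UNIV"
  by (simp add: space_borel_of topspace_projector_topology)

lemma projector_psd: "P \<in> rank_one_projectors \<Longrightarrow> psd P"
  by (auto simp: rank_one_projectors_def psd_rank_one)

text \<open>\<open>testcoeff\<close> and \<open>testbase\<close> separate the phase point from the
  vector: all dependence of \<open>testvec\<close> on \<open>z\<close> sits in one unimodular
  continuous scalar. Its form then becomes a combination of four fixed matrix entries with bounded
  coefficients.\<close>

definition testcoeff :: "real \<Rightarrow> nat \<Rightarrow> 'd::finite \<times> bool \<Rightarrow> 'd phase_space \<Rightarrow> complex" where
  "testcoeff hbar n = (\<lambda>(i, b) z. cis ((if b then fst z $ i else snd z $ i / hbar) / 2 ^ n))"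

definition testbase :: "nat \<Rightarrow> 'd \<times> bool \<Rightarrow> nat \<Rightarrow> 'd::finite L2" where
  "testbase n = (\<lambda>(i, b) k. if b then modu (- (1 / 2 ^ n)) i (bas k) else shift (- ((1 / 2 ^ n) *\<^sub>R axis i 1)) (bas k))"

lemma testvec_eq: "testvec hbar n p k z = 2 ^ n *\<^sub>R (scaleC (testcoeff hbar n p z) (testbase n p k) - bas k)"
  by (cases p) (simp add: testvec_def testcoeff_def testbase_def)

lemma cmod_testcoeff: "cmod (testcoeff hbar n p z) = 1"
  by (cases p) (simp add: testcoeff_def)

lemma testcoeff_measurable [measurable]: "testcoeff hbar n p \<in> borel_measurable (borel :: 'd::finite phase_space measure)"
proof -
  have "continuous_on UNIV (testcoeff hbar n p :: 'd phase_space \<Rightarrow> complex)"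
    unfolding testcoeff_def divide_inverse by (cases p; cases "snd p") (auto intro!: continuous_intros)
  then show ?thesis by (rule borel_measurable_continuous_onI)
qed

lemma testvec_form:
  fixes Q :: "'d::finite operator" and hbar :: real and n k :: nat and p :: "'d \<times> bool" and z :: "'d phase_space"
  assumes Q: "psd Q"
  defines "c \<equiv> testcoeff hbar n p z" and "v \<equiv> testbase n p k"
  shows "cinner (testvec hbar n p k z) (blinfun_apply Q (testvec hbar n p k z))
    = 4 ^ n * (cinner v (blinfun_apply Q v) + cinner (bas k) (blinfun_apply Q (bas k))
        - cnj c * cinner v (blinfun_apply Q (bas k)) - c * cinner (bas k) (blinfun_apply Q v))"
proof -
  have "c * cnj c = 1" unfolding c_def complex_norm_square[symmetric] cmod_testcoeff by simp
  then have cc: "c * (cnj c * w) = w" for w by (metis mult.assoc mult_1)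
  have "cinner (testvec hbar n p k z) (blinfun_apply Q (testvec hbar n p k z))
      = 2 ^ n *\<^sub>R 2 ^ n *\<^sub>R cinner (scaleC c v - bas k) (blinfun_apply Q (scaleC c v - bas k))"
    unfolding testvec_eq c_def[symmetric] v_def[symmetric] blinfun.scaleR_right cinner.scaleR_right cinner.scaleR_left ..
  also have "cinner (scaleC c v - bas k) (blinfun_apply Q (scaleC c v - bas k))
      = cinner v (blinfun_apply Q v) + cinner (bas k) (blinfun_apply Q (bas k))
        - cnj c * cinner v (blinfun_apply Q (bas k)) - c * cinner (bas k) (blinfun_apply Q v)"
    by (simp add: blinfun.diff_right cinner.diff_left cinner.diff_right psd_scaleC[OF Q]
        cinner_scaleC_left cinner_scaleC_right right_diff_distrib cc)
  also have "2 ^ n *\<^sub>R 2 ^ n *\<^sub>R w = 4 ^ n * w" for w :: complex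
    by (simp add: scaleR_conv_of_real flip: power_mult_distrib mult.assoc)
  finally show ?thesis .
qed

lemma measurable_plan_testvec:
  "(\<lambda>(P, z). cinner (testvec hbar n p k z) (blinfun_apply P (testvec hbar n p k z)))
    \<in> borel_measurable (borel_of (plan_topology :: ('d::finite operator \<times> 'd phase_space) topology))"
proof -
  note [measurable] = measurable_compose[OF measurable_plan_fst measurable_projector_cinner]
    measurable_compose[OF measurable_plan_snd testcoeff_measurable]
  let ?g = "\<lambda>w :: 'd operator \<times> 'd phase_space.
    4 ^ n * (cinner (testbase n p k) (blinfun_apply (fst w) (testbase n p k))
      + cinner (bas k) (blinfun_apply (fst w) (bas k))
      - cnj (testcoeff hbar n p (snd w)) * cinner (testbase n p k) (blinfun_apply (fst w) (bas k))
      - testcoeff hbar n p (snd w) * cinner (bas k) (blinfun_apply (fst w) (testbase n p k)))"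
  have "?g \<in> borel_measurable (borel_of plan_topology)" by measurable
  then show ?thesis
    by (subst measurable_cong[of _ _ ?g]) (auto simp: space_plan testvec_form projector_psd)
qed

lemma measurable_plan_opcost_step:
  "(\<lambda>(P, z). opcost_step lam hbar n z P) \<in> borel_measurable (borel_of (plan_topology :: ('d::finite operator \<times> 'd phase_space) topology))"
proof -
  note [measurable] = measurable_plan_testvec[unfolded case_prod_beta]
  show ?thesis unfolding opcost_step_def case_prod_beta by measurable
qed

text \<open>The choice inside \<open>cost\<close> gives no direct access to measurability; on the
  underlying space it agrees with \<open>opcost\<close>, a countable supremum of sums of measurable
  terms.\<close>

lemma measurable_plan_cost:
  assumes hbar: "0 < hbar"
  shows "cost lam hbar \<in> borel_measurable (borel_of (plan_topology :: ('d::finite operator \<times> 'd phase_space) topology))"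
proof -
  note [measurable] = measurable_plan_opcost_step[unfolded case_prod_beta]
  have "(\<lambda>w. opcost lam hbar (snd w) (fst w)) \<in> borel_measurable (borel_of (plan_topology :: ('d operator \<times> 'd phase_space) topology))"
    unfolding opcost_def by measurable
  then show ?thesis
    by (subst measurable_cong[of _ _ "\<lambda>w. opcost lam hbar (snd w) (fst w)"])
       (auto simp: space_plan cost_eq_opcost[OF hbar])
qed

section \<open>From couplings to transport plans\<close>

lemma coupling_psd:
  assumes "Q \<in> couplings R f"
  shows "psd (Q z)" "diag_sums (Q z) (f z)"
proof -
  have *: "psd (Q z)" "trace_class (Q z)" "op_trace (Q z) = of_real (f z)"
    using assms unfolding couplings_def by blast+
  then show "psd (Q z)" by blast
  show "diag_sums (Q z) (f z)" unfolding diag_sums_def by (rule psd_trace_sums[OF *])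
qed

lemma coupling_measurable:
  assumes "Q \<in> couplings R f"
  shows "(\<lambda>z. cinner x (blinfun_apply (Q z) y)) \<in> borel_measurable lebesgue"
  using assms by (auto simp: couplings_def)

lemma coupling_integral:
  assumes "Q \<in> couplings R f"
  shows "has_bochner_integral lebesgue (\<lambda>z. cinner x (blinfun_apply (Q z) y)) (cinner x (blinfun_apply R y))"
  using assms by (auto simp: couplings_def)

text \<open>An elimination step expresses the new entries by products, a square root and a division
  of old ones. All of these are Borel operations, including division by zero, so measurability
  passes through the induction.\<close>

lemma measurable_chol_rem:
  assumes psd: "\<And>z. psd (Q z)"
    and meas: "\<And>x y. (\<lambda>z. cinner x (blinfun_apply (Q z) y)) \<in> borel_measurable M"
  shows "(\<lambda>z. cinner x (blinfun_apply (chol_rem (Q z) n) y)) \<in> borel_measurable M"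
proof (induction n arbitrary: x y)
  case (Suc n)
  note [measurable] = Suc.IH
  let ?A = "\<lambda>z. chol_rem (Q z) n"
  have "cinner x (blinfun_apply (chol_rem (Q z) (Suc n)) y) = cinner x (blinfun_apply (?A z) y)
      - (1 / sqrt (Re (cinner (bas n) (blinfun_apply (?A z) (bas n))))) *\<^sub>R cinner x (blinfun_apply (?A z) (bas n))
        * ((1 / sqrt (Re (cinner (bas n) (blinfun_apply (?A z) (bas n))))) *\<^sub>R cinner (bas n) (blinfun_apply (?A z) y))" for z
    by (simp add: blinfun.diff_left cinner.diff_right cinner_rank_one pivot_def cinner.scaleR_left
        cinner.scaleR_right psd_self_adjoint[OF psd_chol_rem[OF psd]])
  then show ?case by simp
qed (simp add: meas)

lemma measurable_chol:
  assumes psd: "\<And>z. psd (Q z)"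
    and meas: "\<And>x y. (\<lambda>z. cinner x (blinfun_apply (Q z) y)) \<in> borel_measurable M"
  shows "(\<lambda>z. cinner x (chol (Q z) n)) \<in> borel_measurable M"
proof -
  note [measurable] = measurable_chol_rem[OF assms]
  show ?thesis unfolding chol_def pivot_def cinner.scaleR_right by measurable
qed

text \<open>Weak measurability suffices: the map is the pointwise limit of its partial Fourier sums,
  each a finite combination of fixed vectors with measurable coefficients.\<close>

lemma borel_measurable_L2I:
  fixes F :: "'x \<Rightarrow> 'd::finite L2"
  assumes "\<And>k. (\<lambda>z. cinner (bas k) (F z)) \<in> borel_measurable M"
  shows "F \<in> borel_measurable M"
proof (rule borel_measurable_LIMSEQ_metric)
  show "(\<lambda>z. \<Sum>k<n. scaleC (cinner (bas k) (F z)) (bas k :: 'd L2)) \<in> borel_measurable M" for n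
  proof (rule borel_measurable_sum)
    fix k
    have "continuous_on UNIV (\<lambda>c. scaleC c (bas k :: 'd L2))"
      by (intro scaleC.continuous_on continuous_intros)
    from borel_measurable_continuous_on[OF this assms[of k]]
    show "(\<lambda>z. scaleC (cinner (bas k) (F z)) (bas k :: 'd L2)) \<in> borel_measurable M" .
  qed
  show "(\<lambda>n. \<Sum>k<n. scaleC (cinner (bas k) (F z)) (bas k)) \<longlonglongrightarrow> F z" for z
    using bas_expansion[of "F z"] by (simp add: sums_def)
qed

text \<open>The zero vector is sent to \<open>bas 0\<close> only to stay on the unit sphere; its
  weight \<open>(norm v)\<^sup>2\<close> is 0, so the choice never contributes.\<close>

definition unitize :: "'d::finite L2 \<Rightarrow> 'd L2" where
  "unitize v = (if v = 0 then bas 0 else inverse (norm v) *\<^sub>R v)"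

lemma norm_unitize [simp]: "norm (unitize v) = 1"
  by (simp add: unitize_def)

lemma unitize_measurable [measurable]: "unitize \<in> borel_measurable borel"
  unfolding unitize_def by measurable

lemma unitize_scale: "scaleC (of_real (norm v)) (unitize v) = v"
  unfolding scaleC_of_real by (simp add: unitize_def)

lemma cost_unitize:
  assumes hbar: "0 < hbar"
  shows "ennreal ((norm v)\<^sup>2) * cost lam hbar (rank_one_op (unitize v), z) = cost_form lam hbar z v"
proof -
  have "cost lam hbar (rank_one_op (unitize v), z) = cost_form lam hbar z (unitize v)"
    unfolding cost_form_eq_opcost_rank_one[OF hbar]
    by (rule cost_eq_opcost[OF hbar]) (auto simp: rank_one_projectors_def)
  then show ?thesis
    using cost_form_scaleC[OF hbar, of lam z "of_real (norm v)" "unitize v"] by (simp add: unitize_scale)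
qed

lemma cinner_rank_one_unitize:
  "of_real ((norm v)\<^sup>2) * cinner x (blinfun_apply (rank_one_op (unitize v)) y) = cinner x v * cinner v y"
proof -
  have "cinner x (scaleC (of_real (norm v)) (unitize v)) * cinner (scaleC (of_real (norm v)) (unitize v)) y
      = of_real (norm v) * of_real (norm v) * (cinner x (unitize v) * cinner (unitize v) y)"
    unfolding cinner_scaleC_right cinner_scaleC_left by simp
  then show ?thesis unfolding unitize_scale cinner_rank_one by (simp add: power2_eq_square)
qed

lemma sigma_finite_lebesgue: "sigma_finite_measure (lebesgue :: 'a::euclidean_space measure)"
proof
  obtain A :: "'a set set" where "countable A" "A \<subseteq> sets lborel" "\<Union>A = space lborel"
      "\<forall>a\<in>A. emeasure lborel a \<noteq> \<infinity>"
    using lborel.sigma_finite_countable by blast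
  then show "\<exists>A :: 'a set set. countable A \<and> A \<subseteq> sets lebesgue \<and> \<Union>A = space lebesgue
      \<and> (\<forall>a\<in>A. emeasure lebesgue a \<noteq> \<infinity>)"
    by (intro exI[of _ A]) (auto simp: subset_iff)
qed

lemma cinner_rank_one_op_le:
  "norm \<psi> = 1 \<Longrightarrow> cmod (cinner x (blinfun_apply (rank_one_op \<psi>) y)) \<le> norm x * norm y"
  unfolding cinner_rank_one norm_mult
  by (rule mult_mono) (use cmod_cinner_le[of x \<psi>] cmod_cinner_le[of \<psi> y] in auto)

text \<open>The plan is the law of \<open>(P\<^bsub>\<phi>(k,z)\<^esub>, z)\<close> when \<open>(k, z)\<close> has density \<open>\<parallel>\<phi>(k,z)\<parallel>\<^sup>2\<close>, where \<open>\<phi>(k,z)\<close> are the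
  Cholesky vectors of \<open>Q(z)\<close>, which depend measurably on \<open>z\<close>.\<close>

theorem coupling_to_plan:
  fixes R :: "'d::finite operator" and f :: "'d phase_space \<Rightarrow> real"
  assumes hbar: "0 < hbar" and f: "probability_density f" and Q: "Q \<in> couplings R f"
  shows "\<exists>\<mu>\<in>representing_measures R. \<exists>\<pi>\<in>transport_plans \<mu> (density_measure f).
    (\<integral>\<^sup>+p. cost lam hbar p \<partial>\<pi>) = (\<integral>\<^sup>+z. trace_cost lam hbar z (Q z) \<partial>lebesgue)"
proof -
  interpret Z: sigma_finite_measure "lebesgue :: 'd phase_space measure" by (rule sigma_finite_lebesgue)
  interpret N: sigma_finite_measure "count_space UNIV :: nat measure" by (rule sigma_finite_measure_count_space)
  interpret NZ: pair_sigma_finite "count_space UNIV :: nat measure" "lebesgue :: 'd phase_space measure" ..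
  let ?NZ = "count_space UNIV \<Otimes>\<^sub>M lebesgue :: (nat \<times> 'd phase_space) measure"
  define \<phi> where "\<phi> k z = chol (Q z) k" for k z
  have dec: "decomposes (\<lambda>k. \<phi> k z) (Q z)" for z
    unfolding \<phi>_def by (rule decomposes_chol[OF coupling_psd(1)[OF Q]])
  have nsum: "(\<Sum>k. ennreal ((norm (\<phi> k z))\<^sup>2)) = ennreal (f z)" for z
    by (rule suminf_ennreal_eq[OF _ decomposes_norm_sums[OF coupling_psd[OF Q] dec]]) simp
  have f_meas [measurable]: "f \<in> borel_measurable lebesgue" and f_nn: "\<And>z. 0 \<le> f z"
    and f_int: "(\<integral>\<^sup>+z. ennreal (f z) \<partial>lebesgue) = 1"
    using f by (auto simp: probability_density_def)
  have \<phi>_meas: "\<phi> k \<in> borel_measurable lebesgue" for k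
    unfolding \<phi>_def[abs_def]
    by (intro borel_measurable_L2I measurable_chol coupling_psd(1)[OF Q] coupling_measurable[OF Q])
  have \<phi>2 [measurable]: "(\<lambda>(k, z). \<phi> k z) \<in> borel_measurable ?NZ"
    by (rule measurable_pair_measure_countable1) (auto intro: \<phi>_meas)
  define w where "w = (\<lambda>(k, z). (norm (\<phi> k z))\<^sup>2)"
  have w_meas [measurable]: "w \<in> borel_measurable ?NZ"
    using \<phi>2 unfolding w_def case_prod_beta by measurable
  define M where "M = density ?NZ (\<lambda>x. ennreal (w x))"
  have nnM: "(\<integral>\<^sup>+x. g x \<partial>M) = (\<integral>\<^sup>+z. (\<Sum>k. ennreal ((norm (\<phi> k z))\<^sup>2) * g (k, z)) \<partial>lebesgue)"
    if [measurable]: "g \<in> borel_measurable ?NZ" for g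
  proof -
    have "(\<integral>\<^sup>+x. g x \<partial>M) = (\<integral>\<^sup>+x. ennreal (w x) * g x \<partial>?NZ)"
      unfolding M_def by (rule nn_integral_density) measurable
    also have "\<dots> = (\<integral>\<^sup>+z. (\<integral>\<^sup>+k. ennreal (w (k, z)) * g (k, z) \<partial>count_space UNIV) \<partial>lebesgue)"
      by (rule NZ.nn_integral_snd[symmetric]) measurable
    finally show ?thesis unfolding nn_integral_count_space_nat by (simp add: w_def)
  qed
  have sets_M: "sets M = sets ?NZ" by (simp add: M_def)
  have M: "prob_space M"
  proof
    have "emeasure M (space M) = (\<integral>\<^sup>+x. 1 \<partial>M)" by simp
    also have "\<dots> = 1" by (subst nnM) (simp_all add: nsum f_int)
    finally show "emeasure M (space M) = 1" .
  qed
  interpret M: prob_space M by (rule M)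
  define h where "h = (\<lambda>(k, z). (unitize (\<phi> k z), z))"
  have id_meas [measurable]: "(\<lambda>z. z) \<in> borel_measurable (lebesgue :: 'd phase_space measure)"
    by (simp add: measurable_completion)
  have h_NZ: "h \<in> borel_measurable ?NZ"
  proof -
    have 1: "(\<lambda>x. unitize (case x of (k, z) \<Rightarrow> \<phi> k z)) \<in> borel_measurable ?NZ"
      using \<phi>2 by measurable
    have 2: "(\<lambda>x. snd x) \<in> borel_measurable ?NZ"
      by (rule measurable_compose[OF measurable_snd id_meas])
    have "(\<lambda>x. (unitize (case x of (k, z) \<Rightarrow> \<phi> k z), snd x)) \<in> ?NZ \<rightarrow>\<^sub>M borel \<Otimes>\<^sub>M borel"
      using 1 2 by (rule measurable_Pair)
    then show ?thesis unfolding borel_prod h_def by (simp add: case_prod_beta)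
  qed
  then have h_meas: "h \<in> borel_measurable M" by (simp add: M_def)
  \<comment> \<open>The measure first lives on unit vectors and phase points, a closed subset of a
    Polish space; \<open>G\<close> carries it continuously to pairs of a projector and a phase
    point.\<close>
  define S where "S = {\<psi> :: 'd L2. norm \<psi> = 1} \<times> (UNIV :: 'd phase_space set)"
  have hS: "h x \<in> S" for x by (cases x) (simp add: h_def S_def)
  have S: "S \<in> sets borel"
  proof -
    have "closed {\<psi> :: 'd L2. norm \<psi> = 1}" by (intro closed_Collect_eq continuous_intros)
    then show ?thesis unfolding S_def by (intro borel_closed closed_Times) auto
  qed
  have top_S: "subtopology euclidean S = prod_topology (subtopology euclidean {\<psi> :: 'd L2. norm \<psi> = 1}) (euclidean :: 'd phase_space topology)"
    unfolding S_def prod_topology_euclidean[symmetric] subtopology_Times by simp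
  define G where "G = (\<lambda>(\<psi> :: 'd L2, z :: 'd phase_space). (rank_one_op \<psi>, z))"
  have G: "continuous_map (subtopology euclidean S) plan_topology G"
    unfolding top_S G_def case_prod_beta
    by (intro continuous_map_pairwise[THEN iffD2] conjI)
       (auto simp: o_def intro: continuous_map_compose[OF continuous_map_fst continuous_map_rank_one_op, unfolded o_def] continuous_map_snd)
  define \<pi> where "\<pi> = distr M (borel_of plan_topology) (\<lambda>x. G (h x))"
  define \<mu> where "\<mu> = distr M (borel_of projector_topology) (\<lambda>x. fst (G (h x)))"
  have Gh: "(\<lambda>x. G (h x)) \<in> M \<rightarrow>\<^sub>M borel_of plan_topology"
    by (rule measurable_comp_continuous_map[OF h_meas hS S G])
  have fGh: "(\<lambda>x. fst (G (h x))) \<in> M \<rightarrow>\<^sub>M borel_of projector_topology"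
    by (rule measurable_compose[OF Gh measurable_plan_fst])
  have Hplan: "Hausdorff_space (plan_topology :: ('d operator \<times> 'd phase_space) topology)"
    by (simp add: Hausdorff_space_prod_topology Hausdorff_projector_topology)
  have rad\<pi>: "radon_probability plan_topology \<pi>"
    unfolding \<pi>_def by (rule radon_probability_image[OF M h_meas hS S G Hplan])
  \<comment> \<open>Instead of deriving the Radon property of the marginal from that of the plan,
    the first marginal is presented as an image of the same Polish space under \<open>fst\<close>
    after \<open>G\<close>.\<close>
  have rad\<mu>: "radon_probability projector_topology \<mu>"
    unfolding \<mu>_def
    by (rule radon_probability_image[OF M h_meas hS S _ Hausdorff_projector_topology, where G = "\<lambda>x. fst (G x)"])
       (rule continuous_map_compose[OF G continuous_map_fst, unfolded o_def])
  have Gh_eq: "G (h (k, z)) = (rank_one_op (unitize (\<phi> k z)), z)" for k z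
    by (simp add: G_def h_def)
  have sGh: "snd (G (h x)) = snd x" for x by (cases x) (simp add: Gh_eq)
  have marg1: "distr \<pi> (borel_of projector_topology) fst = \<mu>"
    unfolding \<pi>_def \<mu>_def by (subst distr_distr[OF measurable_plan_fst Gh]) (simp add: o_def)
  have marg2: "distr \<pi> borel snd = density_measure f"
  proof (rule measure_eqI)
    fix A assume "A \<in> sets (distr \<pi> borel snd)"
    then have A: "A \<in> sets borel" by simp
    then have Al [measurable]: "A \<in> sets (lebesgue :: 'd phase_space measure)" by simp
    have sndm: "(\<lambda>x. snd (G (h x))) \<in> borel_measurable M" by (rule measurable_compose[OF Gh measurable_plan_snd])
    have "emeasure (distr \<pi> borel snd) A = emeasure (distr M borel (\<lambda>x. snd (G (h x)))) A"
      unfolding \<pi>_def by (subst distr_distr[OF measurable_plan_snd Gh]) (simp add: o_def)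
    also have "\<dots> = (\<integral>\<^sup>+x. indicator A (snd x) \<partial>M)"
    proof -
      have "emeasure (distr M borel (\<lambda>x. snd (G (h x)))) A = (\<integral>\<^sup>+y. indicator A y \<partial>distr M borel (\<lambda>x. snd (G (h x))))"
        using A by simp
      also have "\<dots> = (\<integral>\<^sup>+x. indicator A (snd (G (h x))) \<partial>M)"
        by (rule nn_integral_distr[OF sndm]) (use A in simp)
      finally show ?thesis unfolding sGh .
    qed
    also have "\<dots> = (\<integral>\<^sup>+z. (\<Sum>k. ennreal ((norm (\<phi> k z))\<^sup>2) * indicator A z) \<partial>lebesgue)"
      by (subst nnM) simp_all
    also have "\<dots> = (\<integral>\<^sup>+z. ennreal (f z) * indicator A z \<partial>lebesgue)"
      by (simp add: ennreal_suminf_multc nsum)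
    also have "\<dots> = emeasure (density lebesgue (\<lambda>z. ennreal (f z))) A"
      by (rule emeasure_density[symmetric]) measurable
    also have "\<dots> = emeasure (density_measure f) A"
      unfolding density_measure_def by (subst emeasure_distr) (use A id_meas in auto)
    finally show "emeasure (distr \<pi> borel snd) A = emeasure (density_measure f) A" .
  qed (simp add: density_measure_def)
  have rep: "has_bochner_integral \<mu> (\<lambda>P. cinner x (blinfun_apply P y)) (cinner x (blinfun_apply R y))" for x y
  proof -
    let ?F = "\<lambda>P. cinner x (blinfun_apply P y)"
    let ?g = "\<lambda>v. cinner x (blinfun_apply (rank_one_op (unitize (\<phi> (fst v) (snd v)))) y)"
    have Fm: "?F \<in> borel_measurable (borel_of projector_topology)" by (rule measurable_projector_cinner)
    have Fg: "?F (fst (G (h v))) = ?g v" for v by (cases v) (simp add: Gh_eq)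
    have gm: "?g \<in> borel_measurable M"
      using measurable_compose[OF fGh Fm] unfolding Fg .
    \<comment> \<open>Entries of projectors are bounded and \<open>M\<close> is a probability
      measure, which licenses the use of Fubini for the weighted series below.\<close>
    have gi: "integrable M ?g"
      by (rule M.integrable_const_bound[of _ "norm x * norm y"])
         (use gm in \<open>auto intro!: AE_I2 cinner_rank_one_op_le\<close>)
    have w_eq: "w v *\<^sub>R ?g v = cinner x (\<phi> (fst v) (snd v)) * cinner (\<phi> (fst v) (snd v)) y" for v
      using cinner_rank_one_unitize[of "\<phi> (fst v) (snd v)" x y]
      by (simp add: w_def case_prod_beta scaleR_conv_of_real)
    have gm': "?g \<in> borel_measurable ?NZ" using gm by (simp add: M_def)
    have wi: "integrable ?NZ (\<lambda>v. w v *\<^sub>R ?g v)"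
      using gi gm' unfolding M_def by (subst (asm) integrable_density) (auto simp: w_def)
    have cp: "(\<lambda>(k, z). w (k, z) *\<^sub>R ?g (k, z)) = (\<lambda>v. w v *\<^sub>R ?g v)" by auto
    have wi': "integrable ?NZ (\<lambda>(k, z). w (k, z) *\<^sub>R ?g (k, z))" unfolding cp by (rule wi)
    have "integral\<^sup>L M ?g = integral\<^sup>L ?NZ (\<lambda>v. w v *\<^sub>R ?g v)"
      unfolding M_def by (rule integral_density) (use gm' in \<open>auto simp: w_def\<close>)
    also have "\<dots> = (LINT z|lebesgue. (LINT k|count_space UNIV. w (k, z) *\<^sub>R ?g (k, z)))"
      using NZ.integral_snd[OF wi'] unfolding cp by (rule sym)
    also have "\<dots> = (LINT z|lebesgue. cinner x (blinfun_apply (Q z) y))"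
    proof (rule integral_cong_AE)
      have "AE z in lebesgue. integrable (count_space UNIV) (\<lambda>k. w (k, z) *\<^sub>R ?g (k, z))"
        by (rule NZ.AE_integrable_snd[OF wi'])
      then show "AE z in lebesgue. (LINT k|count_space UNIV. w (k, z) *\<^sub>R ?g (k, z)) = cinner x (blinfun_apply (Q z) y)"
      proof eventually_elim
        case (elim z)
        \<comment> \<open>For almost every \<open>z\<close> the inner integral over indices is an
          absolutely convergent series, and the decomposition identifies its sum.\<close>
        from sums_integral_count_space_nat[OF elim]
        have "(\<lambda>k. cinner x (\<phi> k z) * cinner (\<phi> k z) y) sums (LINT k|count_space UNIV. w (k, z) *\<^sub>R ?g (k, z))"
          unfolding w_eq by simp
        from sums_unique2[OF this decomposes_form[OF dec]] show ?case .
      qed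
      show "(\<lambda>z. LINT k|count_space UNIV. w (k, z) *\<^sub>R ?g (k, z)) \<in> borel_measurable lebesgue"
        using NZ.integrable_snd[OF wi'] by (rule borel_measurable_integrable)
    qed (rule coupling_measurable[OF Q])
    also have "\<dots> = cinner x (blinfun_apply R y)"
      by (rule has_bochner_integral_integral_eq[OF coupling_integral[OF Q]])
    finally have "has_bochner_integral M ?g (cinner x (blinfun_apply R y))"
      using gi by (simp add: has_bochner_integral_iff)
    then show ?thesis
      unfolding \<mu>_def has_bochner_integral_iff
      by (simp add: integrable_distr_eq[OF fGh Fm] integral_distr[OF fGh Fm] Fg)
  qed
  have costeq: "(\<integral>\<^sup>+p. cost lam hbar p \<partial>\<pi>) = (\<integral>\<^sup>+z. trace_cost lam hbar z (Q z) \<partial>lebesgue)"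
  proof -
    have cm: "cost lam hbar \<in> borel_measurable (borel_of plan_topology)" by (rule measurable_plan_cost[OF hbar])
    have cGh: "(\<lambda>x. cost lam hbar (G (h x))) \<in> borel_measurable ?NZ"
      using measurable_compose[OF Gh cm] by (simp add: M_def)
    have "(\<integral>\<^sup>+p. cost lam hbar p \<partial>\<pi>) = (\<integral>\<^sup>+x. cost lam hbar (G (h x)) \<partial>M)"
      unfolding \<pi>_def by (rule nn_integral_distr[OF Gh]) (use cm in simp)
    also have "\<dots> = (\<integral>\<^sup>+z. (\<Sum>k. ennreal ((norm (\<phi> k z))\<^sup>2) * cost lam hbar (G (h (k, z)))) \<partial>lebesgue)"
      by (rule nnM[OF cGh])
    also have "\<dots> = (\<integral>\<^sup>+z. opcost lam hbar z (Q z) \<partial>lebesgue)"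
      unfolding Gh_eq cost_unitize[OF hbar] suminf_cost_form[OF hbar dec] ..
    finally show ?thesis
      by (simp add: trace_cost_eq_opcost[OF hbar coupling_psd[OF Q]])
  qed
  have "\<mu> \<in> representing_measures R" using rad\<mu> rep by (simp add: representing_measures_def)
  moreover have "\<pi> \<in> transport_plans \<mu> (density_measure f)"
    using rad\<pi> marg1 marg2 by (simp add: transport_plans_def)
  ultimately show ?thesis using costeq by blast
qed

section \<open>Operators from positive matrices\<close>

text \<open>Polarisation: reality of the form at \<open>x + y\<close> and at \<open>x + i y\<close>
  determines the imaginary and the real part of the cross terms, which yields
  self-adjointness.\<close>

lemma psdI_form:
  fixes T :: "'d::finite operator"
  assumes cl: "clinear_op T"
    and real: "\<And>x. Im (cinner x (blinfun_apply T x)) = 0" and nonneg: "\<And>x. 0 \<le> Re (cinner x (blinfun_apply T x))"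
  shows "psd T"
proof -
  have scale: "blinfun_apply T (scaleC c x) = scaleC c (blinfun_apply T x)" for c x
    using cl by (simp add: clinear_op_def)
  have "cinner x (blinfun_apply T y) = cinner (blinfun_apply T x) y" for x y
  proof -
    have Im: "Im (cinner x (blinfun_apply T y) + cinner y (blinfun_apply T x)) = 0" for x y
      using real[of "x + y"] real[of x] real[of y]
      by (simp add: blinfun.add_right cinner.add_left cinner.add_right)
    have "Im (\<i> * cinner x (blinfun_apply T y) - \<i> * cinner y (blinfun_apply T x)) = 0"
      using Im[of x "scaleC \<i> y"] by (simp add: scale cinner_scaleC_left cinner_scaleC_right)
    then have "cinner x (blinfun_apply T y) = cnj (cinner y (blinfun_apply T x))"
      using Im[of x y] by (simp add: complex_eq_iff)
    then show ?thesis by (simp add: cinner_commute[of "blinfun_apply T x" y])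
  qed
  then show ?thesis using cl nonneg by (simp add: psd_def self_adjoint_def)
qed

definition matrix_form :: "(nat \<Rightarrow> nat \<Rightarrow> complex) \<Rightarrow> nat \<Rightarrow> (nat \<Rightarrow> complex) \<Rightarrow> complex" where
  "matrix_form m N c = (\<Sum>j<N. \<Sum>k<N. cnj (c j) * c k * m j k)"

definition nonneg_real :: "complex set" where
  "nonneg_real = {z. Im z = 0 \<and> 0 \<le> Re z}"

lemma closed_nonneg_real: "closed nonneg_real"
  unfolding nonneg_real_def
  by (intro closed_Collect_conj closed_Collect_eq closed_Collect_le continuous_intros)

text \<open>Positivity on finite lists from a dense set passes to the limit because the target is
  closed. With a countable \<open>D\<close> this reduces positivity to countably many conditions, as
  an almost everywhere statement requires.\<close>

lemma matrix_form_nonneg_if_dense: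
  assumes D: "\<And>X :: complex set. open X \<Longrightarrow> X \<noteq> {} \<Longrightarrow> \<exists>d\<in>D. d \<in> X"
    and nn: "\<And>l. l \<in> lists D \<Longrightarrow> matrix_form m (length l) (\<lambda>j. l ! j) \<in> nonneg_real"
  shows "matrix_form m N c \<in> nonneg_real"
proof -
  have "\<exists>d\<in>D. dist (c j) d < inverse (real (Suc n))" for j n
  proof -
    have "ball (c j) (inverse (real (Suc n))) \<noteq> {}" by (simp del: of_nat_Suc)
    from D[OF open_ball this] show ?thesis by (simp del: of_nat_Suc)
  qed
  then have "\<exists>d. d \<in> D \<and> dist (c j) d < inverse (real (Suc n))" for j n by blast
  note ex = someI_ex[OF this]
  define d where "d n j = (SOME d. d \<in> D \<and> dist (c j) d < inverse (real (Suc n)))" for n j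
  have d: "d n j \<in> D" "dist (c j) (d n j) < inverse (real (Suc n))" for n j
    using ex[of j n] by (simp_all only: d_def)
  have lim: "(\<lambda>n. d n j) \<longlonglongrightarrow> c j" for j
  proof (rule metric_tendsto_imp_tendsto[OF LIMSEQ_inverse_real_of_nat])
    have "dist (d n j) (c j) \<le> dist (inverse (real (Suc n))) 0" for n
      using d(2)[of j n] by (simp add: dist_commute dist_real_def del: of_nat_Suc)
    then show "\<forall>\<^sub>F n in sequentially. dist (d n j) (c j) \<le> dist (inverse (real (Suc n))) 0" by simp
  qed
  have conv: "(\<lambda>n. matrix_form m N (d n)) \<longlonglongrightarrow> matrix_form m N c"
    unfolding matrix_form_def by (intro tendsto_intros lim)
  have "matrix_form m N (d n) \<in> nonneg_real" for n
  proof -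
    have "matrix_form m N (d n) = matrix_form m (length (map (d n) [0..<N])) (\<lambda>j. map (d n) [0..<N] ! j)"
      by (simp add: matrix_form_def)
    also have "\<dots> \<in> nonneg_real" by (rule nn) (use d(1) in auto)
    finally show ?thesis .
  qed
  from closed_sequentially[OF closed_nonneg_real this conv] show ?thesis .
qed

lemma matrix_Cauchy_Schwarz:
  fixes m :: "nat \<Rightarrow> nat \<Rightarrow> complex"
  assumes nn: "\<And>N c. matrix_form m N c \<in> nonneg_real"
  shows "(cmod (m j k))\<^sup>2 \<le> Re (m j j) * Re (m k k)" and "0 \<le> Re (m j j)"
proof -
  define N where "N = Suc (max j k)"
  txt \<open>The matrix is realised on \<open>L\<^sup>2(\<real>)\<close> so that the Cauchy-Schwarz inequality for positive
    operators applies.\<close>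
  define F :: "unit L2 \<Rightarrow> unit L2" where "F x = (\<Sum>a<N. \<Sum>b<N. scaleC (m a b * cinner (bas b) x) (bas a))" for x
  have "bounded_linear F"
  proof -
    have "bounded_linear (\<lambda>x. scaleC (m a b * cinner (bas b) x) (bas a :: unit L2))" for a b
      by (rule bounded_linear_compose[OF scaleC.bounded_linear_left
            bounded_linear_compose[OF bounded_linear_mult_right cinner.bounded_linear_right]])
    then show ?thesis unfolding F_def[abs_def] by (intro bounded_linear_sum)
  qed
  then have T: "blinfun_apply (Blinfun F) = F" by (rule bounded_linear_Blinfun_apply)
  have form: "cinner y (F x) = (\<Sum>a<N. \<Sum>b<N. cinner y (bas a) * (m a b * cinner (bas b) x))" for x y
    by (simp add: F_def cinner.sum_right cinner_scaleC_right mult_ac)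
  have "psd (Blinfun F)"
  proof (rule psdI_form)
    show "clinear_op (Blinfun F)"
      unfolding clinear_op_def T F_def
      by (simp add: scaleC.sum_right scaleC_scaleC cinner_scaleC_right mult_ac)
    have "cinner x (F x) = matrix_form m N (\<lambda>j. cinner (bas j) x)" for x
      unfolding form matrix_form_def by (simp add: cinner_commute[of x] mult_ac)
    then have "cinner x (F x) \<in> nonneg_real" for x using nn by simp
    then show "Im (cinner x (blinfun_apply (Blinfun F) x)) = 0" "0 \<le> Re (cinner x (blinfun_apply (Blinfun F) x))" for x
      unfolding T by (auto simp: nonneg_real_def)
  qed
  moreover have "cinner (bas a) (F (bas b)) = m a b" if "a < N" "b < N" for a b
  proof -
    have "cinner (bas a) (F (bas b)) = (\<Sum>a'<N. \<Sum>b'<N. if a' = a then if b' = b then m a b else 0 else 0)"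
      unfolding form cinner_bas by (intro sum.cong refl) auto
    also have "\<dots> = (\<Sum>a'<N. if a' = a then (\<Sum>b'<N. if b' = b then m a b else 0) else 0)"
      by (intro sum.cong refl) (simp split: if_split)
    also have "\<dots> = m a b" using that by simp
    finally show ?thesis .
  qed
  moreover have "j < N" "k < N" by (simp_all add: N_def)
  ultimately show "(cmod (m j k))\<^sup>2 \<le> Re (m j j) * Re (m k k)" "0 \<le> Re (m j j)"
    using psd_Cauchy_Schwarz[of "Blinfun F" "bas j" "bas k"] psd_nonneg[of "Blinfun F" "bas j"]
    unfolding T by simp_all
qed

text \<open>Cauchy-Schwarz for the entries and the convergent diagonal make row \<open>j\<close>
  square-summable with squared norm at most \<open>Re (m j j) * t\<close>. Rows therefore represent
  vectors \<open>r j\<close>, and \<open>F x\<close> with coefficients \<open>cinner (r j) x\<close>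
  is bounded by \<open>t * norm x\<close>; positivity passes from finite sections to the
  limit.\<close>

theorem ex_operator_of_matrix:
  fixes m :: "nat \<Rightarrow> nat \<Rightarrow> complex"
  assumes nn: "\<And>N c. matrix_form m N c \<in> nonneg_real" and tr: "(\<lambda>j. Re (m j j)) sums t"
  shows "\<exists>Q :: 'd::finite operator. psd Q \<and> diag_sums Q t \<and> (\<forall>j k. cinner (bas j) (blinfun_apply Q (bas k)) = m j k)"
proof -
  note CS = matrix_Cauchy_Schwarz[OF nn]
  have t0: "0 \<le> t" using sums_le[OF CS(2) sums_zero tr] .
  have row: "summable (\<lambda>k. (cmod (m j k))\<^sup>2)" "(\<Sum>k. (cmod (m j k))\<^sup>2) \<le> Re (m j j) * t" for j
  proof -
    have s: "(\<lambda>k. Re (m j j) * Re (m k k)) sums (Re (m j j) * t)" by (rule sums_mult[OF tr])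
    show *: "summable (\<lambda>k. (cmod (m j k))\<^sup>2)"
      by (rule summable_comparison_test'[OF sums_summable[OF s], of 0]) (use CS(1) in auto)
    show "(\<Sum>k. (cmod (m j k))\<^sup>2) \<le> Re (m j j) * t"
      by (rule sums_le[OF CS(1) summable_sums[OF *] s])
  qed
  \<comment> \<open>The conjugate compensates the antilinear first slot, so that
    \<open>cinner (r j) (bas k)\<close> is \<open>m j k\<close>.\<close>
  have "\<exists>r :: 'd L2. (\<lambda>k. scaleC (cnj (m j k)) (bas k)) sums r" for j
    using Riesz_Fischer[OF orthonormal_seq_bas, of "\<lambda>k. cnj (m j k)"] row(1)[of j] by (auto simp: summable_def)
  then obtain r :: "nat \<Rightarrow> 'd L2" where r: "\<And>j. (\<lambda>k. scaleC (cnj (m j k)) (bas k)) sums r j" by metis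
  have rb: "cinner (bas k) (r j) = cnj (m j k)" for j k
    by (rule cinner_sums_orthonormal_seq[OF orthonormal_seq_bas r])
  have rb': "cinner (r j) (bas k) = m j k" for j k
    using rb[of k j] by (subst cinner_commute) simp
  have "(norm (r j))\<^sup>2 = (\<Sum>k. (cmod (m j k))\<^sup>2)" for j
    using Parseval_norm[of "r j"] by (simp add: rb sums_iff)
  then have rn: "(norm (r j))\<^sup>2 \<le> Re (m j j) * t" for j using row(2) by simp
  have coef: "(cmod (cinner (r j) x))\<^sup>2 \<le> Re (m j j) * (t * (norm x)\<^sup>2)" for j x
  proof -
    have "(cmod (cinner (r j) x))\<^sup>2 \<le> (norm (r j) * norm x)\<^sup>2" by (intro power_mono cmod_cinner_le) auto
    also have "\<dots> \<le> Re (m j j) * t * (norm x)\<^sup>2"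
      unfolding power_mult_distrib by (intro mult_right_mono rn) auto
    finally show ?thesis by (simp add: mult.assoc)
  qed
  have csum: "(\<lambda>j. Re (m j j) * (t * (norm x)\<^sup>2)) sums (t * (t * (norm x)\<^sup>2))" for x :: "'d L2"
    by (rule sums_mult2[OF tr])
  have sumc: "summable (\<lambda>j. (cmod (cinner (r j) x))\<^sup>2)" for x
    by (rule summable_comparison_test'[OF sums_summable[OF csum], of 0]) (use coef in auto)
  have "\<exists>y :: 'd L2. (\<lambda>j. scaleC (cinner (r j) x) (bas j)) sums y" for x
    using Riesz_Fischer[OF orthonormal_seq_bas sumc[of x]] by (auto simp: summable_def)
  then obtain F :: "'d L2 \<Rightarrow> 'd L2" where F: "\<And>x. (\<lambda>j. scaleC (cinner (r j) x) (bas j)) sums F x" by metis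
  have Fb: "cinner (bas j) (F x) = cinner (r j) x" for j x
    by (rule cinner_sums_orthonormal_seq[OF orthonormal_seq_bas F])
  have eqI: "a = b" if "\<And>j. cinner (bas j) a = cinner (bas j) b" for a b :: "'d L2"
  proof -
    have "a - b = 0" by (rule eq_0_if_orthogonal_bas) (simp add: cinner.diff_right that)
    then show ?thesis by simp
  qed
  have Fn: "norm (F x) \<le> norm x * t" for x
  proof -
    have "(norm (F x))\<^sup>2 \<le> t * (t * (norm x)\<^sup>2)"
      by (rule sums_le[OF _ Parseval_norm csum]) (simp add: Fb coef)
    also have "\<dots> = (norm x * t)\<^sup>2" by (simp add: power2_eq_square mult_ac)
    finally show ?thesis by (rule power2_le_imp_le) (use t0 in simp)
  qed
  have "bounded_linear F"
  proof (rule bounded_linear_intro[OF _ _ Fn])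
    show "F (x + y) = F x + F y" for x y by (rule eqI) (simp add: Fb cinner.add_right)
    show "F (s *\<^sub>R x) = s *\<^sub>R F x" for s x by (rule eqI) (simp add: Fb cinner.scaleR_right)
  qed
  then have T: "blinfun_apply (Blinfun F) = F" by (rule bounded_linear_Blinfun_apply)
  have scale: "F (scaleC c x) = scaleC c (F x)" for c x by (rule eqI) (simp add: Fb cinner_scaleC_right)
  have "cinner x (F x) \<in> nonneg_real" for x
  proof -
    define P where "P N = (\<Sum>k<N. scaleC (cinner (bas k) x) (bas k :: 'd L2))" for N
    have P: "P \<longlonglongrightarrow> x" using bas_expansion[of x] by (simp add: sums_def P_def[abs_def])
    have conv: "(\<lambda>N. cinner (P N) (F (P N))) \<longlonglongrightarrow> cinner x (F x)"
      by (intro cinner.tendsto P bounded_linear.tendsto[OF \<open>bounded_linear F\<close>])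
    have "cinner (P N) (F (P N)) = matrix_form m N (\<lambda>j. cinner (bas j) x)" for N
      unfolding matrix_form_def
      by (simp add: P_def cinner.sum_left cinner_scaleC_left Fb cinner.sum_right cinner_scaleC_right rb'
          sum_distrib_left mult_ac)
    then have "cinner (P N) (F (P N)) \<in> nonneg_real" for N using nn by simp
    from closed_sequentially[OF closed_nonneg_real this conv] show ?thesis .
  qed
  then have "psd (Blinfun F)"
    by (intro psdI_form) (auto simp: clinear_op_def T scale nonneg_real_def)
  moreover have mk: "cinner (bas j) (blinfun_apply (Blinfun F) (bas k)) = m j k" for j k
    unfolding T Fb rb' ..
  moreover have "diag_sums (Blinfun F) t" unfolding diag_sums_def mk by (rule tr)
  ultimately show ?thesis by blast
qed

section \<open>Conditional densities\<close>

text \<open>The image under \<open>Z\<close> of the measure with density \<open>h\<close> is at most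
  \<open>C\<close> times the law of \<open>Z\<close>, hence finite and absolutely continuous. The
  Radon-Nikodym density is finite almost everywhere and can be replaced by a real function.\<close>

lemma ex_density_nonneg:
  fixes \<pi> :: "'a measure" and Z :: "'a \<Rightarrow> 'b::euclidean_space" and h :: "'a \<Rightarrow> real"
  assumes \<pi>: "finite_measure \<pi>" and Z: "Z \<in> borel_measurable \<pi>"
    and ac: "\<And>A. A \<in> null_sets lborel \<Longrightarrow> emeasure \<pi> (Z -` A \<inter> space \<pi>) = 0"
    and h: "h \<in> borel_measurable \<pi>" "\<And>w. w \<in> space \<pi> \<Longrightarrow> 0 \<le> h w" "\<And>w. w \<in> space \<pi> \<Longrightarrow> h w \<le> C"
  shows "\<exists>g. g \<in> borel_measurable borel \<and> (\<forall>z. 0 \<le> g z) \<and> integrable lborel g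
    \<and> distr (density \<pi> (\<lambda>w. ennreal (h w))) borel Z = density lborel (\<lambda>z. ennreal (g z))"
proof -
  interpret finite_measure \<pi> by (rule \<pi>)
  note [measurable] = Z h(1)
  let ?N = "distr (density \<pi> (\<lambda>w. ennreal (h w))) borel Z"
  have em: "emeasure ?N A = (\<integral>\<^sup>+w. ennreal (h w) * indicator (Z -` A \<inter> space \<pi>) w \<partial>\<pi>)" if A: "A \<in> sets borel" for A
  proof -
    have "emeasure ?N A = emeasure (density \<pi> (\<lambda>w. ennreal (h w))) (Z -` A \<inter> space \<pi>)"
      by (subst emeasure_distr) (use A in auto)
    also have "\<dots> = (\<integral>\<^sup>+w. ennreal (h w) * indicator (Z -` A \<inter> space \<pi>) w \<partial>\<pi>)"
      by (rule emeasure_density) (use A in measurable)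
    finally show ?thesis .
  qed
  have le: "emeasure ?N A \<le> ennreal C * emeasure \<pi> (Z -` A \<inter> space \<pi>)" if A: "A \<in> sets borel" for A
  proof -
    have "emeasure ?N A \<le> (\<integral>\<^sup>+w. ennreal C * indicator (Z -` A \<inter> space \<pi>) w \<partial>\<pi>)"
      unfolding em[OF A] by (intro nn_integral_mono mult_right_mono ennreal_leI h) auto
    also have "\<dots> = ennreal C * emeasure \<pi> (Z -` A \<inter> space \<pi>)"
      by (rule nn_integral_cmult_indicator) (use A in measurable)
    finally show ?thesis .
  qed
  have "absolutely_continuous lborel ?N"
    unfolding absolutely_continuous_def
  proof
    fix A :: "'b set" assume A: "A \<in> null_sets lborel"
    then have "emeasure ?N A \<le> 0" using le[of A] ac[OF A] by auto
    then show "A \<in> null_sets ?N" using A by (intro null_setsI) auto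
  qed
  then obtain g0 where g0 [measurable]: "g0 \<in> borel_measurable lborel" and eq: "density lborel g0 = ?N"
    using sigma_finite_measure.Radon_Nikodym[OF sigma_finite_lborel, of ?N] by auto
  have "(\<integral>\<^sup>+z. g0 z \<partial>lborel) = emeasure (density lborel g0) UNIV"
    by (subst emeasure_density) auto
  also have "\<dots> \<le> ennreal C * emeasure \<pi> (space \<pi>)" unfolding eq using le[of UNIV] by simp
  also have "\<dots> < \<infinity>" by (simp add: ennreal_mult_eq_top_iff less_top[symmetric])
  finally have fin: "(\<integral>\<^sup>+z. g0 z \<partial>lborel) < \<infinity>" .
  then have "AE z in lborel. g0 z \<noteq> \<infinity>" by (intro nn_integral_PInf_AE) auto
  then have g0_eq: "AE z in lborel. ennreal (enn2real (g0 z)) = g0 z"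
    by eventually_elim (simp add: less_top)
  define g where "g z = enn2real (g0 z)" for z
  have [measurable]: "g \<in> borel_measurable borel" using g0 unfolding g_def by measurable
  have "(\<integral>\<^sup>+z. ennreal (g z) \<partial>lborel) = (\<integral>\<^sup>+z. g0 z \<partial>lborel)"
    by (rule nn_integral_cong_AE) (use g0_eq in \<open>simp add: g_def\<close>)
  then have "integrable lborel g" using fin by (intro integrableI_nonneg) (auto simp: g_def)
  moreover have "density lborel (\<lambda>z. ennreal (g z)) = density lborel g0"
    by (rule density_cong) (use g0_eq in \<open>auto simp: g_def\<close>)
  ultimately show ?thesis using eq by (intro exI[of _ g]) (auto simp: g_def)
qed

text \<open>The conditional expectation of \<open>h\<close> given \<open>Z\<close>, multiplied by
  the density of the law of \<open>Z\<close>. It is tested against bounded Borel functions, not only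
  indicators, because the phases \<open>testcoeff\<close> must later be integrated along with the
  entries.\<close>

definition conditional_density :: "'a measure \<Rightarrow> ('a \<Rightarrow> 'b::euclidean_space) \<Rightarrow> ('a \<Rightarrow> complex) \<Rightarrow> ('b \<Rightarrow> complex) \<Rightarrow> bool" where
  "conditional_density \<pi> Z h g \<longleftrightarrow> integrable lborel g \<and>
     (\<forall>a\<in>borel_measurable borel. (\<exists>B. \<forall>z. cmod (a z) \<le> B) \<longrightarrow>
        (LINT w|\<pi>. a (Z w) * h w) = (LINT z|lborel. a z * g z))"

lemma conditional_densityD:
  "conditional_density \<pi> Z h g \<Longrightarrow> a \<in> borel_measurable borel \<Longrightarrow> \<forall>z. cmod (a z) \<le> B \<Longrightarrow>
    (LINT w|\<pi>. a (Z w) * h w) = (LINT z|lborel. a z * g z)"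
  unfolding conditional_density_def by blast

lemma ex_conditional_density:
  fixes \<pi> :: "'a measure" and Z :: "'a \<Rightarrow> 'b::euclidean_space" and h :: "'a \<Rightarrow> complex"
  assumes \<pi>: "finite_measure \<pi>" and Z: "Z \<in> borel_measurable \<pi>"
    and ac: "\<And>A. A \<in> null_sets lborel \<Longrightarrow> emeasure \<pi> (Z -` A \<inter> space \<pi>) = 0"
    and h: "h \<in> borel_measurable \<pi>" "\<And>w. w \<in> space \<pi> \<Longrightarrow> cmod (h w) \<le> C"
  shows "\<exists>g. conditional_density \<pi> Z h g"
proof -
  interpret finite_measure \<pi> by (rule \<pi>)
  note [measurable] = Z h(1)
  have real_case: "\<exists>g. conditional_density \<pi> Z (\<lambda>w. of_real (k w)) g"
    if k [measurable]: "k \<in> borel_measurable \<pi>" and b: "\<And>w. w \<in> space \<pi> \<Longrightarrow> 0 \<le> k w" "\<And>w. w \<in> space \<pi> \<Longrightarrow> k w \<le> C'" for k C'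
  proof -
    obtain g where g [measurable]: "g \<in> borel_measurable borel" and g0: "\<And>z. 0 \<le> g z" and gi: "integrable lborel g"
      and eq: "distr (density \<pi> (\<lambda>w. ennreal (k w))) borel Z = density lborel (\<lambda>z. ennreal (g z))"
      using ex_density_nonneg[OF \<pi> Z ac k b] by blast
    have "(LINT w|\<pi>. a (Z w) * of_real (k w)) = (LINT z|lborel. a z * of_real (g z))"
      if [measurable]: "a \<in> borel_measurable borel" for a :: "'b \<Rightarrow> complex"
    proof -
      have "(LINT w|\<pi>. a (Z w) * of_real (k w)) = (LINT w|\<pi>. k w *\<^sub>R a (Z w))"
        by (simp add: scaleR_conv_of_real mult.commute)
      also have "\<dots> = (LINT w|density \<pi> (\<lambda>w. ennreal (k w)). a (Z w))"
        by (rule integral_density[symmetric]) (use b in \<open>auto intro!: AE_I2\<close>)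
      also have "\<dots> = (LINT z|distr (density \<pi> (\<lambda>w. ennreal (k w))) borel Z. a z)"
        by (rule integral_distr[symmetric]) measurable
      also have "\<dots> = (LINT z|lborel. g z *\<^sub>R a z)"
        unfolding eq by (rule integral_density) (use g0 in auto)
      also have "\<dots> = (LINT z|lborel. a z * of_real (g z))"
        by (simp add: scaleR_conv_of_real mult.commute)
      finally show ?thesis .
    qed
    then show ?thesis
      using gi by (intro exI[of _ "\<lambda>z. of_real (g z)"]) (auto simp: conditional_density_def)
  qed
  have C0: "\<bar>Re (h w)\<bar> \<le> C" "\<bar>Im (h w)\<bar> \<le> C" if "w \<in> space \<pi>" for w
    using abs_Re_le_cmod[of "h w"] abs_Im_le_cmod[of "h w"] h(2)[OF that] by linarith+
  \<comment> \<open>Radon-Nikodym is available for nonnegative functions only, so real and imaginary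
    parts are shifted upwards by \<open>C\<close>; the density \<open>g3\<close> of the constant
    undoes the shift.\<close>
  obtain g1 where g1: "conditional_density \<pi> Z (\<lambda>w. of_real (Re (h w) + C)) g1"
    using real_case[of "\<lambda>w. Re (h w) + C" "2 * C"] C0 by (fastforce simp: abs_le_iff)
  obtain g2 where g2: "conditional_density \<pi> Z (\<lambda>w. of_real (Im (h w) + C)) g2"
    using real_case[of "\<lambda>w. Im (h w) + C" "2 * C"] C0 by (fastforce simp: abs_le_iff)
  \<comment> \<open>On an empty space the bound \<open>C\<close> could be negative, hence the
    absolute value; in the nonempty case it equals \<open>C\<close>.\<close>
  obtain g3 where g3: "conditional_density \<pi> Z (\<lambda>w. of_real \<bar>C\<bar>) g3"
    using real_case[of "\<lambda>w. \<bar>C\<bar>" "\<bar>C\<bar>"] by auto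
  show ?thesis
  proof (cases "space \<pi> = {}")
    case True
    have "(LINT w|\<pi>. F w) = 0" for F :: "'a \<Rightarrow> complex"
      using Bochner_Integration.integral_cong[of \<pi> \<pi> F "\<lambda>_. 0"] True by simp
    then show ?thesis by (intro exI[of _ "\<lambda>z. 0"]) (simp add: conditional_density_def)
  next
    case False
    then have C: "0 \<le> C" using h(2) norm_ge_zero order_trans by blast
    define g where "g z = (g1 z - g3 z) + \<i> * (g2 z - g3 z)" for z
    have gi: "integrable lborel g1" "integrable lborel g2" "integrable lborel g3"
      using g1 g2 g3 by (auto simp: conditional_density_def)
    have "(LINT w|\<pi>. a (Z w) * h w) = (LINT z|lborel. a z * g z)"
      if a [measurable]: "a \<in> borel_measurable borel" and B: "\<forall>z. cmod (a z) \<le> B" for a :: "'b \<Rightarrow> complex" and B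
    proof -
      have i\<pi>: "integrable \<pi> (\<lambda>w. a (Z w) * of_real (k w))"
        if [measurable]: "k \<in> borel_measurable \<pi>" and b: "\<And>w. w \<in> space \<pi> \<Longrightarrow> \<bar>k w\<bar> \<le> C'" for k C'
      proof (rule integrable_const_bound[of _ "B * C'"])
        have "0 \<le> B" using B norm_ge_zero order_trans by blast
        then show "AE w in \<pi>. norm (a (Z w) * of_real (k w)) \<le> B * C'"
          unfolding norm_mult norm_of_real using B b by (intro AE_I2 mult_mono) auto
      qed measurable
      have il: "integrable lborel (\<lambda>z. a z * G z)" if "integrable lborel G" for G :: "'b \<Rightarrow> complex"
        by (rule Bochner_Integration.integrable_bound[OF integrable_mult_right[OF integrable_norm[OF that], of B]])
           (use that B in \<open>auto simp: norm_mult intro!: AE_I2 mult_right_mono order_trans[OF _ abs_ge_self]\<close>)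
      have b: "\<bar>Re (h w) + C\<bar> \<le> 2 * C" "\<bar>Im (h w) + C\<bar> \<le> 2 * C" if "w \<in> space \<pi>" for w
        using C0[OF that] by (auto simp: abs_le_iff)
      have i1: "integrable \<pi> (\<lambda>w. a (Z w) * of_real (Re (h w) + C))"
        by (rule i\<pi>[OF _ b(1)]) measurable
      have i2: "integrable \<pi> (\<lambda>w. a (Z w) * of_real (Im (h w) + C))"
        by (rule i\<pi>[OF _ b(2)]) measurable
      have i3: "integrable \<pi> (\<lambda>w. a (Z w) * of_real \<bar>C\<bar>)"
        by (rule i\<pi>[of _ "\<bar>C\<bar>"]) auto
      have e: "(LINT w|\<pi>. a (Z w) * of_real (Re (h w) + C)) = (LINT z|lborel. a z * g1 z)"
        "(LINT w|\<pi>. a (Z w) * of_real (Im (h w) + C)) = (LINT z|lborel. a z * g2 z)"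
        "(LINT w|\<pi>. a (Z w) * of_real \<bar>C\<bar>) = (LINT z|lborel. a z * g3 z)"
        by (rule conditional_densityD[OF g1 a B] conditional_densityD[OF g2 a B] conditional_densityD[OF g3 a B])+
      have "a (Z w) * h w = (a (Z w) * of_real (Re (h w) + C) - a (Z w) * of_real \<bar>C\<bar>)
          + \<i> * (a (Z w) * of_real (Im (h w) + C) - a (Z w) * of_real \<bar>C\<bar>)" for w
        using C by (subst complex_eq[of "h w"]) (simp add: algebra_simps)
      then have "(LINT w|\<pi>. a (Z w) * h w) = ((LINT z|lborel. a z * g1 z) - (LINT z|lborel. a z * g3 z))
          + \<i> * ((LINT z|lborel. a z * g2 z) - (LINT z|lborel. a z * g3 z))"
        unfolding e[symmetric]
        by (simp only: Bochner_Integration.integral_add Bochner_Integration.integral_diff integral_mult_right_zero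
            Bochner_Integration.integrable_diff integrable_mult_right i1 i2 i3)
      also have "\<dots> = (LINT z|lborel. (a z * g1 z - a z * g3 z) + \<i> * (a z * g2 z - a z * g3 z))"
        by (simp only: Bochner_Integration.integral_add Bochner_Integration.integral_diff integral_mult_right_zero
            Bochner_Integration.integrable_diff integrable_mult_right il gi)
      also have "\<dots> = (LINT z|lborel. a z * g z)"
        by (simp add: g_def algebra_simps)
      finally show ?thesis .
    qed
    moreover have "integrable lborel g"
      unfolding g_def using gi by (intro Bochner_Integration.integrable_add integrable_mult_right Bochner_Integration.integrable_diff)
    ultimately show ?thesis by (intro exI[of _ g]) (auto simp: conditional_density_def)
  qed
qed

section \<open>From transport plans to couplings\<close>

definition bas_part :: "nat \<Rightarrow> 'd::finite L2 \<Rightarrow> 'd L2" where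
  "bas_part N x = (\<Sum>k<N. scaleC (cinner (bas k) x) (bas k))"

lemma bas_part_tendsto: "(\<lambda>N. bas_part N x) \<longlonglongrightarrow> x"
  using bas_expansion[of x] by (simp add: sums_def bas_part_def)

lemma norm_bas_part_le: "norm (bas_part N x) \<le> norm x"
proof (rule power2_le_imp_le)
  show "(norm (bas_part N x))\<^sup>2 \<le> (norm x)\<^sup>2"
    unfolding bas_part_def norm_sum_orthonormal_seq[OF orthonormal_seq_bas finite_lessThan]
    by (rule orthonormal_seq_Bessel[OF orthonormal_seq_bas])
qed simp

lemma bas_part_form:
  assumes "psd T"
  shows "cinner (bas_part N x) (blinfun_apply T (bas_part N y))
    = (\<Sum>j<N. \<Sum>k<N. cinner x (bas j) * cinner (bas k) y * cinner (bas j) (blinfun_apply T (bas k)))"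
  unfolding bas_part_def blinfun.sum_right psd_scaleC[OF assms] cinner.sum_left cinner_scaleC_left
  unfolding cinner.sum_right cinner_scaleC_right sum_distrib_left
  by (simp add: cinner_commute[of x] mult_ac)

lemma psd_bas_part_tendsto:
  "(\<lambda>N. cinner (bas_part N x) (blinfun_apply T (bas_part N y))) \<longlonglongrightarrow> cinner x (blinfun_apply T y)"
  by (intro cinner.tendsto bas_part_tendsto blinfun.tendsto tendsto_const)

lemma sums_if_suminf_ennreal_eq:
  assumes "(\<Sum>j. ennreal (a j)) = ennreal t" "\<And>j. 0 \<le> a j" "0 \<le> t"
  shows "a sums t"
proof -
  have s: "summable a" using assms by (intro summable_suminf_not_top) auto
  have "ennreal (\<Sum>j. a j) = ennreal t"
    using suminf_ennreal_eq[OF assms(2) summable_sums[OF s]] assms(1) by simp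
  then have "(\<Sum>j. a j) = t" using suminf_nonneg[OF s assms(2)] assms(3) by simp
  then show ?thesis using summable_sums[OF s] by simp
qed

lemma diag_sums_scaled_bas: "diag_sums (t *\<^sub>R rank_one_op (bas 0 :: 'd::finite L2)) t"
proof -
  have "Re (cinner (bas k) (blinfun_apply (t *\<^sub>R rank_one_op (bas 0 :: 'd L2)) (bas k))) = (if k = 0 then t else 0)" for k
    by (simp add: blinfun.scaleR_left cinner.scaleR_right Re_cinner_rank_one cinner_bas)
  then show ?thesis unfolding diag_sums_def using sums_single[of 0 "\<lambda>_. t"] by simp
qed

lemma rank_one_diag_suminf:
  assumes "P \<in> rank_one_projectors"
  shows "(\<Sum>j. ennreal (Re (cinner (bas j) (blinfun_apply P (bas j))))) = 1"
proof -
  obtain \<psi> where \<psi>: "norm \<psi> = 1" "P = rank_one_op \<psi>" using assms by (auto simp: rank_one_projectors_def)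
  have "Re (cinner (bas j) (blinfun_apply P (bas j))) = (cmod (cinner (bas j) \<psi>))\<^sup>2" for j
    unfolding \<psi>(2) Re_cinner_rank_one by (simp add: cmod_cinner_commute)
  then show ?thesis by (simp add: Parseval_norm_ennreal \<psi>(1))
qed

lemma integral_nonneg_real:
  assumes "integrable M F" "\<And>w. w \<in> space M \<Longrightarrow> F w \<in> nonneg_real"
  shows "integral\<^sup>L M F \<in> nonneg_real"
proof -
  have "Im (integral\<^sup>L M F) = (LINT w|M. Im (F w))" using assms(1) by simp
  also have "\<dots> = (LINT w|M. 0)"
    by (intro Bochner_Integration.integral_cong refl) (use assms(2) in \<open>simp add: nonneg_real_def\<close>)
  finally have "Im (integral\<^sup>L M F) = 0" by simp
  moreover have "0 \<le> Re (integral\<^sup>L M F)"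
  proof -
    have "0 \<le> (LINT w|M. Re (F w))"
      by (intro Bochner_Integration.integral_nonneg) (use assms(2) in \<open>simp add: nonneg_real_def\<close>)
    then show ?thesis using assms(1) by simp
  qed
  ultimately show ?thesis by (simp add: nonneg_real_def)
qed

lemma nonneg_real_scaleR: "z \<in> nonneg_real \<Longrightarrow> 0 \<le> r \<Longrightarrow> r *\<^sub>R z \<in> nonneg_real"
  by (simp add: nonneg_real_def)

locale transport_plan =
  fixes R :: "'d::finite operator" and f :: "'d phase_space \<Rightarrow> real"
    and \<mu> :: "'d operator measure" and \<pi> :: "('d operator \<times> 'd phase_space) measure"
  assumes f: "probability_density f" and \<mu>: "\<mu> \<in> representing_measures R"
    and \<pi>: "\<pi> \<in> transport_plans \<mu> (density_measure f)"
begin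

lemma f_measurable [measurable]: "f \<in> borel_measurable lebesgue"
  and f_nonneg: "0 \<le> f z" and f_integral: "(\<integral>\<^sup>+z. ennreal (f z) \<partial>lebesgue) = 1"
  using f unfolding probability_density_def by blast+

lemma f_integrable: "integrable lebesgue f"
  by (rule integrableI_nonneg) (auto simp: f_nonneg f_integral)

lemma sets_\<pi> [measurable_cong]: "sets \<pi> = sets (borel_of plan_topology)"
  using \<pi> by (simp add: transport_plans_def radon_probability_def)

lemma space_\<pi>: "space \<pi> = rank_one_projectors \<times> UNIV"
  using sets_eq_imp_space_eq[OF sets_\<pi>] by (simp only: space_plan)

sublocale prob_space \<pi>
  using \<pi> by (simp add: transport_plans_def radon_probability_def)

lemma snd_measurable [measurable]: "snd \<in> borel_measurable \<pi>"
  using measurable_plan_snd by (simp add: measurable_cong_sets[OF sets_\<pi> refl])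

lemma fst_measurable: "fst \<in> \<pi> \<rightarrow>\<^sub>M borel_of projector_topology"
  using measurable_plan_fst by (simp add: measurable_cong_sets[OF sets_\<pi> refl])

definition entry :: "'d L2 \<Rightarrow> 'd L2 \<Rightarrow> 'd operator \<times> 'd phase_space \<Rightarrow> complex" where
  "entry x y w = cinner x (blinfun_apply (fst w) y)"

lemma entry_measurable [measurable]: "entry x y \<in> borel_measurable \<pi>"
  unfolding entry_def[abs_def] by (rule measurable_compose[OF fst_measurable measurable_projector_cinner])

lemma entry_le: "w \<in> space \<pi> \<Longrightarrow> cmod (entry x y w) \<le> norm x * norm y"
  using cinner_rank_one_op_le[of _ x y] by (auto simp: space_\<pi> entry_def rank_one_projectors_def)

lemma psd_fst: "w \<in> space \<pi> \<Longrightarrow> psd (fst w)"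
  by (auto simp: space_\<pi> intro: projector_psd)

lemma marginal: "emeasure \<pi> (snd -` A \<inter> space \<pi>) = (\<integral>\<^sup>+z. ennreal (f z) * indicator A z \<partial>lebesgue)"
  if A: "A \<in> sets borel"
proof -
  have "emeasure \<pi> (snd -` A \<inter> space \<pi>) = emeasure (distr \<pi> borel snd) A"
    by (rule emeasure_distr[symmetric]) (use A in auto)
  also have "distr \<pi> borel snd = density_measure f" using \<pi> by (simp add: transport_plans_def)
  also have "emeasure (density_measure f) A = emeasure (density lebesgue (\<lambda>z. ennreal (f z))) A"
    unfolding density_measure_def by (subst emeasure_distr) (use A in \<open>auto simp: measurable_completion\<close>)
  also have "\<dots> = (\<integral>\<^sup>+z. ennreal (f z) * indicator A z \<partial>lebesgue)"
    by (rule emeasure_density) (use A in auto)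
  finally show ?thesis .
qed

text \<open>The second marginal has a Lebesgue density, which provides the absolute continuity
  needed for densities of the entries.\<close>

lemma marginal_null: "emeasure \<pi> (snd -` A \<inter> space \<pi>) = 0" if A: "A \<in> null_sets lborel"
proof -
  have "AE z in lebesgue. z \<notin> A" using null_sets_completionI[OF A] by (rule AE_not_in)
  then have "(\<integral>\<^sup>+z. ennreal (f z) * indicator A z \<partial>lebesgue) = (\<integral>\<^sup>+z. 0 \<partial>(lebesgue :: 'd phase_space measure))"
    by (intro nn_integral_cong_AE) auto
  then show ?thesis using A by (subst marginal) auto
qed

text \<open>Each entry is a separate choice of density, determined only up to a null set, so
  positivity of the matrix at a given \<open>z\<close> is not automatic.\<close>

definition q :: "nat \<Rightarrow> nat \<Rightarrow> 'd phase_space \<Rightarrow> complex" where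
  "q j k = (SOME g. conditional_density \<pi> snd (entry (bas j) (bas k)) g)"

lemma q: "conditional_density \<pi> snd (entry (bas j) (bas k)) (q j k)"
  unfolding q_def
  by (rule someI_ex[of "conditional_density \<pi> snd (entry (bas j) (bas k))"])
     (rule ex_conditional_density[OF finite_measure_axioms snd_measurable marginal_null entry_measurable entry_le])

lemma q_integrable: "integrable lborel (q j k)"
  using q by (simp add: conditional_density_def)

lemma q_measurable [measurable]: "q j k \<in> borel_measurable borel"
  using borel_measurable_integrable[OF q_integrable] by simp

lemma entry_integrable:
  assumes [measurable]: "a \<in> borel_measurable borel" and B: "\<forall>z. cmod (a z) \<le> B"
  shows "integrable \<pi> (\<lambda>w. a (snd w) * entry x y w)"
proof (rule integrable_const_bound[of _ "B * (norm x * norm y)"])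
  have "0 \<le> B" using B norm_ge_zero order_trans by blast
  then show "AE w in \<pi>. norm (a (snd w) * entry x y w) \<le> B * (norm x * norm y)"
    unfolding norm_mult using B entry_le by (intro AE_I2 mult_mono) auto
qed measurable

lemma q_mult_integrable:
  assumes [measurable]: "a \<in> borel_measurable borel" and B: "\<forall>z. cmod (a z) \<le> B"
  shows "integrable lborel (\<lambda>z. a z * q j k z)"
proof (rule Bochner_Integration.integrable_bound[OF integrable_mult_right[OF integrable_norm[OF q_integrable[of j k]], of B]])
  show "AE z in lborel. norm (a z * q j k z) \<le> norm (B * norm (q j k z))"
    using B by (auto simp: norm_mult intro!: AE_I2 mult_right_mono order_trans[OF _ abs_ge_self])
qed measurable

lemma matrix_form_fst:
  assumes w: "w \<in> space \<pi>"
  shows "matrix_form (\<lambda>j k. entry (bas j) (bas k) w) N c \<in> nonneg_real"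
proof -
  define v where "v = (\<Sum>k<N. scaleC (c k) (bas k :: 'd L2))"
  have "cinner v (blinfun_apply (fst w) v) = matrix_form (\<lambda>j k. entry (bas j) (bas k) w) N c"
    unfolding v_def matrix_form_def blinfun.sum_right psd_scaleC[OF psd_fst[OF w]] cinner.sum_left cinner_scaleC_left
    unfolding cinner.sum_right cinner_scaleC_right sum_distrib_left
    by (simp add: entry_def mult_ac)
  then show ?thesis
    using psd_nonneg[OF psd_fst[OF w], of v] psd_Im[OF psd_fst[OF w], of v] by (simp add: nonneg_real_def)
qed

text \<open>By the averaging theorem it is enough that averages over measurable sets lie in the
  closed set \<open>nonneg_real\<close>. Such an average is a nonnegative multiple of an integral of
  forms of projectors against the plan.\<close>

lemma AE_matrix_form: "AE z in lborel. matrix_form (\<lambda>j k. q j k z) N c \<in> nonneg_real"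
proof (rule sigma_finite_measure.averaging_theorem[OF sigma_finite_lborel _ closed_nonneg_real])
  show "integrable lborel (\<lambda>z. matrix_form (\<lambda>j k. q j k z) N c)"
    unfolding matrix_form_def by (intro Bochner_Integration.integrable_sum integrable_mult_right q_integrable)
  fix A :: "'d phase_space set" assume "A \<in> sets lborel"
  then have A [measurable]: "A \<in> sets borel" by simp
  let ?a = "indicator A :: 'd phase_space \<Rightarrow> complex"
  have a: "?a \<in> borel_measurable borel" "\<forall>z. cmod (?a z) \<le> 1" by (auto simp: indicator_def)
  have "set_lebesgue_integral lborel A (\<lambda>z. matrix_form (\<lambda>j k. q j k z) N c)
      = (LINT z|lborel. (\<Sum>j<N. \<Sum>k<N. cnj (c j) * c k * (?a z * q j k z)))"
    unfolding set_lebesgue_integral_def matrix_form_def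
    by (intro Bochner_Integration.integral_cong refl)
       (simp add: scaleR_conv_of_real sum_distrib_left mult_ac of_real_indicator)
  also have "\<dots> = (\<Sum>j<N. \<Sum>k<N. cnj (c j) * c k * (LINT z|lborel. ?a z * q j k z))"
    by (simp only: Bochner_Integration.integral_sum Bochner_Integration.integrable_sum integrable_mult_right
        integral_mult_right_zero q_mult_integrable[OF a])
  also have "\<dots> = (\<Sum>j<N. \<Sum>k<N. cnj (c j) * c k * (LINT w|\<pi>. ?a (snd w) * entry (bas j) (bas k) w))"
    by (simp only: conditional_densityD[OF q a])
  also have "\<dots> = (LINT w|\<pi>. (\<Sum>j<N. \<Sum>k<N. cnj (c j) * c k * (?a (snd w) * entry (bas j) (bas k) w)))"
    by (simp only: Bochner_Integration.integral_sum Bochner_Integration.integrable_sum integrable_mult_right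
        integral_mult_right_zero entry_integrable[OF a])
  also have "\<dots> \<in> nonneg_real"
  proof (rule integral_nonneg_real)
    show "integrable \<pi> (\<lambda>w. \<Sum>j<N. \<Sum>k<N. cnj (c j) * c k * (?a (snd w) * entry (bas j) (bas k) w))"
      by (intro Bochner_Integration.integrable_sum integrable_mult_right entry_integrable[OF a])
    fix w assume w: "w \<in> space \<pi>"
    have "(\<Sum>j<N. \<Sum>k<N. cnj (c j) * c k * (?a (snd w) * entry (bas j) (bas k) w))
        = indicator A (snd w) *\<^sub>R matrix_form (\<lambda>j k. entry (bas j) (bas k) w) N c"
      unfolding matrix_form_def by (simp add: indicator_def)
    also have "\<dots> \<in> nonneg_real" by (rule nonneg_real_scaleR[OF matrix_form_fst[OF w]]) simp
    finally show "(\<Sum>j<N. \<Sum>k<N. cnj (c j) * c k * (?a (snd w) * entry (bas j) (bas k) w)) \<in> nonneg_real" .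
  qed
  finally show "(1 / measure lborel A) *\<^sub>R set_lebesgue_integral lborel A (\<lambda>z. matrix_form (\<lambda>j k. q j k z) N c) \<in> nonneg_real"
    by (rule nonneg_real_scaleR) simp
qed

text \<open>Finite lists over a countable dense set form a countable family of coefficient vectors,
  so one null set serves them all; density then covers arbitrary coefficients.\<close>

lemma AE_matrix_form_all: "AE z in lborel. \<forall>N c. matrix_form (\<lambda>j k. q j k z) N c \<in> nonneg_real"
proof -
  obtain D :: "complex set" where D: "countable D" "\<And>X. open X \<Longrightarrow> X \<noteq> {} \<Longrightarrow> \<exists>d\<in>D. d \<in> X"
    by (rule countable_dense_setE) blast
  have "AE z in lborel. \<forall>l\<in>lists D. matrix_form (\<lambda>j k. q j k z) (length l) (\<lambda>j. l ! j) \<in> nonneg_real"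
    by (subst AE_ball_countable[OF countable_lists[OF D(1)]]) (auto intro: AE_matrix_form)
  then show ?thesis
    by eventually_elim (auto intro: matrix_form_nonneg_if_dense[OF D(2)])
qed

lemma AE_q_diag_nonneg: "AE z in lborel. \<forall>j. 0 \<le> Re (q j j z)"
  using AE_matrix_form_all by eventually_elim (use matrix_Cauchy_Schwarz(2) in blast)

text \<open>Integrated over a Borel set, the diagonal series gives the plan's mass above that set,
  because every projector has trace 1; by the marginal condition \<open>f\<close> gives the same
  mass. Densities of a common measure agree almost everywhere.\<close>

lemma AE_q_trace: "AE z in lborel. (\<lambda>j. Re (q j j z)) sums f z"
proof -
  \<comment> \<open>The comparison takes place over \<open>lborel\<close>, whereas \<open>f\<close>
    is only Lebesgue measurable, so a Borel version is used.\<close>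
  obtain f' where f' [measurable]: "f' \<in> borel_measurable lborel" and ff': "AE z in lborel. f z = f' z"
    using completion_ex_borel_measurable_real[OF f_measurable] by blast
  define F where "F z = (\<Sum>j. ennreal (Re (q j j z)))" for z
  have [measurable]: "F \<in> borel_measurable borel" unfolding F_def by measurable
  have "density lborel F = density lborel (\<lambda>z. ennreal (f' z))"
  proof (rule measure_eqI)
    fix A assume "A \<in> sets (density lborel F)"
    then have A [measurable]: "A \<in> sets borel" by simp
    let ?a = "indicator A :: 'd phase_space \<Rightarrow> complex"
    have a: "?a \<in> borel_measurable borel" "\<forall>z. cmod (?a z) \<le> 1" by (auto simp: indicator_def)
    have entry_nn: "0 \<le> Re (entry (bas j) (bas j) w)" if "w \<in> space \<pi>" for j w
      unfolding entry_def by (rule psd_nonneg[OF psd_fst[OF that]])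
    have eq: "(\<integral>\<^sup>+z. ennreal (Re (q j j z)) * indicator A z \<partial>lborel)
        = (\<integral>\<^sup>+w. ennreal (Re (entry (bas j) (bas j) w)) * indicator A (snd w) \<partial>\<pi>)" for j
    proof -
      have Re_a: "Re (?a z * u) = Re u * indicator A z" for z u by (simp add: indicator_def)
      have "(\<integral>\<^sup>+z. ennreal (Re (q j j z)) * indicator A z \<partial>lborel) = (\<integral>\<^sup>+z. ennreal (Re (?a z * q j j z)) \<partial>lborel)"
        unfolding Re_a by (intro nn_integral_cong) (auto simp: indicator_def)
      also have "\<dots> = ennreal (LINT z|lborel. Re (?a z * q j j z))"
      proof (rule nn_integral_eq_integral[OF integrable_Re[OF q_mult_integrable[OF a]]])
        show "AE z in lborel. 0 \<le> Re (?a z * q j j z)"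
          using AE_q_diag_nonneg unfolding Re_a by eventually_elim auto
      qed
      also have "(LINT z|lborel. Re (?a z * q j j z)) = Re (LINT w|\<pi>. ?a (snd w) * entry (bas j) (bas j) w)"
        unfolding conditional_densityD[OF q a] by (rule integral_Re[OF q_mult_integrable[OF a]])
      also have "\<dots> = (LINT w|\<pi>. Re (?a (snd w) * entry (bas j) (bas j) w))"
        by (rule integral_Re[OF entry_integrable[OF a], symmetric])
      also have "ennreal \<dots> = (\<integral>\<^sup>+w. ennreal (Re (?a (snd w) * entry (bas j) (bas j) w)) \<partial>\<pi>)"
      proof (rule nn_integral_eq_integral[OF integrable_Re[OF entry_integrable[OF a]], symmetric])
        show "AE w in \<pi>. 0 \<le> Re (?a (snd w) * entry (bas j) (bas j) w)"
          unfolding Re_a by (intro AE_I2 mult_nonneg_nonneg entry_nn) auto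
      qed
      also have "\<dots> = (\<integral>\<^sup>+w. ennreal (Re (entry (bas j) (bas j) w)) * indicator A (snd w) \<partial>\<pi>)"
        unfolding Re_a by (intro nn_integral_cong) (auto simp: indicator_def)
      finally show ?thesis .
    qed
    have "emeasure (density lborel F) A = (\<integral>\<^sup>+z. F z * indicator A z \<partial>lborel)"
      by (rule emeasure_density) auto
    also have "\<dots> = (\<Sum>j. \<integral>\<^sup>+z. ennreal (Re (q j j z)) * indicator A z \<partial>lborel)"
      unfolding F_def ennreal_suminf_multc[symmetric] by (rule nn_integral_suminf) measurable
    also have "\<dots> = (\<integral>\<^sup>+w. (\<Sum>j. ennreal (Re (entry (bas j) (bas j) w)) * indicator A (snd w)) \<partial>\<pi>)"
      unfolding eq by (rule nn_integral_suminf[symmetric]) measurable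
    also have "\<dots> = (\<integral>\<^sup>+w. indicator (snd -` A \<inter> space \<pi>) w \<partial>\<pi>)"
    proof (rule nn_integral_cong)
      fix w assume w: "w \<in> space \<pi>"
      then have "(\<Sum>j. ennreal (Re (entry (bas j) (bas j) w))) = 1"
        unfolding entry_def by (intro rank_one_diag_suminf) (auto simp: space_\<pi>)
      then show "(\<Sum>j. ennreal (Re (entry (bas j) (bas j) w)) * indicator A (snd w)) = indicator (snd -` A \<inter> space \<pi>) w"
        using w by (simp add: ennreal_suminf_multc indicator_def)
    qed
    also have "\<dots> = emeasure \<pi> (snd -` A \<inter> space \<pi>)" by (rule nn_integral_indicator) measurable
    also have "\<dots> = (\<integral>\<^sup>+z. ennreal (f z) * indicator A z \<partial>lebesgue)" by (rule marginal[OF A])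
    also have "\<dots> = (\<integral>\<^sup>+z. ennreal (f' z) * indicator A z \<partial>lebesgue)"
      by (rule nn_integral_cong_AE) (use ff' in \<open>auto simp: AE_completion_iff\<close>)
    also have "\<dots> = (\<integral>\<^sup>+z. ennreal (f' z) * indicator A z \<partial>lborel)" by (rule nn_integral_completion) 
    also have "\<dots> = emeasure (density lborel (\<lambda>z. ennreal (f' z))) A"
      by (rule emeasure_density[symmetric]) auto
    finally show "emeasure (density lborel F) A = emeasure (density lborel (\<lambda>z. ennreal (f' z))) A" .
  qed simp
  then have "AE z in lborel. F z = ennreal (f' z)"
    by (subst (asm) sigma_finite_measure.density_unique_iff[OF sigma_finite_lborel]) auto
  with ff' AE_q_diag_nonneg show ?thesis
  proof eventually_elim
    case (elim z)
    then show ?case by (intro sums_if_suminf_ennreal_eq f_nonneg) (simp_all add: F_def)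
  qed
qed

lemma ex_null_set:
  "\<exists>N. N \<in> null_sets lborel \<and> (\<forall>z. z \<notin> N \<longrightarrow>
    (\<exists>T :: 'd operator. psd T \<and> diag_sums T (f z) \<and> (\<forall>j k. cinner (bas j) (blinfun_apply T (bas k)) = q j k z)))"
proof -
  have "AE z in lborel. \<exists>T :: 'd operator. psd T \<and> diag_sums T (f z) \<and> (\<forall>j k. cinner (bas j) (blinfun_apply T (bas k)) = q j k z)"
    using AE_matrix_form_all AE_q_trace by eventually_elim (rule ex_operator_of_matrix, auto)
  then obtain N where "{z \<in> space lborel. \<not> (\<exists>T :: 'd operator. psd T \<and> diag_sums T (f z)
      \<and> (\<forall>j k. cinner (bas j) (blinfun_apply T (bas k)) = q j k z))} \<subseteq> N"
    "emeasure lborel N = 0" "N \<in> sets lborel"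
    by (rule AE_E)
  then show ?thesis by (intro exI[of _ N] conjI null_setsI) (simp_all only: space_lborel space_borel, blast)
qed

definition N :: "'d phase_space set" where
  "N = (SOME N. N \<in> null_sets lborel \<and> (\<forall>z. z \<notin> N \<longrightarrow>
    (\<exists>T :: 'd operator. psd T \<and> diag_sums T (f z) \<and> (\<forall>j k. cinner (bas j) (blinfun_apply T (bas k)) = q j k z))))"

text \<open>A coupling must be positive with trace \<open>f z\<close> at every point, not almost
  every point. On the exceptional Borel null set a multiple of a fixed projector meets these
  requirements without affecting integrals.\<close>

definition Q :: "'d phase_space \<Rightarrow> 'd operator" where
  "Q z = (if z \<in> N then f z *\<^sub>R rank_one_op (bas 0)
    else SOME T. psd T \<and> diag_sums T (f z) \<and> (\<forall>j k. cinner (bas j) (blinfun_apply T (bas k)) = q j k z))"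

lemma N_null: "N \<in> null_sets lborel"
  using someI_ex[OF ex_null_set] unfolding N_def by blast

lemma Q_good:
  assumes "z \<notin> N"
  shows "psd (Q z) \<and> diag_sums (Q z) (f z) \<and> (\<forall>j k. cinner (bas j) (blinfun_apply (Q z) (bas k)) = q j k z)"
proof -
  have "\<exists>T :: 'd operator. psd T \<and> diag_sums T (f z) \<and> (\<forall>j k. cinner (bas j) (blinfun_apply T (bas k)) = q j k z)"
    using someI_ex[OF ex_null_set] assms unfolding N_def by blast
  from someI_ex[OF this] show ?thesis using assms by (simp add: Q_def)
qed

lemma Q_psd: "psd (Q z)" and Q_diag: "diag_sums (Q z) (f z)"
proof -
  have "psd (Q z) \<and> diag_sums (Q z) (f z)"
  proof (cases "z \<in> N")
    case True
    then show ?thesis by (simp add: Q_def psd_scaleR psd_rank_one f_nonneg diag_sums_scaled_bas)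
  qed (use Q_good in blast)
  then show "psd (Q z)" "diag_sums (Q z) (f z)" by auto
qed

lemma lebesgue_measurable: "a \<in> borel_measurable borel \<Longrightarrow> a \<in> borel_measurable (lebesgue :: 'd phase_space measure)"
  by (simp add: measurable_completion)

lemma Q_entry_measurable: "(\<lambda>z. cinner (bas j) (blinfun_apply (Q z) (bas k))) \<in> borel_measurable lebesgue"
proof -
  have "cinner (bas j) (blinfun_apply (Q z) (bas k))
      = (if z \<in> N then of_real (f z) * cinner (bas j) (blinfun_apply (rank_one_op (bas 0 :: 'd L2)) (bas k)) else q j k z)" for z
    using Q_good[of z] by (auto simp: Q_def blinfun.scaleR_left cinner.scaleR_right scaleR_conv_of_real)
  moreover have "N \<in> sets lebesgue" using N_null by auto
  note [measurable] = this lebesgue_measurable[OF q_measurable]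
  have "(\<lambda>z. if z \<in> N then of_real (f z) * cinner (bas j) (blinfun_apply (rank_one_op (bas 0 :: 'd L2)) (bas k)) else q j k z)
      \<in> borel_measurable lebesgue"
    by measurable
  ultimately show ?thesis by simp
qed

lemma Q_measurable: "(\<lambda>z. cinner x (blinfun_apply (Q z) y)) \<in> borel_measurable lebesgue"
proof (rule borel_measurable_LIMSEQ_metric)
  show "(\<lambda>z. cinner (bas_part n x) (blinfun_apply (Q z) (bas_part n y))) \<in> borel_measurable lebesgue" for n
    unfolding bas_part_form[OF Q_psd]
    by (intro borel_measurable_sum borel_measurable_times borel_measurable_const Q_entry_measurable)
qed (rule psd_bas_part_tendsto)

lemma Q_bound:
  assumes "\<forall>z. cmod (a z) \<le> B" "norm x' \<le> norm x" "norm y' \<le> norm y"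
  shows "cmod (a z * cinner x' (blinfun_apply (Q z) y')) \<le> B * (norm x * norm y) * f z"
proof -
  have B: "0 \<le> B" using assms(1) norm_ge_zero order_trans by blast
  have "cmod (cinner x' (blinfun_apply (Q z) y')) \<le> f z * (norm x' * norm y')"
    by (rule psd_cinner_le_trace[OF Q_psd Q_diag])
  also have "\<dots> \<le> f z * (norm x * norm y)"
    by (intro mult_left_mono mult_mono assms f_nonneg) auto
  finally have "cmod (a z) * cmod (cinner x' (blinfun_apply (Q z) y')) \<le> B * (f z * (norm x * norm y))"
    by (intro mult_mono assms(1)[rule_format] B) auto
  then show ?thesis by (simp add: norm_mult mult_ac)
qed

lemma Q_integrable:
  assumes a: "a \<in> borel_measurable borel" and B: "\<forall>z. cmod (a z) \<le> B"
  shows "integrable lebesgue (\<lambda>z. a z * cinner x (blinfun_apply (Q z) y))"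
proof (rule Bochner_Integration.integrable_bound[OF integrable_mult_right[OF f_integrable, of "B * (norm x * norm y)"]])
  show "(\<lambda>z. a z * cinner x (blinfun_apply (Q z) y)) \<in> borel_measurable lebesgue"
    by (intro borel_measurable_times Q_measurable lebesgue_measurable a)
  show "AE z in lebesgue. norm (a z * cinner x (blinfun_apply (Q z) y)) \<le> norm (B * (norm x * norm y) * f z)"
    using Q_bound[OF B order_refl order_refl, of _ x y] by (intro AE_I2) (auto intro: order_trans[OF _ abs_ge_self])
qed

section \<open>Integrals of the reconstructed coupling\<close>

lemma Q_entry_integral:
  assumes a: "a \<in> borel_measurable borel" and B: "\<forall>z. cmod (a z) \<le> B"
  shows "(LINT z|lebesgue. a z * cinner (bas j) (blinfun_apply (Q z) (bas k)))
    = (LINT w|\<pi>. a (snd w) * entry (bas j) (bas k) w)"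
proof -
  have [measurable]: "a \<in> borel_measurable borel" by (rule a)
  have m: "(\<lambda>z. a z * q j k z) \<in> borel_measurable borel" by measurable
  have "AE z in lebesgue. z \<notin> N" using null_sets_completionI[OF N_null] by (rule AE_not_in)
  then have "(LINT z|lebesgue. a z * cinner (bas j) (blinfun_apply (Q z) (bas k))) = (LINT z|lebesgue. a z * q j k z)"
    by (intro integral_cong_AE borel_measurable_times Q_measurable lebesgue_measurable a q_measurable)
       (auto elim!: eventually_mono simp: Q_good)
  also have "\<dots> = (LINT z|lborel. a z * q j k z)" by (rule integral_completion) (use m in simp)
  also have "\<dots> = (LINT w|\<pi>. a (snd w) * entry (bas j) (bas k) w)" by (rule conditional_densityD[OF q a B, symmetric])
  finally show ?thesis .
qed

text \<open>Finite sections of the basis reduce the claim to entries, and dominated convergence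
  removes the truncation: on the operator side the trace bound supplies the majorant
  \<open>f\<close>, on the plan side projectors are bounded by 1. The weight \<open>a\<close> is
  what allows test vectors depending on \<open>z\<close>.\<close>

lemma Q_integral:
  assumes a: "a \<in> borel_measurable borel" and B: "\<forall>z. cmod (a z) \<le> B"
  shows "(LINT z|lebesgue. a z * cinner x (blinfun_apply (Q z) y)) = (LINT w|\<pi>. a (snd w) * entry x y w)"
proof -
  have [measurable]: "a \<in> borel_measurable borel" by (rule a)
  have B0: "0 \<le> B" using B norm_ge_zero order_trans by blast
  have eq: "(LINT z|lebesgue. a z * cinner (bas_part n x) (blinfun_apply (Q z) (bas_part n y)))
      = (LINT w|\<pi>. a (snd w) * entry (bas_part n x) (bas_part n y) w)" for n
  proof -
    have "(LINT z|lebesgue. a z * cinner (bas_part n x) (blinfun_apply (Q z) (bas_part n y)))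
        = (LINT z|lebesgue. (\<Sum>j<n. \<Sum>k<n. cinner x (bas j) * cinner (bas k) y * (a z * cinner (bas j) (blinfun_apply (Q z) (bas k)))))"
      unfolding bas_part_form[OF Q_psd] sum_distrib_left by (simp add: mult_ac)
    also have "\<dots> = (\<Sum>j<n. \<Sum>k<n. cinner x (bas j) * cinner (bas k) y * (LINT z|lebesgue. a z * cinner (bas j) (blinfun_apply (Q z) (bas k))))"
      by (simp only: Bochner_Integration.integral_sum Bochner_Integration.integrable_sum integrable_mult_right
          integral_mult_right_zero Q_integrable[OF a B])
    also have "\<dots> = (\<Sum>j<n. \<Sum>k<n. cinner x (bas j) * cinner (bas k) y * (LINT w|\<pi>. a (snd w) * entry (bas j) (bas k) w))"
      by (simp only: Q_entry_integral[OF a B])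
    also have "\<dots> = (LINT w|\<pi>. (\<Sum>j<n. \<Sum>k<n. cinner x (bas j) * cinner (bas k) y * (a (snd w) * entry (bas j) (bas k) w)))"
      by (simp only: Bochner_Integration.integral_sum Bochner_Integration.integrable_sum integrable_mult_right
          integral_mult_right_zero entry_integrable[OF a B])
    also have "\<dots> = (LINT w|\<pi>. a (snd w) * entry (bas_part n x) (bas_part n y) w)"
      by (intro Bochner_Integration.integral_cong refl)
         (simp add: entry_def bas_part_form[OF psd_fst] sum_distrib_left mult_ac)
    finally show ?thesis .
  qed
  have "(\<lambda>n. LINT z|lebesgue. a z * cinner (bas_part n x) (blinfun_apply (Q z) (bas_part n y)))
      \<longlonglongrightarrow> (LINT z|lebesgue. a z * cinner x (blinfun_apply (Q z) y))"
  proof (rule integral_dominated_convergence)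
    show "integrable lebesgue (\<lambda>z. B * (norm x * norm y) * f z)" by (intro integrable_mult_right f_integrable)
    show "AE z in lebesgue. (\<lambda>n. a z * cinner (bas_part n x) (blinfun_apply (Q z) (bas_part n y)))
        \<longlonglongrightarrow> a z * cinner x (blinfun_apply (Q z) y)"
      by (intro AE_I2 tendsto_mult tendsto_const psd_bas_part_tendsto)
    show "AE z in lebesgue. norm (a z * cinner (bas_part n x) (blinfun_apply (Q z) (bas_part n y))) \<le> B * (norm x * norm y) * f z" for n
      by (intro AE_I2 Q_bound[OF B] norm_bas_part_le)
  qed (intro borel_measurable_times Q_measurable lebesgue_measurable a)+
  moreover have "(\<lambda>n. LINT w|\<pi>. a (snd w) * entry (bas_part n x) (bas_part n y) w)
      \<longlonglongrightarrow> (LINT w|\<pi>. a (snd w) * entry x y w)"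
  proof (rule integral_dominated_convergence)
    show "integrable \<pi> (\<lambda>w. B * (norm x * norm y))" by simp
    show "AE w in \<pi>. (\<lambda>n. a (snd w) * entry (bas_part n x) (bas_part n y) w) \<longlonglongrightarrow> a (snd w) * entry x y w"
      unfolding entry_def by (intro AE_I2 tendsto_mult tendsto_const psd_bas_part_tendsto)
    show "AE w in \<pi>. norm (a (snd w) * entry (bas_part n x) (bas_part n y) w) \<le> B * (norm x * norm y)" for n
    proof (rule AE_I2)
      fix w assume "w \<in> space \<pi>"
      then have "cmod (entry (bas_part n x) (bas_part n y) w) \<le> norm (bas_part n x) * norm (bas_part n y)"
        by (rule entry_le)
      also have "\<dots> \<le> norm x * norm y" by (intro mult_mono norm_bas_part_le) auto
      finally show "norm (a (snd w) * entry (bas_part n x) (bas_part n y) w) \<le> B * (norm x * norm y)"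
        unfolding norm_mult by (intro mult_mono B[rule_format] B0) auto
    qed
  qed measurable
  ultimately show ?thesis unfolding eq by (rule LIMSEQ_unique)
qed

lemma Q_coupling: "Q \<in> couplings R f"
proof -
  have one: "(\<lambda>_. 1) \<in> borel_measurable borel" "\<forall>z :: 'd phase_space. cmod ((\<lambda>_. 1) z) \<le> 1" by auto
  have "has_bochner_integral lebesgue (\<lambda>z. cinner x (blinfun_apply (Q z) y)) (cinner x (blinfun_apply R y))" for x y
  proof -
    have mar: "distr \<pi> (borel_of projector_topology) fst = \<mu>" using \<pi> by (simp add: transport_plans_def)
    have "(LINT z|lebesgue. cinner x (blinfun_apply (Q z) y)) = (LINT w|\<pi>. entry x y w)"
      using Q_integral[OF one, of x y] by simp
    also have "\<dots> = (LINT P|distr \<pi> (borel_of projector_topology) fst. cinner x (blinfun_apply P y))"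
      unfolding entry_def by (rule integral_distr[OF fst_measurable measurable_projector_cinner, symmetric])
    also have "\<dots> = cinner x (blinfun_apply R y)"
      unfolding mar using \<mu> by (simp add: representing_measures_def has_bochner_integral_iff)
    finally show ?thesis using Q_integrable[OF one, of x y] by (simp add: has_bochner_integral_iff)
  qed
  moreover have "trace_class (Q z)" "op_trace (Q z) = of_real (f z)" for z
    using psd_op_trace[OF Q_psd Q_diag[unfolded diag_sums_def]] by auto
  ultimately show ?thesis using Q_psd Q_measurable by (simp add: couplings_def)
qed

text \<open>The test vectors vary with \<open>z\<close>, so a fixed matrix entry does not suffice.
  \<open>testvec_form\<close> splits the expression into four fixed entries with weights 1,
  \<open>c\<close> and \<open>cnj c\<close>, and for each of them the two integrals agree.\<close>

lemma testvec_has_integral: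
  fixes hbar n p k
  defines "G \<equiv> \<lambda>z T. cinner (testvec hbar n p k z) (blinfun_apply T (testvec hbar n p k z))"
  shows "\<exists>I. has_bochner_integral lebesgue (\<lambda>z. G z (Q z)) I \<and> has_bochner_integral \<pi> (\<lambda>w. G (snd w) (fst w)) I"
proof -
  let ?c = "testcoeff hbar n p :: 'd phase_space \<Rightarrow> complex" and ?v = "testbase n p k :: 'd L2" and ?e = "bas k :: 'd L2"
  have one: "(\<lambda>_. 1) \<in> borel_measurable borel" "\<forall>z :: 'd phase_space. cmod ((\<lambda>_. 1) z) \<le> 1" by auto
  have c: "?c \<in> borel_measurable borel" "\<forall>z. cmod (?c z) \<le> 1" by (auto simp: cmod_testcoeff)
  have cc: "(\<lambda>z. cnj (?c z)) \<in> borel_measurable borel" "\<forall>z. cmod (cnj (?c z)) \<le> 1" by (auto simp: cmod_testcoeff)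
  have L: "has_bochner_integral lebesgue (\<lambda>z. a z * cinner x (blinfun_apply (Q z) y)) (LINT w|\<pi>. a (snd w) * entry x y w)"
    and P: "has_bochner_integral \<pi> (\<lambda>w. a (snd w) * entry x y w) (LINT w|\<pi>. a (snd w) * entry x y w)"
    if a: "a \<in> borel_measurable borel" "\<forall>z. cmod (a z) \<le> 1" for a x y
    using Q_integrable[OF a] Q_integral[OF a] entry_integrable[OF a] by (auto simp: has_bochner_integral_iff)
  have 1: "has_bochner_integral lebesgue (\<lambda>z. 4 ^ n * (1 * cinner ?v (blinfun_apply (Q z) ?v) + 1 * cinner ?e (blinfun_apply (Q z) ?e)
      - cnj (?c z) * cinner ?v (blinfun_apply (Q z) ?e) - ?c z * cinner ?e (blinfun_apply (Q z) ?v)))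
    (4 ^ n * ((LINT w|\<pi>. 1 * entry ?v ?v w) + (LINT w|\<pi>. 1 * entry ?e ?e w)
      - (LINT w|\<pi>. cnj (?c (snd w)) * entry ?v ?e w) - (LINT w|\<pi>. ?c (snd w) * entry ?e ?v w)))"
    by (intro has_bochner_integral_mult_right has_bochner_integral_add has_bochner_integral_diff L one c cc)
  have 2: "has_bochner_integral \<pi> (\<lambda>w. 4 ^ n * (1 * entry ?v ?v w + 1 * entry ?e ?e w
      - cnj (?c (snd w)) * entry ?v ?e w - ?c (snd w) * entry ?e ?v w))
    (4 ^ n * ((LINT w|\<pi>. 1 * entry ?v ?v w) + (LINT w|\<pi>. 1 * entry ?e ?e w)
      - (LINT w|\<pi>. cnj (?c (snd w)) * entry ?v ?e w) - (LINT w|\<pi>. ?c (snd w) * entry ?e ?v w)))"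
    by (intro has_bochner_integral_mult_right has_bochner_integral_add has_bochner_integral_diff P one c cc)
  have "has_bochner_integral lebesgue (\<lambda>z. G z (Q z)) (4 ^ n * ((LINT w|\<pi>. 1 * entry ?v ?v w) + (LINT w|\<pi>. 1 * entry ?e ?e w)
      - (LINT w|\<pi>. cnj (?c (snd w)) * entry ?v ?e w) - (LINT w|\<pi>. ?c (snd w) * entry ?e ?v w)))"
    using 1 unfolding G_def testvec_form[OF Q_psd] by simp
  moreover have "has_bochner_integral \<pi> (\<lambda>w. G (snd w) (fst w)) (4 ^ n * ((LINT w|\<pi>. 1 * entry ?v ?v w) + (LINT w|\<pi>. 1 * entry ?e ?e w)
      - (LINT w|\<pi>. cnj (?c (snd w)) * entry ?v ?e w) - (LINT w|\<pi>. ?c (snd w) * entry ?e ?v w)))"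
    using 2 by (rule has_bochner_integral_cong[THEN iffD1, rotated -1])
      (auto simp: G_def testvec_form[OF psd_fst] entry_def)
  ultimately show ?thesis by blast
qed

lemma nn_integral_testvec:
  "(\<integral>\<^sup>+z. ennreal (Re (cinner (testvec hbar n p k z) (blinfun_apply (Q z) (testvec hbar n p k z)))) \<partial>lebesgue)
    = (\<integral>\<^sup>+w. ennreal (Re (cinner (testvec hbar n p k (snd w)) (blinfun_apply (fst w) (testvec hbar n p k (snd w))))) \<partial>\<pi>)"
proof -
  let ?G = "\<lambda>z T. cinner (testvec hbar n p k z) (blinfun_apply T (testvec hbar n p k z))"
  obtain I where I: "has_bochner_integral lebesgue (\<lambda>z. ?G z (Q z)) I" "has_bochner_integral \<pi> (\<lambda>w. ?G (snd w) (fst w)) I"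
    using testvec_has_integral[of hbar n p k] by blast
  have "(\<integral>\<^sup>+z. ennreal (Re (?G z (Q z))) \<partial>lebesgue) = ennreal (LINT z|lebesgue. Re (?G z (Q z)))"
    by (rule nn_integral_eq_integral) (use I(1) psd_nonneg[OF Q_psd] in \<open>auto simp: has_bochner_integral_iff\<close>)
  also have "(LINT z|lebesgue. Re (?G z (Q z))) = (LINT w|\<pi>. Re (?G (snd w) (fst w)))"
    using I by (simp add: has_bochner_integral_iff)
  also have "ennreal \<dots> = (\<integral>\<^sup>+w. ennreal (Re (?G (snd w) (fst w))) \<partial>\<pi>)"
    by (rule nn_integral_eq_integral[symmetric])
       (use I(2) psd_nonneg[OF psd_fst] in \<open>auto simp: has_bochner_integral_iff intro!: AE_I2\<close>)
  finally show ?thesis .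
qed

lemma Q_testvec_measurable:
  "(\<lambda>z. ennreal (Re (cinner (testvec hbar n p k z) (blinfun_apply (Q z) (testvec hbar n p k z))))) \<in> borel_measurable lebesgue"
proof -
  obtain I where "has_bochner_integral lebesgue (\<lambda>z. cinner (testvec hbar n p k z) (blinfun_apply (Q z) (testvec hbar n p k z))) I"
    using testvec_has_integral[of hbar n p k] by blast
  then have [measurable]: "(\<lambda>z. cinner (testvec hbar n p k z) (blinfun_apply (Q z) (testvec hbar n p k z))) \<in> borel_measurable lebesgue"
    by (simp add: has_bochner_integral_iff borel_measurable_integrable)
  show ?thesis by measurable
qed

lemma plan_testvec_measurable:
  "(\<lambda>w. ennreal (Re (cinner (testvec hbar n p k (snd w)) (blinfun_apply (fst w) (testvec hbar n p k (snd w)))))) \<in> borel_measurable \<pi>"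
proof -
  note [measurable] = measurable_plan_testvec[unfolded case_prod_beta]
  show ?thesis by measurable
qed

lemma nn_integral_opcost_step:
  "(\<integral>\<^sup>+z. opcost_step lam hbar n z (Q z) \<partial>lebesgue) = (\<integral>\<^sup>+w. opcost_step lam hbar n (snd w) (fst w) \<partial>\<pi>)"
proof -
  note [measurable] = Q_testvec_measurable plan_testvec_measurable
  have "(\<integral>\<^sup>+z. opcost_step lam hbar n z (Q z) \<partial>lebesgue) = (\<Sum>p\<in>UNIV. weight lam hbar p * (\<Sum>k.
      \<integral>\<^sup>+z. ennreal (Re (cinner (testvec hbar n p k z) (blinfun_apply (Q z) (testvec hbar n p k z)))) \<partial>lebesgue))"
    unfolding opcost_step_def by (simp add: nn_integral_sum nn_integral_cmult nn_integral_suminf)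
  also have "\<dots> = (\<integral>\<^sup>+w. opcost_step lam hbar n (snd w) (fst w) \<partial>\<pi>)"
    unfolding opcost_step_def nn_integral_testvec by (simp add: nn_integral_sum nn_integral_cmult nn_integral_suminf)
  finally show ?thesis .
qed

lemma incseq_opcost_step_psd: "psd T \<Longrightarrow> incseq (\<lambda>n. opcost_step lam hbar n z T)"
  by (rule incseq_opcost_step[OF decomposes_chol])

lemma Q_cost:
  assumes hbar: "0 < hbar"
  shows "(\<integral>\<^sup>+z. trace_cost lam hbar z (Q z) \<partial>lebesgue) = (\<integral>\<^sup>+w. cost lam hbar w \<partial>\<pi>)"
proof -
  note [measurable] = Q_testvec_measurable plan_testvec_measurable
  have "(\<integral>\<^sup>+z. trace_cost lam hbar z (Q z) \<partial>lebesgue) = (\<integral>\<^sup>+z. (SUP n. opcost_step lam hbar n z (Q z)) \<partial>lebesgue)"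
    by (simp add: trace_cost_eq_opcost[OF hbar Q_psd Q_diag] opcost_def)
  also have "\<dots> = (SUP n. \<integral>\<^sup>+z. opcost_step lam hbar n z (Q z) \<partial>lebesgue)"
  proof (rule nn_integral_monotone_convergence_SUP)
    show "incseq (\<lambda>n z. opcost_step lam hbar n z (Q z))"
      using incseq_opcost_step_psd[OF Q_psd] by (auto simp: incseq_def le_fun_def)
    show "(\<lambda>z. opcost_step lam hbar n z (Q z)) \<in> borel_measurable lebesgue" for n
      unfolding opcost_step_def by measurable
  qed
  also have "\<dots> = (SUP n. \<integral>\<^sup>+w. opcost_step lam hbar n (snd w) (fst w) \<partial>\<pi>)"
    by (simp only: nn_integral_opcost_step)
  also have "\<dots> = (\<integral>\<^sup>+w. (SUP n. opcost_step lam hbar n (snd w) (fst w)) \<partial>\<pi>)"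
  \<comment> \<open>Monotonicity in \<open>n\<close> relies on positivity of \<open>fst w\<close>,
    known only on the space of the plan, hence the almost everywhere version.\<close>
  proof (rule nn_integral_monotone_convergence_SUP_AE[symmetric])
    show "AE w in \<pi>. opcost_step lam hbar n (snd w) (fst w) \<le> opcost_step lam hbar (Suc n) (snd w) (fst w)" for n
      using incseq_SucD[OF incseq_opcost_step_psd[OF psd_fst]] by (intro AE_I2)
    show "(\<lambda>w. opcost_step lam hbar n (snd w) (fst w)) \<in> borel_measurable \<pi>" for n
      unfolding opcost_step_def by measurable
  qed
  also have "\<dots> = (\<integral>\<^sup>+w. cost lam hbar w \<partial>\<pi>)"
    by (rule nn_integral_cong) (auto simp: space_\<pi> cost_eq_opcost[OF hbar] opcost_def)
  finally show ?thesis .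
qed

end

lemma plan_to_coupling:
  fixes R :: "'d::finite operator"
  assumes hbar: "0 < hbar" and f: "probability_density f" and \<mu>: "\<mu> \<in> representing_measures R"
    and \<pi>: "\<pi> \<in> transport_plans \<mu> (density_measure f)"
  shows "\<exists>Q\<in>couplings R f. (\<integral>\<^sup>+z. trace_cost lam hbar z (Q z) \<partial>lebesgue) = (\<integral>\<^sup>+p. cost lam hbar p \<partial>\<pi>)"
proof -
  interpret transport_plan R f \<mu> \<pi> using f \<mu> \<pi> by unfold_locales
  show ?thesis using Q_coupling Q_cost[OF hbar] by blast
qed

lemma ennreal_sqrt_power2: "(ennreal_sqrt a)\<^sup>2 = a"
proof (cases a)
  case (real r)
  then show ?thesis by (simp add: ennreal_sqrt_def ennreal_power)
qed (simp add: ennreal_sqrt_def power2_eq_square ennreal_top_mult)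

lemma ennreal_sqrt_mono: "a \<le> b \<Longrightarrow> ennreal_sqrt a \<le> ennreal_sqrt b"
  by (auto simp: ennreal_sqrt_def top_unique less_top intro!: ennreal_leI real_sqrt_le_mono enn2real_mono)

text \<open>Squaring and \<open>ennreal_sqrt\<close> are monotone and \<open>ennreal_sqrt\<close> is
  a right inverse of squaring, so the square moves inside the infimum even when it is not
  attained.\<close>

lemma GP_power2: "(GP lam hbar R f)\<^sup>2 = (INF Q\<in>couplings R f. \<integral>\<^sup>+z. trace_cost lam hbar z (Q z) \<partial>lebesgue)"
    (is "_ = (INF Q\<in>_. ?I Q)")
proof (rule antisym)
  show "(GP lam hbar R f)\<^sup>2 \<le> (INF Q\<in>couplings R f. ?I Q)"
  proof (rule INF_greatest)
    fix Q assume "Q \<in> couplings R f"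
    then have "GP lam hbar R f \<le> ennreal_sqrt (?I Q)" unfolding GP_def by (rule INF_lower)
    then have "(GP lam hbar R f)\<^sup>2 \<le> (ennreal_sqrt (?I Q))\<^sup>2" by (rule power_mono) simp
    then show "(GP lam hbar R f)\<^sup>2 \<le> ?I Q" unfolding ennreal_sqrt_power2 .
  qed
  have "ennreal_sqrt (INF Q\<in>couplings R f. ?I Q) \<le> GP lam hbar R f"
    unfolding GP_def by (intro INF_greatest ennreal_sqrt_mono INF_lower)
  then have "(ennreal_sqrt (INF Q\<in>couplings R f. ?I Q))\<^sup>2 \<le> (GP lam hbar R f)\<^sup>2" by (rule power_mono) simp
  then show "(INF Q\<in>couplings R f. ?I Q) \<le> (GP lam hbar R f)\<^sup>2" unfolding ennreal_sqrt_power2 .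
qed

theorem proposition3p2:
  fixes lam hbar :: real
    and R :: "'d::finite operator"
    and f :: "'d phase_space \<Rightarrow> real"
  assumes "0 < lam" and "0 < hbar"
    and "R \<in> density_operators"
    and "probability_density f"
  shows "(GP lam hbar R f)\<^sup>2 = maximal_convex_extension (cost lam hbar) R (density_measure f)"
proof (rule antisym)
  show "(GP lam hbar R f)\<^sup>2 \<le> maximal_convex_extension (cost lam hbar) R (density_measure f)"
    unfolding GP_power2 maximal_convex_extension_def transport_cost_def
  \<comment> \<open>Every plan, for every representing measure, has a coupling of equal cost, and
    conversely below. Matching values is enough for the infima: neither has to be attained, and an
    empty family gives the value infinity.\<close>
  proof (intro INF_greatest)
    fix \<mu> \<pi> assume "\<mu> \<in> representing_measures R" "\<pi> \<in> transport_plans \<mu> (density_measure f)"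
    from plan_to_coupling[OF assms(2,4) this, of lam] obtain Q
      where Q: "Q \<in> couplings R f" "(\<integral>\<^sup>+z. trace_cost lam hbar z (Q z) \<partial>lebesgue) = (\<integral>\<^sup>+p. cost lam hbar p \<partial>\<pi>)"
      by blast
    then show "(INF Q\<in>couplings R f. \<integral>\<^sup>+z. trace_cost lam hbar z (Q z) \<partial>lebesgue) \<le> (\<integral>\<^sup>+p. cost lam hbar p \<partial>\<pi>)"
      using INF_lower[OF Q(1), of "\<lambda>Q. \<integral>\<^sup>+z. trace_cost lam hbar z (Q z) \<partial>lebesgue"] by simp
  qed
  show "maximal_convex_extension (cost lam hbar) R (density_measure f) \<le> (GP lam hbar R f)\<^sup>2"
    unfolding GP_power2
  proof (rule INF_greatest)
    fix Q assume "Q \<in> couplings R f"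
    from coupling_to_plan[OF assms(2,4) this, of lam] obtain \<mu> \<pi> where "\<mu> \<in> representing_measures R"
        "\<pi> \<in> transport_plans \<mu> (density_measure f)"
        "(\<integral>\<^sup>+p. cost lam hbar p \<partial>\<pi>) = (\<integral>\<^sup>+z. trace_cost lam hbar z (Q z) \<partial>lebesgue)"
      by blast
    then show "maximal_convex_extension (cost lam hbar) R (density_measure f) \<le> (\<integral>\<^sup>+z. trace_cost lam hbar z (Q z) \<partial>lebesgue)"
      unfolding maximal_convex_extension_def transport_cost_def
      by (intro INF_lower2[of \<mu>] INF_lower2[of \<pi>]) auto
  qed
qed

end
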